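(* Let $\Gamma=(V,E)$ be a finite graph with $st(v)\ne V$ for all $v\in V$. Let $G$ be one of the following groups: (1) $G=W(\Gamma,\{G_v\}_{v\in V})$, a graph product of non-trivial finite abelian groups, such that there is no partition $V=V_1\sqcup\dots\sqcup V_\ell$ ($\ell\ge1$, $V_i$ non-empty) for which the natural map $W_{\Gamma_{V_1}}\times\dots\times W_{\Gamma_{V_\ell}}\to G$ is an isomorphism and each $W_{\Gamma_{V_i}}$ is isomorphic to $Z_k=\mathbb{Z}/2\ast\dots\ast\mathbb{Z}/2$ ($k$ factors) for some $k\ge1$ or is finite abelian; (2) $G=R_\Gamma$, the right angled Artin group on $\Gamma$, where either there is a $\le_\tau$-minimal $\sim_\tau$-equivalence class $M$ with $R_{\Gamma_M}\cong F_2$, or no $\sim_\tau$-equivalence class $N$ satisfies $R_{\Gamma_N}\cong F_k$ for any $k\ge2$. Then there exists $x\in[\mathrm{Aut}(G),G]$ with $\mathrm{scl}_{\mathrm{Aut}}(x)>0$.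
   Context: Graph: $\Gamma=(V,E)$, $V$ non-empty finite, $E$ a set of 2-element subsets; $lk(v)=\{x:\{v,x\}\in E\}$, $st(v)=lk(v)\cup\{v\}$; $\Gamma_X$ full subgraph on $X$. Graph product $W(\Gamma,\{G_v\})=(\ast_vG_v)/N$, $N$ normally generated by $[G_x,G_y]$, $\{x,y\}\in E$; $W_{\Gamma_X}$ the subgroup generated by $G_v$, $v\in X$. $R_\Gamma$: generated by $V$ with $xy=yx$ for $\{x,y\}\in E$; $R_{\Gamma_X}$ the subgroup generated by $X$; $F_k$ the free group of rank $k$. For $R_\Gamma$: $v\le_\tau v$, and for $v\ne w$, $v\le_\tau w$ iff $lk(v)\subset st(w)$; $v\sim_\tau w$ iff $v\le_\tau w$ and $w\le_\tau v$; minimality of classes refers to the partial order induced by $\le_\tau$ on classes. $[\mathrm{Aut}(G),G]$ is the subgroup of $G$ generated by all $\varphi(g)g^{-1}$, $\varphi\in\mathrm{Aut}(G)$, $g\in G$. For $x\in[\mathrm{Aut}(G),G]$, $\mathrm{cl}_{\mathrm{Aut}}(x)$ is the minimal number $n$ such that $x$ is a product of $n$ elements each of the form $\varphi(g)g^{-1}$ or $(\varphi(g)g^{-1})^{-1}$, and $\mathrm{scl}_{\mathrm{Aut}}(x)=\lim_{n\to\infty}\mathrm{cl}_{\mathrm{Aut}}(x^n)/n$. *)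

theory Defs
  imports "HOL-Analysis.Analysis" "HOL-Algebra.Algebra"
begin

definition is_graph :: "'v set \<Rightarrow> 'v set set \<Rightarrow> bool" where
  "is_graph V E \<longleftrightarrow> V \<noteq> {} \<and> finite V \<and>
     (\<forall>e\<in>E. \<exists>x y. x \<noteq> y \<and> x \<in> V \<and> y \<in> V \<and> e = {x, y})"

definition lk :: "'v set set \<Rightarrow> 'v \<Rightarrow> 'v set" where
  "lk E v = {x. {v, x} \<in> E}"

definition st :: "'v set set \<Rightarrow> 'v \<Rightarrow> 'v set" where
  "st E v = lk E v \<union> {v}"

definition gp_words :: "'v set \<Rightarrow> ('v \<Rightarrow> ('a, 'b) monoid_scheme) \<Rightarrow> ('v \<times> 'a) list set" where
  "gp_words V Gs = {w. \<forall>(v, a) \<in> set w. v \<in> V \<and> a \<in> carrier (Gs v)}"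

inductive_set gp_step :: "'v set \<Rightarrow> 'v set set \<Rightarrow> ('v \<Rightarrow> ('a, 'b) monoid_scheme)
    \<Rightarrow> (('v \<times> 'a) list \<times> ('v \<times> 'a) list) set"
  for V E Gs where
  mult: "u \<in> gp_words V Gs \<Longrightarrow> u' \<in> gp_words V Gs \<Longrightarrow> v \<in> V \<Longrightarrow>
     a \<in> carrier (Gs v) \<Longrightarrow> b \<in> carrier (Gs v) \<Longrightarrow>
     (u @ [(v, a), (v, b)] @ u', u @ [(v, a \<otimes>\<^bsub>Gs v\<^esub> b)] @ u') \<in> gp_step V E Gs"
| one: "u \<in> gp_words V Gs \<Longrightarrow> u' \<in> gp_words V Gs \<Longrightarrow> v \<in> V \<Longrightarrow>
     (u @ [(v, \<one>\<^bsub>Gs v\<^esub>)] @ u', u @ u') \<in> gp_step V E Gs"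
| comm: "u \<in> gp_words V Gs \<Longrightarrow> u' \<in> gp_words V Gs \<Longrightarrow> v \<in> V \<Longrightarrow> w \<in> V \<Longrightarrow>
     {v, w} \<in> E \<Longrightarrow> a \<in> carrier (Gs v) \<Longrightarrow> b \<in> carrier (Gs w) \<Longrightarrow>
     (u @ [(v, a), (w, b)] @ u', u @ [(w, b), (v, a)] @ u') \<in> gp_step V E Gs"

definition gp_eq :: "'v set \<Rightarrow> 'v set set \<Rightarrow> ('v \<Rightarrow> ('a, 'b) monoid_scheme)
    \<Rightarrow> (('v \<times> 'a) list \<times> ('v \<times> 'a) list) set" where
  "gp_eq V E Gs = {(x, y). x \<in> gp_words V Gs \<and> y \<in> gp_words V Gs \<and>
      (x, y) \<in> (gp_step V E Gs \<union> (gp_step V E Gs)\<inverse>)\<^sup>*}"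

text \<open>The graph product W(\<Gamma>, {G_v}) as a group (monoid presentation of the free product
  of the G_v with the relations [G_x, G_y] = 1 for edges {x,y}).\<close>
definition graph_product :: "'v set \<Rightarrow> 'v set set \<Rightarrow> ('v \<Rightarrow> ('a, 'b) monoid_scheme)
    \<Rightarrow> ('v \<times> 'a) list set monoid" where
  "graph_product V E Gs =
     \<lparr>carrier = gp_words V Gs // gp_eq V E Gs,
      monoid.mult = (\<lambda>A B. {z. \<exists>x\<in>A. \<exists>y\<in>B. (x @ y, z) \<in> gp_eq V E Gs}),
      one = gp_eq V E Gs `` {[]}\<rparr>"

definition gp_incl :: "'v set \<Rightarrow> 'v set set \<Rightarrow> ('v \<Rightarrow> ('a, 'b) monoid_scheme)
    \<Rightarrow> 'v \<Rightarrow> 'a \<Rightarrow> ('v \<times> 'a) list set" where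
  "gp_incl V E Gs v a = gp_eq V E Gs `` {[(v, a)]}"

definition gp_sub :: "'v set \<Rightarrow> 'v set set \<Rightarrow> ('v \<Rightarrow> ('a, 'b) monoid_scheme)
    \<Rightarrow> 'v set \<Rightarrow> ('v \<times> 'a) list set monoid" where
  "gp_sub V E Gs S = (graph_product V E Gs)\<lparr>carrier :=
      generate (graph_product V E Gs) {gp_incl V E Gs v a | v a. v \<in> S \<and> a \<in> carrier (Gs v)}\<rparr>"

definition RAAG :: "'v set \<Rightarrow> 'v set set \<Rightarrow> ('v \<times> int) list set monoid" where
  "RAAG V E = graph_product V E (\<lambda>_. integer_group)"

definition free_grp :: "nat \<Rightarrow> (nat \<times> int) list set monoid" where
  "free_grp k = RAAG {..<k} {}"

definition Zk_grp :: "nat \<Rightarrow> (nat \<times> int) list set monoid" where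
  "Zk_grp k = graph_product {..<k} {} (\<lambda>_. integer_mod_group 2)"

definition tau_le :: "'v set set \<Rightarrow> 'v \<Rightarrow> 'v \<Rightarrow> bool" where
  "tau_le E v w \<longleftrightarrow> v = w \<or> lk E v \<subseteq> st E w"

definition tau_equiv :: "'v set set \<Rightarrow> 'v \<Rightarrow> 'v \<Rightarrow> bool" where
  "tau_equiv E v w \<longleftrightarrow> tau_le E v w \<and> tau_le E w v"

definition tau_classes :: "'v set \<Rightarrow> 'v set set \<Rightarrow> 'v set set" where
  "tau_classes V E = {{w \<in> V. tau_equiv E v w} | v. v \<in> V}"

text \<open>Induced order on classes (well defined since \<le>_\<tau> is a preorder).\<close>
definition tau_class_le :: "'v set set \<Rightarrow> 'v set \<Rightarrow> 'v set \<Rightarrow> bool" where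
  "tau_class_le E N M \<longleftrightarrow> (\<exists>n\<in>N. \<exists>m\<in>M. tau_le E n m)"

definition tau_minimal_class :: "'v set \<Rightarrow> 'v set set \<Rightarrow> 'v set \<Rightarrow> bool" where
  "tau_minimal_class V E M \<longleftrightarrow> M \<in> tau_classes V E \<and>
     (\<forall>N\<in>tau_classes V E. tau_class_le E N M \<longrightarrow> N = M)"

definition aut_gens :: "('g, 'b) monoid_scheme \<Rightarrow> 'g set" where
  "aut_gens G = {\<phi> g \<otimes>\<^bsub>G\<^esub> inv\<^bsub>G\<^esub> g | \<phi> g. \<phi> \<in> iso G G \<and> g \<in> carrier G}"

definition aut_comm :: "('g, 'b) monoid_scheme \<Rightarrow> 'g set" where
  "aut_comm G = generate G (aut_gens G)"

definition cl_aut :: "('g, 'b) monoid_scheme \<Rightarrow> 'g \<Rightarrow> nat" where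
  "cl_aut G x = (LEAST n. \<exists>xs. length xs = n \<and>
      (\<forall>y\<in>set xs. y \<in> aut_gens G \<or> inv\<^bsub>G\<^esub> y \<in> aut_gens G) \<and>
      foldr (\<otimes>\<^bsub>G\<^esub>) xs \<one>\<^bsub>G\<^esub> = x)"

definition scl_aut :: "('g, 'b) monoid_scheme \<Rightarrow> 'g \<Rightarrow> real" where
  "scl_aut G x = lim (\<lambda>n. real (cl_aut G (x [^]\<^bsub>G\<^esub> n)) / real n)"

definition gp_product_map :: "'v set \<Rightarrow> 'v set set \<Rightarrow> ('v \<Rightarrow> ('a, 'b) monoid_scheme)
    \<Rightarrow> 'v set list \<Rightarrow> (nat \<Rightarrow> ('v \<times> 'a) list set) \<Rightarrow> ('v \<times> 'a) list set" where
  "gp_product_map V E Gs Vs f =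
     foldr (\<lambda>i acc. f i \<otimes>\<^bsub>graph_product V E Gs\<^esub> acc) [0..<length Vs] \<one>\<^bsub>graph_product V E Gs\<^esub>"

definition is_vertex_partition :: "'v set \<Rightarrow> 'v set list \<Rightarrow> bool" where
  "is_vertex_partition V Vs \<longleftrightarrow> length Vs \<ge> 1 \<and> (\<forall>P\<in>set Vs. P \<noteq> {}) \<and>
     (\<forall>i<length Vs. \<forall>j<length Vs. i \<noteq> j \<longrightarrow> Vs ! i \<inter> Vs ! j = {}) \<and> \<Union>(set Vs) = V"

definition bad_splitting :: "'v set \<Rightarrow> 'v set set \<Rightarrow> ('v \<Rightarrow> ('a, 'b) monoid_scheme) \<Rightarrow> bool" where
  "bad_splitting V E Gs \<longleftrightarrow> (\<exists>Vs. is_vertex_partition V Vs \<and>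
     gp_product_map V E Gs Vs \<in> iso (product_group {..<length Vs} (\<lambda>i. gp_sub V E Gs (Vs ! i)))
                                      (graph_product V E Gs) \<and>
     (\<forall>i<length Vs. (\<exists>k\<ge>1. gp_sub V E Gs (Vs ! i) \<cong> Zk_grp k) \<or>
        (finite (carrier (gp_sub V E Gs (Vs ! i))) \<and> comm_group (gp_sub V E Gs (Vs ! i)))))"

definition has_pos_scl_aut :: "('g, 'b) monoid_scheme \<Rightarrow> bool" where
  "has_pos_scl_aut G \<longleftrightarrow> (\<exists>x\<in>aut_comm G. scl_aut G x > 0)"

end

theory Submission
  imports Defs
begin

text \<open>
  A counting quasimorphism on the free product of two infinite cyclic groups, built from the cyclic order of the sizes of
  three consecutive large syllables, is antisymmetric enough to survive conjugation, inversion and the averaging over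
  finitely many maps. Hence a group has an element of positive stable autocommutator length as soon as
  a characteristic subgroup of finite index has a map onto a large enough part of a free product of two finite abelian groups
  whose compositions with all automorphisms fall into finitely many conjugacy classes.

  For a graph product of finite abelian groups one projects to the free product of two non-adjacent cliques: torsion elements
  are elliptic, so an automorphism trivial on abelianizations changes the projection by an inner automorphism only.
  If no such pair of cliques is available, non-adjacency is an equivalence relation, all vertex groups have order two, and the
  group splits as excluded. For a right-angled Artin group one projects to two non-adjacent transvection classes. An
  automorphism congruent to the identity modulo 3 kills the remaining vertices under this projection, because a hyperbolic
  image would make the exponent vectors of commuting elements proportional. If one of the
  classes has at least two elements, reduction modulo 3 again leaves an inner automorphism. Otherwise the target is free of
  rank two, and one uses its four maps to the modular group coming from braids on four strands, which
  Nielsen's generators permute up to conjugation and mirror image.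
\<close>

text \<open>The obstacle is cancellation: invariance forces a sum over a whole orbit of maps, and
  one summand could undo the growth of another. The test word \<open>xw\<close> prevents this. The
  exponents of \<open>s\<close> along it have absolute values n1, n2, n3, n1, n2, n3. Whatever two
  elements replace \<open>s\<close> and \<open>t\<close>, up to bounded error either the word
  becomes trivial, or its syllables stay below the threshold, or its large syllables are these
  numbers times one constant, and then all consecutive triples are positively ordered. So every
  summand is bounded below on the powers of the word, and one of them grows. The threshold can be
  fixed last because only finitely many maps occur. A free product of finite groups is usable once
  one factor has two different non-trivial elements; Z/2 * Z/2 is virtually cyclic. This is the
  origin of the modulus 3, which also keeps the diagonal entries of an automorphism and of its
  inverse non-zero. With two one-vertex classes nothing makes the images of the generators elliptic
  modulo 3: automorphisms of the free group of rank two that are trivial modulo 3 form an infinite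
  group even up to inner ones. Hence the detour through braids.\<close>

abbreviation (input) car where "car \<equiv> carrier"
abbreviation (input) group_mult ("_ *[_] _" [70, 0, 71] 70) where "x *[G] y \<equiv> x \<otimes>\<^bsub>G\<^esub> y"
abbreviation (input) group_inv ("inv[_] _" [0, 81] 80) where "inv[G] x \<equiv> inv\<^bsub>G\<^esub> x"
abbreviation (input) group_one ("one[_]") where "one[G] \<equiv> \<one>\<^bsub>G\<^esub>"
abbreviation (input) group_pow ("_ ^[_] _" [76, 0, 75] 75) where "x ^[G] n \<equiv> x [^]\<^bsub>G\<^esub> n"

section \<open>Graph products\<close>

lemma gp_words_simps [simp]:
	"[] : gp_words V Gs"
	"x # w : gp_words V Gs \<longleftrightarrow> fst x : V & snd x : car (Gs (fst x)) & w : gp_words V Gs"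
	"u @ w : gp_words V Gs \<longleftrightarrow> u : gp_words V Gs & w : gp_words V Gs"
	by (auto simp: gp_words_def split_beta)

definition gp_eval :: "('h, 'z) monoid_scheme => ('v => 'a => 'h) => ('v \<times> 'a) list => 'h" where
	"gp_eval H f w = foldr (%x y. f (fst x) (snd x) *[H] y) w one[H]"

text \<open>The value is read off from an arbitrary word of the class; for compatible families
  \<open>gp_lift_cls\<close> makes the choice harmless.\<close>

definition gp_lift :: "('h, 'z) monoid_scheme => ('v => 'a => 'h) => ('v \<times> 'a) list set => 'h" where
	"gp_lift H f Q = gp_eval H f (Eps (%w. w : Q))"

lemma gp_eval_simps [simp]:
	"gp_eval H f [] = one[H]"
	"gp_eval H f (x # w) = f (fst x) (snd x) *[H] gp_eval H f w"
	by (auto simp: gp_eval_def)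

locale graph_prod =
	fixes V :: "'v set" and E :: "'v set set" and Gs :: "'v => 'a monoid"
	assumes vertex_group: "v : V ==> group (Gs v)"
begin

abbreviation "GP \<equiv> graph_product V E Gs"
abbreviation "W \<equiv> gp_words V Gs"

definition cls :: "('v \<times> 'a) list => ('v \<times> 'a) list set" where
	"cls w = gp_eq V E Gs `` {w}"

lemma step_words: "(x, y) : gp_step V E Gs ==> x : W & y : W"
	by (induction rule: gp_step.induct) (auto intro: group.is_monoid[OF vertex_group] monoid.m_closed monoid.one_closed)

lemma step_context:
	assumes "(x, y) : gp_step V E Gs" "p : W" "q : W"
	shows "(p @ x @ q, p @ y @ q) : gp_step V E Gs"
	using assms
proof (induction rule: gp_step.induct)
	case (mult u u' v a b)
	then show ?case using gp_step.mult[of "p @ u" V Gs "u' @ q" v a b E] by simp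
next
	case (one u u' v)
	then show ?case using gp_step.one[of "p @ u" V Gs "u' @ q" v E] by simp
next
	case (comm u u' v w a b)
	then show ?case using gp_step.comm[of "p @ u" V Gs "u' @ q" v w E a b] by simp
qed

lemma gp_eq_refl: "w : W ==> (w, w) : gp_eq V E Gs"
	by (simp add: gp_eq_def)

lemma gp_eq_sym: "(x, y) : gp_eq V E Gs ==> (y, x) : gp_eq V E Gs"
proof -
	have "sym ((gp_step V E Gs \<union> (gp_step V E Gs)\<inverse>)\<^sup>*)"
		by (intro sym_rtrancl) (auto simp: sym_def)
	then show "(x, y) : gp_eq V E Gs ==> (y, x) : gp_eq V E Gs"
		by (auto simp: gp_eq_def sym_def)
qed

lemma gp_eq_trans: "(x, y) : gp_eq V E Gs ==> (y, z) : gp_eq V E Gs ==> (x, z) : gp_eq V E Gs"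
	by (auto simp: gp_eq_def)

lemma gp_eq_words: "(x, y) : gp_eq V E Gs ==> x : W & y : W"
	by (auto simp: gp_eq_def)

lemma step_gp_eq: "(x, y) : gp_step V E Gs ==> (x, y) : gp_eq V E Gs"
	using step_words by (fastforce simp: gp_eq_def)

lemma gp_eq_context:
	assumes "(x, y) : gp_eq V E Gs" "p : W" "q : W"
	shows "(p @ x @ q, p @ y @ q) : gp_eq V E Gs"
proof -
	have "(x, y) : (gp_step V E Gs \<union> (gp_step V E Gs)\<inverse>)\<^sup>*" using assms by (auto simp: gp_eq_def)
	then have "(p @ x @ q, p @ y @ q) : (gp_step V E Gs \<union> (gp_step V E Gs)\<inverse>)\<^sup>*"
	proof (induction rule: rtrancl_induct)
		case (step y z)
		have "(p @ y @ q, p @ z @ q) : gp_step V E Gs \<union> (gp_step V E Gs)\<inverse>"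
			using step(2) step_context[OF _ assms(2,3)] by auto
		then show ?case using step(3) by (rule rtrancl_into_rtrancl[rotated])
	qed simp
	then show ?thesis using assms gp_eq_words[OF assms(1)] by (auto simp: gp_eq_def)
qed

lemma gp_eq_append:
	assumes "(x, x') : gp_eq V E Gs" "(y, y') : gp_eq V E Gs"
	shows "(x @ y, x' @ y') : gp_eq V E Gs"
	using gp_eq_context[OF assms(1), of "[]" y] gp_eq_context[OF assms(2), of x' "[]"]
		gp_eq_words[OF assms(1)] gp_eq_words[OF assms(2)] gp_eq_trans by fastforce

lemma gp_eq_invariant:
	assumes "(x, y) : gp_eq V E Gs" "!!x y. (x, y) : gp_step V E Gs ==> F x = F y"
	shows "F x = F y"
proof -
	have "(x, y) : (gp_step V E Gs \<union> (gp_step V E Gs)\<inverse>)\<^sup>*" using assms by (auto simp: gp_eq_def)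
	then show ?thesis by (induction rule: rtrancl_induct) (auto dest: assms(2))
qed

lemma mem_cls: "z : cls w \<longleftrightarrow> (w, z) : gp_eq V E Gs"
	by (simp add: cls_def)

lemma cls_eq_iff: "w : W ==> w' : W ==> cls w = cls w' \<longleftrightarrow> (w, w') : gp_eq V E Gs"
	unfolding cls_def by (auto intro: gp_eq_refl gp_eq_sym gp_eq_trans)

lemma carrier_GP: "car GP = cls ` W"
	by (auto simp: graph_product_def quotient_def cls_def)

lemma cls_carrier [simp]: "w : W ==> cls w : car GP"
	by (simp add: carrier_GP)

lemma carrier_cases: assumes "Q : car GP" obtains w where "w : W" "Q = cls w"
	using assms by (auto simp: carrier_GP)

lemma mult_GP: "A *[GP] B = {z. \<exists>x\<in>A. \<exists>y\<in>B. (x @ y, z) : gp_eq V E Gs}"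
	by (simp add: graph_product_def)

lemma cls_mult: "u : W ==> w : W ==> cls u *[GP] cls w = cls (u @ w)"
proof -
	assume uw: "u : W" "w : W"
	have "(\<exists>x\<in>cls u. \<exists>y\<in>cls w. (x @ y, z) : gp_eq V E Gs) \<longleftrightarrow> (u @ w, z) : gp_eq V E Gs" for z
		using uw gp_eq_append gp_eq_trans gp_eq_refl unfolding mem_cls Bex_def by blast
	then show ?thesis unfolding mult_GP by (auto simp: mem_cls)
qed

lemma one_GP: "one[GP] = cls []"
	by (simp add: graph_product_def cls_def)

definition winv :: "('v \<times> 'a) list => ('v \<times> 'a) list" where
	"winv w = rev (map (%x. (fst x, inv[Gs (fst x)] (snd x))) w)"

lemma winv_simps [simp]:
	"winv [] = []" "winv (x # w) = winv w @ [(fst x, inv[Gs (fst x)] (snd x))]"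
	"winv (u @ w) = winv w @ winv u"
	by (auto simp: winv_def)

lemma winv_W [simp]: "w : W ==> winv w : W"
	by (induction w) (auto simp: vertex_group)

lemma cancel_letter:
	assumes "v : V" "a : car (Gs v)" "b : car (Gs v)" "a *[Gs v] b = one[Gs v]" "p : W" "q : W"
	shows "(p @ [(v, a), (v, b)] @ q, p @ q) : gp_eq V E Gs"
	using step_gp_eq[OF gp_step.mult[of p V Gs q v a b E]] step_gp_eq[OF gp_step.one[of p V Gs q v E]]
		gp_eq_trans assms by simp

lemma winv_right: "w : W ==> (w @ winv w, []) : gp_eq V E Gs"
proof (induction w)
	case Nil then show ?case by (simp add: gp_eq_refl)
next
	case (Cons x w)
	let ?x' = "(fst x, inv[Gs (fst x)] (snd x))"
	have x: "[x] : W" "[?x'] : W" using Cons by (auto simp: vertex_group)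
	have "([x] @ (w @ winv w) @ [?x'], [x] @ [] @ [?x']) : gp_eq V E Gs"
		using Cons x by (intro gp_eq_context) auto
	moreover have "([x] @ [] @ [?x'], []) : gp_eq V E Gs"
		using cancel_letter[of "fst x" "snd x" "inv[Gs (fst x)] (snd x)" "[]" "[]"] Cons
		by (auto simp: vertex_group group.r_inv)
	ultimately show ?case using gp_eq_trans by fastforce
qed

lemma winv_left: "w : W ==> (winv w @ w, []) : gp_eq V E Gs"
proof (induction w)
	case Nil then show ?case by (simp add: gp_eq_refl)
next
	case (Cons x w)
	let ?x' = "(fst x, inv[Gs (fst x)] (snd x))"
	have "(winv w @ [?x', (fst x, snd x)] @ w, winv w @ w) : gp_eq V E Gs"
		using Cons by (intro cancel_letter) (auto simp: vertex_group group.l_inv)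
	then show ?case using gp_eq_trans Cons by fastforce
qed

lemma group_GP: "group GP"
proof (rule groupI)
	show "one[GP] : car GP" by (simp add: one_GP)
	fix x assume x: "x : car GP"
	then obtain u where u: "u : W" "x = cls u" by (rule carrier_cases)
	show "one[GP] *[GP] x = x" using u by (simp add: one_GP cls_mult)
	show "\<exists>y\<in>car GP. y *[GP] x = one[GP]"
		using u by (intro bexI[of _ "cls (winv u)"]) (auto simp: cls_mult one_GP cls_eq_iff winv_left)
	fix y assume "y : car GP"
	then obtain v where v: "v : W" "y = cls v" by (rule carrier_cases)
	show "x *[GP] y : car GP" using u v by (simp add: cls_mult)
	fix z assume "z : car GP"
	then obtain w where w: "w : W" "z = cls w" by (rule carrier_cases)
	show "x *[GP] y *[GP] z = x *[GP] (y *[GP] z)" using u v w by (simp add: cls_mult)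
qed

sublocale GP: group GP by (rule group_GP)

lemma cls_inv: "w : W ==> inv[GP] (cls w) = cls (winv w)"
	by (rule GP.inv_equality) (auto simp: cls_mult one_GP cls_eq_iff winv_left)

abbreviation "incl \<equiv> gp_incl V E Gs"

lemma incl_cls: "incl v a = cls [(v, a)]"
	by (simp add: gp_incl_def cls_def)

lemma incl_carrier [simp]: "v : V ==> a : car (Gs v) ==> incl v a : car GP"
	by (simp add: incl_cls)

lemma incl_mult:
	"v : V ==> a : car (Gs v) ==> b : car (Gs v) ==>
	 incl v (a *[Gs v] b) = incl v a *[GP] incl v b"
	using step_gp_eq[OF gp_step.mult[of "[]" V Gs "[]" v a b E]] cls_eq_iff gp_eq_words
	by (simp add: incl_cls cls_mult) metis

lemma incl_one: "v : V ==> incl v one[Gs v] = one[GP]"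
	using step_gp_eq[OF gp_step.one[of "[]" V Gs "[]" v E]] cls_eq_iff gp_eq_words
	by (simp add: incl_cls one_GP) metis

lemma incl_hom: "v : V ==> incl v : hom (Gs v) GP"
	by (auto simp: hom_def incl_mult)

lemma incl_comm:
	"v : V ==> w : V ==> {v, w} : E ==> a : car (Gs v) ==> b : car (Gs w) ==>
	 incl v a *[GP] incl w b = incl w b *[GP] incl v a"
	using step_gp_eq[OF gp_step.comm[of "[]" V Gs "[]" v w E a b]] cls_eq_iff gp_eq_words
	by (simp add: incl_cls cls_mult)

lemma cls_Cons: "fst x : V ==> snd x : car (Gs (fst x)) ==> w : W ==>
	 cls (x # w) = incl (fst x) (snd x) *[GP] cls w"
	by (simp add: incl_cls cls_mult)

lemma GP_induct [consumes 1, case_names one mult]: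
	assumes "Q : car GP" "P one[GP]"
		"!!v a Q. v : V ==> a : car (Gs v) ==> Q : car GP ==> P Q ==> P (incl v a *[GP] Q)"
	shows "P Q"
proof -
	obtain w where w: "w : W" "Q = cls w" using assms(1) by (rule carrier_cases)
	have "P (cls w)" using w(1)
		by (induction w) (use assms(2,3) in \<open>auto simp: one_GP cls_Cons\<close>)
	then show ?thesis using w by simp
qed

lemma hom_ext:
	assumes "h : hom GP H" "h' : hom GP H" "group H" "Q : car GP"
		"!!v a. v : V ==> a : car (Gs v) ==> h (incl v a) = h' (incl v a)"
	shows "h Q = h' Q"
	using assms(4)
proof (induction rule: GP_induct)
	case one then show ?case using assms(1-3) hom_one group_GP by metis
next
	case (mult v a Q) then show ?case using assms by (simp add: hom_mult)
qed

section \<open>Universal property of the graph product\<close>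

definition compatible :: "('h, 'z) monoid_scheme => ('v => 'a => 'h) => bool" where
	"compatible H f \<longleftrightarrow> (\<forall>v\<in>V. f v : hom (Gs v) H) &
		 (\<forall>v\<in>V. \<forall>w\<in>V. {v, w} : E --> (\<forall>a\<in>car (Gs v). \<forall>b\<in>car (Gs w).
				f v a *[H] f w b = f w b *[H] f v a))"

context
	fixes H :: "('h, 'z) monoid_scheme" and f
	assumes H: "group H" and f: "compatible H f"
begin

interpretation H: group H by (rule H)

lemma fv_hom: "v : V ==> f v : hom (Gs v) H"
	using f by (simp add: compatible_def)

lemma fv_closed: "v : V ==> a : car (Gs v) ==> f v a : car H"
	using fv_hom by (meson hom_in_carrier)

lemma gp_eval_closed: "w : W ==> gp_eval H f w : car H"
	by (induction w) (auto simp: fv_closed)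

lemma gp_eval_append: "u : W ==> w : W ==> gp_eval H f (u @ w) = gp_eval H f u *[H] gp_eval H f w"
	by (induction u) (auto simp: fv_closed gp_eval_closed H.m_assoc)

lemma gp_eval_step: "(x, y) : gp_step V E Gs ==> gp_eval H f x = gp_eval H f y"
proof (induction rule: gp_step.induct)
	case (mult u u' v a b)
	then show ?case
		using hom_mult[OF fv_hom[OF mult(3)]] vertex_group[OF mult(3)]
		by (simp add: gp_eval_append fv_closed gp_eval_closed H.m_assoc group.is_monoid monoid.m_closed)
next
	case (one u u' v)
	then have "f v one[Gs v] = one[H]" using hom_one[OF fv_hom _ H] vertex_group by metis
	then show ?case using one vertex_group[OF one(3)]
		by (simp add: gp_eval_append gp_eval_closed group.is_monoid monoid.one_closed)
next
	case (comm u u' v w a b)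
	have "f v a *[H] f w b = f w b *[H] f v a" using f comm unfolding compatible_def by blast
	then have "f v a *[H] (f w b *[H] z) = f w b *[H] (f v a *[H] z)" if "z : car H" for z
		using comm that by (simp add: H.m_assoc[symmetric] fv_closed)
	then show ?case using comm by (simp add: gp_eval_append gp_eval_closed fv_closed)
qed

lemma gp_lift_cls: "w : W ==> gp_lift H f (cls w) = gp_eval H f w"
proof -
	assume w: "w : W"
	then have "w : cls w" by (simp add: mem_cls gp_eq_refl)
	then have "(SOME z. z : cls w) : cls w" by (rule someI)
	then have "(w, SOME z. z : cls w) : gp_eq V E Gs" by (simp add: mem_cls)
	then show ?thesis unfolding gp_lift_def using gp_eq_invariant[of _ _ "gp_eval H f"] gp_eval_step by metis
qed

lemma gp_lift_hom: "gp_lift H f : hom GP H"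
	by (auto simp: hom_def gp_lift_cls gp_eval_closed cls_mult gp_eval_append elim!: carrier_cases)

lemma gp_lift_incl: "v : V ==> a : car (Gs v) ==> gp_lift H f (incl v a) = f v a"
	by (simp add: incl_cls gp_lift_cls fv_closed)

end

text \<open>\<open>A\<close> and \<open>B\<close> are arbitrary sets, possibly with lists that are
  not words. If their product is one class, any two words of \<open>A\<close> followed by the same
  word of \<open>B\<close> are equivalent; cancelling the latter in the group puts all words of
  \<open>A\<close> into one class, and symmetrically for \<open>B\<close>.\<close>

lemma mult_GP_sat:
	assumes "A *[GP] B : car GP"
	obtains a b where "a : W" "b : W" "A \<inter> W \<subseteq> cls a" "B \<inter> W \<subseteq> cls b" "a : A" "b : B"
proof -
	obtain c where c: "c : W" "A *[GP] B = cls c" using assms by (rule carrier_cases)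
	then have "c : A *[GP] B" by (simp add: mem_cls gp_eq_refl)
	then obtain a b where ab: "a : A" "b : B" "(a @ b, c) : gp_eq V E Gs" by (auto simp: mult_GP)
	then have W: "a : W" "b : W" using gp_eq_words by fastforce+
	have "A \<inter> W \<subseteq> cls a"
	proof
		fix a' assume "a' : A \<inter> W"
		then have "a' @ b : A *[GP] B" using ab W unfolding mult_GP
			by (intro CollectI bexI[of _ a'] bexI[of _ b]) (auto intro: gp_eq_refl)
		then have "a' @ b : cls c" using c by simp
		then have "cls (a' @ b) = cls (a @ b)" using ab W c \<open>a' : A \<inter> W\<close>
			by (simp add: mem_cls cls_eq_iff) (meson gp_eq_sym gp_eq_trans)
		then have "cls a' = cls a" using W \<open>a' : A \<inter> W\<close>
			by (simp add: cls_mult[symmetric] del: GP.m_assoc) 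
		then show "a' : cls a" using \<open>a' : A \<inter> W\<close> by (metis IntD2 gp_eq_refl mem_cls)
	qed
	moreover have "B \<inter> W \<subseteq> cls b"
	proof
		fix b' assume "b' : B \<inter> W"
		then have "a @ b' : A *[GP] B" using ab W unfolding mult_GP
			by (intro CollectI bexI[of _ a] bexI[of _ b']) (auto intro: gp_eq_refl)
		then have "a @ b' : cls c" using c by simp
		then have "cls (a @ b') = cls (a @ b)" using ab W c \<open>b' : B \<inter> W\<close>
			by (simp add: mem_cls cls_eq_iff) (meson gp_eq_sym gp_eq_trans)
		then have "cls b' = cls b" using W \<open>b' : B \<inter> W\<close>
			by (simp add: cls_mult[symmetric] del: GP.m_assoc) 
		then show "b' : cls b" using \<open>b' : B \<inter> W\<close> by (metis IntD2 gp_eq_refl mem_cls)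
	qed
	ultimately show ?thesis using that W ab by blast
qed

text \<open>A product set is closed under the word relation, so it cannot distinguish a class from a
  set that contains a member of it and no word outside it.\<close>

lemma mult_sat:
	assumes "a : W" "a : A" "A \<inter> W \<subseteq> cls a"
	shows "A *[GP] C = cls a *[GP] C" "C *[GP] A = C *[GP] cls a"
proof -
	have *: "x : cls a" if "x : A" "x : W" for x using assms that by auto
	have W: "x : W & y : W" if "(x @ y, z) : gp_eq V E Gs" for x y z using gp_eq_words[OF that] by simp
	show "A *[GP] C = cls a *[GP] C"
		unfolding mult_GP
	proof (intro Collect_cong iffI; elim bexE)
		fix z x y assume z: "x : A" "y : C" "(x @ y, z) : gp_eq V E Gs"
		then show "\<exists>x\<in>cls a. \<exists>y\<in>C. (x @ y, z) : gp_eq V E Gs" using * W by blast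
	next
		fix z x y assume z: "x : cls a" "y : C" "(x @ y, z) : gp_eq V E Gs"
		then have "(a @ y, x @ y) : gp_eq V E Gs" using W gp_eq_append gp_eq_refl mem_cls by blast
		then show "\<exists>x\<in>A. \<exists>y\<in>C. (x @ y, z) : gp_eq V E Gs" using assms z gp_eq_trans by blast
	qed
	show "C *[GP] A = C *[GP] cls a"
		unfolding mult_GP
	proof (intro Collect_cong iffI; elim bexE)
		fix z x y assume z: "x : C" "y : A" "(x @ y, z) : gp_eq V E Gs"
		then show "\<exists>x\<in>C. \<exists>y\<in>cls a. (x @ y, z) : gp_eq V E Gs" using * W by blast
	next
		fix z x y assume z: "x : C" "y : cls a" "(x @ y, z) : gp_eq V E Gs"
		then have "(x @ a, x @ y) : gp_eq V E Gs" using W gp_eq_append gp_eq_refl mem_cls by blast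
		then show "\<exists>x\<in>C. \<exists>y\<in>A. (x @ y, z) : gp_eq V E Gs" using assms z gp_eq_trans by blast
	qed
qed

text \<open>The definition of \<open>cl_aut\<close> quantifies over lists whose entries need not be group elements;
	the product of such a list is a group element only if every entry acts like one.\<close>
lemma foldr_mult_carrier:
	assumes "foldr (\<otimes>\<^bsub>GP\<^esub>) xs one[GP] : car GP"
	shows "\<exists>ys. length ys = length xs & set ys \<subseteq> car GP &
		 foldr (\<otimes>\<^bsub>GP\<^esub>) ys one[GP] = foldr (\<otimes>\<^bsub>GP\<^esub>) xs one[GP] &
		 (\<forall>y\<in>set ys. y : set xs | (\<exists>x\<in>set xs. x \<notin> car GP & inv[GP] x = inv[GP] y))"
	using assms
proof (induction xs)
	case Nil then show ?case by simp
next
	case (Cons x xs)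
	let ?r = "foldr (\<otimes>\<^bsub>GP\<^esub>) xs one[GP]"
	from Cons.prems have "x *[GP] ?r : car GP" by simp
	then obtain a b where ab: "a : W" "b : W" "x \<inter> W \<subseteq> cls a" "?r \<inter> W \<subseteq> cls b" "a : x" "b : ?r"
		by (rule mult_GP_sat)
	have sat: "(\<exists>A B. R = A *[GP] B) ==> z : R ==> (z, z') : gp_eq V E Gs ==> z' : R & R \<subseteq> W" for R z z'
		by (auto simp: mult_GP dest: gp_eq_trans gp_eq_words) 
	\<comment> \<open>The tail is \<open>one[GP]\<close> or itself a product, hence a union of classes;
	  as its words lie in a single class, it equals that class.\<close>
	have r_eq: "?r = cls b"
	proof (cases xs)
		case Nil
		then show ?thesis using ab by (simp add: one_GP) (metis cls_eq_iff mem_cls gp_words_simps(1))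
	next
		case (Cons x' xs')
		then have "\<exists>A B. ?r = A *[GP] B" by auto
		then show ?thesis using sat[of ?r b] ab by (auto simp: mem_cls intro: gp_eq_refl)
	qed
	then obtain ys where ys: "length ys = length xs" "set ys \<subseteq> car GP"
		 "foldr (\<otimes>\<^bsub>GP\<^esub>) ys one[GP] = ?r"
		 "\<forall>y\<in>set ys. y : set xs | (\<exists>x\<in>set xs. x \<notin> car GP & inv[GP] x = inv[GP] y)"
		using Cons.IH ab by auto
	\<comment> \<open>\<open>m_inv\<close> is a definite description in terms of products with its
	  argument, so it agrees on \<open>x\<close> and on the class that \<open>x\<close> acts like, even
	  if \<open>x\<close> is outside the carrier.\<close>
	have inv: "inv[GP] x = inv[GP] (cls a)"
		unfolding m_inv_def using mult_sat[OF ab(1,5,3)] by simp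
	show ?case
	proof (cases "x : car GP")
		case True
		then show ?thesis using ys by (intro exI[of _ "x # ys"]) auto
	next
		case False
		then show ?thesis using ys inv ab mult_sat[OF ab(1,5,3)] by (intro exI[of _ "cls a # ys"]) auto
	qed
qed

end

section \<open>Normal forms in free products\<close>

locale free_prod =
	fixes A :: "bool => 'c monoid"
	assumes factor_group: "group (A i)"

sublocale free_prod \<subseteq> graph_prod "UNIV :: bool set" "{}" A
	by (rule graph_prod.intro) (rule factor_group)

context free_prod
begin

lemma factor_simps [simp]:
	"a : car (A i) ==> b : car (A i) ==> a *[A i] b : car (A i)"
	"one[A i] : car (A i)"
	"a : car (A i) ==> a *[A i] one[A i] = a"
	"a : car (A i) ==> one[A i] *[A i] a = a"
	"a : car (A i) ==> inv[A i] a : car (A i)"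
	"a : car (A i) ==> a *[A i] inv[A i] a = one[A i]"
	"a : car (A i) ==> inv[A i] a *[A i] a = one[A i]"
	"a : car (A i) ==> inv[A i] (inv[A i] a) = a"
proof -
	interpret group "A i" by (rule factor_group)
	show "a : car (A i) ==> b : car (A i) ==> a *[A i] b : car (A i)"
		"one[A i] : car (A i)"
		"a : car (A i) ==> a *[A i] one[A i] = a"
		"a : car (A i) ==> one[A i] *[A i] a = a"
		"a : car (A i) ==> inv[A i] a : car (A i)"
		"a : car (A i) ==> a *[A i] inv[A i] a = one[A i]"
		"a : car (A i) ==> inv[A i] a *[A i] a = one[A i]"
		"a : car (A i) ==> inv[A i] (inv[A i] a) = a" by simp_all
qed

lemma factor_inv_one_iff [simp]: "a : car (A i) ==> inv[A i] a = one[A i] \<longleftrightarrow> a = one[A i]"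
	using factor_group group.inv_eq_1_iff by metis

lemma factor_assoc: "a : car (A i) ==> b : car (A i) ==> c : car (A i) ==>
	 a *[A i] b *[A i] c = a *[A i] (b *[A i] c)"
	using factor_group by (simp add: group.is_monoid monoid.m_assoc)

definition rw :: "(bool \<times> 'c) list => bool" where
	"rw w \<longleftrightarrow> (\<forall>x\<in>set w. snd x : car (A (fst x)) & snd x ~= one[A (fst x)]) &
		 successively (%x y. fst x ~= fst y) w"

text \<open>Van der Waerden's device: letters act on reduced words. Once this action respects the
  defining relations (\<open>lact_lact\<close>, \<open>nfw_step\<close>), every element has a unique
  reduced word.\<close>

definition lact :: "bool \<times> 'c => (bool \<times> 'c) list => (bool \<times> 'c) list" where
	"lact x w = (if snd x = one[A (fst x)] then w else
		 case w of [] => [x] | y # w' =>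
			 if fst x = fst y then
				 (if snd x *[A (fst x)] snd y = one[A (fst x)] then w'
					else (fst x, snd x *[A (fst x)] snd y) # w')
			 else x # w)"

definition nfw :: "(bool \<times> 'c) list => (bool \<times> 'c) list" where
	"nfw w = foldr lact w []"

definition nf :: "(bool \<times> 'c) list set => (bool \<times> 'c) list" where
	"nf Q = nfw (SOME w. w : Q)"

lemma rw_Nil [simp]: "rw []" by (simp add: rw_def)

lemma rw_Cons: "rw (x # w) \<longleftrightarrow> snd x : car (A (fst x)) & snd x ~= one[A (fst x)] &
		(w ~= [] --> fst x ~= fst (hd w)) & rw w"
	by (cases w) (auto simp: rw_def)

lemma rw_append: "rw (u @ w) \<longleftrightarrow> rw u & rw w & (u ~= [] --> w ~= [] --> fst (last u) ~= fst (hd w))"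
	by (auto simp: rw_def successively_append_iff)

lemma rw_W [simp]: "rw w ==> w : W"
	by (induction w) (auto simp: rw_Cons)

lemma winv_eq_Nil [simp]: "winv w = [] \<longleftrightarrow> w = []" by (simp add: winv_def)

lemma rw_winv [simp]: "rw w ==> rw (winv w)"
proof (induction w)
	case (Cons x w)
	have "fst (last (winv w)) = fst (hd w)" if "w ~= []"
		using that by (cases w) auto
	then show ?case using Cons by (auto simp: rw_Cons rw_append)
qed simp

lemma length_winv [simp]: "length (winv w) = length w" by (simp add: winv_def)
lemma fst_hd_winv: "w ~= [] ==> fst (hd (winv w)) = fst (last w)"
	by (simp add: winv_def hd_rev last_map)
lemma fst_last_winv: "w ~= [] ==> fst (last (winv w)) = fst (hd w)"
	by (simp add: winv_def last_rev hd_map)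
lemma winv_winv [simp]: "w : W ==> winv (winv w) = w"
	by (induction w) auto

lemma lact_rw [simp]:
	assumes "rw w" "snd x : car (A (fst x))"
	shows "rw (lact x w)"
	using assms by (cases w) (auto simp: lact_def rw_Cons)

lemma lact_one [simp]: "lact (i, one[A i]) w = w" by (simp add: lact_def)

lemma factor_one_cases:
	assumes "a : car (A i)" "b : car (A i)" "a *[A i] b = one[A i]"
	shows "b = inv[A i] a" "a = inv[A i] b"
	using assms factor_group group.inv_equality factor_simps(8) by metis+

lemma factor_inv_cancel:
	"a : car (A i) ==> b : car (A i) ==> a *[A i] (inv[A i] a *[A i] b) = b"
	"a : car (A i) ==> b : car (A i) ==> inv[A i] a *[A i] (a *[A i] b) = b"
	by (simp_all add: factor_assoc[symmetric])

lemma lact_lact: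
	assumes "rw w" "a : car (A i)" "b : car (A i)"
	shows "lact (i, a) (lact (i, b) w) = lact (i, a *[A i] b) w"
proof (cases "b = one[A i] | a = one[A i]")
	case True then show ?thesis using assms by auto
next
	case ab: False
	show ?thesis
	proof (cases "w ~= [] & fst (hd w) = i")
		case False
		then have "lact (i, b) w = (i, b) # w" using ab by (cases w) (auto simp: lact_def)
		then show ?thesis using ab assms False by (cases w) (auto simp: lact_def)
	next
		case True
		then obtain c w' where w: "w = (i, c) # w'" by (cases w) auto
		have c: "c : car (A i)" "c ~= one[A i]" "w' ~= [] ==> fst (hd w') ~= i" using assms(1) w by (auto simp: rw_Cons)
		show ?thesis
		proof (cases "b *[A i] c = one[A i]")
			case True
			then have "a *[A i] b *[A i] c = a" using assms c by (simp add: factor_assoc)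
			moreover have "a *[A i] b = one[A i] ==> a = c"
				using True assms c factor_one_cases by metis
			ultimately show ?thesis using True ab w c by (cases w') (auto simp: lact_def)
		next
			case False
			moreover have "a *[A i] b = one[A i] ==> a *[A i] (b *[A i] c) = c"
				using assms c by (simp add: factor_assoc[symmetric])
			ultimately show ?thesis using ab w c assms by (auto simp: lact_def factor_assoc)
		qed
	qed
qed

lemma foldr_lact_rw [simp]: "u : W ==> rw w ==> rw (foldr lact u w)"
	by (induction u) auto

lemma nfw_append: "nfw (u @ w) = foldr lact u (nfw w)" by (simp add: nfw_def)

lemma nfw_Cons: "nfw (x # w) = lact x (nfw w)" by (simp add: nfw_def)

lemma nfw_rw [simp]: "w : W ==> rw (nfw w)" by (simp add: nfw_def)

lemma nfw_step: "(x, y) : gp_step UNIV {} A ==> nfw x = nfw y"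
	by (induction rule: gp_step.induct) (auto simp: nfw_append nfw_Cons lact_lact)

lemma nf_cls: "w : W ==> nf (cls w) = nfw w"
proof -
	assume w: "w : W"
	then have "w : cls w" by (simp add: mem_cls gp_eq_refl)
	then have "(SOME z. z : cls w) : cls w" by (rule someI)
	then have "(w, SOME z. z : cls w) : gp_eq UNIV {} A" by (simp add: mem_cls)
	then show ?thesis unfolding nf_def using gp_eq_invariant[of _ _ nfw] nfw_step by metis
qed

lemma lact_Cons: "rw (x # w) ==> lact x w = x # w"
	by (cases w) (auto simp: lact_def rw_Cons)

lemma foldr_lact_append: "rw (u @ w) ==> foldr lact u w = u @ w"
	by (induction u) (auto simp: lact_Cons rw_Cons)

lemma nfw_id: "rw w ==> nfw w = w"
	using foldr_lact_append[of w "[]"] by (simp add: nfw_def)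

lemma nf_cls_rw [simp]: "rw w ==> nf (cls w) = w"
	by (simp add: nf_cls nfw_id)

lemma cls_lact:
	assumes "snd x : car (A (fst x))" "w : W"
	shows "cls (lact x w) = cls (x # w)"
proof -
	have e: "cls (x # w) = incl (fst x) (snd x) *[GP] cls w" using assms by (intro cls_Cons) auto
	show ?thesis
	proof (cases "snd x = one[A (fst x)]")
		case True
		then show ?thesis using e assms incl_one[of "fst x"] by (simp add: lact_def)
	next
		case x: False
		show ?thesis
		proof (cases w)
			case (Cons y w')
			have y: "cls w = incl (fst y) (snd y) *[GP] cls w'" unfolding Cons using assms Cons by (intro cls_Cons) auto
			show ?thesis
			proof (cases "fst x = fst y")
				case True
				have "cls (x # w) = incl (fst x) (snd x *[A (fst x)] snd y) *[GP] cls w'"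
					using e y assms Cons True by (simp add: incl_mult GP.m_assoc)
				moreover have "\<dots> = cls ((fst x, snd x *[A (fst x)] snd y) # w')"
					using assms Cons True by (subst cls_Cons) auto
				moreover have "incl (fst x) one[A (fst x)] *[GP] cls w' = cls w'" using assms Cons incl_one[of "fst x"] by simp
				ultimately show ?thesis using x True Cons by (auto simp: lact_def)
			qed (use x Cons in \<open>auto simp: lact_def\<close>)
		qed (use x in \<open>auto simp: lact_def\<close>)
	qed
qed

lemma lact_W [simp]: "snd x : car (A (fst x)) ==> w : W ==> lact x w : W"
	by (cases w) (auto simp: lact_def)

lemma cls_foldr_lact: "u : W ==> w : W ==> cls (foldr lact u w) = cls (u @ w) & foldr lact u w : W"
proof (induction u)
	case (Cons x u)
	then have "cls (lact x (foldr lact u w)) = incl (fst x) (snd x) *[GP] cls (foldr lact u w)"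
		by (simp add: cls_lact cls_Cons)
	then show ?case using Cons by (simp add: cls_Cons)
qed simp

lemma cls_nfw: "w : W ==> cls (nfw w) = cls w"
	using cls_foldr_lact[of w "[]"] by (simp add: nfw_def)

lemma nf_rw [simp]: "Q : car GP ==> rw (nf Q)"
	by (metis carrier_cases nf_cls nfw_rw)

lemma nf_W [simp]: "Q : car GP ==> nf Q : W" by simp

lemma cls_nf [simp]: "Q : car GP ==> cls (nf Q) = Q"
	by (metis carrier_cases nf_cls cls_nfw)

lemma nf_inj: "P : car GP ==> Q : car GP ==> nf P = nf Q ==> P = Q"
	by (metis cls_nf)

lemma nf_one [simp]: "nf one[GP] = []" by (simp add: one_GP)

lemma nf_eq_Nil: "Q : car GP ==> nf Q = [] \<longleftrightarrow> Q = one[GP]"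
	by (metis nf_one nf_inj GP.one_closed)

lemma nf_mult: "P : car GP ==> Q : car GP ==> nf (P *[GP] Q) = foldr lact (nf P) (nf Q)"
proof -
	assume PQ: "P : car GP" "Q : car GP"
	have "P *[GP] Q = cls (nf P @ nf Q)" using PQ cls_mult[of "nf P" "nf Q"] by simp
	then have "nf (P *[GP] Q) = nfw (nf P @ nf Q)" using PQ by (simp add: nf_cls)
	then show ?thesis using PQ by (simp add: nfw_append nfw_id)
qed

lemma nf_mult_cls: "rw u ==> rw w ==> nf (cls u *[GP] cls w) = foldr lact u w"
	by (simp add: nf_mult)

lemma nf_inv: "Q : car GP ==> nf (inv[GP] Q) = winv (nf Q)"
	by (metis cls_nf cls_inv nf_W nf_rw nf_cls_rw rw_winv)

lemma incl_nf: "a : car (A i) ==> nf (incl i a) = (if a = one[A i] then [] else [(i, a)])"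
	using incl_one[of i] by (auto simp: incl_cls rw_Cons one_GP nf_cls nfw_def lact_def)

lemma incl_inj: "a : car (A i) ==> b : car (A i) ==> incl i a = incl i b \<longleftrightarrow> a = b"
	by (metis incl_nf list.distinct(1) list.inject prod.inject)

text \<open>What can remain between the uncancelled parts of two reduced words: nothing, or one
  letter from each, in the same factor and with non-trivial product.\<close>

definition merge :: "(bool \<times> 'c) list => (bool \<times> 'c) list => (bool \<times> 'c) list => bool" where
	"merge x z m \<longleftrightarrow> (x = [] & z = [] & m = []) |
			(\<exists>i a b. x = [(i, a)] & z = [(i, b)] & a *[A i] b ~= one[A i] & m = [(i, a *[A i] b)])"

lemma merge_Nil [simp]: "merge [] [] []" by (simp add: merge_def)

text \<open>Peel off the last letter of \<open>u\<close>: either it cancels the head of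
  \<open>w\<close> and the induction continues, or it merges with that head or meets another factor
  and all cancellation stops. The later estimates of defects, syllable sizes and lengths use this
  shape.\<close>

lemma prod_decomp:
	assumes "rw u" "rw w"
	shows "\<exists>p c q x z m. u = p @ x @ c & w = winv c @ z @ q & foldr lact u w = p @ m @ q &
		 merge x z m"
	using assms
proof (induction u arbitrary: w rule: rev_induct)
	case Nil
	then show ?case by (intro exI[of _ "[]"] exI[of _ w]) auto
next
	case (snoc l u)
	have u: "rw u" and l: "snd l : car (A (fst l))" "snd l ~= one[A (fst l)]"
		"u ~= [] ==> fst (last u) ~= fst l"
		using snoc.prems by (auto simp: rw_append rw_Cons)
	show ?case
	proof (cases "w ~= [] & fst (hd w) = fst l")
		case False
		then have "rw ((u @ [l]) @ w)" using snoc.prems by (subst rw_append) auto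
		then have "foldr lact (u @ [l]) w = (u @ [l]) @ w" by (rule foldr_lact_append)
		then show ?thesis by (intro exI[of _ "u @ [l]"] exI[of _ "[]"] exI[of _ w]) auto
	next
		case True
		then obtain b w' where w: "w = (fst l, b) # w'" by (cases w) auto
		have b: "b : car (A (fst l))" "rw w'" "w' ~= [] ==> fst (hd w') ~= fst l"
			using snoc.prems w by (auto simp: rw_Cons)
		show ?thesis
		proof (cases "snd l *[A (fst l)] b = one[A (fst l)]")
			case T: True
			then have lw: "lact l w = w'" using w l by (simp add: lact_def)
			have b': "b = inv[A (fst l)] (snd l)" using factor_one_cases T l b by blast
			from snoc.IH[OF u b(2)] obtain p c q x z m where *: "u = p @ x @ c" "w' = winv c @ z @ q"
				"foldr lact u w' = p @ m @ q"
				"merge x z m" by blast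
			show ?thesis
			proof (intro exI conjI)
				show "u @ [l] = p @ x @ (c @ [l])" using *(1) by simp
				show "w = winv (c @ [l]) @ z @ q" using w b' *(2) by simp
				show "foldr lact (u @ [l]) w = p @ m @ q" using lw *(3) by simp
				show "merge x z m" by fact
			qed
		next
			case F: False
			let ?m = "(fst l, snd l *[A (fst l)] b)"
			have lw: "lact l w = ?m # w'" using w l F by (simp add: lact_def)
			have "rw (u @ ?m # w')" using u l b F by (subst rw_append) (auto simp: rw_Cons)
			then have "foldr lact u (?m # w') = u @ ?m # w'" by (rule foldr_lact_append)
			then have e: "foldr lact (u @ [l]) w = u @ [?m] @ w'" using lw by simp
			show ?thesis
			proof (intro exI conjI)
				show "u @ [l] = u @ [(fst l, snd l)] @ []" by simp
				show "w = winv [] @ [(fst l, b)] @ w'" using w by simp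
				show "merge [(fst l, snd l)] [(fst l, b)] [?m]" using F unfolding merge_def by blast
			qed (rule e)
		qed
	qed
qed

lemma conj_cls_append:
	assumes "d : W" "w : W"
	shows "cls (d @ w @ winv d) = cls d *[GP] cls w *[GP] inv[GP] cls d"
	using assms by (simp add: cls_inv cls_mult)

text \<open>Conjugation removes a cancelling pair of end letters; if the ends only merge, the result
  is cyclically reduced and the process stops. So at most one new letter arises, a product of two
  old ones. The last clause records this, because it bounds the syllables of all powers.\<close>

lemma cyclic_reduction:
	assumes "rw w"
	shows "\<exists>d v. d : W & rw v & cls w = cls d *[GP] cls v *[GP] inv[GP] cls d &
		 (length v <= 1 | fst (hd v) ~= fst (last v)) &
		 (\<forall>x\<in>set v. x : set w | (\<exists>i a b. (i, a) : set w & (i, b) : set w & x = (i, a *[A i] b)))"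
	using assms
proof (induction "length w" arbitrary: w rule: less_induct)
	case less
	show ?case
	proof (cases "length w <= 1 | fst (hd w) ~= fst (last w)")
		case True
		then show ?thesis using less.prems
			by (intro exI[of _ "[]", OF exI[of _ w]]) (auto simp: one_GP[symmetric])
	next
		case False
		then obtain x w0 where "w = x # w0" "w0 ~= []" by (cases w) auto
		then obtain w' y where w: "w = x # w' @ [y]" by (metis append_butlast_last_id)
		have xy: "fst x = fst y" using False w by simp
		have ne: "w' ~= []" using less.prems xy unfolding w by (cases w') (auto simp: rw_Cons)
		have x: "snd x : car (A (fst x))" and y: "snd y : car (A (fst y))"
			using less.prems unfolding w rw_Cons rw_append by blast+
		have w': "rw w'" "w' ~= []" "fst (last w') ~= fst y" "fst (hd w') ~= fst x"
			using less.prems ne unfolding w by (auto simp: rw_Cons rw_append)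
		show ?thesis
		proof (cases "snd y *[A (fst y)] snd x = one[A (fst y)]")
			case True
			then have "snd y = inv[A (fst x)] (snd x)" using factor_one_cases(2)[of "snd y" "fst y" "snd x"] True x y xy by simp
			then have "y = (fst x, inv[A (fst x)] (snd x))" using xy by (simp add: prod_eq_iff)
			then have e: "w = [x] @ w' @ winv [x]" using w by simp
			obtain d v where dv: "d : W" "rw v" "cls w' = cls d *[GP] cls v *[GP] inv[GP] cls d"
				"length v <= 1 | fst (hd v) ~= fst (last v)"
				"\<forall>x\<in>set v. x : set w' | (\<exists>i a b. (i, a) : set w' & (i, b) : set w' & x = (i, a *[A i] b))"
				using less.hyps[of w'] w' w by auto
			have "cls w = cls [x] *[GP] cls w' *[GP] inv[GP] cls [x]"
				unfolding e using x w' by (intro conj_cls_append) auto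
			also have "\<dots> = cls ([x] @ d) *[GP] cls v *[GP] inv[GP] cls ([x] @ d)"
				using x dv by (simp add: cls_mult cls_inv)
			finally have 1: "cls w = \<dots>" .
			have "set w' \<subseteq> set w" using w by auto
			then have "\<forall>x\<in>set v. x : set w | (\<exists>i a b. (i, a) : set w & (i, b) : set w & x = (i, a *[A i] b))"
				using dv(5) by blast
			then show ?thesis using dv(1,2,4) x 1 by (intro exI[of _ "[x] @ d", OF exI[of _ v]]) simp
		next
			case F: False
			\<comment> \<open>The last letter is moved to the front, w = y^-1 (y x w') y, where it merges
			  with the first.\<close>
			let ?m = "(fst y, snd y *[A (fst y)] snd x)"
			let ?d = "winv [y]"
			have rv: "rw (?m # w')" using w' F x y xy by (auto simp: rw_Cons)
			have "snd y ~= one[A (fst y)]" using less.prems unfolding w rw_Cons rw_append by blast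
			then have "lact y (x # w') = ?m # w'" using F xy[symmetric] by (simp add: lact_def)
			then have "cls (?m # w') = cls ([y, x] @ w')" using cls_lact[of y "x # w'"] x y w' by simp
			then have "cls ?d *[GP] cls (?m # w') *[GP] inv[GP] cls ?d = cls (winv [y] @ [y] @ [x] @ w' @ [y])"
				using x y w' xy by (simp add: cls_mult cls_inv)
			also have "\<dots> = cls (winv [y]) *[GP] cls [y] *[GP] cls w"
				using x y w' xy w by (simp add: cls_mult)
			also have "\<dots> = cls w" using y w' x xy w
				by (simp add: cls_inv[symmetric] del: winv_simps)
			finally have "cls w = cls ?d *[GP] cls (?m # w') *[GP] inv[GP] cls ?d" by simp
			moreover have "fst (hd (?m # w')) ~= fst (last (?m # w'))" using w' by auto
			moreover have "\<forall>z\<in>set (?m # w'). z : set w | (\<exists>i a b. (i, a) : set w & (i, b) : set w & z = (i, a *[A i] b))"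
			proof -
				have 1: "(fst y, snd y) : set w" "(fst x, snd x) : set w" using w by simp_all
				from 1(2) have "(fst y, snd x) : set w" unfolding xy .
				note 1(1) this
				moreover have "set (?m # w') \<subseteq> insert ?m (set w)" using w by auto
				ultimately show ?thesis by blast
			qed
			ultimately show ?thesis using rv y by (intro exI[of _ ?d, OF exI[of _ "?m # w'"]]) simp
		qed
	qed
qed

lemma rw_replicate:
	assumes "rw v" "fst (hd v) ~= fst (last v)"
	shows "rw (concat (replicate k v)) & (k > 0 --> v ~= [] --> hd (concat (replicate k v)) = hd v)"
	using assms by (induction k) (auto simp: rw_append)

lemma cls_pow: "v : W ==> cls v ^[GP] (k::nat) = cls (concat (replicate k v)) & concat (replicate k v) : W"
proof (induction k)
	case (Suc k)
	have "replicate (Suc k) v = replicate k v @ [v]" by (metis replicate_append_same replicate_Suc)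
	then have "concat (replicate (Suc k) v) = concat (replicate k v) @ v" by (simp del: replicate_Suc)
	then show ?case using Suc by (simp add: cls_mult del: replicate_Suc)
qed (simp add: one_GP)

end

section \<open>Stable commutator length\<close>

text \<open>Fekete's lemma. \<open>scl_aut\<close> is a \<open>lim\<close>, which carries no
  information before convergence is known.\<close>

lemma subadditive_convergent:
	fixes a :: "nat => real"
	assumes sub: "!!m n. a (m + n) <= a m + a n" and nonneg: "!!n. a n \<ge> 0"
	shows "convergent (%n. a n / real n)"
proof -
	define S where "S = (%n. a n / real n) ` {1..}"
	have bdd: "bdd_below S" unfolding S_def by (rule bdd_belowI[of _ 0]) (auto simp: nonneg)
	have ne: "S ~= {}" by (auto simp: S_def)
	have mult: "a (q * m + r) <= real q * a m + a r" for q m r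
	proof (induction q)
		case (Suc q)
		have "a (m + (q * m + r)) <= a m + a (q * m + r)" by (rule sub)
		then show ?case using Suc by (simp add: algebra_simps)
	qed simp
	have "(%n. a n / real n) \<longlonglongrightarrow> Inf S"
	proof (rule metric_LIMSEQ_I)
		fix e :: real assume e: "e > 0"
		obtain m where m: "m \<ge> 1" "a m / real m < Inf S + e / 2"
			using cInf_lessD[OF ne, of "Inf S + e / 2"] e by (auto simp: S_def)
		define M where "M = (\<Sum>r<m. a r)"
		have M: "a r <= M" if "r < m" for r unfolding M_def using that by (intro member_le_sum) (auto simp: nonneg)
		obtain N :: nat where N: "real N > 2 * M / e" using reals_Archimedean2 by blast
		have "dist (a n / real n) (Inf S) < e" if n: "n \<ge> Suc N" for n
		proof -
			have n0: "real n > 0" using n by simp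
			have "a n <= real (n div m) * a m + a (n mod m)" using mult[of "n div m" m "n mod m"] by simp
			also have "\<dots> <= (real n / real m) * a m + M"
			proof (intro add_mono mult_right_mono nonneg M)
				show "real (n div m) <= real n / real m" using m by (simp add: pos_le_divide_eq flip: of_nat_mult)
				show "n mod m < m" using m by simp
			qed
			finally have "a n / real n <= a m / real m + M / real n"
				using n0 m by (simp add: field_simps)
			moreover have "M / real n < e / 2" 
			proof -
				have "2 * M / e < real n" using N n by linarith
				then show ?thesis using e n0 by (simp add: field_simps)
			qed
			moreover have "Inf S <= a n / real n" using n by (intro cInf_lower bdd) (auto simp: S_def)
			ultimately show ?thesis using m unfolding dist_real_def by linarith
		qed
		then show "\<exists>no. \<forall>n\<ge>no. dist (a n / real n) (Inf S) < e" by blast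
	qed
	then show ?thesis by (auto simp: convergent_def)
qed

section \<open>Autocommutators and their length\<close>

lemma (in group) inv_cancel:
	"x : car G ==> y : car G ==> x \<otimes> (inv x \<otimes> y) = y"
	"x : car G ==> y : car G ==> inv x \<otimes> (x \<otimes> y) = y"
	by (simp_all add: m_assoc[symmetric])

lemma (in group) inner_iso: "g : car G ==> (%x. g \<otimes> x \<otimes> inv g) : iso G G"
proof -
	assume g: "g : car G"
	have h: "(%x. g \<otimes> x \<otimes> inv g) : hom G G"
		using g by (intro homI) (auto simp: m_assoc inv_cancel)
	have "bij_betw (%x. g \<otimes> x \<otimes> inv g) (car G) (car G)"
		by (rule bij_betw_byWitness[where f' = "%x. inv g \<otimes> x \<otimes> g"]) (use g in \<open>auto simp: m_assoc inv_cancel\<close>)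
	then show ?thesis using h by (simp add: iso_def)
qed

lemma (in group) aut_gens_carrier: "y : aut_gens G ==> y : car G"
	by (auto simp: aut_gens_def iso_def hom_def)

lemma (in group) aut_comm_subgroup: "subgroup (aut_comm G) G"
	unfolding aut_comm_def using aut_gens_carrier by (intro generate_is_subgroup) auto

lemma (in group) commutator_aut_gens:
	"g : car G ==> x : car G ==> g \<otimes> x \<otimes> inv g \<otimes> inv x : aut_gens G"
	unfolding aut_gens_def
	by (intro CollectI exI[of _ "%x. g \<otimes> x \<otimes> inv g"] exI[of _ x]) (simp add: inner_iso)

lemma (in group) aut_comm_conj:
	assumes "g : car G" "x : aut_comm G"
	shows "g \<otimes> x \<otimes> inv g : aut_comm G"
proof -
	interpret S: subgroup "aut_comm G" G by (rule aut_comm_subgroup)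
	have x: "x : car G" using assms S.subset by blast
	have "g \<otimes> x \<otimes> inv g \<otimes> inv x : aut_comm G"
		unfolding aut_comm_def by (rule generate.incl) (rule commutator_aut_gens[OF assms(1) x])
	then have "g \<otimes> x \<otimes> inv g \<otimes> inv x \<otimes> x : aut_comm G" using assms by blast
	then show ?thesis using assms x by (simp add: m_assoc)
qed

lemma (in group) foldr_mult_append:
	"set xs \<subseteq> car G ==> set ys \<subseteq> car G ==>
	 foldr (\<otimes>) xs \<one> : car G & foldr (\<otimes>) (xs @ ys) \<one> = foldr (\<otimes>) xs \<one> \<otimes> foldr (\<otimes>) ys \<one>"
proof (induction xs)
	case Nil
	have "foldr (\<otimes>) ys \<one> : car G" using Nil(2) by (induction ys) auto
	then show ?case by simp
next
	case (Cons x xs)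
	have "foldr (\<otimes>) ys \<one> : car G" using Cons(3) by (induction ys) auto
	then show ?case using Cons by (auto simp: m_assoc)
qed

context graph_prod
begin

text \<open>Asks in addition that all entries lie in the carrier; by \<open>cl_aut_eq\<close> this
  does not change the minimum.\<close>

definition aut_expr :: "nat => ('v \<times> 'a) list set => bool" where
	"aut_expr n y \<longleftrightarrow> (\<exists>xs. length xs = n & set xs \<subseteq> car GP &
			(\<forall>y\<in>set xs. y : aut_gens GP | inv[GP] y : aut_gens GP) & foldr (\<otimes>\<^bsub>GP\<^esub>) xs one[GP] = y)"

lemma cl_aut_eq: "y : car GP ==> cl_aut GP y = (LEAST n. aut_expr n y)"
proof -
	assume y: "y : car GP"
	have "(\<exists>xs. length xs = n & (\<forall>y\<in>set xs. y : aut_gens GP | inv[GP] y : aut_gens GP) &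
			foldr (\<otimes>\<^bsub>GP\<^esub>) xs one[GP] = y) = aut_expr n y" for n
	proof
		assume "\<exists>xs. length xs = n & (\<forall>y\<in>set xs. y : aut_gens GP | inv[GP] y : aut_gens GP) &
			foldr (\<otimes>\<^bsub>GP\<^esub>) xs one[GP] = y"
		then obtain xs where xs: "length xs = n" "\<forall>y\<in>set xs. y : aut_gens GP | inv[GP] y : aut_gens GP"
			"foldr (\<otimes>\<^bsub>GP\<^esub>) xs one[GP] = y" by blast
		obtain ys where ys: "length ys = length xs" "set ys \<subseteq> car GP"
			"foldr (\<otimes>\<^bsub>GP\<^esub>) ys one[GP] = foldr (\<otimes>\<^bsub>GP\<^esub>) xs one[GP]"
			"\<forall>y\<in>set ys. y : set xs | (\<exists>x\<in>set xs. x \<notin> car GP & inv[GP] x = inv[GP] y)"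
			using foldr_mult_carrier[of xs] xs y by blast
		have "\<forall>y\<in>set ys. y : aut_gens GP | inv[GP] y : aut_gens GP"
			using ys(4) xs(2) GP.aut_gens_carrier by metis
		then show "aut_expr n y" unfolding aut_expr_def using ys xs by metis
	qed (auto simp: aut_expr_def)
	then show ?thesis by (simp add: cl_aut_def)
qed

lemma aut_expr_mult: "aut_expr m y ==> aut_expr n z ==> aut_expr (m + n) (y *[GP] z)"
	unfolding aut_expr_def
proof (elim exE conjE)
	fix xs ys
	assume a: "length xs = m" "set xs \<subseteq> car GP" "\<forall>y\<in>set xs. y : aut_gens GP | inv[GP] y : aut_gens GP"
		"foldr (\<otimes>\<^bsub>GP\<^esub>) xs one[GP] = y" "length ys = n" "set ys \<subseteq> car GP"
		"\<forall>y\<in>set ys. y : aut_gens GP | inv[GP] y : aut_gens GP" "foldr (\<otimes>\<^bsub>GP\<^esub>) ys one[GP] = z"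
	then show "\<exists>xs. length xs = m + n & set xs \<subseteq> car GP &
			 (\<forall>y\<in>set xs. y : aut_gens GP | inv[GP] y : aut_gens GP) &
			 foldr (\<otimes>\<^bsub>GP\<^esub>) xs one[GP] = y *[GP] z"
		using GP.foldr_mult_append[of xs ys] by (intro exI[of _ "xs @ ys"]) auto
qed

lemma aut_comm_expr: "y : aut_comm GP ==> \<exists>n. aut_expr n y"
	unfolding aut_comm_def
proof (induction rule: generate.induct)
	case one
	show ?case by (intro exI[of _ 0]) (simp add: aut_expr_def)
next
	case (incl h)
	have "h : car GP" using incl GP.aut_gens_carrier by blast
	then show ?case using incl by (intro exI[of _ 1]) (auto simp: aut_expr_def intro!: exI[of _ "[h]"])
next
	case (inv h)
	have "h : car GP" using inv GP.aut_gens_carrier by blast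
	then show ?case using inv
		by (intro exI[of _ 1]) (auto simp: aut_expr_def intro!: exI[of _ "[inv[GP] h]"])
next
	case (eng h1 h2)
	then show ?case using aut_expr_mult by blast
qed

text \<open>The easy half of Bavard duality. \<open>F\<close> is bounded by 4 D on the elements
  \<phi>(g) g^-1 and by 6 D on their inverses, so a product of n of these has value at most 7 D n +
  D. Linear growth along the powers of \<open>x\<close> therefore needs linearly many
  factors.\<close>

lemma scl_pos:
	fixes F :: "('v \<times> 'a) list set => real"
	assumes x: "x : aut_comm GP"
		and qm: "!!g h. g : car GP ==> h : car GP ==> \<bar>F (g *[GP] h) - F g - F h\<bar> <= D"
		and inv: "!!\<phi> g. \<phi> : iso GP GP ==> g : car GP ==> \<bar>F (\<phi> g) - F g\<bar> <= D"
		and low: "!!n. F (x ^[GP] (n::nat)) \<ge> \<epsilon> * real n - C" and \<epsilon>: "\<epsilon> > 0"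
	shows "scl_aut GP x > 0"
proof -
	interpret S: subgroup "aut_comm GP" GP by (rule GP.aut_comm_subgroup)
	have xc: "x : car GP" using x S.subset by blast
	have D: "D \<ge> 0" using qm[OF GP.one_closed GP.one_closed] by linarith
	have F1: "\<bar>F one[GP]\<bar> <= D" using qm[OF GP.one_closed GP.one_closed] by simp
	have Finv: "\<bar>F (inv[GP] g) + F g\<bar> <= 2 * D" if "g : car GP" for g
		using qm[OF GP.inv_closed[OF that] that] F1 that by (simp add: abs_le_iff; linarith?)
	have gens: "\<bar>F y\<bar> <= 4 * D" if y: "y : aut_gens GP" for y
	proof -
		obtain \<phi> g where \<phi>: "\<phi> : iso GP GP" "g : car GP" "y = \<phi> g *[GP] inv[GP] g"
			using y by (auto simp: aut_gens_def)
		have "\<phi> g : car GP" using \<phi> by (auto simp: iso_def hom_def)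
		then show ?thesis using qm[of "\<phi> g" "inv[GP] g"] inv[OF \<phi>(1,2)] Finv[OF \<phi>(2)] \<phi> by (simp add: abs_le_iff; linarith?)
	qed
	have gens': "\<bar>F y\<bar> <= 6 * D" if "y : car GP" "y : aut_gens GP | inv[GP] y : aut_gens GP" for y
		using that(2) gens[of y] gens[of "inv[GP] y"] Finv[OF that(1)] D by (auto simp: abs_le_iff)
	have list: "\<bar>F (foldr (\<otimes>\<^bsub>GP\<^esub>) xs one[GP])\<bar> <= 7 * D * real (length xs) + D"
		if "set xs \<subseteq> car GP" "\<forall>y\<in>set xs. y : aut_gens GP | inv[GP] y : aut_gens GP" for xs
		using that
	proof (induction xs)
		case Nil then show ?case using F1 by simp
	next
		case (Cons y xs)
		have c: "y : car GP" "foldr (\<otimes>\<^bsub>GP\<^esub>) xs one[GP] : car GP"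
			using Cons GP.foldr_mult_append[of xs "[]"] by auto
		show ?case using qm[OF c] gens'[of y] Cons c by (simp add: abs_le_iff algebra_simps)
	qed
	define a where "a n = real (cl_aut GP (x ^[GP] (n::nat)))" for n
	have xn: "x ^[GP] (n::nat) : aut_comm GP" for n
		using x by (induction n) auto
	have xnc: "x ^[GP] (n::nat) : car GP" for n using xc by simp
	have expr: "aut_expr (cl_aut GP (x ^[GP] (n::nat))) (x ^[GP] n)" for n
		unfolding cl_aut_eq[OF xnc] using aut_comm_expr[OF xn] by (rule LeastI_ex)
	have "a (m + n) <= a m + a n" for m n
	proof -
		have "aut_expr (cl_aut GP (x ^[GP] m) + cl_aut GP (x ^[GP] n)) (x ^[GP] (m + n))"
			using aut_expr_mult[OF expr[of m] expr[of n]] xc by (simp add: GP.nat_pow_mult)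
		then show ?thesis unfolding a_def cl_aut_eq[OF xnc[of "m + n"]] using Least_le by fastforce
	qed
	then have "convergent (%n. a n / real n)" by (intro subadditive_convergent) (auto simp: a_def)
	then have lim: "(%n. a n / real n) \<longlonglongrightarrow> scl_aut GP x"
		unfolding scl_aut_def a_def by (simp add: convergent_LIMSEQ_iff)
	have low': "\<epsilon> * real n - C <= 7 * D * a n + D" for n
	proof -
		obtain xs where "length xs = cl_aut GP (x ^[GP] n)" "set xs \<subseteq> car GP"
			"\<forall>y\<in>set xs. y : aut_gens GP | inv[GP] y : aut_gens GP" "foldr (\<otimes>\<^bsub>GP\<^esub>) xs one[GP] = x ^[GP] n"
			using expr[of n] by (auto simp: aut_expr_def)
		then show ?thesis using list[of xs] low[of n] by (simp add: a_def)
	qed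
	\<comment> \<open>The extra 1 keeps the divisor positive when D = 0.\<close>
	define E where "E = 7 * D + 1"
	have E: "E > 0" using D by (simp add: E_def)
	have "(\<epsilon> - (C + D) / real n) / E <= a n / real n" if "n \<ge> 1" for n
	proof -
		have "\<epsilon> * real n - (C + D) <= E * a n"
			using low'[of n] mult_right_mono[of "7 * D" E "a n"] by (simp add: E_def a_def)
		then have "(\<epsilon> * real n - (C + D)) / real n <= E * a n / real n" by (rule divide_right_mono) simp
		then have "\<epsilon> - (C + D) / real n <= a n / real n * E" using that by (simp add: diff_divide_distrib mult.commute)
		then show ?thesis using E by (simp add: pos_divide_le_eq)
	qed
	moreover have "(%n. (\<epsilon> - (C + D) / real n) / E) \<longlonglongrightarrow> (\<epsilon> - 0) / E"
		using E by (intro tendsto_intros lim_const_over_n) auto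
	ultimately have "(\<epsilon> - 0) / E <= scl_aut GP x"
		using lim by (intro LIMSEQ_le) auto
	then show ?thesis using \<epsilon> E by (smt (verit) divide_pos_pos)
qed

text \<open>\<open>F\<close> is controlled only on a characteristic subgroup and is extended by
  dividing off a coset representative; the defect grows by finitely many correction terms.
  Invariance is tested on a power that lies in \<open>K\<close> for all elements at once, and
  dividing by the exponent returns to the element itself.\<close>

lemma scl_pos_char:
	fixes F :: "('v \<times> 'a) list set => real"
	assumes K: "subgroup K GP"
		and char: "!!\<phi> k. \<phi> : iso GP GP ==> k : K ==> \<phi> k : K"
		and T: "finite T" "T \<subseteq> car GP" "!!g. g : car GP ==> \<exists>t\<in>T. g *[GP] inv[GP] t : K"
		and x: "x : aut_comm GP" "x : K"
		and qm: "!!g h. g : K ==> h : K ==> \<bar>F (g *[GP] h) - F g - F h\<bar> <= D"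
		and inv: "!!\<phi> g. \<phi> : iso GP GP ==> g : K ==> \<bar>F (\<phi> g) - F g\<bar> <= D"
		and low: "!!n. F (x ^[GP] (n::nat)) \<ge> \<epsilon> * real n - C" and \<epsilon>: "\<epsilon> > 0"
	shows "scl_aut GP x > 0"
proof -
	interpret K: subgroup K GP by (rule K)
	have D0: "D \<ge> 0" using qm[OF K.one_closed K.one_closed] by linarith
	define \<tau> where "\<tau> g = (SOME t. t : T & g *[GP] inv[GP] t : K)" for g
	have \<tau>: "\<tau> g : T" "g *[GP] inv[GP] (\<tau> g) : K" if "g : car GP" for g
		using someI_ex[of "%t. t : T & g *[GP] inv[GP] t : K"] T(3)[OF that] unfolding \<tau>_def by auto
	have \<tau>c: "\<tau> g : car GP" if "g : car GP" for g using \<tau>(1)[OF that] T(2) by blast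
	define F' where "F' g = F (g *[GP] inv[GP] (\<tau> g))" for g
	have conjK: "g *[GP] k *[GP] inv[GP] g : K" "\<bar>F (g *[GP] k *[GP] inv[GP] g) - F k\<bar> <= D"
		if "g : car GP" "k : K" for g k
		using char[OF GP.inner_iso] inv[OF GP.inner_iso] that by auto
	define B where "B = (\<Sum>u\<in>(%(a, b, c). a *[GP] b *[GP] inv[GP] c) ` (T \<times> T \<times> T). \<bar>F u\<bar>)"
	have B: "\<bar>F (a *[GP] b *[GP] inv[GP] c)\<bar> <= B" if "a : T" "b : T" "c : T" for a b c
		unfolding B_def using that T(1) by (intro member_le_sum[of _ _ "%u. \<bar>F u\<bar>"]) (auto intro!: image_eqI[of _ _ "(a, b, c)"])
	have qm': "\<bar>F' (g *[GP] h) - F' g - F' h\<bar> <= 3 * D + B" if g: "g : car GP" and h: "h : car GP" for g h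
	proof -
		let ?k = "g *[GP] inv[GP] (\<tau> g)" and ?l = "h *[GP] inv[GP] (\<tau> h)"
		let ?l' = "\<tau> g *[GP] ?l *[GP] inv[GP] (\<tau> g)"
		let ?u = "\<tau> g *[GP] \<tau> h *[GP] inv[GP] (\<tau> (g *[GP] h))"
		have gh: "g *[GP] h : car GP" using g h by simp
		note c = g h gh \<tau>c[OF g] \<tau>c[OF h] \<tau>c[OF gh]
		have K1: "?k : K" "?l : K" using \<tau> g h by auto
		have l': "?l' : K" by (rule conjK(1)[OF \<tau>c[OF g] K1(2)])
		\<comment> \<open>Both representatives are moved to the right. The remaining \<open>?u\<close>
		  takes finitely many values and lies in \<open>K\<close>, since the other two factors and the
		  left side do.\<close>
		have e: "g *[GP] h *[GP] inv[GP] (\<tau> (g *[GP] h)) = ?k *[GP] ?l' *[GP] ?u"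
			using c by (simp add: GP.m_assoc GP.inv_cancel)
		have kl: "?k *[GP] ?l' : K" using K1 l' by blast
		have "?u = inv[GP] (?k *[GP] ?l') *[GP] (?k *[GP] ?l' *[GP] ?u)"
			using c by (simp add: GP.m_assoc GP.inv_cancel GP.inv_mult_group)
		then have u: "?u : K" using kl \<tau>(2)[OF gh] unfolding e[symmetric]
			by (metis K.m_closed K.m_inv_closed)
		have "\<bar>F ?u\<bar> <= B" using \<tau> c by (intro B) auto
		then show ?thesis unfolding F'_def e
			using qm[OF kl u] qm[OF K1(1) l'] conjK(2)[OF \<tau>c[OF g] K1(2)] by (simp add: abs_le_iff)
	qed
	define B0 where "B0 = (\<Sum>t\<in>T. \<bar>F (inv[GP] t)\<bar>)"
	have FK: "\<bar>F' k - F k\<bar> <= D + B0" if k: "k : K" for k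
	proof -
		have kc: "k : car GP" using k by (rule K.mem_carrier)
		have "inv[GP] k *[GP] (k *[GP] inv[GP] (\<tau> k)) : K" using \<tau>(2)[OF kc] k by blast
		then have t: "inv[GP] (\<tau> k) : K" using kc \<tau>c[OF kc] by (simp add: GP.m_assoc[symmetric])
		have "\<bar>F (inv[GP] (\<tau> k))\<bar> <= B0"
			unfolding B0_def using \<tau>(1)[OF kc] T(1) by (intro member_le_sum[of _ _ "%t. \<bar>F (inv[GP] t)\<bar>"]) auto
		then show ?thesis unfolding F'_def using qm[OF k t] by (simp add: abs_le_iff)
	qed
	define D' where "D' = 3 * D + B + D + B0"
	have B_nonneg: "B \<ge> 0" "B0 \<ge> 0" by (auto simp: B_def B0_def intro: sum_nonneg)
	then have D'0: "D' \<ge> 0" "3 * D + B <= D'" "D + B0 <= D'" using D0 by (auto simp: D'_def)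
	have qm'': "\<bar>F' (g *[GP] h) - F' g - F' h\<bar> <= D'" if "g : car GP" "h : car GP" for g h
		using qm'[OF that] D'0 by linarith
	\<comment> \<open>An error proportional to n is affordable: n will be the fixed exponent
	  \<open>e\<close>, and the estimate is then divided by \<open>e\<close>.\<close>
	have pow: "\<bar>F' (g ^[GP] n) - real n * F' g\<bar> <= real n * D' + D'" if g: "g : car GP" for g and n :: nat
	proof (induction n)
		case 0
		then show ?case using qm''[OF GP.one_closed GP.one_closed] by simp
	next
		case (Suc n)
		have "\<bar>F' (g ^[GP] n *[GP] g) - F' (g ^[GP] n) - F' g\<bar> <= D'" using g by (intro qm'') auto
		then show ?case using Suc by (simp add: abs_le_iff algebra_simps)
	qed
	\<comment> \<open>Two of the powers with exponents 0, ..., card T share a representative, so a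
	  positive exponent of at most card T leads into \<open>K\<close>; the factorial is a common
	  multiple of all of these.\<close>
	define e where "e = fact (card T) * (1::nat)"
	have e1: "e \<ge> 1" by (simp add: e_def)
	have powK: "g ^[GP] e : K" if g: "g : car GP" for g
	proof -
		have gn: "g ^[GP] (n::nat) : car GP" for n using g by simp
		have "~ inj_on (%n. \<tau> (g ^[GP] (n::nat))) {0..card T}"
		proof
			assume "inj_on (%n. \<tau> (g ^[GP] (n::nat))) {0..card T}"
			then have "card {0..card T} <= card T" using T(1) \<tau>(1)[OF gn] by (intro card_inj_on_le) auto
			then show False by simp
		qed
		then obtain i j where ij: "i < j" "j <= card T" "\<tau> (g ^[GP] i) = \<tau> (g ^[GP] (j::nat))"
			unfolding inj_on_def by (metis atLeastAtMost_iff linorder_neqE_nat)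
		let ?t = "\<tau> (g ^[GP] i)"
		have t: "?t : car GP" by (rule \<tau>c[OF gn])
		have "g ^[GP] j *[GP] inv[GP] ?t : K" "g ^[GP] i *[GP] inv[GP] ?t : K"
			using \<tau>(2)[OF gn, of j] \<tau>(2)[OF gn, of i] ij by auto
		then have "g ^[GP] j *[GP] inv[GP] ?t *[GP] inv[GP] (g ^[GP] i *[GP] inv[GP] ?t) : K" by blast
		then have 1: "g ^[GP] j *[GP] inv[GP] (g ^[GP] i) : K"
			using gn t by (simp add: GP.inv_mult_group GP.m_assoc GP.inv_cancel)
		have "g ^[GP] j = g ^[GP] (j - i) *[GP] g ^[GP] i" using ij g by (simp add: GP.nat_pow_mult)
		then have "g ^[GP] (j - i) : K" using 1 gn by (simp add: GP.m_assoc)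
		moreover have "(j - i) dvd e" unfolding e_def using ij by (simp add: dvd_fact)
		ultimately show ?thesis
		proof -
			assume a: "g ^[GP] (j - i) : K" and "(j - i) dvd e"
			then obtain m where "e = (j - i) * m" by (auto simp: dvd_def)
			then have "g ^[GP] e = (g ^[GP] (j - i)) ^[GP] m" using g by (simp add: GP.nat_pow_pow)
			moreover have "(g ^[GP] (j - i)) ^[GP] m : K" using a by (induction m) auto
			ultimately show ?thesis by simp
		qed
	qed
	have inv': "\<bar>F' (\<phi> g) - F' g\<bar> <= 7 * D'" if \<phi>: "\<phi> : iso GP GP" and g: "g : car GP" for \<phi> g
	proof -
		have hom: "\<phi> : hom GP GP" using \<phi> by (simp add: iso_def)
		have \<phi>g: "\<phi> g : car GP" using hom g by (simp add: hom_in_carrier)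
		have p: "\<phi> (g ^[GP] e) = \<phi> g ^[GP] e" using hom g hom_nat_pow[OF hom g group_GP group_GP] by simp
		let ?h = "g ^[GP] e"
		have h: "?h : K" "\<phi> ?h : K" using powK[OF g] char[OF \<phi>] by auto
		have "\<bar>F' (\<phi> ?h) - F' ?h\<bar> <= 3 * D'"
			using FK[OF h(1)] FK[OF h(2)] inv[OF \<phi> h(1)] D'0 D0 B_nonneg by (simp add: abs_le_iff D'_def)
		moreover have "\<bar>F' (\<phi> ?h) - real e * F' (\<phi> g)\<bar> <= real e * D' + D'" using pow[OF \<phi>g, of e] p by simp
		moreover have "\<bar>F' ?h - real e * F' g\<bar> <= real e * D' + D'" by (rule pow[OF g])
		ultimately have "\<bar>real e * F' (\<phi> g) - real e * F' g\<bar> <= 2 * (real e * D') + 5 * D'"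
			by (simp add: abs_le_iff)
		also have "\<dots> <= 2 * (real e * D') + 5 * (real e * D')" using e1 D'0 mult_right_mono[of 1 "real e" D'] by linarith
		also have "\<bar>real e * F' (\<phi> g) - real e * F' g\<bar> = real e * \<bar>F' (\<phi> g) - F' g\<bar>"
			by (simp add: abs_mult flip: right_diff_distrib)
		finally have "real e * \<bar>F' (\<phi> g) - F' g\<bar> <= real e * (7 * D')" by (simp add: algebra_simps)
		then show ?thesis using e1 by simp
	qed
	have xn: "x ^[GP] (n::nat) : K" for n using x(2) by (induction n) auto
	show ?thesis
	proof (rule scl_pos[OF x(1)])
		show "\<bar>F' (g *[GP] h) - F' g - F' h\<bar> <= 7 * D'" if "g : car GP" "h : car GP" for g h
			using qm''[OF that] D'0 by linarith
		show "\<epsilon> * real n - (C + D') <= F' (x ^[GP] n)" for n :: nat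
			using low[of n] FK[OF xn[of n]] D'0 by (simp add: abs_le_iff)
	qed (use inv' \<epsilon> in auto)
qed

end

section \<open>Counting quasimorphisms on the free group of rank two\<close>

lemma hom_on_simps:
	assumes "group G" "group H" "subgroup K G" "p : hom (G\<lparr>carrier := K\<rparr>) H"
	shows "x : K ==> p x : car H"
		"x : K ==> y : K ==> p (x *[G] y) = p x *[H] p y"
		"p one[G] = one[H]"
		"x : K ==> p (inv[G] x) = inv[H] (p x)"
		"x : K ==> p (x ^[G] (n::nat)) = p x ^[H] n"
proof -
	interpret G: group G by fact
	interpret h: group_hom "G\<lparr>carrier := K\<rparr>" H p
		using assms by (simp add: group_hom_def group_hom_axioms_def subgroup.subgroup_is_group)
	show "x : K ==> p x : car H" using h.hom_closed by simp
	show "x : K ==> y : K ==> p (x *[G] y) = p x *[H] p y" using h.hom_mult by simp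
	show "p one[G] = one[H]" using h.hom_one by simp
	show "x : K ==> p (inv[G] x) = inv[H] (p x)" using h.hom_inv[of x] G.m_inv_consistent[OF assms(3)] by simp
	show "x : K ==> p (x ^[G] (n::nat)) = p x ^[H] n"
		using h.hom_nat_pow[of x n] by (simp add: G.nat_pow_consistent[of _ _ K])
qed

text \<open>Isolates the (possibly trivial) end letters in factor \<open>i\<close>: in an abelian
  factor they commute with the factor, so they do not affect how the element conjugates it, except
  by an outer conjugation.\<close>

lemma (in free_prod) strip:
	assumes "Q : car GP"
	obtains a b w where "a : car (A i)" "b : car (A i)" "rw w"
		"w ~= [] ==> fst (hd w) ~= i" "w ~= [] ==> fst (last w) ~= i"
		"Q = incl i a *[GP] cls w *[GP] incl i b"
proof -
	have "\<exists>a u. a : car (A i) & rw u & (u ~= [] --> fst (hd u) ~= i) & Q = incl i a *[GP] cls u"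
	proof (cases "nf Q ~= [] & fst (hd (nf Q)) = i")
		case True
		then obtain x u where u: "nf Q = x # u" "fst x = i" by (cases "nf Q") auto
		then have r: "rw (x # u)" using nf_rw[OF assms] by simp
		have "Q = cls (x # u)" using u cls_nf[OF assms] by simp
		also have "\<dots> = incl (fst x) (snd x) *[GP] cls u" using r by (intro cls_Cons) (auto simp: rw_Cons)
		finally show ?thesis using r u unfolding rw_Cons by blast
	next
		case False
		have "Q = incl i one[A i] *[GP] cls (nf Q)" using assms incl_one[of i] by simp
		then show ?thesis using False nf_rw[OF assms] factor_simps(2)[of i] by blast
	qed
	then obtain a u where a: "a : car (A i)" "rw u" "u ~= [] --> fst (hd u) ~= i" "Q = incl i a *[GP] cls u" by blast
	show ?thesis
	proof (cases "u ~= [] & fst (last u) = i")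
		case True
		then obtain w x where u: "u = w @ [x]" "fst x = i" by (cases u rule: rev_cases) auto
		have r: "rw w" "rw [x]" "w ~= [] ==> fst (last w) ~= i" using a(2) u by (auto simp: rw_append)
		have "snd x : car (A (fst x))" using r(2) unfolding rw_Cons by blast
		then have x: "snd x : car (A i)" unfolding u(2) .
		have "cls u = cls w *[GP] cls [x]" unfolding u(1) using r by (intro cls_mult[symmetric] rw_W)
		also have "cls [x] = incl i (snd x)" unfolding incl_cls u(2)[symmetric] by simp
		finally have "cls u = cls w *[GP] incl i (snd x)" .
		note this
		then have "Q = incl i a *[GP] cls w *[GP] incl i (snd x)"
			using a r x by (simp add: GP.m_assoc)
		moreover have "w ~= [] ==> fst (hd w) ~= i" using a(3) u by simp
		ultimately show ?thesis using that[of a "snd x" w] a x r by blast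
	next
		case False
		have "Q = incl i a *[GP] cls u *[GP] incl i one[A i]" using a incl_one[of i] by simp
		then show ?thesis using that[of a "one[A i]" u] a False factor_simps(2)[of i] by blast
	qed
qed

section \<open>Test words and their behaviour under conjugation\<close>

definition xq :: "('g, 'z) monoid_scheme => 'g => 'g => 'g => 'g => 'g => 'g => 'g" where
	"xq G p1 p2 p3 q1 q2 q3 = p1 *[G] q2 *[G] p3 *[G] inv[G] q1 *[G] inv[G] p2 *[G] inv[G] q3"

text \<open>Written out: s^n1 t s^n2 t^-1 s^n3 t s^-n1 t^-1 s^-n2 t s^-n3 t^-1. For n1 < n2 < n3 the
  absolute values of the exponents of \<open>s\<close> have positive cyclic order at every
  consecutive triple, also around the end. The exponent sums vanish, which makes the word a product
  of autocommutators, and the word collapses when \<open>t\<close> commutes with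
  \<open>s\<close>.\<close>

definition xw :: "('g, 'z) monoid_scheme => 'g => 'g => nat => nat => nat => 'g" where
	"xw G s t n1 n2 n3 = xq G (s ^[G] n1) (s ^[G] n2) (s ^[G] n3)
		 (t *[G] s ^[G] n1 *[G] inv[G] t) (t *[G] s ^[G] n2 *[G] inv[G] t) (t *[G] s ^[G] n3 *[G] inv[G] t)"

context group
begin

lemma xq_conj:
	assumes "c : car G" "p1 : car G" "p2 : car G" "p3 : car G" "q1 : car G" "q2 : car G" "q3 : car G"
	shows "xq G (c \<otimes> p1 \<otimes> inv c) (c \<otimes> p2 \<otimes> inv c) (c \<otimes> p3 \<otimes> inv c) (c \<otimes> q1 \<otimes> inv c) (c \<otimes> q2 \<otimes> inv c) (c \<otimes> q3 \<otimes> inv c)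
		 = c \<otimes> xq G p1 p2 p3 q1 q2 q3 \<otimes> inv c"
	using assms by (simp add: xq_def m_assoc inv_mult_group inv_cancel)

lemma xq_closed: "p1 : car G ==> p2 : car G ==> p3 : car G ==> q1 : car G ==> q2 : car G ==> q3 : car G
	 ==> xq G p1 p2 p3 q1 q2 q3 : car G"
	by (simp add: xq_def)

lemma xw_closed [simp]: "s : car G ==> t : car G ==> xw G s t n1 n2 n3 : car G"
	by (simp add: xw_def xq_closed)

lemma pow_conj: "c : car G ==> s : car G ==> (c \<otimes> s \<otimes> inv c) [^] (n::nat) = c \<otimes> s [^] n \<otimes> inv c"
	by (induction n) (auto simp: m_assoc inv_cancel)

lemma xw_conj:
	assumes "c : car G" "s : car G" "t : car G"
	shows "xw G (c \<otimes> s \<otimes> inv c) (c \<otimes> t \<otimes> inv c) n1 n2 n3 = c \<otimes> xw G s t n1 n2 n3 \<otimes> inv c"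
proof -
	have "c \<otimes> t \<otimes> inv c \<otimes> (c \<otimes> p \<otimes> inv c) \<otimes> inv (c \<otimes> t \<otimes> inv c) = c \<otimes> (t \<otimes> p \<otimes> inv t) \<otimes> inv c" if "p : car G" for p
		using assms that by (simp add: m_assoc inv_mult_group inv_cancel)
	then show ?thesis unfolding xw_def using assms by (simp add: pow_conj xq_conj)
qed

text \<open>A centralizing element on the right of \<open>t\<close> drops out of t s^n t^-1; one on
  the left conjugates the whole word, because it also fixes the unconjugated powers of
  \<open>s\<close>.\<close>

lemma xw_strip:
	assumes "a : car G" "b : car G" "s : car G" "t : car G" "a \<otimes> s = s \<otimes> a" "b \<otimes> s = s \<otimes> b"
	shows "xw G s (a \<otimes> t \<otimes> b) n1 n2 n3 = a \<otimes> xw G s t n1 n2 n3 \<otimes> inv a"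
proof -
	have fix_conj: "c \<otimes> s [^] (n::nat) \<otimes> inv c = s [^] n" if "c : car G" "c \<otimes> s = s \<otimes> c" for c n
	proof -
		have "c \<otimes> s \<otimes> inv c = s" using that assms by (simp add: m_assoc)
		then show ?thesis using pow_conj[of c s n] that assms by simp
	qed
	have "a \<otimes> t \<otimes> b \<otimes> s [^] n \<otimes> inv (a \<otimes> t \<otimes> b) = a \<otimes> (t \<otimes> s [^] n \<otimes> inv t) \<otimes> inv a" for n :: nat
	proof -
		have "a \<otimes> t \<otimes> b \<otimes> s [^] n \<otimes> inv (a \<otimes> t \<otimes> b) = a \<otimes> (t \<otimes> (b \<otimes> s [^] n \<otimes> inv b) \<otimes> inv t) \<otimes> inv a"
			using assms by (simp add: m_assoc inv_mult_group)
		then show ?thesis using fix_conj[of b n] assms by simp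
	qed
	then have "xw G s (a \<otimes> t \<otimes> b) n1 n2 n3 = xq G (a \<otimes> s [^] n1 \<otimes> inv a) (a \<otimes> s [^] n2 \<otimes> inv a) (a \<otimes> s [^] n3 \<otimes> inv a)
		 (a \<otimes> (t \<otimes> s [^] n1 \<otimes> inv t) \<otimes> inv a) (a \<otimes> (t \<otimes> s [^] n2 \<otimes> inv t) \<otimes> inv a) (a \<otimes> (t \<otimes> s [^] n3 \<otimes> inv t) \<otimes> inv a)"
		unfolding xw_def using fix_conj[of a] assms by simp
	then show ?thesis unfolding xw_def using assms by (simp add: xq_conj)
qed

lemma xw_aut_comm:
	assumes "s : car G" "t : car G"
	shows "xw G s t n1 n2 n3 : aut_comm G"
proof -
	interpret S: subgroup "aut_comm G" G by (rule aut_comm_subgroup)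
	\<comment> \<open>Each conjugated power of \<open>s\<close> is a commutator times the plain power.
	  The plain powers cancel after being collected, leaving conjugates of some \<open>g n\<close> and
	  of inverses of others.\<close>
	define g where "g n = t \<otimes> s [^] n \<otimes> inv t \<otimes> inv (s [^] n)" for n :: nat
	have g: "g n : aut_comm G" "g n : car G" for n
		unfolding g_def aut_comm_def using assms by (auto intro!: generate.incl commutator_aut_gens)
	have q: "t \<otimes> s [^] n \<otimes> inv t = g n \<otimes> s [^] n" for n
		using assms by (simp add: g_def m_assoc)
	have e: "s [^] n1 \<otimes> (s [^] n2 \<otimes> s [^] n3) = s [^] n2 \<otimes> s [^] n3 \<otimes> s [^] n1"
		using assms by (simp add: nat_pow_mult add_ac)
	have "s [^] n2 \<otimes> s [^] n3 \<otimes> inv (s [^] n1) = inv (s [^] n1) \<otimes> (s [^] n1 \<otimes> (s [^] n2 \<otimes> s [^] n3)) \<otimes> inv (s [^] n1)"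
		using assms by (simp add: inv_cancel m_assoc)
	also have "\<dots> = inv (s [^] n1) \<otimes> (s [^] n2 \<otimes> s [^] n3)" unfolding e using assms by (simp add: m_assoc)
	finally have 1: "s [^] n2 \<otimes> s [^] n3 \<otimes> inv (s [^] n1) = inv (s [^] n1) \<otimes> (s [^] n2 \<otimes> s [^] n3)" .
	have 2: "inv (s [^] n2) \<otimes> inv (s [^] n3) = inv (s [^] n2 \<otimes> s [^] n3)"
		using assms by (simp add: inv_mult_group[symmetric] nat_pow_mult add.commute)
	have "xw G s t n1 n2 n3 = s [^] n1 \<otimes> g n2 \<otimes> (s [^] n2 \<otimes> s [^] n3 \<otimes> inv (s [^] n1)) \<otimes> inv (g n1)
			\<otimes> (inv (s [^] n2) \<otimes> inv (s [^] n3)) \<otimes> inv (g n3)"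
		unfolding xw_def xq_def q using assms g(2) by (simp add: m_assoc inv_mult_group)
	also have "\<dots> = (s [^] n1 \<otimes> g n2 \<otimes> inv (s [^] n1)) \<otimes> ((s [^] n2 \<otimes> s [^] n3) \<otimes> inv (g n1) \<otimes> inv (s [^] n2 \<otimes> s [^] n3)) \<otimes> inv (g n3)"
		unfolding 1 2 using assms g(2) by (simp add: m_assoc)
	finally have "xw G s t n1 n2 n3 = \<dots>" .
	moreover have "s [^] n1 \<otimes> g n2 \<otimes> inv (s [^] n1) : aut_comm G" using assms g by (intro aut_comm_conj) auto
	moreover have "(s [^] n2 \<otimes> s [^] n3) \<otimes> inv (g n1) \<otimes> inv (s [^] n2 \<otimes> s [^] n3) : aut_comm G"
		using assms S.m_inv_closed[OF g(1)] by (intro aut_comm_conj) auto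
	ultimately show ?thesis using S.m_inv_closed[OF g(1)] by (simp add: S.m_closed)
qed

end

lemma xw_hom_on:
	assumes "group G" "group H" "subgroup K G" "p : hom (G\<lparr>carrier := K\<rparr>) H" "s : K" "t : K"
	shows "xw G s t n1 n2 n3 : K" "p (xw G s t n1 n2 n3) = xw H (p s) (p t) n1 n2 n3"
proof -
	interpret K: subgroup K G by fact
	interpret G: group G by fact
	note h = hom_on_simps[OF assms(1-4)]
	have sn: "s ^[G] (n::nat) : K" for n using assms(5) by (induction n) auto
	show "xw G s t n1 n2 n3 : K" unfolding xw_def xq_def using assms sn by (intro K.m_closed K.m_inv_closed)
	show "p (xw G s t n1 n2 n3) = xw H (p s) (p t) n1 n2 n3"
		unfolding xw_def xq_def using assms(5,6) sn by (simp add: h K.m_closed K.m_inv_closed)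
qed

section \<open>The cyclic-order quasimorphism on the free group of rank two\<close>

global_interpretation Y: free_prod "\<lambda>_::bool. integer_group"
	by (rule free_prod.intro) simp

abbreviation "F2 \<equiv> graph_product (UNIV :: bool set) {} (%_. integer_group)"
abbreviation "F2_incl \<equiv> gp_incl (UNIV :: bool set) {} (%_. integer_group)"

text \<open>Orientation of three numbers placed on a circle: invariant under rotation, negated by
  reversal, zero when two of them coincide.\<close>

definition chi :: "int => int => int => int" where
	"chi a b c = (if a < b & b < c | b < c & c < a | c < a & a < b then 1
		 else if c < b & b < a | b < a & a < c | a < c & c < b then -1 else 0)"

lemma chi_rev: "chi c b a = - chi a b c" by (auto simp: chi_def)
lemma chi_abs: "\<bar>chi a b c\<bar> <= 1" by (auto simp: chi_def)
lemma chi_pos: "a < b ==> b < c ==> chi a b c = 1 & chi b c a = 1 & chi c a b = 1" by (auto simp: chi_def)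

fun tri :: "int list => int" where
	"tri (a # b # c # r) = chi a b c + tri (b # c # r)"
| "tri _ = 0"

text \<open>At most two triples straddle the junction.\<close>

lemma tri_append: "\<bar>tri (xs @ ys) - tri xs - tri ys\<bar> <= 2"
proof (induction xs rule: tri.induct)
	case (1 a b c r)
	then show ?case by simp
next
	case ("2_2" a)
	have "ys = [] | (\<exists>y. ys = [y]) | (\<exists>y z r. ys = y # z # r)" by (metis list.exhaust)
	moreover have "\<bar>chi a y z\<bar> <= 2" for y z using chi_abs[of a y z] by linarith
	ultimately show ?case by auto
next
	case ("2_3" a b)
	have "ys = [] | (\<exists>y. ys = [y]) | (\<exists>y z r. ys = y # z # r)" by (metis list.exhaust)
	moreover have "\<bar>chi a b y + chi b y z\<bar> <= 2" for y z using chi_abs[of a b y] chi_abs[of b y z] by linarith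
	moreover have "\<bar>chi a b y\<bar> <= 2" for y using chi_abs[of a b y] by linarith
	ultimately show ?case by auto
qed simp

lemma tri_snoc: "tri (xs @ [a, b, c]) = tri (xs @ [a, b]) + chi a b c"
proof (induction xs)
	case (Cons x xs)
	have "xs = [] | (\<exists>y. xs = [y]) | (\<exists>y z r. xs = y # z # r)" by (metis list.exhaust)
	then show ?case using Cons by auto
qed simp

lemma tri_rev: "tri (rev xs) = - tri xs"
proof (induction xs rule: tri.induct)
	case (1 a b c r)
	have "tri (rev (a # b # c # r)) = tri (rev r @ [c, b, a])" by simp
	also have "\<dots> = tri (rev (b # c # r)) + chi c b a" by (subst tri_snoc) simp
	finally show ?case using 1 chi_rev[of c b a] by simp
qed auto

text \<open>Signs are dropped so that inverting a word exactly reverses the list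
  (\<open>big_winv\<close>), and only one of the two factors is counted.\<close>

definition big :: "int => (bool \<times> int) list => int list" where
	"big L w = map (%x. \<bar>snd x\<bar>) (filter (%x. fst x & \<bar>snd x\<bar> \<ge> L) w)"

lemma big_simps [simp]: "big L [] = []" "big L (u @ w) = big L u @ big L w"
	"big L (x # w) = (if fst x & \<bar>snd x\<bar> \<ge> L then [\<bar>snd x\<bar>] else []) @ big L w"
	by (auto simp: big_def)

lemma big_concat: "big L (concat (replicate k w)) = concat (replicate k (big L w))"
	by (induction k) auto

lemma big_winv: "big L (Y.winv w) = rev (big L w)"
	by (induction w) auto

definition qf :: "int => (bool \<times> int) list set => int" where
	"qf L Q = tri (big L (Y.nf Q))"

lemma tri_short: "length xs <= 1 ==> tri xs = 0"
	by (cases xs rule: tri.cases) auto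

lemma big_length: "length (big L w) <= length w" by (simp add: big_def)

lemma tri_append3: "length m <= 1 ==> \<bar>tri (xs @ m @ ys) - tri xs - tri ys\<bar> <= 4"
	using tri_append[of xs "m @ ys"] tri_append[of m ys] tri_short[of m] by linarith

text \<open>The cancelled part \<open>c\<close> occurs with opposite orientations in the two
  factors, so its contributions cancel. Each of the three words is cut around a middle of at most
  one syllable, at a cost of 4.\<close>

lemma qf_mult:
	assumes "P : car F2" "Q : car F2"
	shows "\<bar>qf L (P *[F2] Q) - qf L P - qf L Q\<bar> <= 12"
proof -
	obtain p c q x z m where d: "Y.nf P = p @ x @ c" "Y.nf Q = Y.winv c @ z @ q"
		"foldr Y.lact (Y.nf P) (Y.nf Q) = p @ m @ q" "Y.merge x z m"
		using Y.prod_decomp[OF Y.nf_rw[OF assms(1)] Y.nf_rw[OF assms(2)]] by metis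
	have len: "length x <= 1" "length z <= 1" "length m <= 1" using d(4) by (auto simp: Y.merge_def)
	have "qf L (P *[F2] Q) = tri (big L p @ big L m @ big L q)"
		unfolding qf_def Y.nf_mult[OF assms] d(3) by simp
	moreover have "qf L P = tri (big L p @ big L x @ big L c)" unfolding qf_def d(1) by simp
	moreover have "qf L Q = tri (rev (big L c) @ big L z @ big L q)" unfolding qf_def d(2) by (simp add: big_winv)
	moreover have "length (big L x) <= 1" "length (big L z) <= 1" "length (big L m) <= 1"
		using len big_length order_trans by blast+
	ultimately show ?thesis
		using tri_append3[of "big L m" "big L p" "big L q"] tri_append3[of "big L x" "big L p" "big L c"]
			tri_append3[of "big L z" "rev (big L c)" "big L q"] tri_rev[of "big L c"] by linarith
qed

lemma qf_inv: "Q : car F2 ==> qf L (inv[F2] Q) = - qf L Q"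
	by (simp add: qf_def Y.nf_inv big_winv tri_rev)

lemma qf_conj:
	assumes "c : car F2" "Q : car F2"
	shows "\<bar>qf L (c *[F2] Q *[F2] inv[F2] c) - qf L Q\<bar> <= 24"
	using qf_mult[of "c *[F2] Q" "inv[F2] c" L] qf_mult[of c Q L] qf_inv[of c L] assms
	by (simp add: abs_le_iff)

text \<open>Bounds the counted syllables; a threshold above the bound makes \<open>big\<close>
  empty.\<close>

definition tb :: "int => (bool \<times> int) list => bool" where
	"tb B w \<longleftrightarrow> (\<forall>n. (True, n) : set w --> \<bar>n\<bar> <= B)"

lemma tb_exists: "\<exists>B\<ge>0. tb B w"
proof -
	have "tb (\<Sum>x\<in>set w. \<bar>snd x\<bar>) w"
		unfolding tb_def using member_le_sum[of _ "set w" "%x. \<bar>snd x\<bar>"] by fastforce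
	then show ?thesis by (intro exI[of _ "\<Sum>x\<in>set w. \<bar>snd x\<bar>"]) (auto intro: sum_nonneg)
qed

lemma tb_mono: "tb B w ==> B <= C ==> tb C w" by (force simp: tb_def)

lemma tb_winv: "tb B (Y.winv w) \<longleftrightarrow> tb B w"
	unfolding tb_def Y.winv_def by (force simp: image_iff)

lemma big_tb: "tb B w ==> B < L ==> big L w = []"
	unfolding big_def tb_def by (auto simp: filter_empty_conv)

lemma tb_mult:
	assumes "P : car F2" "Q : car F2" "tb B (Y.nf P)" "tb C (Y.nf Q)" "B \<ge> 0" "C \<ge> 0"
	shows "tb (B + C) (Y.nf (P *[F2] Q))"
proof -
	obtain p c q x z m where d: "Y.nf P = p @ x @ c" "Y.nf Q = Y.winv c @ z @ q"
		"foldr Y.lact (Y.nf P) (Y.nf Q) = p @ m @ q" "Y.merge x z m"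
		using Y.prod_decomp[OF Y.nf_rw[OF assms(1)] Y.nf_rw[OF assms(2)]] by metis
	have "\<bar>n\<bar> <= B + C" if n: "(True, n) : set (p @ m @ q)" for n
	proof -
		consider "(True, n) : set p" | "(True, n) : set m" | "(True, n) : set q" using n by auto
		then show ?thesis
		proof cases
			case 1 then show ?thesis using assms(3,6) unfolding tb_def d(1) by force
		next
			case 3 then show ?thesis using assms(4,5) unfolding tb_def d(2) by force
		next
			case 2
			then obtain a b where "x = [(True, a)]" "z = [(True, b)]" "n = a + b"
				using d(4) by (auto simp: Y.merge_def)
			then have "\<bar>a\<bar> <= B" "\<bar>b\<bar> <= C" "n = a + b" using assms(3,4) unfolding tb_def d(1,2) by auto
			then show ?thesis by linarith
		qed
	qed
	then show ?thesis unfolding Y.nf_mult[OF assms(1,2)] d(3) by (simp add: tb_def)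
qed

lemma tb_inv: "Q : car F2 ==> tb B (Y.nf (inv[F2] Q)) \<longleftrightarrow> tb B (Y.nf Q)"
	by (simp add: Y.nf_inv tb_winv)

lemma tb_conj:
	assumes "P : car F2" "Q : car F2" "tb B (Y.nf P)" "tb C (Y.nf Q)" "B \<ge> 0" "C \<ge> 0"
	shows "tb (2 * B + C) (Y.nf (P *[F2] Q *[F2] inv[F2] P))"
	using tb_mult[of "P *[F2] Q" "inv[F2] P" "B + C" B] tb_mult[of P Q B C] assms
	by (simp add: tb_inv algebra_simps)

lemma F2_incl_pow: "F2_incl i e ^[F2] (n::nat) = F2_incl i (int n * e)"
proof (induction n)
	case 0 then show ?case using Y.incl_one[of i] by simp
next
	case (Suc n)
	have "F2_incl i (int n * e + e) = F2_incl i (int n * e) *[F2] F2_incl i e" using Y.incl_mult[of i] by simp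
	then show ?case using Suc by (simp add: algebra_simps)
qed

text \<open>Up to a conjugation, which costs 24, the powers repeat a cyclically reduced word with
  counted syllables of size at most 2 B, the factor 2 coming from the single merge. None reaches the
  threshold. If the reduced word is one syllable, so are its powers at most, and \<open>tri\<close>
  vanishes.\<close>

lemma qf_pow_bound:
	assumes "Q : car F2" "tb B (Y.nf Q)" "B \<ge> 0" "2 * B < L"
	shows "\<bar>qf L (Q ^[F2] (k::nat))\<bar> <= 24"
proof -
	obtain d v where v: "d : gp_words UNIV (%_. integer_group)" "Y.rw v"
		"Y.cls (Y.nf Q) = Y.cls d *[F2] Y.cls v *[F2] inv[F2] Y.cls d"
		"length v <= 1 | fst (hd v) ~= fst (last v)"
		"\<forall>x\<in>set v. x : set (Y.nf Q) | (\<exists>i a b. (i, a) : set (Y.nf Q) & (i, b) : set (Y.nf Q) & x = (i, a + b))"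
		using Y.cyclic_reduction[OF Y.nf_rw[OF assms(1)]] by auto
	have c: "Y.cls d : car F2" "Y.cls v : car F2" using v by auto
	have "Q ^[F2] k = Y.cls d *[F2] Y.cls v ^[F2] k *[F2] inv[F2] Y.cls d"
		using v(3) Y.GP.pow_conj[OF c, of k] assms(1) by simp
	moreover have "qf L (Y.cls v ^[F2] k) = 0"
	proof (cases "length v <= 1")
		case True
		then have "v = [] | (\<exists>i e. v = [(i, e)])" by (cases v) auto
		then show ?thesis
		proof
			assume "v = []"
			then show ?thesis by (simp add: qf_def Y.one_GP[symmetric])
		next
			assume "\<exists>i e. v = [(i, e)]"
			then obtain i e where "v = [(i, e)]" by blast
			then have "Y.cls v ^[F2] k = F2_incl i (int k * e)" by (simp add: F2_incl_pow flip: Y.incl_cls)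
			moreover have "length (Y.nf (F2_incl i (int k * e))) <= 1" using Y.incl_nf[of "int k * e" i] by simp
			ultimately show ?thesis unfolding qf_def using order_trans[OF big_length] by (intro tri_short) simp
		qed
	next
		case False
		then have "Y.rw (concat (replicate k v))" using Y.rw_replicate v by blast
		then have nf: "Y.nf (Y.cls v ^[F2] k) = concat (replicate k v)" using Y.cls_pow[of v k] v by simp
		have "tb (2 * B) v" unfolding tb_def
		proof (intro allI impI)
			fix n assume "(True, n) : set v"
			then have "(True, n) : set (Y.nf Q) | (\<exists>a b. (True, a) : set (Y.nf Q) & (True, b) : set (Y.nf Q) & n = a + b)"
				using v(5) by auto
			then show "\<bar>n\<bar> <= 2 * B"
			proof
				assume "(True, n) : set (Y.nf Q)"
				then have "\<bar>n\<bar> <= B" using assms(2) unfolding tb_def by blast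
				then show ?thesis using assms(3) by linarith
			next
				assume "\<exists>a b. (True, a) : set (Y.nf Q) & (True, b) : set (Y.nf Q) & n = a + b"
				then obtain a b where ab: "(True, a) : set (Y.nf Q)" "(True, b) : set (Y.nf Q)" "n = a + b" by blast
				then have "\<bar>a\<bar> <= B" "\<bar>b\<bar> <= B" using assms(2) unfolding tb_def by blast+
				then show ?thesis using ab(3) by linarith
			qed
		qed
		then have "big L v = []" using big_tb assms(4) by blast
		then show ?thesis by (simp add: qf_def nf big_concat)
	qed
	moreover have "Y.cls v ^[F2] k : car F2" using c by simp
	ultimately show ?thesis using qf_conj[OF c(1), of "Y.cls v ^[F2] k" L] by simp
qed

lemma tri_periodic:
	assumes "a < b" "b < c"
	shows "tri (concat (replicate k [a, b, c, a, b, c])) \<ge> int k"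
proof (cases k)
	case (Suc m)
	\<comment> \<open>A list of length 6 (m + 1) has 6 m + 4 consecutive triples, all of them
	  positively ordered.\<close>
	have "tri (concat (replicate (Suc m) [a, b, c, a, b, c])) = 6 * int m + 4"
	proof (induction m)
		case 0 then show ?case using chi_pos[OF assms] by simp
	next
		case (Suc m) then show ?case using chi_pos[OF assms] by simp
	qed
	then show ?thesis using Suc by simp
qed simp

text \<open>The first element is a single counted syllable. Strip the counted factor from both ends
  of \<open>T\<close>. If nothing remains, \<open>T\<close> commutes with that syllable and the word
  is trivial. Otherwise the word is reduced as written, and a threshold beyond the syllables of the
  stripped \<open>T\<close> sees only the powers of the first element.\<close>

lemma qf_good:
	assumes "e ~= 0" "T : car F2"
	shows "\<exists>L0. \<forall>L>L0. \<forall>n1 n2 n3 k. L <= int n1 & n1 < n2 & n2 < n3 -->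
		 qf L (xw F2 (F2_incl True e) T n1 n2 n3 ^[F2] (k::nat)) \<ge> -24 &
		 ((\<nexists>j. T = F2_incl True j) --> qf L (xw F2 (F2_incl True e) T n1 n2 n3 ^[F2] k) \<ge> int k - 24)"
proof -
	obtain a b w where w: "Y.rw w" "w ~= [] ==> fst (hd w) ~= True" "w ~= [] ==> fst (last w) ~= True"
		"T = F2_incl True a *[F2] Y.cls w *[F2] F2_incl True b"
		using Y.strip[OF assms(2), of True] by metis
	let ?s = "F2_incl True e"
	have s: "?s : car F2" "F2_incl True a : car F2" "F2_incl True b : car F2" "Y.cls w : car F2"
		using w by auto
	have comm: "F2_incl True a *[F2] ?s = ?s *[F2] F2_incl True a" for a
		using Y.incl_mult[of True a e] Y.incl_mult[of True e a] by (simp add: add.commute)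
	have strip: "xw F2 ?s T n1 n2 n3 = F2_incl True a *[F2] xw F2 ?s (Y.cls w) n1 n2 n3 *[F2] inv[F2] F2_incl True a" for n1 n2 n3
		unfolding w(4) by (rule Y.GP.xw_strip[OF s(2,3,1,4) comm comm])
	obtain L0 where L0: "L0 \<ge> 0" "tb L0 w" using tb_exists by blast
	have main: "qf L (xw F2 ?s (Y.cls w) n1 n2 n3 ^[F2] k) \<ge> (if w = [] then 0 else int k)"
		if L: "L > L0" "L <= int n1" "n1 < n2" "n2 < n3" for L n1 n2 n3 and k :: nat
	proof (cases "w = []")
		case True
		have "xw F2 ?s (Y.cls w) n1 n2 n3 = one[F2]"
		proof -
			have 1: "Y.cls [] = one[F2]" by (simp add: Y.one_GP)
			have "?s ^[F2] (n::nat) : car F2" for n using s by simp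
			moreover have "inv[F2] F2_incl True x = F2_incl True (-x)" for x using Y.cls_inv[of "[(True, x)]"] by (simp add: Y.incl_cls)
			moreover have "F2_incl True x *[F2] F2_incl True y = F2_incl True (x + y)" for x y using Y.incl_mult[of True x y] by simp
			ultimately show ?thesis unfolding xw_def xq_def True 1 using s Y.incl_one[of True] by (simp add: F2_incl_pow)
		qed
		then show ?thesis using True by (simp add: qf_def)
	next
		case False
		let ?l = "%n. [(True, int n * e)]" and ?l' = "%n. [(True, - (int n * e))]"
		define wd where "wd = ?l n1 @ w @ ?l n2 @ Y.winv w @ ?l n3 @ w @ ?l' n1 @ Y.winv w @ ?l' n2 @ w @ ?l' n3 @ Y.winv w"
		have n1: "n1 > 0" using L L0 by linarith
		have W: "w : gp_words UNIV (%_. integer_group)" using w by simp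
		have s_pow: "?s ^[F2] (n::nat) = Y.cls (?l n)" for n using F2_incl_pow[of True e n] unfolding Y.incl_cls .
		have xw: "xw F2 ?s (Y.cls w) n1 n2 n3 = Y.cls wd"
			unfolding xw_def xq_def s_pow wd_def using W by (simp add: Y.cls_inv Y.cls_mult)
		have rw: "Y.rw wd" unfolding wd_def
			using w(1-3) False assms(1) L n1 by (simp add: Y.rw_append Y.rw_Cons Y.fst_hd_winv Y.fst_last_winv)
		have hl: "fst (hd wd) ~= fst (last wd)" unfolding wd_def using w(2) False by (simp add: Y.fst_last_winv)
		have "Y.cls wd ^[F2] k = Y.cls (concat (replicate k wd))" using Y.cls_pow[OF Y.rw_W[OF rw], of k] by blast
		moreover have "Y.rw (concat (replicate k wd))" using Y.rw_replicate[OF rw hl, of k] by blast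
		ultimately have "Y.nf (xw F2 ?s (Y.cls w) n1 n2 n3 ^[F2] k) = concat (replicate k wd)"
			unfolding xw by (simp only: Y.nf_cls_rw)
		then have "qf L (xw F2 ?s (Y.cls w) n1 n2 n3 ^[F2] k) = tri (concat (replicate k (big L wd)))"
			by (simp only: qf_def big_concat)
		moreover have "big L wd = [int n1 * \<bar>e\<bar>, int n2 * \<bar>e\<bar>, int n3 * \<bar>e\<bar>, int n1 * \<bar>e\<bar>, int n2 * \<bar>e\<bar>, int n3 * \<bar>e\<bar>]"
		proof -
			have "int n * \<bar>e\<bar> \<ge> L" if "L <= int n" for n
			proof -
				have "1 <= \<bar>e\<bar>" using assms(1) by linarith
				then have "int n * 1 <= int n * \<bar>e\<bar>" by (intro mult_left_mono) auto
				then show ?thesis using that by linarith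
			qed
			then have "L <= int n1 * \<bar>e\<bar>" "L <= int n2 * \<bar>e\<bar>" "L <= int n3 * \<bar>e\<bar>" using L by simp_all
			moreover have "big L w = []" "big L (Y.winv w) = []" using big_tb L0 L by (auto simp: big_winv)
			ultimately show ?thesis unfolding wd_def by (simp add: abs_mult)
		qed
		ultimately show ?thesis using tri_periodic[of "int n1 * \<bar>e\<bar>" "int n2 * \<bar>e\<bar>" "int n3 * \<bar>e\<bar>" k] assms(1) L False by simp
	qed
	have notin: "w ~= []" if "\<nexists>j. T = F2_incl True j"
	proof
		assume "w = []"
		then have "T = F2_incl True (a + b)" using w(4) Y.incl_mult[of True a b] s by (simp flip: Y.one_GP)
		then show False using that by blast
	qed
	have est: "qf L (xw F2 ?s T n1 n2 n3 ^[F2] k) \<ge> qf L (xw F2 ?s (Y.cls w) n1 n2 n3 ^[F2] k) - 24" for L n1 n2 n3 and k :: nat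
	proof -
		have x: "xw F2 ?s (Y.cls w) n1 n2 n3 : car F2" using s by simp
		show ?thesis unfolding strip using qf_conj[OF s(2), of "xw F2 ?s (Y.cls w) n1 n2 n3 ^[F2] k" L] x
			by (simp add: Y.GP.pow_conj[OF s(2) x])
	qed
	show ?thesis
	proof (intro exI[of _ L0] allI impI conjI)
		fix L n1 n2 n3 and k :: nat
		assume "L0 < L" "L <= int n1 & n1 < n2 & n2 < n3"
		then have m: "qf L (xw F2 ?s (Y.cls w) n1 n2 n3 ^[F2] k) \<ge> (if w = [] then 0 else int k)"
			by (intro main) auto
		then show "qf L (xw F2 ?s T n1 n2 n3 ^[F2] k) \<ge> -24" using est[of L n1 n2 n3 k] by (simp split: if_splits)
		assume "\<nexists>j. T = F2_incl True j"
		then show "qf L (xw F2 ?s T n1 n2 n3 ^[F2] k) \<ge> int k - 24" using est[of L n1 n2 n3 k] m notin by simp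
	qed
qed

text \<open>If all powers of \<open>S\<close> have uniformly bounded syllables, the six factors of
  \<open>xq\<close> bound those of the word independently of n1, n2, n3, so
  \<open>qf_pow_bound\<close> applies beyond twice that bound.\<close>

lemma qf_bad:
	assumes "S : car F2" "T : car F2" "B \<ge> 0" "!!n. tb B (Y.nf (S ^[F2] (n::nat)))"
	shows "\<exists>L0. \<forall>L>L0. \<forall>n1 n2 n3 k. \<bar>qf L (xw F2 S T n1 n2 n3 ^[F2] (k::nat))\<bar> <= 24"
proof -
	obtain C where C: "C \<ge> 0" "tb C (Y.nf T)" using tb_exists by blast
	have Sn: "S ^[F2] (n::nat) : car F2" for n using assms by simp
	have TS: "T *[F2] S ^[F2] n *[F2] inv[F2] T : car F2" for n :: nat using assms by simp
	define D where "D = 2 * C + B"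
	have D: "D \<ge> 0" "B <= D" using C assms by (auto simp: D_def)
	have q: "tb D (Y.nf (T *[F2] S ^[F2] n *[F2] inv[F2] T))" for n :: nat
		unfolding D_def by (intro tb_conj C assms Sn)
	have p: "tb D (Y.nf (S ^[F2] n))" for n :: nat using assms(4) D tb_mono by blast
	have x: "tb (D + D + D + D + D + D) (Y.nf (xw F2 S T n1 n2 n3))" for n1 n2 n3
		unfolding xw_def xq_def using D Sn TS p q by (intro tb_mult) (auto simp: tb_inv)
	have "\<bar>qf L (xw F2 S T n1 n2 n3 ^[F2] (k::nat))\<bar> <= 24" if "L > 2 * (D + D + D + D + D + D)" for L n1 n2 n3 k
		using that D by (intro qf_pow_bound[OF _ x]) (use assms in auto)
	then show ?thesis by blast
qed

text \<open>The lower bound that excludes cancellation between different maps; it holds for every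
  pair. If \<open>S\<close> is conjugate to a non-trivial element of the counted factor,
  \<open>qf_good\<close> applies after conjugation. Otherwise the powers of \<open>S\<close> have
  bounded counted syllables and \<open>qf_bad\<close> applies.\<close>

lemma qf_xw:
	assumes "S : car F2" "T : car F2"
	shows "\<exists>L0. \<forall>L>L0. \<forall>n1 n2 n3 k. L <= int n1 & n1 < n2 & n2 < n3 -->
		 qf L (xw F2 S T n1 n2 n3 ^[F2] (k::nat)) \<ge> -48"
proof -
	obtain d v where v: "d : gp_words UNIV (%_. integer_group)" "Y.rw v"
		"Y.cls (Y.nf S) = Y.cls d *[F2] Y.cls v *[F2] inv[F2] Y.cls d"
		"length v <= 1 | fst (hd v) ~= fst (last v)"
		using Y.cyclic_reduction[OF Y.nf_rw[OF assms(1)]] by auto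
	have c: "Y.cls d : car F2" "Y.cls v : car F2" using v by auto
	have S: "S = Y.cls d *[F2] Y.cls v *[F2] inv[F2] Y.cls d" using v(3) assms by simp
	show ?thesis
	proof (cases "\<exists>e. e ~= 0 & v = [(True, e)]")
		case True
		then obtain e where e: "e ~= 0" "v = [(True, e)]" by blast
		let ?T = "inv[F2] Y.cls d *[F2] T *[F2] Y.cls d"
		have T: "?T : car F2" "T = Y.cls d *[F2] ?T *[F2] inv[F2] Y.cls d"
			using c assms by (auto simp: Y.GP.m_assoc Y.GP.inv_cancel)
		have sv: "Y.cls v = F2_incl True e" using e by (simp add: Y.incl_cls)
		from qf_good[OF e(1) T(1)] obtain L0 where L0': "\<forall>L>L0. \<forall>n1 n2 n3 k. L <= int n1 & n1 < n2 & n2 < n3 -->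
		 qf L (xw F2 (F2_incl True e) ?T n1 n2 n3 ^[F2] (k::nat)) \<ge> -24 &
		 ((\<nexists>j. ?T = F2_incl True j) --> qf L (xw F2 (F2_incl True e) ?T n1 n2 n3 ^[F2] k) \<ge> int k - 24)" ..
		have L0: "qf L (xw F2 (Y.cls v) ?T n1 n2 n3 ^[F2] (k::nat)) \<ge> -24"
			if "L > L0" "L <= int n1 & n1 < n2 & n2 < n3" for L n1 n2 n3 k
			unfolding sv using L0'[rule_format, OF that, of k] by (rule conjunct1)
		have cmp: "qf L (xw F2 S T n1 n2 n3 ^[F2] k) \<ge> qf L (xw F2 (Y.cls v) ?T n1 n2 n3 ^[F2] k) - 24" for L n1 n2 n3 and k :: nat
		proof -
			have x: "xw F2 (Y.cls v) ?T n1 n2 n3 : car F2" using c T by simp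
			have "xw F2 S T n1 n2 n3 = Y.cls d *[F2] xw F2 (Y.cls v) ?T n1 n2 n3 *[F2] inv[F2] Y.cls d"
				using Y.GP.xw_conj[OF c T(1)] S T(2) by simp
			then show ?thesis using qf_conj[OF c(1), of "xw F2 (Y.cls v) ?T n1 n2 n3 ^[F2] k" L] x
				by (simp add: Y.GP.pow_conj[OF c(1) x])
		qed
		show ?thesis
		proof (intro exI[of _ L0] allI impI)
			fix L n1 n2 n3 and k :: nat assume "L0 < L" "L <= int n1 & n1 < n2 & n2 < n3"
			then show "qf L (xw F2 S T n1 n2 n3 ^[F2] k) \<ge> -48"
				using L0[of L n1 n2 n3 k] cmp[of L n1 n2 n3 k] by linarith
		qed
	next
		case False
		obtain B where B: "B \<ge> 0" "tb B v" using tb_exists by blast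
		obtain C where C: "C \<ge> 0" "tb C (Y.nf (Y.cls d))" using tb_exists by blast
		have vn: "tb B (Y.nf (Y.cls v ^[F2] (n::nat)))" for n
		proof (cases "length v <= 1")
			case True
			then have "v = [] | (\<exists>i e. v = [(i, e)])" by (cases v) auto
			then show ?thesis
			proof
				assume "v = []"
				then show ?thesis by (simp add: tb_def Y.one_GP[symmetric])
			next
				assume "\<exists>i e. v = [(i, e)]"
				then obtain i e where ie: "v = [(i, e)]" by blast
				then have "i = False" using False v(2) by (cases i) (auto simp: Y.rw_Cons)
				then have "Y.cls v ^[F2] n = F2_incl False (int n * e)" using ie by (simp add: F2_incl_pow flip: Y.incl_cls)
				then show ?thesis using Y.incl_nf[of "int n * e" False] by (simp add: tb_def)
			qed
		next
			case F: False
			then have "Y.rw (concat (replicate n v))" using Y.rw_replicate v by blast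
			then have nf: "Y.nf (Y.cls v ^[F2] n) = concat (replicate n v)" using Y.cls_pow[of v n] v by simp
			have "set (concat (replicate n v)) \<subseteq> set v" by auto
			then show ?thesis using B unfolding nf tb_def by blast
		qed
		have "tb (2 * C + B) (Y.nf (S ^[F2] (n::nat)))" for n
			using tb_conj[OF c(1) _ C(2) vn[of n] C(1) B(1)] c S Y.GP.pow_conj[OF c, of n] by simp
		then have "\<exists>L0. \<forall>L>L0. \<forall>n1 n2 n3 k. \<bar>qf L (xw F2 S T n1 n2 n3 ^[F2] (k::nat))\<bar> <= 24"
			using B C by (intro qf_bad[OF assms, of "2 * C + B"]) auto
		then obtain L0 where L0: "\<forall>L>L0. \<forall>n1 n2 n3 k. \<bar>qf L (xw F2 S T n1 n2 n3 ^[F2] (k::nat))\<bar> <= 24" ..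
		show ?thesis
		proof (intro exI[of _ L0] allI impI)
			fix L n1 n2 n3 and k :: nat assume "L0 < L" "L <= int n1 & n1 < n2 & n2 < n3"
			then show "qf L (xw F2 S T n1 n2 n3 ^[F2] k) \<ge> -48" using L0[rule_format, of L n1 n2 n3 k] by linarith
		qed
	qed
qed

section \<open>Maps up to conjugacy and the general criterion\<close>

lemma iso_comp: "\<phi> : iso G H ==> \<psi> : iso H I ==> (%x. \<psi> (\<phi> x)) : iso G I"
	unfolding iso_def using hom_compose[of \<phi> G H \<psi> I] bij_betw_trans[of \<phi> "car G" "car H" \<psi> "car I"]
	by (simp add: comp_def)

lemma iso_hom: "\<phi> : iso G H ==> \<phi> : hom G H" by (simp add: iso_def)

lemma iso_carrier: "\<phi> : iso G H ==> x : car G ==> \<phi> x : car H"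
	by (metis iso_hom hom_in_carrier)

lemma id_iso: "(%x. x) : iso G G"
	by (auto simp: iso_def hom_def bij_betw_def inj_on_def)

lemma iso_inverse:
	assumes "group G" "\<phi> : iso G H"
	shows "\<exists>\<psi>\<in>iso H G. (\<forall>x\<in>car G. \<psi> (\<phi> x) = x) & (\<forall>y\<in>car H. \<phi> (\<psi> y) = y)"
proof (intro bexI[of _ "inv_into (car G) \<phi>"] conjI ballI)
	show "inv_into (car G) \<phi> : iso H G" using assms by (simp add: group.iso_set_sym)
qed (use assms in \<open>auto simp: iso_def bij_betw_def inv_into_f_f f_inv_into_f\<close>)

text \<open>Arbitrary functions are allowed: that a representative is a homomorphism follows from
  its being conjugate to one.\<close>

definition conjugate_on :: "'g set => ('h, 'z) monoid_scheme => ('g => 'h) => ('g => 'h) => bool" where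
	"conjugate_on K H p q \<longleftrightarrow> (\<exists>y\<in>car H. \<forall>k\<in>K. p k = y *[H] q k *[H] inv[H] y)"

context group
begin

lemma conjugate_on_sym:
	assumes "conjugate_on K G p q" "!!k. k : K ==> q k : car G"
	shows "conjugate_on K G q p"
proof -
	obtain y where y: "y : car G" "\<forall>k\<in>K. p k = y \<otimes> q k \<otimes> inv y" using assms(1) by (auto simp: conjugate_on_def)
	have "q k = inv y \<otimes> p k \<otimes> inv (inv y)" if "k : K" for k
		using y assms(2)[OF that] that by (simp add: m_assoc inv_cancel)
	then show ?thesis unfolding conjugate_on_def using y(1) by (intro bexI[of _ "inv y"]) auto
qed

lemma conjugate_on_trans:
	assumes "conjugate_on K G p q" "conjugate_on K G q r" "!!k. k : K ==> r k : car G"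
	shows "conjugate_on K G p r"
proof -
	obtain y where y: "y : car G" "\<forall>k\<in>K. p k = y \<otimes> q k \<otimes> inv y" using assms(1) by (auto simp: conjugate_on_def)
	obtain z where z: "z : car G" "\<forall>k\<in>K. q k = z \<otimes> r k \<otimes> inv z" using assms(2) by (auto simp: conjugate_on_def)
	have "p k = (y \<otimes> z) \<otimes> r k \<otimes> inv (y \<otimes> z)" if "k : K" for k
		using y z assms(3)[OF that] that by (simp add: m_assoc inv_mult_group)
	then show ?thesis unfolding conjugate_on_def using y(1) z(1) by (intro bexI[of _ "y \<otimes> z"]) auto
qed

end

lemma conjugate_on_compose:
	"conjugate_on K H p q ==> (!!k. k : K' ==> f k : K) ==> conjugate_on K' H (%k. p (f k)) (%k. q (f k))"
	unfolding conjugate_on_def by blast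

context graph_prod
begin

text \<open>A smallest set of representatives for the maps \<open>r\<close> after automorphisms has
  pairwise non-conjugate members, each realized by an automorphism. So every automorphism permutes
  it up to conjugacy, and the sum of \<open>qf L\<close> over it is almost invariant. On powers of
  the test word the summand conjugate to \<open>r\<close> grows, and all others stay above
  -48.\<close>

lemma pos_scl_criterion:
	fixes r :: "('v \<times> 'a) list set => (bool \<times> int) list set"
	assumes K: "subgroup K GP"
		and char: "!!\<phi> k. \<phi> : iso GP GP ==> k : K ==> \<phi> k : K"
		and T: "finite T" "T \<subseteq> car GP" "!!g. g : car GP ==> \<exists>t\<in>T. g *[GP] inv[GP] t : K"
		and r: "r : hom (GP\<lparr>carrier := K\<rparr>) F2"
		and P: "finite P" "!!p k. p : P ==> k : K ==> p k : car F2"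
		and cover: "!!\<phi>. \<phi> : iso GP GP ==> \<exists>p\<in>P. conjugate_on K F2 (%k. r (\<phi> k)) p"
		and st: "s : K" "t : K" "r s = F2_incl True e" "e ~= 0" "\<nexists>j. r t = F2_incl True j"
	shows "has_pos_scl_aut GP"
proof -
	interpret K: subgroup K GP by (rule K)
	note rs = hom_on_simps[OF group_GP Y.group_GP K r]
	define cov where "cov Q \<longleftrightarrow> (\<forall>\<phi>\<in>iso GP GP. \<exists>p\<in>Q. conjugate_on K F2 (%k. r (\<phi> k)) p)" for Q
	have "\<exists>Q. (Q \<subseteq> P & cov Q) & (\<forall>Q'. Q' \<subseteq> P & cov Q' --> card Q <= card Q')"
		using cover by (intro ex_has_least_nat[of "%Q. Q \<subseteq> P & cov Q" P card]) (auto simp: cov_def)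
	then obtain P0 where P0: "P0 \<subseteq> P" "cov P0" and min: "!!Q'. Q' \<subseteq> P ==> cov Q' ==> card P0 <= card Q'" by blast
	have fin: "finite P0" using P0(1) P(1) finite_subset by blast
	have pc: "p k : car F2" if "p : P0" "k : K" for p k using P(2) P0(1) that by blast
	have rc: "r (\<phi> k) : car F2" if "\<phi> : iso GP GP" "k : K" for \<phi> k using rs(1) char that by blast
	have not_cov: "~ cov (P0 - {p})" if "p : P0" for p
	proof
		assume "cov (P0 - {p})"
		then have "card P0 <= card (P0 - {p})" using P0(1) by (intro min) auto
		then show False using that fin by (metis card_Diff1_less not_le)
	qed
	have real: "\<exists>\<phi>\<in>iso GP GP. conjugate_on K F2 (%k. r (\<phi> k)) p" if p: "p : P0" for p
	proof (rule ccontr)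
		assume n: "~ ?thesis"
		have "cov (P0 - {p})" unfolding cov_def
		proof
			fix \<phi> assume \<phi>: "\<phi> : iso GP GP"
			then obtain q where "q : P0" "conjugate_on K F2 (%k. r (\<phi> k)) q" using P0(2) unfolding cov_def by blast
			then show "\<exists>q\<in>P0 - {p}. conjugate_on K F2 (%k. r (\<phi> k)) q" using n \<phi> by blast
		qed
		then show False using not_cov[OF p] by blast
	qed
	have uniq: "p = q" if pq: "p : P0" "q : P0" "conjugate_on K F2 p q" for p q
	proof (rule ccontr)
		assume n: "p ~= q"
		have "cov (P0 - {p})" unfolding cov_def
		proof
			fix \<phi> assume \<phi>: "\<phi> : iso GP GP"
			then obtain p' where p': "p' : P0" "conjugate_on K F2 (%k. r (\<phi> k)) p'" using P0(2) unfolding cov_def by blast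
			show "\<exists>q\<in>P0 - {p}. conjugate_on K F2 (%k. r (\<phi> k)) q"
			proof (cases "p' = p")
				case True
				then have "conjugate_on K F2 (%k. r (\<phi> k)) q"
					using p' pq pc Y.GP.conjugate_on_trans by blast
				then show ?thesis using pq n by blast
			qed (use p' in blast)
		qed
		then show False using not_cov[OF pq(1)] by blast
	qed
	have p_hom: "p : hom (GP\<lparr>carrier := K\<rparr>) F2" if p: "p : P0" for p
	proof -
		obtain \<phi> where \<phi>: "\<phi> : iso GP GP" "conjugate_on K F2 (%k. r (\<phi> k)) p" using real[OF p] by blast
		have "conjugate_on K F2 p (%k. r (\<phi> k))" using \<phi>(2) pc[OF p] by (rule Y.GP.conjugate_on_sym)
		then obtain y where y: "y : car F2" "\<forall>k\<in>K. p k = y *[F2] r (\<phi> k) *[F2] inv[F2] y"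
			by (auto simp: conjugate_on_def)
		have m: "r (\<phi> (k *[GP] l)) = r (\<phi> k) *[F2] r (\<phi> l)" if "k : K" "l : K" for k l
			using that char[OF \<phi>(1)] rs(2) hom_mult[OF iso_hom[OF \<phi>(1)]] by (simp add: K.mem_carrier)
		show ?thesis
		proof (rule homI)
			fix k l assume kl: "k : car (GP\<lparr>carrier := K\<rparr>)" "l : car (GP\<lparr>carrier := K\<rparr>)"
			then have kl: "k : K" "l : K" by auto
			have c: "r (\<phi> k) : car F2" "r (\<phi> l) : car F2" using rc[OF \<phi>(1)] kl by auto
			have "p (k *[GP] l) = y *[F2] r (\<phi> (k *[GP] l)) *[F2] inv[F2] y" using y(2) kl K.m_closed by blast
			also have "\<dots> = p k *[F2] p l" using y kl m c by (simp add: Y.GP.m_assoc Y.GP.inv_cancel)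
			finally show "p (k *[GP\<lparr>carrier := K\<rparr>] l) = p k *[F2] p l" by simp
		qed (use pc[OF p] in auto)
	qed
	have step: "\<exists>q\<in>P0. conjugate_on K F2 (%k. p (\<phi> k)) q" if p: "p : P0" and \<phi>: "\<phi> : iso GP GP" for p \<phi>
	proof -
		obtain \<psi> where \<psi>: "\<psi> : iso GP GP" "conjugate_on K F2 (%k. r (\<psi> k)) p" using real[OF p] by blast
		have "conjugate_on K F2 p (%k. r (\<psi> k))" using \<psi>(2) pc[OF p] by (rule Y.GP.conjugate_on_sym)
		then have 1: "conjugate_on K F2 (%k. p (\<phi> k)) (%k. r (\<psi> (\<phi> k)))"
			using char[OF \<phi>] by (rule conjugate_on_compose[where p = p and q = "%k. r (\<psi> k)"])
		from P0(2)[unfolded cov_def, rule_format, OF iso_comp[OF \<phi> \<psi>(1)]]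
		obtain q where q: "q : P0" "conjugate_on K F2 (%k. r (\<psi> (\<phi> k))) q" by (elim bexE)
		show ?thesis using Y.GP.conjugate_on_trans[OF 1 q(2) pc[OF q(1)]] q(1) by (rule bexI)
	qed
	define LP where "LP p l \<longleftrightarrow> (\<forall>L>l. \<forall>n1 n2 n3 k. L <= int n1 & n1 < n2 & n2 < n3 -->
		 qf L (xw F2 (p s) (p t) n1 n2 n3 ^[F2] (k::nat)) \<ge> -48)" for p l
	define L0 where "L0 p = (SOME l. LP p l)" for p
	have L0: "LP p (L0 p)" if "p : P0" for p
		unfolding L0_def by (rule someI_ex) (unfold LP_def, rule qf_xw[OF pc[OF that st(1)] pc[OF that st(2)]])
	from qf_good[OF st(4) rs(1)[OF st(2)]] obtain L1 where L1: "\<forall>L>L1. \<forall>n1 n2 n3 k. L <= int n1 & n1 < n2 & n2 < n3 -->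
		 qf L (xw F2 (F2_incl True e) (r t) n1 n2 n3 ^[F2] (k::nat)) \<ge> -24 &
		 ((\<nexists>j. r t = F2_incl True j) --> qf L (xw F2 (F2_incl True e) (r t) n1 n2 n3 ^[F2] k) \<ge> int k - 24)" ..
	\<comment> \<open>Only now is the threshold fixed, beyond what the finitely many maps demand for
	  the given \<open>s\<close> and \<open>t\<close>.\<close>
	define L where "L = 1 + \<bar>L1\<bar> + (\<Sum>p\<in>P0. \<bar>L0 p\<bar>)"
	have L: "L > L1" "!!p. p : P0 ==> L > L0 p" "L > 0"
	proof -
		have nn: "(\<Sum>p\<in>P0. \<bar>L0 p\<bar>) \<ge> 0" by (auto intro: sum_nonneg)
		show "L > L1" "L > 0" unfolding L_def using nn by linarith+
		fix p assume "p : P0"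
		then have "\<bar>L0 p\<bar> <= (\<Sum>p\<in>P0. \<bar>L0 p\<bar>)" using fin by (intro member_le_sum[of _ _ "%p. \<bar>L0 p\<bar>"]) auto
		then show "L > L0 p" unfolding L_def by linarith
	qed
	define n1 where "n1 = nat L"
	have n: "L <= int n1 & n1 < n1 + 1 & n1 + 1 < n1 + 2" using L(3) by (simp add: n1_def)
	define x where "x = xw GP s t n1 (n1 + 1) (n1 + 2)"
	have xK: "x : K" unfolding x_def by (rule xw_hom_on(1)[OF group_GP Y.group_GP K r st(1,2)])
	have xa: "x : aut_comm GP" unfolding x_def using st by (intro GP.xw_aut_comm) (auto simp: K.mem_carrier)
	have xn: "x ^[GP] (k::nat) : K" for k using xK by (induction k) auto
	define F where "F k = real_of_int (\<Sum>p\<in>P0. qf L (p k))" for k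
	define N where "N = real (card P0)"
	have F_def': "F k = (\<Sum>p\<in>P0. real_of_int (qf L (p k)))" for k by (simp add: F_def)
	have px: "p (x ^[GP] (k::nat)) = xw F2 (p s) (p t) n1 (n1 + 1) (n1 + 2) ^[F2] k" if "p : hom (GP\<lparr>carrier := K\<rparr>) F2" for p k
		using hom_on_simps(5)[OF group_GP Y.group_GP K that xK] xw_hom_on(2)[OF group_GP Y.group_GP K that st(1,2)] by (simp add: x_def)
	have p_low: "qf L (p (x ^[GP] (k::nat))) \<ge> -48" if "p : P0" for p k
		unfolding px[OF p_hom[OF that]] by (rule L0[OF that, unfolded LP_def, rule_format, OF L(2)[OF that] n])
	have r_low: "qf L (r (x ^[GP] (k::nat))) \<ge> int k - 24" for k
		unfolding px[OF r] st(3) using L1[rule_format, OF L(1) n, of k] st(5) by (elim conjE) (erule mp)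
	from P0(2)[unfolded cov_def, rule_format, OF id_iso]
	obtain p0 where p0: "p0 : P0" "conjugate_on K F2 (%k. r k) p0" by (elim bexE)
	have p0_low: "qf L (p0 (x ^[GP] (k::nat))) \<ge> int k - 48" for k
	proof -
		obtain y where y: "y : car F2" "\<forall>k\<in>K. r k = y *[F2] p0 k *[F2] inv[F2] y"
			using p0(2) by (auto simp: conjugate_on_def)
		then show ?thesis using qf_conj[OF y(1) pc[OF p0(1) xn[of k]], of L] r_low[of k] xn[of k] by auto
	qed
	have "scl_aut GP x > 0"
	proof (rule scl_pos_char[where K = K and T = T and F = F and D = "24 * N" and \<epsilon> = 1 and C = "48 * N"])
		show "\<phi> k : K" if "\<phi> : iso GP GP" "k : K" for \<phi> k using that by (rule char)
		show "\<exists>t\<in>T. g *[GP] inv[GP] t : K" if "g : car GP" for g using that by (rule T(3))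
	next
		fix g h assume gh: "g : K" "h : K"
		have "\<bar>real_of_int (qf L (p (g *[GP] h))) - real_of_int (qf L (p g)) - real_of_int (qf L (p h))\<bar> <= 24" if "p : P0" for p
			using qf_mult[OF pc[OF that gh(1)] pc[OF that gh(2)], of L] hom_on_simps(2)[OF group_GP Y.group_GP K p_hom[OF that] gh] by simp
		then have "(\<Sum>p\<in>P0. \<bar>real_of_int (qf L (p (g *[GP] h))) - real_of_int (qf L (p g)) - real_of_int (qf L (p h))\<bar>) <= (\<Sum>p\<in>P0. 24)"
			by (intro sum_mono)
		also have "\<dots> = 24 * N" by (simp add: N_def)
		finally have "\<bar>\<Sum>p\<in>P0. real_of_int (qf L (p (g *[GP] h))) - real_of_int (qf L (p g)) - real_of_int (qf L (p h))\<bar> <= 24 * N"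
			by (rule order_trans[OF sum_abs])
		then show "\<bar>F (g *[GP] h) - F g - F h\<bar> <= 24 * N" by (simp add: F_def' sum_subtractf)
	next
		fix \<phi> k assume \<phi>: "\<phi> : iso GP GP" and k: "k : K"
		obtain \<sigma> where \<sigma>: "!!p. p : P0 ==> \<sigma> p : P0 & conjugate_on K F2 (%k. p (\<phi> k)) (\<sigma> p)"
			using step[OF _ \<phi>] by metis
		obtain \<psi> where \<psi>: "\<psi> : iso GP GP" "\<forall>y\<in>car GP. \<phi> (\<psi> y) = y"
			using iso_inverse[OF group_GP \<phi>] by (elim bexE conjE)
		\<comment> \<open>Members with the same image become conjugate to each other after composing with
		  the inverse automorphism, hence are equal.\<close>
		have "inj_on \<sigma> P0"
		proof (rule inj_onI)
			fix p q assume pq: "p : P0" "q : P0" "\<sigma> p = \<sigma> q"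
			have q: "conjugate_on K F2 (\<sigma> q) (%k. q (\<phi> k))" by (rule Y.GP.conjugate_on_sym[OF conjunct2[OF \<sigma>[OF pq(2)]]]) (use \<sigma> pq pc in blast)
			have "conjugate_on K F2 (%k. p (\<phi> k)) (%k. q (\<phi> k))"
				by (rule Y.GP.conjugate_on_trans[OF conjunct2[OF \<sigma>[OF pq(1)]] q[folded pq(3)]]) (rule pc[OF pq(2) char[OF \<phi>]])
			then have "conjugate_on K F2 (%k. p (\<phi> (\<psi> k))) (%k. q (\<phi> (\<psi> k)))"
				using char[OF \<psi>(1)] by (rule conjugate_on_compose[where p = "%k. p (\<phi> k)" and q = "%k. q (\<phi> k)"])
			then have "conjugate_on K F2 p q" using \<psi>(2) K.mem_carrier by (simp add: conjugate_on_def)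
			then show "p = q" using uniq pq by blast
		qed
		moreover have "\<sigma> ` P0 \<subseteq> P0" using \<sigma> by blast
		ultimately have bij: "bij_betw \<sigma> P0 P0" using fin by (simp add: bij_betw_def endo_inj_surj)
		have "(\<Sum>p\<in>P0. real_of_int (qf L (\<sigma> p k))) = F k"
			unfolding F_def' by (rule sum.reindex_bij_betw[OF bij, of "%p. real_of_int (qf L (p k))"])
		then have e: "F (\<phi> k) - F k = (\<Sum>p\<in>P0. real_of_int (qf L (p (\<phi> k))) - real_of_int (qf L (\<sigma> p k)))"
			by (simp add: F_def' sum_subtractf)
		have "\<bar>real_of_int (qf L (p (\<phi> k))) - real_of_int (qf L (\<sigma> p k))\<bar> <= 24" if p: "p : P0" for p
		proof -
			obtain y where y: "y : car F2" "\<forall>k\<in>K. p (\<phi> k) = y *[F2] \<sigma> p k *[F2] inv[F2] y"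
				using \<sigma>[OF p] by (auto simp: conjugate_on_def)
			then show ?thesis using qf_conj[OF y(1) pc[OF _ k], of "\<sigma> p" L] \<sigma>[OF p] k by simp
		qed
		then have "(\<Sum>p\<in>P0. \<bar>real_of_int (qf L (p (\<phi> k))) - real_of_int (qf L (\<sigma> p k))\<bar>) <= (\<Sum>p\<in>P0. 24)"
			by (intro sum_mono)
		also have "\<dots> = 24 * N" by (simp add: N_def)
		finally show "\<bar>F (\<phi> k) - F k\<bar> <= 24 * N" unfolding e by (rule order_trans[OF sum_abs])
	next
		fix k :: nat
		have "F (x ^[GP] k) = real_of_int (qf L (p0 (x ^[GP] k))) + (\<Sum>p\<in>P0 - {p0}. real_of_int (qf L (p (x ^[GP] k))))"
			unfolding F_def' using fin p0(1) by (rule sum.remove)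
		moreover have "(\<Sum>p\<in>P0 - {p0}. real_of_int (qf L (p (x ^[GP] k)))) \<ge> (\<Sum>p\<in>P0 - {p0}. - 48)"
		proof (rule sum_mono)
			fix p assume "p : P0 - {p0}"
			then have "qf L (p (x ^[GP] k)) \<ge> -48" by (intro p_low) simp
			then show "- 48 <= real_of_int (qf L (p (x ^[GP] k)))" by linarith
		qed
		moreover have "(\<Sum>p\<in>P0 - {p0}. - 48 :: real) = - 48 * (N - 1)"
		proof -
			have "card P0 \<ge> 1" using fin p0(1) by (metis card_0_eq empty_iff less_one not_le)
			then show ?thesis using fin p0(1) by (simp add: N_def of_nat_diff card_Diff_singleton)
		qed
		moreover have "real_of_int (qf L (p0 (x ^[GP] k))) \<ge> real k - 48" using p0_low[of k] by linarith
		ultimately show "1 * real k - 48 * N <= F (x ^[GP] k)" by simp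
	qed (use K T(1,2) xa xK in simp_all)
	then show ?thesis unfolding has_pos_scl_aut_def using xa by blast
qed

end

section \<open>Finite free products\<close>

context free_prod
begin

fun wproj :: "bool => 'c => (bool \<times> 'c) list => 'c" where
	"wproj i a [] = a"
| "wproj i a (x # w) = wproj i (if fst x = i then a *[A i] snd x else a) w"

definition proj :: "bool => (bool \<times> 'c) list set => 'c" where
	"proj i Q = wproj i one[A i] (nf Q)"

text \<open>Reidemeister-Schreier rewriting for the map onto the direct product of the factors. The
  state (a, b) is the image of the prefix read so far; moving b to b' contributes \<epsilon>(a,b)^-1
  \<epsilon>(a,b'), moving a contributes nothing. The kernel is free on commutators [a,b], and for
  normalized \<epsilon> such a commutator goes to \<epsilon>(a,b)
  (\<open>kap_commutator\<close>).\<close>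

fun wkap :: "('c => 'c => (bool \<times> int) list set) => 'c => 'c => (bool \<times> 'c) list => (bool \<times> int) list set" where
	"wkap \<epsilon> a b [] = one[F2]"
| "wkap \<epsilon> a b (x # w) = (if fst x then wkap \<epsilon> (a *[A True] snd x) b w
		 else inv[F2] \<epsilon> a b *[F2] \<epsilon> a (b *[A False] snd x) *[F2] wkap \<epsilon> a (b *[A False] snd x) w)"

lemma factor_inv_one [simp]: "inv[A i] one[A i] = one[A i]"
	by (rule monoid.inv_one[OF group.is_monoid[OF factor_group]])

lemma wproj_closed [simp]: "a : car (A i) ==> w : W ==> wproj i a w : car (A i)"
proof (induction w arbitrary: a)
	case (Cons x w)
	then show ?case by (cases "fst x = i") simp_all
qed simp

lemma wproj_append: "wproj i a (u @ w) = wproj i (wproj i a u) w"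
	by (induction u arbitrary: a) simp_all

lemma wproj_mult: "a : car (A i) ==> b : car (A i) ==> w : W ==>
	 wproj i (a *[A i] b) w = a *[A i] wproj i b w"
proof (induction w arbitrary: b)
	case (Cons x w)
	then show ?case by (cases "fst x = i") (simp_all add: factor_assoc)
qed simp

lemma wproj_step: "(x, y) : gp_step UNIV {} A ==> a : car (A i) ==> wproj i a x = wproj i a y"
proof (induction rule: gp_step.induct)
	case (mult u u' v b c)
	then have "wproj i a u : car (A i)" by simp
	then show ?case using mult by (auto simp: wproj_append factor_assoc)
next
	case (one u u' v)
	then have "wproj i a u : car (A i)" by simp
	then show ?case using one by (auto simp: wproj_append)
qed simp

lemma nfw_gp_eq: "w : W ==> (w, nfw w) : gp_eq UNIV {} A"
	using cls_nfw[of w] cls_eq_iff[of w "nfw w"] by simp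

lemma wproj_nfw: "w : W ==> a : car (A i) ==> wproj i a (nfw w) = wproj i a w"
	using gp_eq_invariant[OF nfw_gp_eq, of w "wproj i a"] wproj_step by metis

lemma proj_closed [simp]: "Q : car GP ==> proj i Q : car (A i)"
	by (simp add: proj_def)

lemma nf_mult': "P : car GP ==> Q : car GP ==> nf (P *[GP] Q) = nfw (nf P @ nf Q)"
	by (simp add: nf_mult nfw_append nfw_id)

lemma wproj_nf: "Q : car GP ==> a : car (A i) ==> wproj i a (nf Q) = a *[A i] proj i Q"
	using wproj_mult[of a i "one[A i]" "nf Q"] by (simp add: proj_def)

lemma proj_mult: "P : car GP ==> Q : car GP ==> proj i (P *[GP] Q) = proj i P *[A i] proj i Q"
	unfolding proj_def[of i "P *[GP] Q"]
	by (simp add: nf_mult' wproj_nfw wproj_append wproj_nf)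

lemma proj_hom: "proj i : hom GP (A i)"
	by (auto simp: hom_def proj_mult)

lemma proj_incl: "a : car (A j) ==> proj i (incl j a) = (if i = j then a else one[A i])"
	by (auto simp: proj_def incl_nf)

lemma proj_one: "proj i one[GP] = one[A i]" by (simp add: proj_def)

lemma proj_inv: "Q : car GP ==> proj i (inv[GP] Q) = inv[A i] proj i Q"
	using group_hom.hom_inv[of GP "A i" "proj i" Q] proj_hom[of i] factor_group[of i] group_GP
	by (simp add: group_hom_def group_hom_axioms_def)

lemma proj_conj:
	assumes "comm_group (A i)" "Q : car GP" "y : car GP"
	shows "proj i (y *[GP] Q *[GP] inv[GP] y) = proj i Q"
proof -
	interpret comm_group "A i" by fact
	have "proj i (y *[GP] Q *[GP] inv[GP] y) = proj i y *[A i] proj i Q *[A i] inv[A i] proj i y"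
		using assms by (simp add: proj_mult proj_inv)
	also have "\<dots> = proj i Q *[A i] (proj i y *[A i] inv[A i] proj i y)"
		using assms by (simp add: m_ac)
	finally show ?thesis using assms by simp
qed

context
	fixes \<epsilon> :: "'c => 'c => (bool \<times> int) list set"
	assumes \<epsilon>: "!!a b. \<epsilon> a b : car F2"
begin

lemma wkap_closed [simp]: "wkap \<epsilon> a b w : car F2"
	by (induction w arbitrary: a b) (auto simp: \<epsilon>)

lemma wkap_append: "wkap \<epsilon> a b (u @ w) = wkap \<epsilon> a b u *[F2] wkap \<epsilon> (wproj True a u) (wproj False b u) w"
	by (induction u arbitrary: a b) (auto simp: \<epsilon> Y.GP.m_assoc)

text \<open>The contributions of consecutive letters of one factor telescope.\<close>

lemma wkap_step: "(x, y) : gp_step UNIV {} A ==> a : car (A True) ==> b : car (A False) ==> wkap \<epsilon> a b x = wkap \<epsilon> a b y"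
proof (induction rule: gp_step.induct)
	case (mult u u' v c d)
	have *: "wkap \<epsilon> a b ([(v, c), (v, d)] @ u') = wkap \<epsilon> a b ([(v, c *[A v] d)] @ u')"
		if "a : car (A True)" "b : car (A False)" for a b
	proof (cases v)
		case True
		then show ?thesis using mult that by (simp add: factor_assoc)
	next
		case False
		then show ?thesis using mult that by (simp add: factor_assoc \<epsilon> Y.GP.m_assoc Y.GP.inv_cancel)
	qed
	show ?case unfolding wkap_append[of _ _ u] using mult by (subst *) auto
next
	case (one u u' v)
	have *: "wkap \<epsilon> a b ([(v, one[A v])] @ u') = wkap \<epsilon> a b u'"
		if "a : car (A True)" "b : car (A False)" for a b
		using that one by (cases v) (simp_all add: \<epsilon>)
	show ?case unfolding wkap_append[of _ _ u] using one by (subst *) auto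
qed simp

lemma wkap_nfw: "w : W ==> a : car (A True) ==> b : car (A False) ==> wkap \<epsilon> a b (nfw w) = wkap \<epsilon> a b w"
	using gp_eq_invariant[OF nfw_gp_eq, of w "wkap \<epsilon> a b"] wkap_step by metis

lemma wkap_mult:
	assumes "P : car GP" "Q : car GP" "a : car (A True)" "b : car (A False)"
	shows "wkap \<epsilon> a b (nf (P *[GP] Q)) = wkap \<epsilon> a b (nf P) *[F2]
		 wkap \<epsilon> (a *[A True] proj True P) (b *[A False] proj False P) (nf Q)"
	using assms by (simp add: nf_mult' wkap_nfw wkap_append wproj_nf)

definition kap :: "'c => 'c => (bool \<times> 'c) list set => (bool \<times> int) list set" where
	"kap a b Q = wkap \<epsilon> a b (nf Q)"

lemma kap_closed [simp]: "kap a b Q : car F2" by (simp add: kap_def)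

lemma kap_mult:
	assumes "P : car GP" "Q : car GP" "a : car (A True)" "b : car (A False)"
		"!!i. proj i P = one[A i]"
	shows "kap a b (P *[GP] Q) = kap a b P *[F2] kap a b Q"
	using assms by (simp add: kap_def wkap_mult)

text \<open>Conjugation moves the initial state to the image of \<open>h\<close>. With finite
  factors only finitely many shifted maps arise in this way.\<close>

lemma kap_conj:
	assumes "P : car GP" "h : car GP" "!!i. proj i P = one[A i]"
	shows "kap one[A True] one[A False] (h *[GP] P *[GP] inv[GP] h) =
		kap one[A True] one[A False] h *[F2] kap (proj True h) (proj False h) P *[F2] inv[F2] kap one[A True] one[A False] h"
proof -
	let ?y = "kap one[A True] one[A False] h"
	let ?z = "kap (proj True h) (proj False h) (inv[GP] h)"
	have "kap one[A True] one[A False] (h *[GP] inv[GP] h) = ?y *[F2] ?z"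
		unfolding kap_def using assms by (subst wkap_mult) auto
	moreover have "kap one[A True] one[A False] (h *[GP] inv[GP] h) = one[F2]" using assms by (simp add: kap_def)
	ultimately have yz: "?z = inv[F2] ?y" using Y.GP.inv_equality[of ?z ?y] Y.GP.inv_comm by (metis kap_closed)
	have "kap one[A True] one[A False] (h *[GP] (P *[GP] inv[GP] h)) = ?y *[F2] kap (proj True h) (proj False h) (P *[GP] inv[GP] h)"
		unfolding kap_def using assms by (subst wkap_mult) auto
	also have "kap (proj True h) (proj False h) (P *[GP] inv[GP] h) = kap (proj True h) (proj False h) P *[F2] ?z"
		using assms by (intro kap_mult) auto
	finally show ?thesis unfolding yz using assms by (simp add: GP.m_assoc Y.GP.m_assoc)
qed

lemma kap_one: "kap a b one[GP] = one[F2]" by (simp add: kap_def)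

lemma kap_pow:
	assumes "P : car GP" "a : car (A True)" "b : car (A False)" "!!i. proj i P = one[A i]"
	shows "kap a b (P ^[GP] (n::nat)) = kap a b P ^[F2] n"
proof -
	have "kap a b (P ^[GP] n) = kap a b P ^[F2] n & (\<forall>i. proj i (P ^[GP] n) = one[A i])"
		by (induction n) (use assms in \<open>auto simp: kap_mult kap_one proj_one proj_mult\<close>)
	then show ?thesis by blast
qed

end

definition commutator :: "'c => 'c => (bool \<times> 'c) list set" where
	"commutator a b = incl True a *[GP] incl False b *[GP] inv[GP] incl True a *[GP] inv[GP] incl False b"

lemma commutator_closed [simp]: "a : car (A True) ==> b : car (A False) ==> commutator a b : car GP"
	by (simp add: commutator_def)

lemma proj_commutator: "a : car (A True) ==> b : car (A False) ==> proj i (commutator a b) = one[A i]"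
	by (cases i) (simp_all add: commutator_def proj_mult proj_inv proj_incl)

lemma kap_commutator:
	assumes "a : car (A True)" "b : car (A False)" "a ~= one[A True]" "b ~= one[A False]"
		"!!a b. \<epsilon> a b : car F2" "\<epsilon> a one[A False] = one[F2]" "\<epsilon> one[A True] b = one[F2]" "\<epsilon> one[A True] one[A False] = one[F2]"
	shows "kap \<epsilon> one[A True] one[A False] (commutator a b) = \<epsilon> a b"
proof -
	let ?w = "[(True, a), (False, b), (True, inv[A True] a), (False, inv[A False] b)]"
	have "commutator a b = cls ?w" unfolding commutator_def incl_cls using assms by (simp add: cls_inv cls_mult)
	moreover have "rw ?w" using assms by (simp add: rw_Cons)
	ultimately have "nf (commutator a b) = ?w" by (simp only: nf_cls_rw)
	then show ?thesis unfolding kap_def[OF assms(5)] using assms by simp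
qed

end

context graph_prod
begin

text \<open>On a smaller characteristic subgroup K' every map in the orbit of \<rho> lands in the
  kernel onto the direct product of the factors, where \<open>kap\<close> is a homomorphism to the
  free group. Composing it with automorphisms gives, up to conjugacy, only members of
  \<open>P\<close> followed by one of finitely many shifted rewritings, so
  \<open>pos_scl_criterion\<close> applies.\<close>

lemma finite_free_product_criterion:
	fixes A :: "bool => 'c monoid" and \<rho> :: "('v \<times> 'a) list set => (bool \<times> 'c) list set"
	defines "H \<equiv> graph_product UNIV {} A"
	assumes A: "!!i. comm_group (A i)" "!!i. finite (car (A i))"
		and a: "a0 : car (A True)" "a1 : car (A True)" "a0 ~= one[A True]" "a1 ~= one[A True]" "a0 ~= a1"
		and b: "b0 : car (A False)" "b0 ~= one[A False]"
		and K: "subgroup K GP"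
		and char: "!!\<phi> k. \<phi> : iso GP GP ==> k : K ==> \<phi> k : K"
		and T: "finite T" "T \<subseteq> car GP" "!!g. g : car GP ==> \<exists>t\<in>T. g *[GP] inv[GP] t : K"
		and \<rho>: "\<rho> : hom (GP\<lparr>carrier := K\<rparr>) H"
		and P: "finite P" "!!p k. p : P ==> k : K ==> p k : car H"
		and cover: "!!\<phi>. \<phi> : iso GP GP ==> \<exists>p\<in>P. conjugate_on K H (%k. \<rho> (\<phi> k)) p"
		and st: "s : K" "t : K" "\<rho> s = free_prod.commutator A a0 b0 ^[H] (e1::nat)"
			"\<rho> t = free_prod.commutator A a1 b0 ^[H] (e2::nat)" "e1 > 0" "e2 > 0"
	shows "has_pos_scl_aut GP"
proof -
	interpret K: subgroup K GP by (rule K)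
	interpret H: free_prod A using A(1) by (auto intro!: free_prod.intro comm_group.axioms(2))
	have H_def': "H = H.GP" by (simp add: H_def)
	note \<rho>s = hom_on_simps[OF group_GP H.group_GP K \<rho>[unfolded H_def']]
	have fg: "group (A i)" for i by (rule H.factor_group)
	\<comment> \<open>The commutators of \<open>a0\<close> and of \<open>a1\<close> with
	  \<open>b0\<close> become the two free generators, all other basic commutators die.\<close>
	define \<epsilon> where "\<epsilon> a b = (if a = a0 & b = b0 then F2_incl True 1 else if a = a1 & b = b0 then F2_incl False 1 else one[F2])" for a b
	have \<epsilon>: "\<epsilon> a b : car F2" for a b by (simp add: \<epsilon>_def)
	let ?o = "one[A True]" and ?o' = "one[A False]"
	have kc: "H.kap \<epsilon> a b Q : car F2" for a b Q by (rule H.kap_closed) (rule \<epsilon>)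
	\<comment> \<open>Vanishing is demanded after every automorphism, which makes K'
	  characteristic.\<close>
	define K' where "K' = {k : K. \<forall>\<phi>\<in>iso GP GP. \<forall>i. H.proj i (\<rho> (\<phi> k)) = one[A i]}"
	have \<rho>c: "\<rho> (\<phi> k) : car H.GP" if "\<phi> : iso GP GP" "k : K" for \<phi> k using \<rho>s(1) char that by blast
	have \<phi>K: "\<phi> (k *[GP] l) = \<phi> k *[GP] \<phi> l" "\<phi> (inv[GP] k) = inv[GP] \<phi> k" "\<phi> one[GP] = one[GP]" "\<phi> (k ^[GP] (n::nat)) = \<phi> k ^[GP] n"
		if "\<phi> : iso GP GP" "k : K" "l : K" for \<phi> k l n
		using that iso_hom[OF that(1)] K.mem_carrier hom_mult[of \<phi> GP GP] group_hom.hom_inv[of GP GP \<phi> k] hom_one[of \<phi> GP GP] hom_nat_pow[of \<phi> GP GP k n] group_GP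
		by (simp_all add: group_hom_def group_hom_axioms_def)
	have K'K: "k : K" if "k : K'" for k using that by (simp add: K'_def)
	have K': "subgroup K' GP"
	proof (rule GP.subgroupI)
		show "K' \<subseteq> car GP" using K'K K.mem_carrier by blast
		have "one[GP] : K'" unfolding K'_def
		proof (intro CollectI conjI ballI allI)
			fix \<phi> i assume "\<phi> : iso GP GP"
			from \<phi>K(3)[OF this K.one_closed K.one_closed] show "H.proj i (\<rho> (\<phi> one[GP])) = one[A i]" using \<rho>s(3) by (simp add: H.proj_one)
		qed (rule K.one_closed)
		then show "K' ~= {}" by blast
		fix k assume k: "k : K'"
		then have kK: "k : K" by (rule K'K)
		show "inv[GP] k : K'" unfolding K'_def
		proof (intro CollectI conjI ballI allI)
			fix \<phi> i assume \<phi>: "\<phi> : iso GP GP"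
			show "H.proj i (\<rho> (\<phi> (inv[GP] k))) = one[A i]"
				using k kK \<phi> \<phi>K(2)[OF \<phi> kK kK] \<rho>s(4)[OF char[OF \<phi> kK]] \<rho>c[OF \<phi> kK] by (simp add: K'_def H.proj_inv)
		qed (use kK in auto)
		fix l assume l: "l : K'"
		then have lK: "l : K" by (rule K'K)
		show "k *[GP] l : K'" unfolding K'_def
		proof (intro CollectI conjI ballI allI)
			fix \<phi> i assume \<phi>: "\<phi> : iso GP GP"
			show "H.proj i (\<rho> (\<phi> (k *[GP] l))) = one[A i]"
				using k l kK lK \<phi> \<phi>K(1)[OF \<phi> kK lK] \<rho>s(2)[OF char[OF \<phi> kK] char[OF \<phi> lK]] \<rho>c[OF \<phi> kK] \<rho>c[OF \<phi> lK] by (simp add: K'_def H.proj_mult)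
		qed (use kK lK in auto)
	qed
	have char': "\<phi> k : K'" if \<phi>: "\<phi> : iso GP GP" and k: "k : K'" for \<phi> k
		unfolding K'_def
	proof (intro CollectI conjI ballI allI)
		show "\<phi> k : K" by (rule char[OF \<phi> K'K[OF k]])
		fix \<psi> i assume \<psi>: "\<psi> : iso GP GP"
		have "\<forall>\<phi>\<in>iso GP GP. \<forall>i. H.proj i (\<rho> (\<phi> k)) = one[A i]" using k by (simp add: K'_def)
		from bspec[OF this iso_comp[OF \<phi> \<psi>]] show "H.proj i (\<rho> (\<psi> (\<phi> k))) = one[A i]" by (rule spec)
	qed
	\<comment> \<open>Projections to abelian factors ignore conjugation, so those of
	  \<open>\<rho> (\<phi> k)\<close> are the projections of p k for some p in \<open>P\<close>.
	  Elements of \<open>K\<close> with the same finite record therefore differ by an element of K',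
	  which has finite index.\<close>
	define val where "val k = (\<lambda>p\<in>P. (H.proj True (p k), H.proj False (p k)))" for k
	have val_fin: "finite (val ` K)"
	proof (rule finite_subset)
		show "val ` K \<subseteq> P \<rightarrow>\<^sub>E car (A True) \<times> car (A False)"
			using P(2) by (auto simp: val_def H_def')
		show "finite (P \<rightarrow>\<^sub>E car (A True) \<times> car (A False))" using P(1) A(2) by (intro finite_PiE) auto
	qed
	have proj_val: "H.proj i (\<rho> (\<phi> k)) = H.proj i (\<rho> (\<phi> l))" if \<phi>: "\<phi> : iso GP GP" and kl: "k : K" "l : K" "val k = val l" for \<phi> k l i
	proof -
		obtain p y where p: "p : P" "y : car H.GP" "\<forall>k\<in>K. \<rho> (\<phi> k) = y *[H.GP] p k *[H.GP] inv[H.GP] y"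
			using cover[OF \<phi>] unfolding conjugate_on_def H_def' by blast
		have "val k p = val l p" using kl(3) by simp
		then have "H.proj i (p k) = H.proj i (p l)" using p(1) by (cases i) (auto simp: val_def)
		then show ?thesis using p kl P(2)[unfolded H_def'] A(1) by (simp add: H.proj_conj)
	qed
	define rep where "rep v = (SOME k. k : K & val k = v)" for v
	have rep: "rep (val k) : K" "val (rep (val k)) = val k" if "k : K" for k
		using someI[of "%l. l : K & val l = val k" k] that unfolding rep_def by auto
	define T' where "T' = (%(v, t). rep v *[GP] t) ` (val ` K \<times> T)"
	have T': "finite T'" "T' \<subseteq> car GP"
		unfolding T'_def using val_fin T(1,2) rep(1) K.mem_carrier by auto
	have T'cov: "\<exists>t\<in>T'. g *[GP] inv[GP] t : K'" if g: "g : car GP" for g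
	proof -
		obtain t where t: "t : T" "g *[GP] inv[GP] t : K" using T(3)[OF g] by blast
		define k where "k = g *[GP] inv[GP] t"
		have k: "k : K" using t by (simp add: k_def)
		let ?l = "rep (val k)"
		have "k *[GP] inv[GP] ?l : K'" unfolding K'_def
		proof (intro CollectI conjI ballI allI)
			show "k *[GP] inv[GP] ?l : K" using k rep(1) by blast
			fix \<phi> i assume \<phi>: "\<phi> : iso GP GP"
			have li: "inv[GP] ?l : K" using rep(1)[OF k] by blast
			have "\<rho> (\<phi> (k *[GP] inv[GP] ?l)) = \<rho> (\<phi> k) *[H.GP] inv[H.GP] \<rho> (\<phi> ?l)"
				using \<phi>K(1)[OF \<phi> k li] \<phi>K(2)[OF \<phi> rep(1)[OF k] k] \<rho>s(2)[OF char[OF \<phi> k] char[OF \<phi> li]] \<rho>s(4)[OF char[OF \<phi> rep(1)[OF k]]] by simp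
			then show "H.proj i (\<rho> (\<phi> (k *[GP] inv[GP] ?l))) = one[A i]"
				using proj_val[OF \<phi> rep(1)[OF k] k rep(2)[OF k], of i] \<rho>c[OF \<phi> k] \<rho>c[OF \<phi> rep(1)[OF k]]
				by (simp add: H.proj_mult H.proj_inv)
		qed
		moreover have "g *[GP] inv[GP] (?l *[GP] t) = k *[GP] inv[GP] ?l"
			using g t T(2) K.mem_carrier[OF rep(1)[OF k]] by (auto simp: k_def GP.inv_mult_group GP.m_assoc)
		moreover have "?l *[GP] t : T'" unfolding T'_def using t(1) k by (intro image_eqI[of _ _ "(val k, t)"]) auto
		ultimately show ?thesis by (intro bexI[of _ "?l *[GP] t"]) auto
	qed
	define r where "r k = H.kap \<epsilon> ?o ?o' (\<rho> k)" for k
	have projK': "H.proj i (\<rho> k) = one[A i]" if "k : K'" for k i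
	proof -
		have "\<forall>\<phi>\<in>iso GP GP. \<forall>i. H.proj i (\<rho> (\<phi> k)) = one[A i]" using that by (simp add: K'_def)
		from bspec[OF this id_iso] show ?thesis by (rule spec)
	qed
	have r: "r : hom (GP\<lparr>carrier := K'\<rparr>) F2"
	proof (rule homI)
		fix k l assume "k : car (GP\<lparr>carrier := K'\<rparr>)" "l : car (GP\<lparr>carrier := K'\<rparr>)"
		then have kl: "k : K'" "l : K'" by auto
		then show "r (k *[GP\<lparr>carrier := K'\<rparr>] l) = r k *[F2] r l"
			unfolding r_def using \<rho>s(1,2) K'K projK' by (simp add: H.kap_mult[OF \<epsilon>])
	qed (simp add: r_def kc)
	define P' where "P' = (%(p, a, b) k. H.kap \<epsilon> a b (p k)) ` (P \<times> car (A True) \<times> car (A False))"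
	have P'fin: "finite P'" unfolding P'_def using P(1) A(2) by auto
	have P'c: "p k : car F2" if "p : P'" for p k using that kc by (auto simp: P'_def)
	have cover': "\<exists>p\<in>P'. conjugate_on K' F2 (%k. r (\<phi> k)) p" if \<phi>: "\<phi> : iso GP GP" for \<phi>
	proof -
		obtain p y where p: "p : P" "y : car H.GP" "\<forall>k\<in>K. \<rho> (\<phi> k) = y *[H.GP] p k *[H.GP] inv[H.GP] y"
			using cover[OF \<phi>] unfolding conjugate_on_def H_def' by blast
		let ?p = "%k. H.kap \<epsilon> (H.proj True y) (H.proj False y) (p k)"
		have pP: "?p : P'" unfolding P'_def using p by (intro image_eqI[of _ _ "(p, H.proj True y, H.proj False y)"]) auto
		have re: "r (\<phi> k) = H.kap \<epsilon> ?o ?o' y *[F2] ?p k *[F2] inv[F2] H.kap \<epsilon> ?o ?o' y" if k: "k : K'" for k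
		proof -
			have pk: "p k : car H.GP" using P(2)[OF p(1) K'K[OF k]] by (simp add: H_def')
			have e: "\<rho> (\<phi> k) = y *[H.GP] p k *[H.GP] inv[H.GP] y" using p(3) K'K[OF k] by blast
			have "H.proj i (p k) = one[A i]" for i
				using projK'[OF char'[OF \<phi> k], of i] H.proj_conj[OF A(1) pk p(2), of i] e by simp
			then show ?thesis unfolding r_def e using pk p(2) by (intro H.kap_conj[OF \<epsilon>])
		qed
		have "conjugate_on K' F2 (%k. r (\<phi> k)) ?p" unfolding conjugate_on_def
			by (rule bexI[OF _ kc]) (rule ballI, erule re)
		then show ?thesis using pP by (rule bexI)
	qed
	\<comment> \<open>A common multiple of the two orders: n-th powers of elements of \<open>K\<close>
	  lie in K'.\<close>
	define n where "n = order (A True) * order (A False)"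
	have n0: "n > 0" unfolding n_def order_def using a(1) b(1) A(2) by (auto simp: card_gt_0_iff)
	have proj_pow: "H.proj i (Q ^[H.GP] n) = one[A i]" if Q: "Q : car H.GP" for Q i
	proof -
		interpret Ai: group "A i" by (rule fg)
		have "H.proj i (Q ^[H.GP] n) = H.proj i Q ^[A i] n"
			by (rule hom_nat_pow[OF H.proj_hom Q H.group_GP fg])
		also have "\<dots> = one[A i]"
		proof -
			obtain m where "n = order (A i) * m" by (cases i) (auto simp: n_def mult.commute)
			then have "H.proj i Q ^[A i] n = (H.proj i Q ^[A i] order (A i)) ^[A i] m"
				using Q by (simp add: Ai.nat_pow_pow)
			then show ?thesis using Ai.pow_order_eq_1[of "H.proj i Q"] Q by simp
		qed
		finally show ?thesis .
	qed
	have powK: "k ^[GP] n : K'" if k: "k : K" for k unfolding K'_def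
	proof (intro CollectI conjI ballI allI)
		show "k ^[GP] n : K" using k by (induction n) auto
		fix \<phi> i assume \<phi>: "\<phi> : iso GP GP"
		show "H.proj i (\<rho> (\<phi> (k ^[GP] n))) = one[A i]"
			using \<phi>K(4)[OF \<phi> k k] \<rho>s(5)[OF char[OF \<phi> k]] proj_pow[OF \<rho>c[OF \<phi> k]] by simp
	qed
	have rpow: "r (k ^[GP] n) = F2_incl i (int (e * n))"
		if k: "k : K" "\<rho> k = H.commutator a b0 ^[H.GP] e" "a : car (A True)" "a ~= ?o" "\<epsilon> a b0 = F2_incl i 1" for k a e i
	proof -
		have c: "H.commutator a b0 : car H.GP" using k b by simp
		have "\<rho> (k ^[GP] n) = H.commutator a b0 ^[H.GP] (e * n)"
			using \<rho>s(5)[OF k(1)] k(2) c by (simp add: H.GP.nat_pow_pow)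
		then have "r (k ^[GP] n) = H.kap \<epsilon> ?o ?o' (H.commutator a b0) ^[F2] (e * n)"
			unfolding r_def using k b by (simp add: H.kap_pow[OF \<epsilon> c] H.proj_commutator)
		also have "H.kap \<epsilon> ?o ?o' (H.commutator a b0) = F2_incl i 1"
			unfolding k(5)[symmetric] using k b a by (intro H.kap_commutator \<epsilon>) (auto simp: \<epsilon>_def)
		finally show ?thesis by (simp add: F2_incl_pow)
	qed
	have eps0: "\<epsilon> a0 b0 = F2_incl True 1" and eps1: "\<epsilon> a1 b0 = F2_incl False 1" using a(5) by (simp_all add: \<epsilon>_def)
	show ?thesis
	proof (rule pos_scl_criterion[where K = K' and T = T' and r = r and P = P' and s = "s ^[GP] n" and t = "t ^[GP] n" and e = "int (e1 * n)"])
		show "\<phi> k : K'" if "\<phi> : iso GP GP" "k : K'" for \<phi> k using that by (rule char')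
		show "\<exists>t\<in>T'. g *[GP] inv[GP] t : K'" if "g : car GP" for g using that by (rule T'cov)
		show "p k : car F2" if "p : P'" "k : K'" for p k using that(1) by (rule P'c)
		show "\<exists>p\<in>P'. conjugate_on K' F2 (%k. r (\<phi> k)) p" if "\<phi> : iso GP GP" for \<phi> using that by (rule cover')
		show "r (s ^[GP] n) = F2_incl True (int (e1 * n))"
			by (rule rpow[OF st(1) st(3)[unfolded H_def'] a(1,3) eps0])
		show "int (e1 * n) ~= 0" using st(5) n0 by simp
		have e: "r (t ^[GP] n) = F2_incl False (int (e2 * n))"
			by (rule rpow[OF st(2) st(4)[unfolded H_def'] a(2,4) eps1])
		show "\<nexists>j. r (t ^[GP] n) = F2_incl True j"
		proof
			assume "\<exists>j. r (t ^[GP] n) = F2_incl True j"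
			then obtain j where "F2_incl False (int (e2 * n)) = F2_incl True j" unfolding e by blast
			then have "Y.nf (F2_incl False (int (e2 * n))) = Y.nf (F2_incl True j)" by simp
			then show False using Y.incl_nf[of "int (e2 * n)" False] Y.incl_nf[of j True] st(6) n0 by (auto split: if_splits)
		qed
	qed (use K' T' r P'fin powK[OF st(1)] powK[OF st(2)] in simp_all)
qed

end

section \<open>Elliptic and hyperbolic elements of free products\<close>

context free_prod
begin

lemma cyclic_pow_ne:
	assumes "rw v" "v ~= []" "fst (hd v) ~= fst (last v)" "n > 0"
	shows "cls v ^[GP] (n::nat) ~= one[GP]"
proof -
	have r: "rw (concat (replicate n v))" using rw_replicate[OF assms(1,3)] by blast
	have "cls v ^[GP] n = cls (concat (replicate n v))" using cls_pow[OF rw_W[OF assms(1)], of n] by blast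
	then have "nf (cls v ^[GP] n) = concat (replicate n v)" using r by (simp only: nf_cls_rw)
	moreover have "concat (replicate n v) ~= []" using assms(2,4) by (cases n) auto
	ultimately show ?thesis by auto
qed

text \<open>Conjugate into a factor, that is, fixing a vertex of the Bass-Serre tree.\<close>

definition elliptic :: "(bool \<times> 'c) list set => bool" where
	"elliptic Q \<longleftrightarrow> (\<exists>d\<in>car GP. \<exists>i. \<exists>a\<in>car (A i). Q = d *[GP] incl i a *[GP] inv[GP] d)"

lemma elliptic_or_hyperbolic:
	assumes "Q : car GP"
	shows "elliptic Q | (\<exists>d v. d : car GP & rw v & v ~= [] & fst (hd v) ~= fst (last v) &
		 Q = d *[GP] cls v *[GP] inv[GP] d)"
proof -
	obtain d v where v: "d : W" "rw v" "cls (nf Q) = cls d *[GP] cls v *[GP] inv[GP] cls d"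
		"length v <= 1 | fst (hd v) ~= fst (last v)"
		using cyclic_reduction[OF nf_rw[OF assms]] by (elim exE conjE)
	have Q: "Q = cls d *[GP] cls v *[GP] inv[GP] cls d" using v(3) assms by simp
	have d: "cls d : car GP" using v(1) by simp
	show ?thesis
	proof (cases "length v <= 1")
		case True
		then have "v = [] | (\<exists>i a. v = [(i, a)])" by (cases v) auto
		then show ?thesis
		proof
			assume "v = []"
			then have "cls v = incl True one[A True]" using incl_one[of True] by (simp add: one_GP)
			then show ?thesis using Q d unfolding elliptic_def by (metis factor_simps(2))
		next
			assume "\<exists>i a. v = [(i, a)]"
			then obtain i a where e: "v = [(i, a)]" by blast
			then have "a : car (A i)" using v(2) by (simp add: rw_Cons)
			then show ?thesis using Q d e unfolding elliptic_def incl_cls by blast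
		qed
	next
		case False
		then have "v ~= []" "fst (hd v) ~= fst (last v)" using v(4) by auto
		then show ?thesis using Q d v(2) by blast
	qed
qed

lemma torsion_elliptic:
	assumes "Q : car GP" "n > 0" "Q ^[GP] (n::nat) = one[GP]"
	shows "elliptic Q"
proof (rule ccontr)
	assume "~ elliptic Q"
	then obtain d v where v: "d : car GP" "rw v" "v ~= []" "fst (hd v) ~= fst (last v)"
		"Q = d *[GP] cls v *[GP] inv[GP] d" using elliptic_or_hyperbolic[OF assms(1)] by blast
	have c: "cls v : car GP" using v(2) by simp
	have "d *[GP] cls v ^[GP] n *[GP] inv[GP] d = one[GP]" using assms(3) v(5) GP.pow_conj[OF v(1) c] by simp
	moreover have "cls v ^[GP] n = inv[GP] d *[GP] (d *[GP] cls v ^[GP] n *[GP] inv[GP] d) *[GP] d"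
		using v(1) c by (simp add: GP.m_assoc GP.inv_cancel)
	ultimately have "cls v ^[GP] n = inv[GP] d *[GP] one[GP] *[GP] d" by simp
	then show False using cyclic_pow_ne[OF v(2,3,4) assms(2)] v(1) by simp
qed

text \<open>Once the factor is stripped from both ends, the rest w satisfies w a = a w with both
  sides reduced; comparing first letters shows that w is empty.\<close>

lemma centralizer_factor:
	assumes A: "comm_group (A i)" and a: "a : car (A i)" "a ~= one[A i]"
		and Q: "Q : car GP" "Q *[GP] incl i a = incl i a *[GP] Q"
	shows "\<exists>b\<in>car (A i). Q = incl i b"
proof -
	interpret Ai: comm_group "A i" by (rule A)
	obtain x y w where w: "x : car (A i)" "y : car (A i)" "rw w"
		"w ~= [] ==> fst (hd w) ~= i" "w ~= [] ==> fst (last w) ~= i" "Q = incl i x *[GP] cls w *[GP] incl i y"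
		using strip[OF Q(1), of i] by metis
	have ic: "incl i x : car GP" "incl i y : car GP" "incl i a : car GP" "cls w : car GP"
		using w a by auto
	have com: "incl i u *[GP] incl i v = incl i v *[GP] incl i u" if "u : car (A i)" "v : car (A i)" for u v
		using incl_mult[of i u v] incl_mult[of i v u] that Ai.m_comm[of u v] by simp
	have "cls w *[GP] incl i a = incl i a *[GP] cls w"
	proof -
		have "incl i x *[GP] (cls w *[GP] incl i a) *[GP] incl i y = Q *[GP] incl i a"
			unfolding w(6) using ic com[OF a(1) w(2)] by (simp add: GP.m_assoc)
		also have "\<dots> = incl i a *[GP] Q" by (rule Q(2))
		also have "\<dots> = incl i x *[GP] (incl i a *[GP] cls w) *[GP] incl i y"
			unfolding w(6) using ic com[OF a(1) w(1)] by (simp add: GP.m_assoc[symmetric])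
		finally show ?thesis using ic by simp
	qed
	moreover have "w = []"
	proof (rule ccontr)
		assume ne: "w ~= []"
		have "rw (w @ [(i, a)])" "rw ([(i, a)] @ w)" using w(3-5) ne a by (auto simp: rw_append rw_Cons)
		then have "nf (cls (w @ [(i, a)])) = w @ [(i, a)]" "nf (cls ([(i, a)] @ w)) = [(i, a)] @ w" by (simp_all only: nf_cls_rw)
		moreover have "cls (w @ [(i, a)]) = cls ([(i, a)] @ w)"
			using \<open>cls w *[GP] incl i a = incl i a *[GP] cls w\<close> w(3) a by (simp add: incl_cls cls_mult)
		ultimately have "w @ [(i, a)] = [(i, a)] @ w" by simp
		then have "hd w = (i, a)" using ne by (cases w) auto
		then show False using w(4)[OF ne] by simp
	qed
	then have "Q = incl i (x *[A i] y)" using w(6) ic incl_mult[of i x y] w(1,2) by (simp flip: one_GP)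
	then show ?thesis using w(1,2) by blast
qed

text \<open>After conjugating back by \<open>g\<close>, all values commute with a non-trivial
  element of a factor, hence lie in that factor, where the projection identifies them.\<close>

lemma elliptic_conj_fix:
	assumes A: "comm_group (A i)"
		and f: "!!a. a : C ==> f a : car GP" "!!a b. a : C ==> b : C ==> f a *[GP] f b = f b *[GP] f a"
		and a0: "a0 : C" "f a0 = g *[GP] incl i c *[GP] inv[GP] g" "g : car GP" "c : car (A i)" "c ~= one[A i]"
		and a: "a : C"
	shows "f a = g *[GP] incl i (proj i (f a)) *[GP] inv[GP] g"
proof -
	let ?q = "inv[GP] g *[GP] f a *[GP] g"
	have ic: "incl i c : car GP" using a0 by simp
	note cs = f(1)[OF a] f(1)[OF a0(1)] a0(3) ic
	have e: "incl i c = inv[GP] g *[GP] f a0 *[GP] g" unfolding a0(2) using a0(3) ic by (simp add: GP.m_assoc GP.inv_cancel)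
	have "?q *[GP] incl i c = inv[GP] g *[GP] (f a *[GP] f a0) *[GP] g" unfolding e using cs by (simp add: GP.m_assoc GP.inv_cancel)
	also have "\<dots> = inv[GP] g *[GP] (f a0 *[GP] f a) *[GP] g" using f(2)[OF a a0(1)] by simp
	also have "\<dots> = incl i c *[GP] ?q" unfolding e using cs by (simp add: GP.m_assoc GP.inv_cancel)
	finally have "\<exists>b\<in>car (A i). ?q = incl i b" using cs a0(4,5) by (intro centralizer_factor[OF A, of c]) auto
	then obtain b where b: "b : car (A i)" "?q = incl i b" by blast
	have fa: "f a = g *[GP] incl i b *[GP] inv[GP] g" unfolding b(2)[symmetric] using cs by (simp add: GP.m_assoc GP.inv_cancel)
	moreover have "proj i (f a) = b" unfolding fa using b(1) a0(3) by (simp add: proj_conj[OF A] proj_incl)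
	ultimately show ?thesis by simp
qed

text \<open>Conjugate \<open>g\<close> to a cyclically reduced v and \<open>h\<close> to u. Since v
  u = u v, cancellation or merging occurs on both sides or on neither, which forces u or its inverse
  to begin and end in the same factors as v. Then both products are reduced words and literally
  equal, so the two words are powers of a common word.\<close>

lemma commuting_hyperbolic:
	assumes g: "g : car GP" "~ elliptic g" and h: "h : car GP" "g *[GP] h = h *[GP] g"
	shows "\<exists>m n. m > 0 & (h ^[GP] (m::nat) = g ^[GP] (n::nat) | inv[GP] h ^[GP] (m::nat) = g ^[GP] (n::nat))"
proof -
	obtain d v where v: "d : car GP" "rw v" "v ~= []" "fst (hd v) ~= fst (last v)"
		"g = d *[GP] cls v *[GP] inv[GP] d" using elliptic_or_hyperbolic[OF g(1)] g(2) by blast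
	let ?k = "inv[GP] d *[GP] h *[GP] d"
	have cv: "cls v : car GP" and kc: "?k : car GP" using v h by auto
	have ev: "cls v = inv[GP] d *[GP] g *[GP] d" unfolding v(5) using v(1) cv by (simp add: GP.m_assoc GP.inv_cancel)
	have "cls v *[GP] ?k = inv[GP] d *[GP] (g *[GP] h) *[GP] d" unfolding ev using v(1) g(1) h(1) by (simp add: GP.m_assoc GP.inv_cancel)
	also have "\<dots> = inv[GP] d *[GP] (h *[GP] g) *[GP] d" using h(2) by simp
	also have "\<dots> = ?k *[GP] cls v" unfolding ev using v(1) g(1) h(1) by (simp add: GP.m_assoc GP.inv_cancel)
	finally have com: "cls v *[GP] ?k = ?k *[GP] cls v" .
	have hk: "h = d *[GP] ?k *[GP] inv[GP] d" using v(1) h by (simp add: GP.m_assoc GP.inv_cancel)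
	have main: "\<exists>m n. m > 0 & cls u ^[GP] (m::nat) = cls v ^[GP] (n::nat)"
		if u: "rw u" "u ~= []" "fst (hd u) = fst (hd v)" "fst (last u) = fst (last v)" "cls v *[GP] cls u = cls u *[GP] cls v" for u
	proof -
		have r: "rw (v @ u)" "rw (u @ v)" using u v by (auto simp: rw_append)
		have W: "u : W" "v : W" using u(1) v(2) by simp_all
		have "cls (v @ u) = cls (u @ v)" using u(5) W by (simp add: cls_mult)
		then have "nf (cls (v @ u)) = nf (cls (u @ v))" by simp
		then have "v @ u = u @ v" using r by (simp only: nf_cls_rw)
		then obtain m n zs where z: "concat (replicate m zs) = v" "concat (replicate n zs) = u"
			using comm_append_are_replicate by blast
		have zW: "zs : W" using z(1) v(3) W(2) by (cases m) auto
		have "cls u = cls zs ^[GP] n" "cls v = cls zs ^[GP] m" using cls_pow[OF zW] z by metis+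
		then have "cls u ^[GP] m = cls v ^[GP] n" using zW by (simp add: GP.nat_pow_pow mult.commute)
		moreover have "m > 0" using z(1) v(3) by (cases m) auto
		ultimately show ?thesis by blast
	qed
	have conj_pw: "h' ^[GP] (m::nat) = g ^[GP] (n::nat)" if "k' : car GP" "h' = d *[GP] k' *[GP] inv[GP] d" "k' ^[GP] m = cls v ^[GP] n" for h' k' m n
		unfolding that(2) v(5) GP.pow_conj[OF v(1) that(1)] GP.pow_conj[OF v(1) cv] that(3) ..
	define u where "u = nf ?k"
	have u: "rw u" "cls u = ?k" unfolding u_def using kc by (rule nf_rw, rule cls_nf)
	show ?thesis
	proof (cases "u = []")
		case True
		then have "?k = one[GP]" using u(2) by (simp add: one_GP)
		then have "h = one[GP]" using hk v(1) by simp
		then have "h ^[GP] (1::nat) = g ^[GP] (0::nat)" by simp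
		then show ?thesis by (intro exI[of _ 1, OF exI[of _ 0]]) simp
	next
		case ne: False
		have comu: "cls v *[GP] cls u = cls u *[GP] cls v" using com u(2) by simp
		have len: "length (foldr lact v u) = length (foldr lact u v)"
			using comu nf_mult_cls[OF v(2) u(1)] nf_mult_cls[OF u(1) v(2)] by simp
		have short: "length (foldr lact p q) < length p + length q"
			if pq: "rw p" "rw q" "p ~= []" "q ~= []" "fst (last p) = fst (hd q)" for p q
		proof -
			obtain p' c q' x z m where d: "p = p' @ x @ c" "q = winv c @ z @ q'" "foldr lact p q = p' @ m @ q'" "merge x z m"
				using prod_decomp[OF pq(1,2)] by (elim exE conjE)
			have "x ~= [] | c ~= []"
			proof (rule ccontr)
				assume "~ (x ~= [] | c ~= [])"
				then have e: "p' = p" "q' = q" "m = []" using d by (auto simp: merge_def)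
				have "rw (foldr lact p q)" using pq by simp
				then have "rw (p @ q)" using d(3) e by simp
				then show False using pq(3-5) by (simp add: rw_append)
			qed
			moreover have "length m = length x" "length z = length x" using d(4) by (auto simp: merge_def)
			moreover have "length p = length p' + length x + length c" "length q = length c + length z + length q'"
				using d(1,2) by simp_all
			ultimately show ?thesis using d(3) by auto
		qed
		have long: "length (foldr lact p q) = length p + length q"
			if pq: "rw p" "rw q" "p ~= []" "q ~= []" "fst (last p) ~= fst (hd q)" for p q
		proof -
			have "rw (p @ q)" using pq by (simp add: rw_append)
			then show ?thesis by (simp add: foldr_lact_append)
		qed
		\<comment> \<open>Equal factors at the junction strictly shorten a product, different ones keep
		  the full length.\<close>
		have iff: "fst (last v) = fst (hd u) \<longleftrightarrow> fst (last u) = fst (hd v)"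
			using len short[OF v(2) u(1) v(3) ne] short[OF u(1) v(2) ne v(3)] long[OF v(2) u(1) v(3) ne] long[OF u(1) v(2) ne v(3)] by linarith
		show ?thesis
		proof (cases "fst (hd u) = fst (hd v)")
			case True
			then have "fst (last u) = fst (last v)" using iff v(4) by blast
			then obtain m n where mn: "m > 0" "cls u ^[GP] (m::nat) = cls v ^[GP] (n::nat)" using main[OF u(1) ne True _ comu] by blast
			then have "h ^[GP] m = g ^[GP] n" using u(2) by (intro conj_pw[OF kc hk]) simp
			then show ?thesis using mn(1) by blast
		next
			case False
			have lu: "fst (last u) = fst (hd v)" using iff False v(4) by blast
			have hu: "fst (hd u) = fst (last v)" using False v(4) by blast
			have ci: "cls (winv u) = inv[GP] ?k" using u cls_inv[of u] by simp
			have "cls v *[GP] cls (winv u) = cls (winv u) *[GP] cls v" unfolding ci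
			proof -
				have "inv[GP] ?k *[GP] (cls v *[GP] ?k) *[GP] inv[GP] ?k = inv[GP] ?k *[GP] (?k *[GP] cls v) *[GP] inv[GP] ?k" using com by simp
				moreover have "inv[GP] ?k *[GP] (cls v *[GP] ?k) *[GP] inv[GP] ?k = inv[GP] ?k *[GP] cls v"
					using GP.inv_closed[OF kc] kc cv GP.r_inv[OF kc] by (simp only: GP.m_assoc GP.m_closed GP.r_one)
				moreover have "inv[GP] ?k *[GP] (?k *[GP] cls v) *[GP] inv[GP] ?k = cls v *[GP] inv[GP] ?k"
					using GP.inv_cancel(2)[OF kc cv] by (simp only:)
				ultimately show "cls v *[GP] inv[GP] ?k = inv[GP] ?k *[GP] cls v" by (simp only:)
			qed
			moreover have "fst (hd (winv u)) = fst (hd v)" using lu fst_hd_winv[OF ne] by simp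
			moreover have "fst (last (winv u)) = fst (last v)" using hu fst_last_winv[OF ne] by simp
			ultimately obtain m n where mn: "m > 0" "cls (winv u) ^[GP] (m::nat) = cls v ^[GP] (n::nat)"
				using main[OF rw_winv[OF u(1)]] ne by auto
			have "inv[GP] h = d *[GP] inv[GP] ?k *[GP] inv[GP] d"
				using v(1) h by (simp add: GP.inv_mult_group GP.m_assoc GP.inv_cancel)
			then have "inv[GP] h ^[GP] m = g ^[GP] n" using mn(2) ci by (intro conj_pw[OF GP.inv_closed[OF kc]]) simp_all
			then show ?thesis using mn(1) by blast
		qed
	qed
qed

text \<open>Normal forms of products that alternate between letters of factor \<open>i\<close> and
  non-trivial elements of \<open>S\<close>. The flag tells whether the first piece is a letter; the
  empty word has flag False.\<close>

inductive alternating :: "bool => (bool \<times> 'c) list set set => bool => (bool \<times> 'c) list => bool" for i S where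
	Nil: "alternating i S False []"
| block: "q : S ==> q ~= one[GP] ==> w = [] | alternating i S True w ==> alternating i S False (nf q @ w)"
| letter: "a : car (A i) ==> a ~= one[A i] ==> alternating i S False w ==> alternating i S True ((i, a) # w)"

context
	fixes i :: bool and S :: "(bool \<times> 'c) list set set"
	assumes S: "subgroup S GP"
		and blocks: "!!q. q : S ==> q ~= one[GP] ==> fst (hd (nf q)) ~= i & fst (last (nf q)) ~= i"
begin

interpretation S: subgroup S GP by (rule S)

lemma alternating_rw:
	"alternating i S f w ==> rw w & (f --> w ~= [] & fst (hd w) = i) & (~ f --> w ~= [] --> fst (hd w) ~= i)"
proof (induction rule: alternating.induct)
	case (block q w)
	have q: "q : car GP" "nf q ~= []" using block(1,2) S.mem_carrier nf_eq_Nil by auto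
	have b: "fst (hd (nf q)) ~= i" "fst (last (nf q)) ~= i" using blocks[OF block(1,2)] by auto
	have "rw w" "w ~= [] --> fst (hd w) = i" using block(3) by auto
	then show ?case using q b nf_rw[OF q(1)] by (auto simp: rw_append)
next
	case (letter a w)
	then show ?case by (auto simp: rw_Cons)
qed simp

lemma alternating_False:
	"alternating i S False w ==> w = [] | (\<exists>q w'. w = nf q @ w' & q : S & q ~= one[GP] & (w' = [] | alternating i S True w'))"
	by (erule alternating.cases) (simp, blast, simp)

lemma alternating_letter:
	assumes "Q : car GP" "alternating i S f (nf Q)" "a : car (A i)"
	shows "\<exists>f'. alternating i S f' (nf (incl i a *[GP] Q))"
proof (cases "a = one[A i]")
	case True
	then show ?thesis using assms incl_one[of i] by auto
next
	case a: False
	have nf: "nf (incl i a *[GP] Q) = lact (i, a) (nf Q)"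
		using assms a by (simp add: nf_mult incl_nf)
	show ?thesis
	proof (cases f)
		case False
		then have "rw ((i, a) # nf Q)" using alternating_rw[OF assms(2)] assms a by (auto simp: rw_Cons)
		then have "nf (incl i a *[GP] Q) = (i, a) # nf Q" using nf lact_Cons by simp
		then show ?thesis using alternating.letter[OF assms(3) a] assms(2) False by auto
	next
		case True
		with assms(2) obtain b w where w: "nf Q = (i, b) # w" "b : car (A i)" "alternating i S False w"
			by (auto elim: alternating.cases)
		have "nf (incl i a *[GP] Q) = (if a *[A i] b = one[A i] then w else (i, a *[A i] b) # w)"
			unfolding nf w(1) using a by (simp add: lact_def)
		then show ?thesis using w assms(3) alternating.letter[of "a *[A i] b" i S w] by (metis factor_simps(1))
	qed
qed

lemma alternating_block:
	assumes "Q : car GP" "alternating i S f (nf Q)" "q : S"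
	shows "\<exists>f'. alternating i S f' (nf (q *[GP] Q))"
proof (cases "q = one[GP]")
	case True
	then show ?thesis using assms by auto
next
	case ne: False
	have join: "nf (q' *[GP] cls w) = nf q' @ w" if "q' : S" "q' ~= one[GP]" "w = [] | alternating i S True w" for q' w
	proof -
		have r: "rw (nf q' @ w)" using alternating_rw[OF alternating.block[OF that]] by blast
		then have rw': "rw w" by (simp add: rw_append)
		have "foldr lact (nf q') w = nf q' @ w" using r by (rule foldr_lact_append)
		then show ?thesis using that(1) rw' by (simp add: nf_mult S.mem_carrier)
	qed
	show ?thesis
	proof (cases f)
		case True
		then have al: "alternating i S True (nf Q)" using assms(2) by simp
		have "nf (q *[GP] cls (nf Q)) = nf q @ nf Q" by (rule join[OF assms(3) ne disjI2[OF al]])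
		then have "nf (q *[GP] Q) = nf q @ nf Q" using assms(1) by simp
		then show ?thesis using alternating.block[OF assms(3) ne, of "nf Q" i] assms(2) True by auto
	next
		case False
		with assms(2) have al: "alternating i S False (nf Q)" by simp
		consider "nf Q = []" | q' w where "nf Q = nf q' @ w" "q' : S" "q' ~= one[GP]" "w = [] | alternating i S True w"
			using alternating_False[OF al] by blast
		then show ?thesis
		proof cases
			case 1
			then have "Q = one[GP]" using nf_eq_Nil assms(1) by blast
			then have "nf (q *[GP] Q) = nf q @ []" using assms(3) by simp
			then show ?thesis using alternating.block[OF assms(3) ne, of "[]" i] by auto
		next
			case 2
			have r: "rw (nf q' @ w)" using 2(1) nf_rw[OF assms(1)] by simp
			then have rw': "rw w" by (simp add: rw_append)
			have q': "q' : car GP" using 2(2) by (rule S.mem_carrier)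
			have "Q = cls (nf q' @ w)" using 2(1) cls_nf[OF assms(1)] by simp
			also have "\<dots> = q' *[GP] cls w" using cls_mult[of "nf q'" w] q' rw' by simp
			finally have e: "q *[GP] Q = (q *[GP] q') *[GP] cls w" using q' assms(3) rw' by (simp add: GP.m_assoc S.mem_carrier)
			have qq: "q *[GP] q' : S" using assms(3) 2(2) by (rule S.m_closed)
			show ?thesis
			proof (cases "q *[GP] q' = one[GP]")
				case True
				then have "nf (q *[GP] Q) = w" using e rw' by simp
				then show ?thesis using 2(4) alternating.Nil[of i S] by auto
			next
				case False
				then have "nf (q *[GP] Q) = nf (q *[GP] q') @ w" using e join[OF qq False 2(4)] by simp
				then show ?thesis using alternating.block[OF qq False 2(4)] by auto
			qed
		qed
	qed
qed

text \<open>Ping-pong for the subgroup generated by the factor \<open>i\<close> and \<open>S\<close>.\<close>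
lemma generate_factor_block:
	assumes Q: "Q : generate GP ({incl i a | a. a : car (A i)} \<union> S)" and nf: "nf Q = [(j, b)]" "j ~= i"
	shows "Q : S"
proof -
	have sub: "{incl i a | a. a : car (A i)} \<union> S \<subseteq> car GP" using S.subset by auto
	\<comment> \<open>Left multiplication preserves alternating forms, so \<open>Q\<close> has one. Its
	  only letter lies outside factor \<open>i\<close> and must be a whole block.\<close>
	have main: "\<forall>P f. P : car GP --> alternating i S f (nf P) --> (\<exists>f'. alternating i S f' (nf (h *[GP] P)))"
		if "h : generate GP ({incl i a | a. a : car (A i)} \<union> S)" for h
		using that
	proof (induction rule: generate.induct)
		case one then show ?case by auto
	next
		case (incl h)
		then show ?case using alternating_letter alternating_block by blast
	next
		case (inv h)
		then show ?case
		proof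
			assume "h : {incl i a | a. a : car (A i)}"
			then obtain a where a: "h = incl i a" "a : car (A i)" by blast
			have "inv[GP] h = incl i (inv[A i] a)" using a by (simp add: incl_cls cls_inv)
			then show ?thesis using alternating_letter a by auto
		next
			assume "h : S"
			then show ?thesis using alternating_block S.m_inv_closed by blast
		qed
	next
		case (eng h1 h2)
		have c: "h1 : car GP" "h2 : car GP" using eng(1,2) GP.generate_in_carrier[OF sub] by auto
		show ?case
		proof (intro allI impI)
			fix P f assume P: "P : car GP" "alternating i S f (nf P)"
			then obtain f' where "alternating i S f' (nf (h2 *[GP] P))" using eng(4) by blast
			then have "\<exists>f'. alternating i S f' (nf (h1 *[GP] (h2 *[GP] P)))" using eng(3) P c by blast
			then show "\<exists>f'. alternating i S f' (nf (h1 *[GP] h2 *[GP] P))" using c P by (simp add: GP.m_assoc)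
		qed
	qed
	have Qc: "Q : car GP" using Q GP.generate_in_carrier[OF sub] by blast
	have "alternating i S False (nf one[GP])" using alternating.Nil[of i S] by simp
	then have "\<exists>f'. alternating i S f' (nf (Q *[GP] one[GP]))" using main[OF Q] by blast
	then obtain f where f: "alternating i S f [(j, b)]" using Qc nf(1) by auto
	from f have "~ f" using alternating_rw[OF f] nf(2) by auto
	with f have al: "alternating i S False [(j, b)]" by simp
	obtain q w where q: "q : S" "q ~= one[GP]" "[(j, b)] = nf q @ w"
		using alternating_False[OF al] by blast
	have "nf q ~= []" using q nf_eq_Nil S.mem_carrier by blast
	then have "nf q = [(j, b)]" using q(3) by (cases "nf q") auto
	then have "q = Q" using nf(1) nf_inj[of q Q] Qc q(1) S.mem_carrier by simp
	then show ?thesis using q(1) by simp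
qed

end

text \<open>An asymmetric \<open>strip\<close>: the left end will be absorbed into the element
  conjugating the True factor, the right end into the one conjugating the False factor.\<close>

lemma strip2:
	assumes "Q : car GP"
	shows "\<exists>a b w. a : car (A True) & b : car (A False) & rw w & (w ~= [] --> ~ fst (hd w) & fst (last w)) &
		Q = incl True a *[GP] cls w *[GP] incl False b"
proof -
	obtain x y w where w: "x : car (A True)" "y : car (A True)" "rw w"
		"w ~= [] ==> fst (hd w) ~= True" "w ~= [] ==> fst (last w) ~= True" "Q = incl True x *[GP] cls w *[GP] incl True y"
		using strip[OF assms, of True] by metis
	have ic: "incl True x : car GP" "incl True y : car GP" "cls w : car GP" using w by auto
	show ?thesis
	proof (cases "w = []")
		case True
		then have "Q = incl True (x *[A True] y) *[GP] cls [] *[GP] incl False one[A False]"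
			using w(6) incl_mult[of True x y] w(1,2) ic incl_one[of False] by (simp flip: one_GP)
		then show ?thesis using w(1,2) by (intro exI[of _ "x *[A True] y"] exI[of _ "one[A False]"] exI[of _ "[]"]) simp
	next
		case ne: False
		show ?thesis
		proof (cases "y = one[A True]")
			case True
			obtain w' l where l: "w = w' @ [l]" using ne by (cases w rule: rev_cases) auto
			have fl: "fst l = False" using w(5)[OF ne] l by simp
			have r: "rw w'" "rw [l]" "w' ~= [] --> fst (last w') ~= fst l" using w(3) unfolding l rw_append by auto
			have sl: "snd l : car (A False)" using r(2) fl by (cases l) (simp add: rw_Cons)
			have "cls w = cls w' *[GP] cls [l]" unfolding l using r by (intro cls_mult[symmetric] rw_W)
			moreover have "cls [l] = incl False (snd l)" unfolding incl_cls fl[symmetric] by simp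
			ultimately have "Q = incl True x *[GP] cls w' *[GP] incl False (snd l)"
				using w(6) True incl_one[of True] ic r(1) sl by (simp add: GP.m_assoc)
			moreover have "w' ~= [] --> ~ fst (hd w') & fst (last w')" using w(4)[OF ne] l r(3) fl by auto
			ultimately show ?thesis using w(1) sl r(1) by (intro exI[of _ x] exI[of _ "snd l"] exI[of _ w']) simp
		next
			case False
			have "rw (w @ [(True, y)])" using w(2,3) w(5)[OF ne] ne False by (simp add: rw_append rw_Cons)
			moreover have "Q = incl True x *[GP] cls (w @ [(True, y)]) *[GP] incl False one[A False]"
			proof -
				have "cls (w @ [(True, y)]) = cls w *[GP] incl True y" unfolding incl_cls using w(2,3) by (intro cls_mult[symmetric]) simp_all
				then show ?thesis using w(6) ic incl_one[of False] by (simp add: GP.m_assoc)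
			qed
			ultimately show ?thesis using w(1) w(4)[OF ne] ne
				by (intro exI[of _ x] exI[of _ "one[A False]"] exI[of _ "w @ [(True, y)]"]) simp
		qed
	qed
qed

text \<open>Absorbing end letters replaces \<open>g\<close> by c and \<open>h\<close> by c k, with k
  starting in the False factor and ending in the True one. If k were not empty, each non-trivial k b
  k^-1 would be reduced as written, of length at least 3 and with both ends in the False factor.
  Ping-pong against the True factor would then keep single letters of the False factor out of the
  generated group.\<close>

lemma inner_of_factor_conj:
	assumes A: "!!i. comm_group (A i)"
		and g: "g : car GP" and h: "h : car GP"
		and gen: "car GP \<subseteq> generate GP ({g *[GP] incl True a *[GP] inv[GP] g | a. a : car (A True)} \<union>
			 {h *[GP] incl False b *[GP] inv[GP] h | b. b : car (A False)})" (is "_ \<subseteq> generate GP ?R")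
		and b0: "b0 : car (A False)" "b0 ~= one[A False]"
	shows "\<exists>c\<in>car GP. (\<forall>a\<in>car (A True). g *[GP] incl True a *[GP] inv[GP] g = c *[GP] incl True a *[GP] inv[GP] c) &
		 (\<forall>b\<in>car (A False). h *[GP] incl False b *[GP] inv[GP] h = c *[GP] incl False b *[GP] inv[GP] c)"
proof -
	have kc: "inv[GP] g *[GP] h : car GP" using g h by simp
	obtain a1 b1 k where k: "a1 : car (A True)" "b1 : car (A False)" "rw k" "k ~= [] --> ~ fst (hd k) & fst (last k)"
		"inv[GP] g *[GP] h = incl True a1 *[GP] cls k *[GP] incl False b1"
		using strip2[OF kc] by (elim exE conjE)
	define c where "c = g *[GP] incl True a1"
	have cl: "c : car GP" "incl True a1 : car GP" "incl False b1 : car GP" "cls k : car GP" using g k by (auto simp: c_def)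
	have heq: "h = c *[GP] (cls k *[GP] incl False b1)"
	proof -
		have "h = g *[GP] (inv[GP] g *[GP] h)" using g h by (simp add: GP.inv_cancel)
		then show ?thesis unfolding k(5) c_def using g cl by (simp add: GP.m_assoc)
	qed
	have fix_conj: "incl i x *[GP] incl i y *[GP] inv[GP] incl i x = incl i y" if "x : car (A i)" "y : car (A i)" for i x y
	proof -
		interpret Ai: comm_group "A i" by (rule A)
		have "incl i x *[GP] incl i y = incl i y *[GP] incl i x" using incl_mult[of i x y] incl_mult[of i y x] that Ai.m_comm[of x y] by simp
		then show ?thesis using that by (simp add: GP.m_assoc)
	qed
	have ga: "g *[GP] incl True a *[GP] inv[GP] g = c *[GP] incl True a *[GP] inv[GP] c" if "a : car (A True)" for a
	proof -
		have "c *[GP] incl True a *[GP] inv[GP] c = g *[GP] (incl True a1 *[GP] incl True a *[GP] inv[GP] incl True a1) *[GP] inv[GP] g"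
			unfolding c_def using g cl that by (simp add: GP.m_assoc GP.inv_mult_group)
		then show ?thesis using fix_conj[OF k(1) that] by simp
	qed
	have hb: "h *[GP] incl False b *[GP] inv[GP] h = c *[GP] (cls k *[GP] incl False b *[GP] inv[GP] cls k) *[GP] inv[GP] c" if "b : car (A False)" for b
	proof -
		have "h *[GP] incl False b *[GP] inv[GP] h = c *[GP] (cls k *[GP] (incl False b1 *[GP] incl False b *[GP] inv[GP] incl False b1) *[GP] inv[GP] cls k) *[GP] inv[GP] c"
			unfolding heq using cl that by (simp add: GP.m_assoc GP.inv_mult_group)
		then show ?thesis using fix_conj[OF k(2) that] by simp
	qed
	have "k = []"
	proof (rule ccontr)
		assume ne: "k ~= []"
		let ?S = "{cls k *[GP] incl False b *[GP] inv[GP] cls k | b. b : car (A False)}"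
		have nfS: "nf (cls k *[GP] incl False b *[GP] inv[GP] cls k) = k @ [(False, b)] @ winv k" if "b : car (A False)" "b ~= one[A False]" for b
		proof -
			have "rw (k @ [(False, b)] @ winv k)" using k(3,4) ne that by (simp add: rw_append rw_Cons fst_hd_winv)
			moreover have "cls k *[GP] incl False b *[GP] inv[GP] cls k = cls (k @ [(False, b)] @ winv k)"
				unfolding incl_cls using k(3) that by (intro conj_cls_append[symmetric]) simp_all
			ultimately show ?thesis by (simp only: nf_cls_rw)
		qed
		have S1: "cls k *[GP] incl False one[A False] *[GP] inv[GP] cls k = one[GP]" using cl incl_one[of False] by simp
		have S: "subgroup ?S GP"
		proof (rule GP.subgroupI)
			show "?S \<subseteq> car GP" using cl by auto
			show "?S ~= {}" using factor_simps(2)[of False] by blast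
			fix x assume "x : ?S"
			then obtain b where b: "x = cls k *[GP] incl False b *[GP] inv[GP] cls k" "b : car (A False)" by blast
			have "inv[GP] incl False b = incl False (inv[A False] b)" using b(2) by (simp add: incl_cls cls_inv)
			then have "inv[GP] x = cls k *[GP] incl False (inv[A False] b) *[GP] inv[GP] cls k"
				unfolding b(1) using cl b(2) by (simp add: GP.inv_mult_group GP.m_assoc)
			then show "inv[GP] x : ?S" using b(2) factor_simps(5) by blast
			fix y assume "y : ?S"
			then obtain b' where b': "y = cls k *[GP] incl False b' *[GP] inv[GP] cls k" "b' : car (A False)" by blast
			have "x *[GP] y = cls k *[GP] incl False (b *[A False] b') *[GP] inv[GP] cls k"
				unfolding b(1) b'(1) using cl b(2) b'(2) by (simp add: incl_mult GP.m_assoc GP.inv_cancel)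
			then show "x *[GP] y : ?S" using b(2) b'(2) factor_simps(1) by blast
		qed
		have blocks: "fst (hd (nf q)) ~= True & fst (last (nf q)) ~= True" if q: "q : ?S" "q ~= one[GP]" for q
		proof -
			obtain b where b: "q = cls k *[GP] incl False b *[GP] inv[GP] cls k" "b : car (A False)" using q(1) by blast
			then have "b ~= one[A False]" using q(2) S1 by auto
			then have "nf q = k @ [(False, b)] @ winv k" using nfS b by simp
			then show ?thesis using k(4) ne by (simp add: fst_last_winv)
		qed
		let ?T = "{incl True a | a. a : car (A True)} \<union> ?S"
		have conjT: "inv[GP] c *[GP] Q *[GP] c : generate GP ?T & Q : car GP" if "Q : generate GP ?R" for Q
			using that
		proof (induction rule: generate.induct)
			case one
			show ?case using cl generate.one[of GP ?T] by simp
		next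
			case (incl x)
			then show ?case
			proof
				assume "x : {g *[GP] incl True a *[GP] inv[GP] g | a. a : car (A True)}"
				then obtain a where a: "a : car (A True)" "x = c *[GP] incl True a *[GP] inv[GP] c" using ga by blast
				then have "inv[GP] c *[GP] x *[GP] c = incl True a" using cl by (simp add: GP.m_assoc GP.inv_cancel)
				then show ?thesis using a cl by (auto intro: generate.incl)
			next
				assume "x : {h *[GP] incl False b *[GP] inv[GP] h | b. b : car (A False)}"
				then obtain b where b: "b : car (A False)" "x = c *[GP] (cls k *[GP] incl False b *[GP] inv[GP] cls k) *[GP] inv[GP] c" using hb by blast
				then have "inv[GP] c *[GP] x *[GP] c = cls k *[GP] incl False b *[GP] inv[GP] cls k" using cl by (simp add: GP.m_assoc GP.inv_cancel)
				moreover have "cls k *[GP] incl False b *[GP] inv[GP] cls k : ?T" using b(1) by blast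
				ultimately show ?thesis using b cl generate.incl[of _ ?T GP] by simp
			qed
		next
			case (inv x)
			have sub: "?T \<subseteq> car GP" using cl by auto
			from inv have *: "inv[GP] c *[GP] x *[GP] c : ?T & x : car GP"
			proof
				assume "x : {g *[GP] incl True a *[GP] inv[GP] g | a. a : car (A True)}"
				then obtain a where a: "a : car (A True)" "x = c *[GP] incl True a *[GP] inv[GP] c" using ga by blast
				then have "inv[GP] c *[GP] x *[GP] c = incl True a" using cl by (simp add: GP.m_assoc GP.inv_cancel)
				then show ?thesis using a cl by auto
			next
				assume "x : {h *[GP] incl False b *[GP] inv[GP] h | b. b : car (A False)}"
				then obtain b where b: "b : car (A False)" "x = c *[GP] (cls k *[GP] incl False b *[GP] inv[GP] cls k) *[GP] inv[GP] c" using hb by blast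
				then have "inv[GP] c *[GP] x *[GP] c = cls k *[GP] incl False b *[GP] inv[GP] cls k" using cl by (simp add: GP.m_assoc GP.inv_cancel)
				then show ?thesis using b cl by auto
			qed
			have "inv[GP] c *[GP] inv[GP] x *[GP] c = inv[GP] (inv[GP] c *[GP] x *[GP] c)"
				using * cl by (simp add: GP.inv_mult_group GP.m_assoc)
			then show ?case using * generate.inv[of _ ?T GP] by simp
		next
			case (eng x y)
			then have "inv[GP] c *[GP] (x *[GP] y) *[GP] c = (inv[GP] c *[GP] x *[GP] c) *[GP] (inv[GP] c *[GP] y *[GP] c)"
				using cl by (simp add: GP.m_assoc GP.inv_cancel)
			then show ?case using eng generate.eng[of _ GP ?T] by simp
		qed
		have "c *[GP] incl False b0 *[GP] inv[GP] c : generate GP ?R" using gen cl b0 by (simp add: subset_iff)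
		then have "inv[GP] c *[GP] (c *[GP] incl False b0 *[GP] inv[GP] c) *[GP] c : generate GP ?T" using conjT by blast
		moreover have "inv[GP] c *[GP] (c *[GP] incl False b0 *[GP] inv[GP] c) *[GP] c = incl False b0" using cl b0 by (simp add: GP.m_assoc GP.inv_cancel)
		ultimately have "incl False b0 : generate GP ?T" by simp
		then have "incl False b0 : ?S" using b0 generate_factor_block[OF S blocks, of "incl False b0" False b0] by (simp add: incl_nf)
		then obtain b where b: "incl False b0 = cls k *[GP] incl False b *[GP] inv[GP] cls k" "b : car (A False)" by blast
		have nf0: "nf (incl False b0) = [(False, b0)]" using b0 by (simp add: incl_nf)
		have "b ~= one[A False]" using b S1 nf0 by auto
		then have "[(False, b0)] = k @ [(False, b)] @ winv k" using nfS[OF b(2)] nf0 b(1) by simp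
		then have "length [(False, b0)] = length (k @ [(False, b)] @ winv k)" by simp
		then show False using ne by simp
	qed
	then have "cls k = one[GP]" by (simp add: one_GP)
	then have "h *[GP] incl False b *[GP] inv[GP] h = c *[GP] incl False b *[GP] inv[GP] c" if "b : car (A False)" for b
		using hb[OF that] that by simp
	then show ?thesis using ga cl(1) by blast
qed

end

section \<open>Powers and generation for torsion-free factors\<close>

lemma (in group) pow_swap:
	assumes "p : car G" "r : car G"
	shows "(p \<otimes> r) [^] Suc n = p \<otimes> (r \<otimes> p) [^] n \<otimes> r"
proof (induction n)
	case (Suc n)
	have "(p \<otimes> r) [^] Suc (Suc n) = (p \<otimes> r) [^] Suc n \<otimes> (p \<otimes> r)" by simp
	also have "\<dots> = p \<otimes> ((r \<otimes> p) [^] n \<otimes> (r \<otimes> p)) \<otimes> r" unfolding Suc using assms by (simp add: m_assoc)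
	finally show ?case by simp
qed (use assms in simp)

context free_prod
begin

text \<open>Cancelling ends are conjugated away and the induction continues inside. Merging ends
  leave a cyclically reduced word whose powers concatenate. Torsion-freeness enters at a single
  letter, whose power must not vanish.\<close>

lemma pow_block:
	assumes tf: "!!i a n. a : car (A i) ==> a ~= one[A i] ==> n > 0 ==> a ^[A i] (n::nat) ~= one[A i]"
		and n: "n > (0::nat)"
	shows "rw w ==> w ~= [] ==> fst (hd w) = j ==> fst (last w) = j ==>
		nf (cls w ^[GP] n) ~= [] & fst (hd (nf (cls w ^[GP] n))) = j & fst (last (nf (cls w ^[GP] n))) = j &
		length w <= length (nf (cls w ^[GP] n))"
proof (induction "length w" arbitrary: w j rule: less_induct)
	case less
	show ?case
	proof (cases "length w = 1")
		case True
		then obtain a where w: "w = [(j, a)]" using less.prems(3) by (cases w) (auto simp: prod_eq_iff)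
		have a: "a : car (A j)" "a ~= one[A j]" using less.prems(1) w by (auto simp: rw_Cons)
		have "cls w ^[GP] n = incl j (a ^[A j] n)"
			using hom_nat_pow[OF incl_hom[of j] a(1) factor_group group_GP, of n] w by (simp add: incl_cls)
		then have "nf (cls w ^[GP] n) = [(j, a ^[A j] n)]"
			using tf[OF a n] a(1) by (simp add: incl_nf monoid.nat_pow_closed[OF group.is_monoid[OF factor_group]])
		then show ?thesis using w by simp
	next
		case False
		then have "length w \<ge> 2" using less.prems(2) by (cases w) (auto simp: Suc_le_eq)
		then have "w = hd w # tl w" "tl w ~= []" by (cases w; force)+
		then obtain x w0 where "w = x # w0" "w0 ~= []" by blast
		then obtain w' y where w: "w = x # w' @ [y]" by (metis append_butlast_last_id)
		have xj: "fst x = j" and yj: "fst y = j" using less.prems(3,4) w by auto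
		have ne: "w' ~= []" using less.prems(1) xj yj unfolding w by (cases w') (auto simp: rw_Cons)
		have x: "snd x : car (A (fst x))" "snd x ~= one[A (fst x)]" and y: "snd y : car (A (fst y))" "snd y ~= one[A (fst y)]"
			using less.prems(1) unfolding w rw_Cons rw_append by blast+
		have w': "rw w'" "fst (last w') ~= j" "fst (hd w') ~= j" "rw (w' @ [y])"
			using less.prems(1) ne xj yj unfolding w by (auto simp: rw_Cons rw_append)
		have xW: "[x] : W" "[y] : W" "w' : W" using x y w' by simp_all
		show ?thesis
		proof (cases "snd y *[A j] snd x = one[A j]")
			case True
			have "snd y = inv[A j] (snd x)" using factor_one_cases(2)[of "snd y" j "snd x"] True x(1) y(1) xj yj by simp
			then have "y = (fst x, inv[A (fst x)] (snd x))" using xj yj by (simp add: prod_eq_iff)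
			then have e: "w = [x] @ w' @ winv [x]" using w by simp
			define u where "u = nf (cls w' ^[GP] n)"
			have u: "u ~= []" "fst (hd u) = (~ j)" "fst (last u) = (~ j)" "length w' <= length u"
				using less.hyps[of w' "~ j"] w w' ne by (auto simp: u_def)
			have c: "cls w' : car GP" "cls [x] : car GP" using xW by auto
			have ru: "rw u" "cls u = cls w' ^[GP] n" using c by (auto simp: u_def)
			have "cls w = cls [x] *[GP] cls w' *[GP] inv[GP] cls [x]" unfolding e by (rule conj_cls_append[OF xW(1,3)])
			then have "cls w ^[GP] n = cls [x] *[GP] cls u *[GP] inv[GP] cls [x]" using GP.pow_conj[OF c(2,1)] ru(2) by simp
			also have "\<dots> = cls ([x] @ u @ winv [x])" using conj_cls_append[OF xW(1) rw_W[OF ru(1)]] by simp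
			finally have "cls w ^[GP] n = cls ([x] @ u @ winv [x])" .
			moreover have "rw ([x] @ u @ winv [x])" using ru(1) u(1-3) x xj by (simp add: rw_append rw_Cons)
			ultimately have "nf (cls w ^[GP] n) = [x] @ u @ winv [x]" by (simp only: nf_cls_rw)
			then show ?thesis using u(4) xj e by simp
		next
			case F: False
			let ?m = "(j, snd y *[A j] snd x)"
			have mc: "snd y *[A j] snd x : car (A j)" using x(1) y(1) xj yj by simp
			define v where "v = w' @ [?m]"
			have rv: "rw v" unfolding v_def using w' ne F mc by (simp add: rw_append rw_Cons)
			have hlv: "fst (hd v) ~= fst (last v)" unfolding v_def using w' ne by simp
			have "lact y [x] = [?m]" using F y(2) xj yj by (simp add: lact_def)
			then have m: "cls [?m] = cls [y] *[GP] cls [x]" using cls_lact[of y "[x]"] y(1) xW cls_mult[of "[y]" "[x]"] by simp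
			let ?p = "cls [x]" and ?q = "cls (w' @ [y])"
			have c: "?p : car GP" "?q : car GP" using xW by auto
			have cv: "cls v = ?q *[GP] ?p"
			proof -
				have "cls v = cls w' *[GP] cls [?m]" unfolding v_def using xW mc by (intro cls_mult[symmetric]) auto
				also have "\<dots> = cls w' *[GP] cls [y] *[GP] cls [x]" unfolding m using xW by (simp add: GP.m_assoc)
				also have "cls w' *[GP] cls [y] = ?q" using xW by (intro cls_mult)
				finally show ?thesis .
			qed
			have cw: "cls w = ?p *[GP] ?q" unfolding w using xW cls_mult[of "[x]" "w' @ [y]"] by simp
			obtain k where k: "n = Suc k" using n by (cases n) auto
			define z where "z = concat (replicate k v)"
			have z: "rw z" "k > 0 --> hd z = hd v" "cls v ^[GP] k = cls z" "z : W"
				using rw_replicate[OF rv hlv, of k] cls_pow[OF rw_W[OF rv], of k] unfolding z_def v_def by auto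
			have lz: "z ~= [] --> fst (last z) = j" unfolding z_def
			proof (induction k)
				case (Suc k) then show ?case by (cases "concat (replicate k v) = []") (auto simp: v_def)
			qed simp
			have hz: "z ~= [] --> fst (hd z) ~= j"
				using z(2) w' ne unfolding v_def by (cases k) (auto simp: z_def v_def)
			have "cls w ^[GP] n = ?p *[GP] cls z *[GP] ?q" unfolding cw k using GP.pow_swap[OF c, of k] cv z(3) by simp
			also have "\<dots> = cls ([x] @ z @ w' @ [y])" using xW z(4) cls_mult[of "[x]" z] cls_mult[of "[x] @ z" "w' @ [y]"] by simp
			finally have "cls w ^[GP] n = cls ([x] @ z @ w' @ [y])" .
			moreover have "rw ([x] @ z @ w' @ [y])"
			proof (cases "z = []")
				case True
				then show ?thesis using less.prems(1) w by simp
			next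
				case False
				have "rw (z @ w' @ [y])" using z(1) lz False w'(3,4) ne by (simp add: rw_append)
				then show ?thesis using hz False x xj by (simp add: rw_Cons)
			qed
			ultimately have "nf (cls w ^[GP] n) = [x] @ z @ w' @ [y]" by (simp only: nf_cls_rw)
			then show ?thesis using w xj yj by simp
		qed
	qed
qed

text \<open>Strip factor \<open>i\<close> from \<open>g\<close>, leaving w. By
  \<open>pow_block\<close> the powers of w have their ends outside factor \<open>i\<close>, so
  ping-pong shows that each letter of the other factor is a power of w. Powers of w are not shorter
  than w, so w is one letter, and it generates the other factor.\<close>

lemma factor_and_element_generate:
	assumes tf: "!!i a n. a : car (A i) ==> a ~= one[A i] ==> n > 0 ==> a ^[A i] (n::nat) ~= one[A i]"
		and g: "g : car GP" and gen: "car GP \<subseteq> generate GP ({incl i a | a. a : car (A i)} \<union> {g})"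
		and j: "j ~= i" and a0: "a0 : car (A j)" "a0 ~= one[A j]"
	shows "\<exists>x\<in>car (A i). \<exists>y\<in>car (A i). \<exists>a\<in>car (A j). g = incl i x *[GP] incl j a *[GP] incl i y &
		 (\<forall>b\<in>car (A j). \<exists>n::int. b = a ^[A j] n)"
proof -
	obtain x y w where w: "x : car (A i)" "y : car (A i)" "rw w"
		"w ~= [] ==> fst (hd w) ~= i" "w ~= [] ==> fst (last w) ~= i" "g = incl i x *[GP] cls w *[GP] incl i y"
		using strip[OF g, of i] by metis
	have cw: "cls w : car GP" using w(3) by simp
	define S where "S = generate GP {cls w}"
	have S: "subgroup S GP" unfolding S_def using cw by (intro GP.generate_is_subgroup) simp
	have S_iff: "q : S \<longleftrightarrow> (\<exists>n::int. q = cls w ^[GP] n)" for q unfolding S_def GP.generate_pow[OF cw] by auto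
	have S_nf: "w ~= [] & fst (hd (nf q)) ~= i & fst (last (nf q)) ~= i & length w <= length (nf q)" if q: "q : S" "q ~= one[GP]" for q
	proof -
		have wne: "w ~= []"
		proof
			assume "w = []"
			then have "cls w = one[GP]" by (simp add: one_GP)
			then show False using q S_iff by auto
		qed
		have ends: "fst (hd w) = (~ i)" "fst (last w) = (~ i)" using w(4,5)[OF wne] by auto
		obtain n :: int where n: "q = cls w ^[GP] n" using q(1) S_iff by blast
		have n0: "n ~= 0" using q(2) n by auto
		define m where "m = nat \<bar>n\<bar>"
		have m: "m > 0" using n0 by (simp add: m_def)
		define p where "p = cls w ^[GP] m"
		have p: "nf p ~= []" "fst (hd (nf p)) = (~ i)" "fst (last (nf p)) = (~ i)" "length w <= length (nf p)"
			unfolding p_def using pow_block[OF tf m w(3) wne ends] by auto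
		have pc: "p : car GP" using cw by (simp add: p_def)
		have "q = p | q = inv[GP] p"
		proof (cases "n > 0")
			case True
			then have "n = int m" by (simp add: m_def)
			then show ?thesis using n by (simp add: p_def int_pow_int)
		next
			case False
			then have "n = - int m" by (simp add: m_def)
			then show ?thesis using n cw by (simp add: p_def GP.int_pow_neg_int)
		qed
		then show ?thesis using p pc wne by (auto simp: nf_inv fst_hd_winv fst_last_winv)
	qed
	let ?T = "{incl i a | a. a : car (A i)} \<union> S"
	have T: "?T \<subseteq> car GP" using subgroup.subset[OF S] by auto
	have Tsub: "subgroup (generate GP ?T) GP" by (rule GP.generate_is_subgroup[OF T])
	have wS: "cls w : S" unfolding S_def by (intro generate.incl) simp
	have inc: "u : generate GP ?T" if "u : ?T" for u using that by (rule generate.incl)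
	have "g : generate GP ?T" unfolding w(6) using w(1,2) wS by (intro generate.eng inc) auto
	then have "{incl i a | a. a : car (A i)} \<union> {g} \<subseteq> generate GP ?T" using inc by blast
	then have "generate GP ({incl i a | a. a : car (A i)} \<union> {g}) \<subseteq> generate GP ?T"
		by (rule GP.generate_subgroup_incl[OF _ Tsub])
	then have all: "car GP \<subseteq> generate GP ?T" using gen by blast
	have inS: "incl j b : S" if b: "b : car (A j)" "b ~= one[A j]" for b
	proof (rule generate_factor_block[OF S])
		show "fst (hd (nf q)) ~= i & fst (last (nf q)) ~= i" if "q : S" "q ~= one[GP]" for q using S_nf[OF that] by blast
		show "incl j b : generate GP ?T" using all b by auto
		show "nf (incl j b) = [(j, b)]" using b by (simp add: incl_nf)
	qed (rule j)
	have one: "incl j a0 ~= one[GP]" using a0 incl_nf[of a0 j] by auto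
	from S_nf[OF inS[OF a0] one] have len: "w ~= []" "length w <= 1" using a0 by (auto simp: incl_nf)
	then obtain a where wa: "w = [(j, a)]" using w(4) j by (cases w) (auto simp: prod_eq_iff)
	have a: "a : car (A j)" using w(3) wa by (simp add: rw_Cons)
	have "\<exists>n::int. b = a ^[A j] n" if b: "b : car (A j)" for b
	proof (cases "b = one[A j]")
		case True
		then have "b = a ^[A j] (0::int)" by simp
		then show ?thesis by blast
	next
		case False
		then obtain n :: int where n: "incl j b = cls w ^[GP] n" using inS[OF b] S_iff by blast
		have "cls w ^[GP] n = incl j (a ^[A j] n)"
			using hom_int_pow[OF incl_hom[of j] a factor_group group_GP, of n] wa by (simp add: incl_cls)
		then have "b = a ^[A j] n" using n b a incl_inj[of b j "a ^[A j] n"] group.int_pow_closed[OF factor_group a] by simp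
		then show ?thesis by blast
	qed
	moreover have "g = incl i x *[GP] incl j a *[GP] incl i y" using w(6) wa by (simp add: incl_cls)
	ultimately show ?thesis using w(1,2) a by blast
qed

end

section \<open>Projections to free products\<close>

lemma comm_product_group:
	assumes "!!i. i : I ==> comm_group (D i)"
	shows "comm_group (product_group I D)"
proof (rule group.group_comm_groupI)
	have g: "group (D i)" if "i : I" for i using assms[OF that] by (rule comm_group.axioms(2))
	then show "group (product_group I D)" by simp
	fix x y assume "x : car (product_group I D)" "y : car (product_group I D)"
	then show "x *[product_group I D] y = y *[product_group I D] x"
		using assms by (auto simp: PiE_iff intro!: restrict_ext comm_monoid.m_comm comm_group.axioms(1))
qed

context graph_prod
begin

lemma letters_generate: "car GP = generate GP {incl v a | v a. v : V & a : car (Gs v)}" (is "_ = generate GP ?L")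
proof
	have L: "?L \<subseteq> car GP" by auto
	show "generate GP ?L \<subseteq> car GP" using GP.generate_in_carrier[OF L] by blast
	show "car GP \<subseteq> generate GP ?L"
	proof
		fix x assume "x : car GP"
		then show "x : generate GP ?L"
		proof (induction rule: GP_induct)
			case one show ?case by (rule generate.one)
		next
			case (mult v a Q)
			have "incl v a : ?L" using mult(1,2) by blast
			from generate.eng[OF generate.incl[OF this, of GP] mult(4)] show ?case .
		qed
	qed
qed

text \<open>Automorphisms are sorted by their effect in \<open>Q\<close> on a finite generating set,
  which gives finitely many types. Two automorphisms of one type differ by some \<omega> invisible
  in \<open>Q\<close>, and those are handled by \<open>same\<close>.\<close>

lemma finite_cover:
	assumes H: "group H" and Q: "group Q" "finite (car Q)" and \<pi>: "\<pi> : hom GP Q"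
		and S0: "finite S0" "S0 \<subseteq> car GP" "car GP \<subseteq> generate GP S0"
		and char: "!!\<phi> k. \<phi> : iso GP GP ==> k : K ==> \<phi> k : K" and KG: "K \<subseteq> car GP"
		and P1: "finite P1" "!!p k. p : P1 ==> k : K ==> p k : car H"
		and same: "!!\<omega>. \<omega> : iso GP GP ==> (\<forall>g\<in>car GP. \<pi> (\<omega> g) = \<pi> g) ==> \<exists>p\<in>P1. conjugate_on K H (%k. \<rho> (\<omega> k)) p"
	shows "\<exists>P. finite P & (\<forall>p\<in>P. \<forall>k\<in>K. p k : car H) & (\<forall>\<phi>\<in>iso GP GP. \<exists>p\<in>P. conjugate_on K H (%k. \<rho> (\<phi> k)) p)"
proof -
	define ty where "ty \<phi> = (\<lambda>g\<in>S0. \<pi> (\<phi> g))" for \<phi>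
	have fin: "finite (ty ` iso GP GP)"
	proof (rule finite_subset)
		show "ty ` iso GP GP \<subseteq> S0 \<rightarrow>\<^sub>E car Q"
		proof
			fix f assume "f : ty ` iso GP GP"
			then obtain \<phi> where \<phi>: "\<phi> : iso GP GP" "f = ty \<phi>" by blast
			have "\<pi> (\<phi> g) : car Q" if "g : S0" for g
				using hom_in_carrier[OF \<pi> iso_carrier[OF \<phi>(1)]] S0(2) that by blast
			then show "f : S0 \<rightarrow>\<^sub>E car Q" by (simp add: \<phi>(2) ty_def)
		qed
		show "finite (S0 \<rightarrow>\<^sub>E car Q)" using S0(1) Q(2) by (intro finite_PiE) auto
	qed
	define rep where "rep t = (SOME \<phi>. \<phi> : iso GP GP & ty \<phi> = t)" for t
	have rep: "rep (ty \<phi>) : iso GP GP & ty (rep (ty \<phi>)) = ty \<phi>" if "\<phi> : iso GP GP" for \<phi>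
		unfolding rep_def by (rule someI[of _ \<phi>]) (use that in simp)
	define P where "P = (%(p, t) k. p (rep t k)) ` (P1 \<times> ty ` iso GP GP)"
	have P_cases: "\<exists>p1 \<phi>. p1 : P1 & \<phi> : iso GP GP & p = (%k. p1 (rep (ty \<phi>) k))" if "p : P" for p
		using that unfolding P_def by fastforce
	have "finite P" unfolding P_def using P1(1) fin by simp
	moreover have "p k : car H" if pP: "p : P" and kK: "k : K" for p k
	proof -
		obtain p1 \<phi> where p: "p1 : P1" "\<phi> : iso GP GP" "p = (%k. p1 (rep (ty \<phi>) k))" using P_cases[OF pP] by (elim exE conjE)
		have "rep (ty \<phi>) k : K" by (rule char[OF conjunct1[OF rep[OF p(2)]] kK])
		then show ?thesis unfolding p(3) by (rule P1(2)[OF p(1)])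
	qed
	moreover have "\<exists>p\<in>P. conjugate_on K H (%k. \<rho> (\<phi> k)) p" if \<phi>: "\<phi> : iso GP GP" for \<phi>
	proof -
		define \<phi>' where "\<phi>' = rep (ty \<phi>)"
		have \<phi>': "\<phi>' : iso GP GP" "ty \<phi>' = ty \<phi>" unfolding \<phi>'_def using rep[OF \<phi>] by auto
		obtain \<psi> where \<psi>: "\<psi> : iso GP GP" "\<forall>x\<in>car GP. \<psi> (\<phi>' x) = x" "\<forall>y\<in>car GP. \<phi>' (\<psi> y) = y"
			using iso_inverse[OF group_GP \<phi>'(1)] by (elim bexE conjE)
		\<comment> \<open>Since \<psi> inverts the representative \<phi>' of the type, \<phi> is this map
		  after \<phi>'.\<close>
		let ?\<omega> = "%g. \<phi> (\<psi> g)"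
		have \<omega>: "?\<omega> : iso GP GP" by (rule iso_comp[OF \<psi>(1) \<phi>])
		interpret h1: group_hom GP Q "%g. \<pi> (\<phi> g)"
			using hom_compose[OF iso_hom[OF \<phi>] \<pi>] group_GP Q(1) by (simp add: group_hom_def group_hom_axioms_def comp_def)
		interpret h2: group_hom GP Q "%g. \<pi> (\<phi>' g)"
			using hom_compose[OF iso_hom[OF \<phi>'(1)] \<pi>] group_GP Q(1) by (simp add: group_hom_def group_hom_axioms_def comp_def)
		have agree: "\<pi> (\<phi> g) = \<pi> (\<phi>' g)" if "g : generate GP S0" for g
			using that
		proof (induction rule: generate.induct)
			case one show ?case using h1.hom_one h2.hom_one by simp
		next
			case (incl h)
			then show ?case using fun_cong[OF \<phi>'(2), of h] by (simp add: ty_def)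
		next
			case (inv h)
			have hc: "h : car GP" using inv S0(2) by blast
			show ?case using h1.hom_inv[OF hc] h2.hom_inv[OF hc] fun_cong[OF \<phi>'(2), of h] inv by (simp add: ty_def)
		next
			case (eng h1 h2)
			have "h1 : car GP" "h2 : car GP" using eng(1,2) GP.generate_in_carrier[OF S0(2)] by auto
			then show ?case using eng(3,4) h1.hom_mult[of h1 h2] h2.hom_mult[of h1 h2] by simp
		qed
		have "\<pi> (?\<omega> g) = \<pi> g" if g: "g : car GP" for g
		proof -
			have "\<psi> g : car GP" by (rule iso_carrier[OF \<psi>(1) g])
			then have "\<pi> (\<phi> (\<psi> g)) = \<pi> (\<phi>' (\<psi> g))" using agree S0(3) by blast
			then show ?thesis using \<psi>(3) g by simp
		qed
		then obtain p where p: "p : P1" "conjugate_on K H (%k. \<rho> (\<phi> (\<psi> k))) p" using same[OF \<omega>] by blast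
		have "conjugate_on K H (%k. \<rho> (\<phi> (\<psi> (\<phi>' k)))) (%k. p (\<phi>' k))"
			using p(2) char[OF \<phi>'(1)] by (rule conjugate_on_compose[where p = "%k. \<rho> (\<phi> (\<psi> k))" and q = p])
		then have "conjugate_on K H (%k. \<rho> (\<phi> k)) (%k. p (\<phi>' k))"
			unfolding conjugate_on_def using \<psi>(2) KG by (simp add: subset_iff)
		moreover have "(%k. p (\<phi>' k)) : P" unfolding P_def \<phi>'_def using p(1) \<phi> by (intro image_eqI[of _ _ "(p, ty \<phi>)"]) auto
		ultimately show ?thesis by (rule bexI)
	qed
	ultimately show ?thesis by blast
qed

end

text \<open>Vertices outside \<open>S\<close> and \<open>T\<close> are killed, and each side becomes
  a direct product of groups \<open>D v\<close>. These are kept apart from the vertex groups so that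
  one construction serves finite vertex groups, the integers and their reduction modulo 3.\<close>

locale pair_projection = graph_prod V E Gs for V :: "'v set" and E and Gs :: "'v => 'a monoid" +
	fixes D :: "'v => 'd monoid" and \<theta> :: "'v => 'a => 'd" and S T :: "'v set"
	assumes fin: "finite V" and ST: "S \<subseteq> V" "T \<subseteq> V" "S \<inter> T = {}"
		and no_edge: "!!s t. s : S ==> t : T ==> {s, t} \<notin> E"
		and D: "!!v. comm_group (D v)" and \<theta>: "!!v. v : V ==> \<theta> v : hom (Gs v) (D v)"
begin

definition PD :: "bool => ('v => 'd) monoid" where
	"PD i = product_group (if i then S else T) D"

lemma D_group: "group (D v)" using D by (rule comm_group.axioms(2))

lemma PD_comm: "comm_group (PD i)" unfolding PD_def by (rule comm_product_group) (rule D)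

sublocale HH: free_prod PD
	by (rule free_prod.intro) (rule comm_group.axioms(2)[OF PD_comm])

abbreviation "HG \<equiv> graph_product UNIV {} PD"

definition side :: "bool => 'v set" where "side i = (if i then S else T)"

definition single :: "bool => 'v => 'd => 'v => 'd" where
	"single i v x = (\<lambda>u\<in>side i. if u = v then x else one[D u])"

lemma PD_carrier: "car (PD i) = (\<Pi>\<^sub>E v\<in>side i. car (D v))" by (simp add: PD_def side_def)
lemma PD_one: "one[PD i] = (\<lambda>v\<in>side i. one[D v])" by (simp add: PD_def side_def)
lemma PD_mult: "x *[PD i] y = (\<lambda>v\<in>side i. x v *[D v] y v)" by (simp add: PD_def side_def)

lemma D_one [simp]: "one[D v] : car (D v)" using D_group group.is_monoid monoid.one_closed by blast
lemma D_mult [simp]: "x : car (D v) ==> y : car (D v) ==> x *[D v] y : car (D v)"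
	using monoid.m_closed[OF group.is_monoid[OF D_group]] .
lemma D_unit [simp]: "x : car (D v) ==> x *[D v] one[D v] = x" "x : car (D v) ==> one[D v] *[D v] x = x"
	using D_group group.is_monoid monoid.r_one monoid.l_one by metis+

lemma single_carrier [simp]: "v : side i ==> x : car (D v) ==> single i v x : car (PD i)"
	by (auto simp: single_def PD_carrier)

lemma single_mult: "v : side i ==> x : car (D v) ==> y : car (D v) ==>
	 single i v (x *[D v] y) = single i v x *[PD i] single i v y"
	by (auto simp: single_def PD_mult intro!: restrict_ext)

lemma single_one_iff: "v : side i ==> single i v x = one[PD i] \<longleftrightarrow> x = one[D v]"
proof
	assume v: "v : side i"
	show "single i v x = one[PD i] ==> x = one[D v]" by (drule fun_cong[of _ _ v]) (simp add: v single_def PD_one)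
	show "x = one[D v] ==> single i v x = one[PD i]" by (auto simp: single_def PD_one intro!: restrict_ext)
qed

definition letter :: "'v => 'a => (bool \<times> ('v => 'd)) list set" where
	"letter v a = (if v : S then HH.incl True (single True v (\<theta> v a)) else
		 if v : T then HH.incl False (single False v (\<theta> v a)) else one[HG])"

lemma \<theta>_closed: "v : V ==> a : car (Gs v) ==> \<theta> v a : car (D v)" using \<theta> by (meson hom_in_carrier)

lemma letter_side: "v : side i ==> letter v a = HH.incl i (single i v (\<theta> v a))"
	using ST by (cases i) (auto simp: letter_def side_def)

lemma side_V: "v : side i ==> v : V" using ST by (cases i) (auto simp: side_def)

lemma sides: "v : V ==> (\<exists>i. v : side i) | v \<notin> S \<union> T" by (metis Un_iff side_def)

lemma letter_carrier: "v : V ==> a : car (Gs v) ==> letter v a : car HG"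
	using \<theta>_closed by (auto simp: letter_def side_def)

lemma letter_hom: "v : V ==> letter v : hom (Gs v) HG"
proof (rule homI)
	fix a b assume v: "v : V" and ab: "a : car (Gs v)" "b : car (Gs v)"
	have m: "\<theta> v (a *[Gs v] b) = \<theta> v a *[D v] \<theta> v b" using hom_mult[OF \<theta>[OF v]] ab by simp
	show "letter v (a *[Gs v] b) = letter v a *[HG] letter v b"
	proof (cases "v : S \<union> T")
		case True
		then obtain i where i: "v : side i" using sides[OF v] by blast
		show ?thesis unfolding letter_side[OF i] m
			using i \<theta>_closed[OF v] ab by (simp add: single_mult HH.incl_mult)
	next
		case False
		then show ?thesis by (simp add: letter_def)
	qed
qed (rule letter_carrier)

lemma letter_comm:
	assumes "v : V" "w : V" "{v, w} : E" "a : car (Gs v)" "b : car (Gs w)"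
	shows "letter v a *[HG] letter w b = letter w b *[HG] letter v a"
proof (cases "v : S \<union> T & w : S \<union> T")
	case True
	then obtain i j where ij: "v : side i" "w : side j" using sides assms by metis
	have "i = j"
	proof (rule ccontr)
		assume "i ~= j"
		then have "(v : S & w : T) | (v : T & w : S)" using ij by (cases i; cases j) (auto simp: side_def)
		then show False using no_edge[of v w] no_edge[of w v] assms(3) by (auto simp: insert_commute)
	qed
	then have j: "w : side i" using ij by simp
	interpret PDi: comm_group "PD i" by (rule PD_comm)
	have c: "single i v (\<theta> v a) : car (PD i)" "single i w (\<theta> w b) : car (PD i)"
		using ij(1) j \<theta>_closed assms by auto
	show ?thesis unfolding letter_side[OF ij(1)] letter_side[OF j]
		using HH.incl_mult[of i "single i v (\<theta> v a)" "single i w (\<theta> w b)"] HH.incl_mult[of i "single i w (\<theta> w b)" "single i v (\<theta> v a)"]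
			PDi.m_comm[OF c] c by simp
next
	case False
	then have "letter v a = one[HG] | letter w b = one[HG]" by (auto simp: letter_def)
	then show ?thesis using letter_carrier assms by auto
qed

lemma letter_compatible: "compatible HG letter"
	unfolding compatible_def using letter_hom letter_comm by blast

definition rho where "rho = gp_lift HG letter"

lemma rho_hom: "rho : hom GP HG" unfolding rho_def by (rule gp_lift_hom[OF HH.group_GP letter_compatible])

lemma rho_incl: "v : V ==> a : car (Gs v) ==> rho (incl v a) = letter v a"
	unfolding rho_def by (rule gp_lift_incl[OF HH.group_GP letter_compatible])

lemma rho_closed: "x : car GP ==> rho x : car HG" using rho_hom by (meson hom_in_carrier)

text \<open>Available at all vertices, not only in \<open>S\<close> and \<open>T\<close>: the
  coordinates together form the abelian quotient on which the relevant automorphisms act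
  trivially.\<close>

definition coord :: "'v => ('v \<times> 'a) list set => 'd" where
	"coord v = gp_lift (D v) (%w a. if w = v then \<theta> v a else one[D v])"

lemma coord_compatible: "v : V ==> compatible (D v) (%w a. if w = v then \<theta> v a else one[D v])"
proof -
	assume v: "v : V"
	interpret Dv: comm_group "D v" by (rule D)
	have "(%a. if w = v then \<theta> v a else one[D v]) : hom (Gs w) (D v)" if "w : V" for w
		using \<theta>[OF v] by (cases "w = v") (auto simp: hom_def)
	moreover have "(if w = v then \<theta> v a else one[D v]) : car (D v)" if "w : V" "a : car (Gs w)" for w a
		using \<theta>_closed that by auto
	ultimately show ?thesis unfolding compatible_def using Dv.m_comm by blast
qed

lemma coord_hom: "v : V ==> coord v : hom GP (D v)"
	unfolding coord_def by (rule gp_lift_hom[OF D_group coord_compatible])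

lemma coord_incl: "v : V ==> w : V ==> a : car (Gs w) ==> coord v (incl w a) = (if w = v then \<theta> v a else one[D v])"
	unfolding coord_def by (rule gp_lift_incl[OF D_group coord_compatible])

lemma proj_rho: "v : side i ==> x : car GP ==> HH.proj i (rho x) v = coord v x"
proof (rule hom_ext[of "%x. HH.proj i (rho x) v" "D v" "coord v"])
	assume v: "v : side i"
	show "group (D v)" by (rule D_group)
	show "coord v : hom GP (D v)" using coord_hom side_V[OF v] by blast
	have pc: "HH.proj i Q v : car (D v)" if "Q : car HG" for Q using HH.proj_closed[OF that, of i] v by (auto simp: PD_carrier)
	show "(%x. HH.proj i (rho x) v) : hom GP (D v)"
		using rho_closed pc v by (intro homI) (simp_all add: hom_mult[OF rho_hom] HH.proj_mult PD_mult)
	fix w a assume w: "w : V" "a : car (Gs w)"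
	show "HH.proj i (rho (incl w a)) v = coord v (incl w a)"
	proof (cases "w : S \<union> T")
		case True
		then obtain j where j: "w : side j" using sides[OF w(1)] by blast
		have c: "single j w (\<theta> w a) : car (PD j)" using j \<theta>_closed w by simp
		have r: "HH.proj i (rho (incl w a)) = (if i = j then single j w (\<theta> w a) else one[PD i])"
			unfolding rho_incl[OF w] letter_side[OF j] by (rule HH.proj_incl[OF c])
		have ij: "w ~= v" if "i ~= j" using that v j ST(3) by (cases i; cases j) (auto simp: side_def)
		show ?thesis unfolding r coord_incl[OF side_V[OF v] w] using v ij by (auto simp: single_def PD_one)
	next
		case False
		then have "w ~= v" using v by (cases i) (auto simp: side_def)
		then show ?thesis using False v by (simp add: rho_incl[OF w] letter_def HH.proj_one PD_one coord_incl[OF side_V[OF v] w])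
	qed
qed

lemma proj_eqI:
	assumes "x : car GP" "y : car GP" "!!v. v : V ==> coord v x = coord v y"
	shows "HH.proj i (rho x) = HH.proj i (rho y)"
proof (rule PiE_ext)
	show "HH.proj i (rho x) : (\<Pi>\<^sub>E v\<in>side i. car (D v))" "HH.proj i (rho y) : (\<Pi>\<^sub>E v\<in>side i. car (D v))"
		using HH.proj_closed[OF rho_closed, of _ i] assms by (auto simp: PD_carrier)
	show "HH.proj i (rho x) v = HH.proj i (rho y) v" if "v : side i" for v
		using proj_rho[OF that] assms side_V[OF that] by simp
qed

lemma elliptic_proj:
	assumes "HH.elliptic Q"
	shows "\<exists>d\<in>car HG. \<exists>i. Q = d *[HG] HH.incl i (HH.proj i Q) *[HG] inv[HG] d & (\<forall>j. j ~= i --> HH.proj j Q = one[PD j])"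
proof -
	obtain d i a where d: "d : car HG" "a : car (PD i)" "Q = d *[HG] HH.incl i a *[HG] inv[HG] d"
		using assms unfolding HH.elliptic_def by (elim bexE exE)
	have p: "HH.proj j Q = (if j = i then a else one[PD j])" for j
		unfolding d(3) using HH.proj_conj[OF PD_comm _ d(1), of "HH.incl i a" j] d(2) HH.proj_incl[OF d(2), of j] by simp
	have "Q = d *[HG] HH.incl i (HH.proj i Q) *[HG] inv[HG] d" using p[of i] d(3) by simp
	then show ?thesis using d(1) p by auto
qed

text \<open>An elliptic element is determined up to conjugacy by its projections. So letters outside
  \<open>S\<close> and \<open>T\<close> go to 1, and, as the letters of a side commute and one is
  non-trivial, a single element conjugates the whole side into its factor. Surjectivity lets
  \<open>inner_of_factor_conj\<close> replace the two conjugators by one.\<close>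

lemma conjugate_to_rho:
	assumes f: "f : hom GP HG" "car HG \<subseteq> f ` car GP"
		and ab: "!!x i. x : car GP ==> HH.proj i (f x) = HH.proj i (rho x)"
		and ell: "!!v a. v : V ==> a : car (Gs v) ==> HH.elliptic (f (incl v a))"
		and cliq: "!!i v w. v : side i ==> w : side i ==> v ~= w ==> {v, w} : E"
		and Gs: "!!v. v : V ==> comm_group (Gs v)"
		and nt: "!!i. \<exists>v\<in>side i. \<exists>a\<in>car (Gs v). \<theta> v a ~= one[D v]"
	shows "conjugate_on (car GP) HG f rho"
proof -
	interpret f: group_hom GP HG f using f(1) group_GP HH.group_GP by (simp add: group_hom_def group_hom_axioms_def)
	have triv: "f (incl v a) = one[HG]" if v: "v : V" "a : car (Gs v)" and p: "!!i. HH.proj i (rho (incl v a)) = one[PD i]" for v a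
	proof -
		obtain d i where d: "d : car HG" "f (incl v a) = d *[HG] HH.incl i (HH.proj i (f (incl v a))) *[HG] inv[HG] d"
			using elliptic_proj[OF ell[OF v]] by blast
		have "HH.proj i (f (incl v a)) = one[PD i]" using ab[OF incl_carrier[OF v], of i] p[of i] by simp
		then show ?thesis using d HH.incl_one[of i] by simp
	qed
	have out: "f (incl v a) = one[HG]" if v: "v : V" "v \<notin> S \<union> T" "a : car (Gs v)" for v a
		using v by (intro triv) (auto simp: rho_incl letter_def HH.proj_one)
	have "\<exists>g\<in>car HG. \<forall>v\<in>side i. \<forall>a\<in>car (Gs v). f (incl v a) = g *[HG] rho (incl v a) *[HG] inv[HG] g" for i
	proof -
		obtain v0 x0 where v0: "v0 : side i" "x0 : car (Gs v0)" "\<theta> v0 x0 ~= one[D v0]" using nt[of i] by (elim bexE)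
		have V0: "v0 : V" by (rule side_V[OF v0(1)])
		let ?C = "{incl v a | v a. v : side i & a : car (Gs v)}"
		have CV: "x : car GP" if "x : ?C" for x using that side_V by auto
		have comm: "x *[GP] y = y *[GP] x" if xy: "x : ?C" "y : ?C" for x y
		proof -
			obtain v a w b where x: "x = incl v a" "v : side i" "a : car (Gs v)" and y: "y = incl w b" "w : side i" "b : car (Gs w)"
				using xy by blast
			show ?thesis
			proof (cases "v = w")
				case True
				interpret Gv: comm_group "Gs v" by (rule Gs[OF side_V[OF x(2)]])
				show ?thesis using incl_mult[OF side_V[OF x(2)], of a b] incl_mult[OF side_V[OF x(2)], of b a] x y True Gv.m_comm[of a b] by simp
			next
				case False
				then show ?thesis using incl_comm[OF side_V[OF x(2)] side_V[OF y(2)] cliq[OF x(2) y(2) False]] x y by blast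
			qed
		qed
		have pr: "HH.proj j (rho (incl v a)) = (if j = i then single i v (\<theta> v a) else one[PD j])" if "v : side i" "a : car (Gs v)" for v a j
			unfolding rho_incl[OF side_V[OF that(1)] that(2)] letter_side[OF that(1)]
			using HH.proj_incl[of "single i v (\<theta> v a)" i j] that \<theta>_closed[OF side_V[OF that(1)] that(2)] by simp
		have ne: "single i v0 (\<theta> v0 x0) ~= one[PD i]" using v0 single_one_iff by blast
		obtain g j where g: "g : car HG" "f (incl v0 x0) = g *[HG] HH.incl j (HH.proj j (f (incl v0 x0))) *[HG] inv[HG] g"
			"\<forall>k. k ~= j --> HH.proj k (f (incl v0 x0)) = one[PD k]" using elliptic_proj[OF ell[OF V0 v0(2)]] by blast
		have pf: "HH.proj i (f (incl v0 x0)) = single i v0 (\<theta> v0 x0)" using ab[OF incl_carrier[OF V0 v0(2)], of i] pr[OF v0(1,2), of i] by simp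
		have j: "j = i"
		proof (rule ccontr)
			assume "j ~= i"
			then have "HH.proj i (f (incl v0 x0)) = one[PD i]" using g(3) by blast
			then show False using pf ne by simp
		qed
		have "f (incl v a) = g *[HG] rho (incl v a) *[HG] inv[HG] g" if va: "v : side i" "a : car (Gs v)" for v a
		proof -
			have "f (incl v a) = g *[HG] HH.incl i (HH.proj i (f (incl v a))) *[HG] inv[HG] g"
			proof (rule HH.elliptic_conj_fix[where C = ?C and f = f and ?a0.0 = "incl v0 x0" and c = "single i v0 (\<theta> v0 x0)", OF PD_comm])
				show "f x *[HG] f y = f y *[HG] f x" if "x : ?C" "y : ?C" for x y
					using comm[OF that] f.hom_mult[OF CV[OF that(1)] CV[OF that(2)]] f.hom_mult[OF CV[OF that(2)] CV[OF that(1)]] by simp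
				show "f (incl v0 x0) = g *[HG] HH.incl i (single i v0 (\<theta> v0 x0)) *[HG] inv[HG] g" using g(2) j pf by simp
				show "single i v0 (\<theta> v0 x0) : car (PD i)" using v0 \<theta>_closed[OF V0 v0(2)] by simp
			qed (use v0 va g(1) ne CV in auto)
			moreover have "HH.proj i (f (incl v a)) = single i v (\<theta> v a)" using ab[OF incl_carrier[OF side_V[OF va(1)] va(2)], of i] pr[OF va, of i] by simp
			ultimately show ?thesis unfolding rho_incl[OF side_V[OF va(1)] va(2)] letter_side[OF va(1)] by simp
		qed
		then show ?thesis using g(1) by blast
	qed
	then obtain g h where g: "g : car HG" "\<forall>v\<in>side True. \<forall>a\<in>car (Gs v). f (incl v a) = g *[HG] rho (incl v a) *[HG] inv[HG] g"
		and h: "h : car HG" "\<forall>v\<in>side False. \<forall>a\<in>car (Gs v). f (incl v a) = h *[HG] rho (incl v a) *[HG] inv[HG] h" by meson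
	let ?R = "{g *[HG] HH.incl True a *[HG] inv[HG] g | a. a : car (PD True)} \<union> {h *[HG] HH.incl False b *[HG] inv[HG] h | b. b : car (PD False)}"
	have R: "?R \<subseteq> car HG" using g h by auto
	have fl: "f (incl v a) : generate HG ?R" if v: "v : V" "a : car (Gs v)" for v a
	proof -
		consider "v : side True" | "v : side False" | "v \<notin> S \<union> T" by (auto simp: side_def)
		then show ?thesis
		proof cases
			case 1
			then have "f (incl v a) = g *[HG] HH.incl True (single True v (\<theta> v a)) *[HG] inv[HG] g" using g(2) v rho_incl letter_side[OF 1] by simp
			moreover have "single True v (\<theta> v a) : car (PD True)" using 1 \<theta>_closed v by simp
			ultimately have "f (incl v a) : ?R" by blast
			then show ?thesis by (rule generate.incl)
		next
			case 2
			then have "f (incl v a) = h *[HG] HH.incl False (single False v (\<theta> v a)) *[HG] inv[HG] h" using h(2) v rho_incl letter_side[OF 2] by simp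
			moreover have "single False v (\<theta> v a) : car (PD False)" using 2 \<theta>_closed v by simp
			ultimately have "f (incl v a) : ?R" by blast
			then show ?thesis by (rule generate.incl)
		next
			case 3
			then show ?thesis using out v generate.one[of HG ?R] by simp
		qed
	qed
	have fx: "f x : generate HG ?R" if "x : car GP" for x
		using that
	proof (induction rule: GP_induct)
		case one show ?case using f.hom_one generate.one[of HG ?R] by simp
	next
		case (mult v a Q)
		then show ?case using f.hom_mult[of "incl v a" Q] generate.eng[OF fl[OF mult(1,2)] mult(4)] by simp
	qed
	have gen: "car HG \<subseteq> generate HG ?R" using f(2) fx by blast
	obtain v1 x1 where v1: "v1 : side False" "x1 : car (Gs v1)" "\<theta> v1 x1 ~= one[D v1]" using nt[of False] by (elim bexE)
	have b0: "single False v1 (\<theta> v1 x1) : car (PD False)" "single False v1 (\<theta> v1 x1) ~= one[PD False]"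
		using v1 \<theta>_closed[OF side_V[OF v1(1)] v1(2)] single_one_iff by auto
	obtain c where c: "c : car HG"
		"\<forall>a\<in>car (PD True). g *[HG] HH.incl True a *[HG] inv[HG] g = c *[HG] HH.incl True a *[HG] inv[HG] c"
		"\<forall>b\<in>car (PD False). h *[HG] HH.incl False b *[HG] inv[HG] h = c *[HG] HH.incl False b *[HG] inv[HG] c"
		using HH.inner_of_factor_conj[OF PD_comm g(1) h(1) gen b0] by (elim bexE conjE)
	have ci: "(%x. c *[HG] rho x *[HG] inv[HG] c) : hom GP HG"
		using c(1) rho_closed by (intro homI) (simp_all add: hom_mult[OF rho_hom] HH.GP.m_assoc HH.GP.inv_cancel)
	have "f x = c *[HG] rho x *[HG] inv[HG] c" if x: "x : car GP" for x
	proof (rule hom_ext[OF f(1) ci HH.group_GP x])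
		fix v a assume v: "v : V" "a : car (Gs v)"
		consider "v : side True" | "v : side False" | "v \<notin> S \<union> T" by (auto simp: side_def)
		then show "f (incl v a) = c *[HG] rho (incl v a) *[HG] inv[HG] c"
		proof cases
			case 1
			have "single True v (\<theta> v a) : car (PD True)" using 1 \<theta>_closed v by simp
			then show ?thesis using 1 g(2) v c(2) rho_incl[OF v] letter_side[OF 1, of a] by simp
		next
			case 2
			have "single False v (\<theta> v a) : car (PD False)" using 2 \<theta>_closed v by simp
			then show ?thesis using 2 h(2) v c(3) rho_incl[OF v] letter_side[OF 2, of a] by simp
		next
			case 3
			then show ?thesis using out v c(1) by (simp add: rho_incl letter_def)
		qed
	qed
	then show ?thesis unfolding conjugate_on_def using c(1) by blast
qed

end

context pair_projection
begin

lemma rho_surj: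
	assumes \<theta>s: "!!v. v : S \<union> T ==> car (D v) \<subseteq> \<theta> v ` car (Gs v)"
	shows "car HG \<subseteq> rho ` car GP"
proof
	have sf: "finite (side i)" for i using fin ST finite_subset by (cases i) (auto simp: side_def)
	have factor: "HH.incl i x : rho ` car GP"
		if "finite F" "F \<subseteq> side i" "x : car (PD i)" "!!u. u : side i - F ==> x u = one[D u]" for F i x
		using that
	proof (induction F arbitrary: x rule: finite_induct)
		case empty
		have "x = one[PD i]" unfolding PD_one by (rule PiE_ext[of _ "side i" "%v. car (D v)"]) (use empty in \<open>auto simp: PD_carrier\<close>)
		then have "HH.incl i x = rho one[GP]" using HH.incl_one[of i] hom_one[OF rho_hom group_GP HH.group_GP] by simp
		then show ?case by blast
	next
		case (insert v F)
		have v: "v : side i" using insert.prems(1) by blast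
		define x' where "x' = (\<lambda>u\<in>side i. if u = v then one[D u] else x u)"
		have xc: "x u : car (D u)" if "u : side i" for u using insert.prems(2) that by (auto simp: PD_carrier)
		have x': "x' : car (PD i)" using xc by (auto simp: x'_def PD_carrier)
		have x'u: "x' u = one[D u]" if "u : side i - F" for u using that insert.prems(3) by (auto simp: x'_def)
		have "HH.incl i x' : rho ` car GP" using insert.IH[OF _ x' x'u] insert.prems(1) by blast
		then obtain g where g: "g : car GP" "HH.incl i x' = rho g" by blast
		have "v : S \<union> T" using v by (cases i) (auto simp: side_def)
		then obtain a where a: "a : car (Gs v)" "x v = \<theta> v a" using \<theta>s[of v] xc[OF v] by blast
		have s: "single i v (x v) : car (PD i)" using v xc by simp
		have "x = single i v (x v) *[PD i] x'"
		proof (rule PiE_ext[of _ "side i" "%v. car (D v)"])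
			show "x : (\<Pi>\<^sub>E v\<in>side i. car (D v))" using insert.prems(2) by (simp add: PD_carrier)
			show "single i v (x v) *[PD i] x' : (\<Pi>\<^sub>E v\<in>side i. car (D v))"
				using HH.factor_simps(1)[OF s x'] by (simp add: PD_carrier)
			fix u assume u: "u : side i"
			then show "x u = (single i v (x v) *[PD i] x') u" using xc[OF u] xc[OF v] by (cases "u = v") (simp_all add: PD_mult single_def x'_def)
		qed
		then have "HH.incl i x = HH.incl i (single i v (x v)) *[HG] HH.incl i x'" using HH.incl_mult[of i "single i v (x v)" x'] s x' by simp
		also have "HH.incl i (single i v (x v)) = rho (incl v a)" using rho_incl[OF side_V[OF v] a(1)] letter_side[OF v, of a] a(2) by simp
		finally have "HH.incl i x = rho (incl v a *[GP] g)" using g hom_mult[OF rho_hom incl_carrier[OF side_V[OF v] a(1)] g(1)] by simp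
		moreover have "incl v a *[GP] g : car GP" using g(1) side_V[OF v] a(1) by simp
		ultimately show ?case by blast
	qed
	fix Q assume "Q : car HG"
	then show "Q : rho ` car GP"
	proof (induction rule: HH.GP_induct)
		case one
		have "one[HG] = rho one[GP]" using hom_one[OF rho_hom group_GP HH.group_GP] by simp
		then show ?case by (rule image_eqI) simp
	next
		case (mult i x Q)
		have "HH.incl i x : rho ` car GP" using mult(2) by (intro factor[OF sf[of i]]) auto
		then obtain g h where gh: "g : car GP" "HH.incl i x = rho g" "h : car GP" "Q = rho h" using mult(4) by blast
		then have "HH.incl i x *[HG] Q = rho (g *[GP] h)" using hom_mult[OF rho_hom gh(1,3)] by simp
		then show ?case using gh(1,3) by blast
	qed
qed

definition coords :: "('v \<times> 'a) list set => 'v => 'd" where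
	"coords g = (\<lambda>v\<in>V. coord v g)"

lemma coord_closed: "v : V ==> g : car GP ==> coord v g : car (D v)"
	using coord_hom by (meson hom_in_carrier)

lemma coords_hom: "coords : hom GP (product_group V D)"
proof (rule homI)
	show "coords x : car (product_group V D)" if "x : car GP" for x using that coord_closed by (auto simp: coords_def)
	show "coords (x *[GP] y) = coords x *[product_group V D] coords y" if "x : car GP" "y : car GP" for x y
		using that by (auto simp: coords_def hom_mult[OF coord_hom] intro!: restrict_ext)
qed

text \<open>Combines \<open>finite_cover\<close>, for the finite group of all coordinates, with
  \<open>finite_free_product_criterion\<close>, for the whole group as characteristic subgroup. The
  two elements \<open>a0\<close>, \<open>a1\<close> exclude the infinite dihedral target.\<close>

lemma pos_scl_of_pair:
	assumes Dfin: "!!v. v : V ==> finite (car (D v))"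
		and \<theta>s: "!!v. v : S \<union> T ==> car (D v) \<subseteq> \<theta> v ` car (Gs v)"
		and S0: "finite S0" "S0 \<subseteq> car GP" "car GP \<subseteq> generate GP S0"
		and P1: "finite P1" "!!p k. p : P1 ==> k : car GP ==> p k : car HG"
		and same: "!!\<omega>. \<omega> : iso GP GP ==> (\<forall>v\<in>V. \<forall>g\<in>car GP. coord v (\<omega> g) = coord v g) ==>
			 \<exists>p\<in>P1. conjugate_on (car GP) HG (%k. rho (\<omega> k)) p"
		and a: "a0 : car (PD True)" "a1 : car (PD True)" "a0 ~= one[PD True]" "a1 ~= one[PD True]" "a0 ~= a1"
		and b: "b0 : car (PD False)" "b0 ~= one[PD False]"
	shows "has_pos_scl_aut GP"
proof -
	have gQ: "group (product_group V D)" using D_group by simp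
	have fQ: "finite (car (product_group V D))" using Dfin fin by (auto intro!: finite_PiE)
	have same': "\<exists>p\<in>P1. conjugate_on (car GP) HG (%k. rho (\<omega> k)) p"
		if \<omega>: "\<omega> : iso GP GP" and e: "\<forall>g\<in>car GP. coords (\<omega> g) = coords g" for \<omega>
	proof (rule same[OF \<omega>], intro ballI)
		fix v g assume v: "v : V" "g : car GP"
		then have "coords (\<omega> g) v = coords g v" using e by simp
		then show "coord v (\<omega> g) = coord v g" using v(1) by (simp add: coords_def)
	qed
	have "\<exists>P. finite P & (\<forall>p\<in>P. \<forall>k\<in>car GP. p k : car HG) &
		(\<forall>\<phi>\<in>iso GP GP. \<exists>p\<in>P. conjugate_on (car GP) HG (%k. rho (\<phi> k)) p)"
	proof (rule finite_cover[where H = HG and K = "car GP" and \<rho> = rho and \<pi> = coords, OF HH.group_GP gQ fQ coords_hom S0 _ subset_refl P1(1)])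
		show "\<phi> k : car GP" if "\<phi> : iso GP GP" "k : car GP" for \<phi> k using that by (rule iso_carrier)
		show "p k : car HG" if "p : P1" "k : car GP" for p k using that by (rule P1(2))
		show "\<exists>p\<in>P1. conjugate_on (car GP) HG (%k. rho (\<omega> k)) p"
			if "\<omega> : iso GP GP" "\<forall>g\<in>car GP. coords (\<omega> g) = coords g" for \<omega> using that by (rule same')
	qed
	then obtain P where P: "finite P" "\<forall>p\<in>P. \<forall>k\<in>car GP. p k : car HG"
		"\<forall>\<phi>\<in>iso GP GP. \<exists>p\<in>P. conjugate_on (car GP) HG (%k. rho (\<phi> k)) p" by (elim exE conjE)
	have pfin: "finite (car (PD i))" for i unfolding PD_carrier
		by (rule finite_PiE) (use fin ST finite_subset side_V Dfin in \<open>auto simp: side_def\<close>)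
	have im: "\<exists>s\<in>car GP. rho s = Q" if "Q : car HG" for Q using rho_surj[OF \<theta>s] that by force
	obtain s where s: "s : car GP" "rho s = HH.commutator a0 b0" using im[OF HH.commutator_closed[OF a(1) b(1)]] by (elim bexE)
	obtain t where t: "t : car GP" "rho t = HH.commutator a1 b0" using im[OF HH.commutator_closed[OF a(2) b(1)]] by (elim bexE)
	show ?thesis
	proof (rule finite_free_product_criterion[where A = PD and K = "car GP" and T = "{one[GP]}" and \<rho> = rho and P = P and s = s and t = t
				and ?e1.0 = 1 and ?e2.0 = 1 and ?a0.0 = a0 and ?a1.0 = a1 and ?b0.0 = b0])
		show "comm_group (PD i)" for i by (rule PD_comm)
		show "finite (car (PD i))" for i by (rule pfin)
		show "rho : hom (GP\<lparr>carrier := car GP\<rparr>) HG" using rho_hom by (simp add: hom_def)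
		show "\<phi> k : car GP" if "\<phi> : iso GP GP" "k : car GP" for \<phi> k using that by (rule iso_carrier)
		show "\<exists>t\<in>{one[GP]}. g *[GP] inv[GP] t : car GP" if "g : car GP" for g using that by simp
		show "subgroup (car GP) GP" by (rule GP.subgroup_self)
		show "\<exists>p\<in>P. conjugate_on (car GP) HG (%k. rho (\<phi> k)) p" if "\<phi> : iso GP GP" for \<phi> using P(3) that by (rule bspec)
		show "p k : car HG" if "p : P" "k : car GP" for p k using P(2) that by simp
		show "rho s = HH.commutator a0 b0 ^[HG] (1::nat)" using s(2) a b by simp
		show "rho t = HH.commutator a1 b0 ^[HG] (1::nat)" using t(2) a b by simp
	qed (use a b P(1) s(1) t(1) in simp_all)
qed

end

lemma (in graph_prod) finite_abelian_pair:
	fixes S T :: "'v set"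
	assumes fin: "finite V" and Gs: "!!v. v : V ==> comm_group (Gs v)" "!!v. v : V ==> finite (car (Gs v))"
		and ST: "S \<subseteq> V" "T \<subseteq> V" "S \<inter> T = {}" "!!s t. s : S ==> t : T ==> {s, t} \<notin> E"
		and cliq: "!!v w. v : S ==> w : S ==> v ~= w ==> {v, w} : E" "!!v w. v : T ==> w : T ==> v ~= w ==> {v, w} : E"
		and nt: "v1 : S" "x1 : car (Gs v1)" "x1 ~= one[Gs v1]" "v2 : T" "x2 : car (Gs v2)" "x2 ~= one[Gs v2]"
		and a: "a0 : (\<Pi>\<^sub>E v\<in>S. car (Gs v))" "a1 : (\<Pi>\<^sub>E v\<in>S. car (Gs v))"
			"a0 ~= (\<lambda>v\<in>S. one[Gs v])" "a1 ~= (\<lambda>v\<in>S. one[Gs v])" "a0 ~= a1"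
	shows "has_pos_scl_aut GP"
proof -
	\<comment> \<open>The locale wants an abelian group at every \<open>v\<close>, so some vertex group
	  serves as default outside \<open>V\<close>.\<close>
	define D where "D v = (if v : V then Gs v else Gs v1)" for v
	have DV: "D v = Gs v" if "v : V" for v using that by (simp add: D_def)
	have v1: "v1 : V" using nt ST by blast
	interpret pair_projection V E Gs D "%_ x. x" S T
	proof (rule pair_projection.intro, rule graph_prod_axioms, rule pair_projection_axioms.intro)
		show "comm_group (D v)" for v using Gs(1) v1 by (simp add: D_def)
		show "(%x. x) : hom (Gs v) (D v)" if "v : V" for v using that by (simp add: D_def hom_def)
	qed (use fin ST in auto)
	define L where "L = {incl v a | v a. v : V & a : car (Gs v)}"
	have "L = (%(v, a). incl v a) ` (SIGMA v : V. car (Gs v))" unfolding L_def by auto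
	then have Lf: "finite L" using fin Gs(2) by simp
	have sub: "car (D v) \<subseteq> (%x. x) ` car (Gs v)" if "v : S \<union> T" for v using that ST DV[of v] by auto
	have SD: "car (PD True) = (\<Pi>\<^sub>E v\<in>S. car (Gs v))" "one[PD True] = (\<lambda>v\<in>S. one[Gs v])"
		unfolding PD_carrier PD_one side_def using ST(1) DV by (auto intro!: PiE_cong restrict_ext)
	have v2: "v2 : side False" "x2 : car (D v2)" "x2 ~= one[D v2]" using nt ST DV[of v2] by (auto simp: side_def)
	have ntD: "\<exists>v\<in>side i. \<exists>a\<in>car (Gs v). a ~= one[D v]" for i
	proof (cases i)
		case True
		have "x1 ~= one[D v1]" using nt DV[OF v1] by simp
		then show ?thesis using nt(1,2) True unfolding side_def by auto
	next
		case False
		have "x2 : car (Gs v2)" by (rule nt(5))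
		then show ?thesis using v2(1,3) False by auto
	qed
	have same: "\<exists>p\<in>{rho}. conjugate_on (car GP) HG (%k. rho (\<omega> k)) p"
		if \<omega>: "\<omega> : iso GP GP" and e: "\<forall>v\<in>V. \<forall>g\<in>car GP. coord v (\<omega> g) = coord v g" for \<omega>
	proof (rule bexI[of _ rho])
		have \<omega>h: "\<omega> : hom GP GP" by (rule iso_hom[OF \<omega>])
		have \<omega>c: "\<omega> g : car GP" if "g : car GP" for g using \<omega> that by (rule iso_carrier)
		have fh: "(%k. rho (\<omega> k)) : hom GP HG" using hom_compose[OF \<omega>h rho_hom] by (simp add: comp_def)
		show "conjugate_on (car GP) HG (%k. rho (\<omega> k)) rho"
		proof (rule conjugate_to_rho[OF fh])
			have "\<omega> ` car GP = car GP" using \<omega> by (simp add: iso_def bij_betw_def)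
			then have "(%k. rho (\<omega> k)) ` car GP = rho ` car GP" by (metis image_image)
			then show "car HG \<subseteq> (%k. rho (\<omega> k)) ` car GP" using rho_surj[OF sub] by simp
			show "HH.proj i (rho (\<omega> x)) = HH.proj i (rho x)" if x: "x : car GP" for x i
				by (rule proj_eqI[OF \<omega>c[OF x] x]) (use e x in blast)
			show "HH.elliptic (rho (\<omega> (incl v x)))" if v: "v : V" "x : car (Gs v)" for v x
			proof (rule HH.torsion_elliptic)
				interpret Gv: comm_group "Gs v" by (rule Gs(1)[OF v(1)])
				have i: "incl v x : car GP" using v by simp
				show "rho (\<omega> (incl v x)) : car HG" by (rule rho_closed[OF \<omega>c[OF i]])
				show "order (Gs v) > 0" using Gs(2)[OF v(1)] by (simp add: Gv.order_gt_0_iff_finite)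
				have "rho (\<omega> (incl v x)) ^[HG] order (Gs v) = rho (\<omega> (incl v x ^[GP] order (Gs v)))"
					using hom_nat_pow[OF fh i group_GP HH.group_GP, of "order (Gs v)"] by simp
				also have "incl v x ^[GP] order (Gs v) = incl v (x ^[Gs v] order (Gs v))"
					using hom_nat_pow[OF incl_hom[OF v(1)] v(2) Gv.is_group group_GP, of "order (Gs v)"] by simp
				also have "\<dots> = one[GP]" using Gv.pow_order_eq_1[OF v(2)] incl_one[OF v(1)] by simp
				also have "rho (\<omega> one[GP]) = one[HG]" by (rule hom_one[OF fh group_GP HH.group_GP])
				finally show "rho (\<omega> (incl v x)) ^[HG] order (Gs v) = one[HG]" .
			qed
			show "{v, w} : E" if "v : side i" "w : side i" "v ~= w" for i v w using that cliq by (cases i) (auto simp: side_def)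
			show "\<exists>v\<in>side i. \<exists>a\<in>car (Gs v). a ~= one[D v]" for i by (rule ntD)
		qed (rule Gs(1))
	qed simp
	show ?thesis
	proof (rule pos_scl_of_pair[where ?S0.0 = L and ?P1.0 = "{rho}" and ?a0.0 = a0 and ?a1.0 = a1 and ?b0.0 = "single False v2 x2"])
		show "finite (car (D v))" if "v : V" for v using Gs(2) DV that by simp
		show "car (D v) \<subseteq> (%x. x) ` car (Gs v)" if "v : S \<union> T" for v using that by (rule sub)
		show "L \<subseteq> car GP" by (auto simp: L_def)
		show "car GP \<subseteq> generate GP L" using letters_generate by (simp add: L_def)
		show "p k : car HG" if "p : {rho}" "k : car GP" for p k using that rho_closed by simp
		show "\<exists>p\<in>{rho}. conjugate_on (car GP) HG (%k. rho (\<omega> k)) p"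
			if "\<omega> : iso GP GP" "\<forall>v\<in>V. \<forall>g\<in>car GP. coord v (\<omega> g) = coord v g" for \<omega> using that by (rule same)
		show "single False v2 x2 : car (PD False)" by (rule single_carrier[OF v2(1,2)])
		show "single False v2 x2 ~= one[PD False]" using single_one_iff[OF v2(1), of x2] v2(3) by simp
	qed (use Lf a SD in simp_all)
qed

section \<open>Subgroups on sets of vertices\<close>

lemma (in group) generate_commute:
	assumes "B \<subseteq> car G" "C \<subseteq> car G" "!!b c. b : B ==> c : C ==> b \<otimes> c = c \<otimes> b"
		"x : generate G B" "y : generate G C"
	shows "x \<otimes> y = y \<otimes> x"
proof -
	have inv_comm: "inv b \<otimes> c = c \<otimes> inv b" if "b : car G" "c : car G" "b \<otimes> c = c \<otimes> b" for b c
	proof -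
		have "inv b \<otimes> c = inv b \<otimes> (c \<otimes> b) \<otimes> inv b" using that(1,2) by (simp add: m_assoc)
		also have "\<dots> = inv b \<otimes> (b \<otimes> c) \<otimes> inv b" using that(3) by simp
		also have "\<dots> = c \<otimes> inv b" using that(1,2) by (simp add: m_assoc inv_cancel)
		finally show ?thesis .
	qed
	have gen: "x \<otimes> c = c \<otimes> x" if "B \<subseteq> car G" "c : car G" "!!b. b : B ==> b \<otimes> c = c \<otimes> b" "x : generate G B" for B c x
		using that(4)
	proof (induction rule: generate.induct)
		case (inv b) then show ?case using that inv_comm[of b c] by blast
	next
		case (eng h1 h2)
		have "h1 : car G" "h2 : car G" using eng(1,2) generate_in_carrier[OF that(1)] by auto
		then show ?case using eng(3,4) that(2) by (metis m_assoc)
	qed (use that in auto)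
	have "y \<otimes> x = x \<otimes> y"
	proof (rule gen[OF assms(2) _ _ assms(5)])
		show "x : car G" using assms(4) generate_in_carrier[OF assms(1)] by blast
		fix c assume "c : C"
		then have "x \<otimes> c = c \<otimes> x" using assms(2,3) by (intro gen[OF assms(1) _ _ assms(4)]) auto
		then show "c \<otimes> x = x \<otimes> c" by simp
	qed
	then show ?thesis by simp
qed

lemma (in group) generate_image_closed:
	assumes "B \<subseteq> car G" "h : hom G H" "group H" "!!b. b : B ==> h b : L" "subgroup L H" "x : generate G B"
	shows "h x : L"
proof -
	interpret h: group_hom G H h using assms(2,3) is_group by (simp add: group_hom_def group_hom_axioms_def)
	show ?thesis using assms(6)
	proof (induction rule: generate.induct)
		case one then show ?case using subgroup.one_closed[OF assms(5)] by simp
	next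
		case (inv b) 
		then have "b : car G" using assms(1) by blast
		then show ?case using inv assms(4) subgroup.m_inv_closed[OF assms(5)] by simp
	next
		case (eng h1 h2)
		have "h1 : car G" "h2 : car G" using eng(1,2) generate_in_carrier[OF assms(1)] by auto
		then show ?case using eng(3,4) subgroup.m_closed[OF assms(5)] by simp
	qed (rule assms(4))
qed

lemma (in group) generate_hom_eq:
	assumes "B \<subseteq> car G" "h : hom G H" "h' : hom G H" "group H" "!!b. b : B ==> h b = h' b" "x : generate G B"
	shows "h x = h' x"
proof -
	interpret h: group_hom G H h using assms(2,4) is_group by (simp add: group_hom_def group_hom_axioms_def)
	interpret h': group_hom G H h' using assms(3,4) is_group by (simp add: group_hom_def group_hom_axioms_def)
	show ?thesis using assms(6)
	proof (induction rule: generate.induct)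
		case (inv b) 
		then have "b : car G" using assms(1) by blast
		then show ?case using inv assms(5) by simp
	next
		case (eng h1 h2)
		have "h1 : car G" "h2 : car G" using eng(1,2) generate_in_carrier[OF assms(1)] by auto
		then show ?case using eng(3,4) by simp
	qed (simp_all add: assms(5))
qed

context graph_prod
begin

definition letters :: "'v set => ('v \<times> 'a) list set set" where
	"letters S = {incl v a | v a. v : S & a : car (Gs v)}"

lemma letters_carrier: "S \<subseteq> V ==> letters S \<subseteq> car GP" by (auto simp: letters_def)

lemma gp_sub_simps: "car (gp_sub V E Gs S) = generate GP (letters S)"
	"x *[gp_sub V E Gs S] y = x *[GP] y" "one[gp_sub V E Gs S] = one[GP]"
	by (simp_all add: gp_sub_def letters_def)

lemma gp_sub_group: "S \<subseteq> V ==> group (gp_sub V E Gs S)"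
	using GP.subgroup_imp_group[OF GP.generate_is_subgroup[OF letters_carrier]]
	by (simp add: gp_sub_def letters_def)

text \<open>Killing the vertices outside \<open>S\<close> defines, by the universal property, a map
  on the whole graph product; restricted to the subgroup it is inverse to the evident map from the
  free product.\<close>

lemma gp_sub_discrete:
	fixes Dg :: "'c monoid"
	assumes S: "S \<subseteq> V" "!!v w. v : S ==> w : S ==> {v, w} \<notin> E" and f: "bij_betw f S {..<k}"
		and Dg: "group Dg" and h: "!!v. v : S ==> h v : iso (Gs v) Dg"
	shows "gp_sub V E Gs S \<cong> graph_product {..<k} {} (%_. Dg)"
proof -
	interpret B: graph_prod "{..<k}" "{}" "%_. Dg" by (rule graph_prod.intro) (rule Dg)
	define r where "r = gp_lift B.GP (%v a. if v : S then B.incl (f v) (h v a) else one[B.GP])"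
	have fk: "f v : {..<k}" if "v : S" for v using f that by (auto simp: bij_betw_def)
	have hc: "h v a : car Dg" if "v : S" "a : car (Gs v)" for v a using h[OF that(1)] that(2) by (rule iso_carrier)
	have bc: "B.incl (f v) (h v a) : car B.GP" if "v : S" "a : car (Gs v)" for v a using fk hc that B.incl_carrier by blast
	have rh: "(%a. if v : S then B.incl (f v) (h v a) else one[B.GP]) : hom (Gs v) B.GP" if v: "v : V" for v
	proof (cases "v : S")
		case True
		have "(%a. B.incl (f v) (h v a)) : hom (Gs v) B.GP"
			using hom_compose[OF iso_hom[OF h[OF True]] B.incl_hom[OF fk[OF True]]] by (simp add: comp_def)
		then show ?thesis using True by simp
	qed (simp add: hom_def)
	have rcomp: "compatible B.GP (%v a. if v : S then B.incl (f v) (h v a) else one[B.GP])"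
		unfolding compatible_def
	proof (intro conjI ballI impI)
		fix v w a b assume *: "v : V" "w : V" "{v, w} : E" "a : car (Gs v)" "b : car (Gs w)"
		then have "v \<notin> S | w \<notin> S" using S(2) by blast
		then show "(if v : S then B.incl (f v) (h v a) else one[B.GP]) *[B.GP] (if w : S then B.incl (f w) (h w b) else one[B.GP]) =
			 (if w : S then B.incl (f w) (h w b) else one[B.GP]) *[B.GP] (if v : S then B.incl (f v) (h v a) else one[B.GP])"
			using bc * by auto
	qed (rule rh)
	have r: "r : hom GP B.GP" unfolding r_def by (rule gp_lift_hom[OF B.group_GP rcomp])
	have ri: "r (incl v a) = B.incl (f v) (h v a)" if "v : S" "a : car (Gs v)" for v a
		unfolding r_def using gp_lift_incl[OF B.group_GP rcomp, of v a] that S(1) by auto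
	define g where "g = inv_into S f"
	have g: "g i : S" "f (g i) = i" if "i : {..<k}" for i
		using that f inv_into_into[of i f S] f_inv_into_f[of i f S] by (auto simp: g_def bij_betw_def)
	have gf: "g (f v) = v" if "v : S" for v using f that by (simp add: g_def bij_betw_def)
	define h' where "h' v = inv_into (car (Gs v)) (h v)" for v
	have h': "h' v : hom Dg (Gs v)" "!!a. a : car (Gs v) ==> h' v (h v a) = a" "!!d. d : car Dg ==> h v (h' v d) = d" "!!d. d : car Dg ==> h' v d : car (Gs v)" if "v : S" for v
	proof -
		have "v : V" using that S(1) by blast
		then have "group (Gs v)" by (rule vertex_group)
		then have i: "h' v : iso Dg (Gs v)" unfolding h'_def using h[OF that] by (simp add: group.iso_set_sym)
		then show "h' v : hom Dg (Gs v)" by (rule iso_hom)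
		show "!!a. a : car (Gs v) ==> h' v (h v a) = a" "!!d. d : car Dg ==> h v (h' v d) = d"
			using h[OF that] by (auto simp: h'_def iso_def bij_betw_def inv_into_f_f f_inv_into_f)
		show "!!d. d : car Dg ==> h' v d : car (Gs v)" using i by (rule iso_carrier)
	qed
	define j where "j = gp_lift GP (%i d. incl (g i) (h' (g i) d))"
	have jcomp: "B.compatible GP (%i d. incl (g i) (h' (g i) d))" unfolding B.compatible_def
	proof (intro conjI ballI impI)
		fix i assume "i : {..<k}"
		then have gi: "g i : S" by (rule g)
		then have "g i : V" using S(1) by blast
		then show "(%d. incl (g i) (h' (g i) d)) : hom Dg GP"
			using hom_compose[OF h'(1)[OF gi] incl_hom] by (simp add: comp_def)
	qed simp
	have j: "j : hom B.GP GP" unfolding j_def by (rule B.gp_lift_hom[OF group_GP jcomp])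
	have ji: "j (B.incl i d) = incl (g i) (h' (g i) d)" if "i : {..<k}" "d : car Dg" for i d
		unfolding j_def by (rule B.gp_lift_incl[OF group_GP jcomp that])
	have rj: "r (j b) = b" if b: "b : car B.GP" for b
	proof -
		have "(%x. r (j x)) : hom B.GP B.GP" using hom_compose[OF j r] by (simp add: comp_def)
		then show ?thesis
		proof (rule B.hom_ext[OF _ _ B.group_GP b])
			show "(%x. x) : hom B.GP B.GP" by (rule iso_hom[OF id_iso])
			fix i d assume id: "i : {..<k}" "d : car Dg"
			then show "r (j (B.incl i d)) = B.incl i d" using ji[OF id] ri[OF g(1)[OF id(1)]] h'(3,4)[OF g(1)[OF id(1)]] g(2)[OF id(1)] by simp
		qed
	qed
	have Lc: "letters S \<subseteq> car GP" by (rule letters_carrier[OF S(1)])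
	have jr: "j (r x) = x" if x: "x : generate GP (letters S)" for x
	proof -
		have "(%x. j (r x)) : hom GP GP" using hom_compose[OF r j] by (simp add: comp_def)
		then show ?thesis
		proof (rule GP.generate_hom_eq[OF Lc _ iso_hom[OF id_iso] group_GP _ x])
			fix b assume "b : letters S"
			then obtain v a where v: "b = incl v a" "v : S" "a : car (Gs v)" by (auto simp: letters_def)
			then show "j (r b) = b" using ri[OF v(2,3)] ji[OF fk[OF v(2)] hc[OF v(2,3)]] gf[OF v(2)] h'(2)[OF v(2,3)] by simp
		qed
	qed
	have jin: "j b : generate GP (letters S)" if "b : car B.GP" for b
		using that
	proof (induction rule: B.GP_induct)
		case one show ?case using hom_one[OF j B.group_GP group_GP] generate.one[of GP "letters S"] by simp
	next
		case (mult i d Q)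
		have "incl (g i) (h' (g i) d) : letters S" unfolding letters_def using g(1)[OF mult(1)] h'(4)[OF g(1)[OF mult(1)] mult(2)] by blast
		from generate.eng[OF generate.incl[OF this, of GP] mult(4)]
		show ?case using hom_mult[OF j B.incl_carrier[OF mult(1,2)] mult(3)] ji[OF mult(1,2)] by simp
	qed
	have gc: "x : car GP" if "x : generate GP (letters S)" for x using GP.generate_in_carrier[OF Lc that] .
	have "r : iso (gp_sub V E Gs S) B.GP" unfolding iso_def
	proof (intro CollectI conjI homI)
		show "r x : car B.GP" if "x : car (gp_sub V E Gs S)" for x
			using that hom_in_carrier[OF r] gc by (simp add: gp_sub_simps)
		show "r (x *[gp_sub V E Gs S] y) = r x *[B.GP] r y" if "x : car (gp_sub V E Gs S)" "y : car (gp_sub V E Gs S)" for x y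
			using that hom_mult[OF r] gc by (simp add: gp_sub_simps)
		show "bij_betw r (car (gp_sub V E Gs S)) (car B.GP)"
			by (rule bij_betw_byWitness[where f' = j]) (use jr rj jin gc hom_in_carrier[OF r] in \<open>auto simp: gp_sub_simps\<close>)
	qed
	then show ?thesis by (rule is_isoI)
qed

end

lemma order_two_iso:
	assumes "group G" "car G = {one[G], c}" "c ~= one[G]"
	shows "(%x. if x = one[G] then 0 else 1) : iso G (integer_mod_group 2)"
proof -
	interpret group G by (rule assms)
	have c: "c : car G" using assms by simp
	have "c *[G] c ~= c" using assms(3) c by simp
	then have cc: "c *[G] c = one[G]" using m_closed[OF c c] assms(2) by blast
	have C: "car (integer_mod_group 2) = {0, 1}" by (auto simp: carrier_integer_mod_group)
	show ?thesis unfolding iso_def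
	proof (intro CollectI conjI homI)
		show "bij_betw (%x. if x = one[G] then 0 else 1) (car G) (car (integer_mod_group 2))"
			unfolding C assms(2) using assms(3) by (auto simp: bij_betw_def inj_on_def)
		show "(if x *[G] y = one[G] then 0 else 1) = (if x = one[G] then 0 else 1) *[integer_mod_group 2] (if y = one[G] then 0 else 1)"
			if "x : car G" "y : car G" for x y
			using that assms(2,3) cc c by (auto simp: mult_integer_mod_group)
	qed (auto simp: C)
qed

section \<open>Joins\<close>

context graph_prod
begin

context
	fixes Vs :: "'v set list"
	assumes part: "is_vertex_partition V Vs"
		and joined: "!!i j v w. i < length Vs ==> j < length Vs ==> i ~= j ==> v : Vs ! i ==> w : Vs ! j ==> {v, w} : E"
begin

private lemma blk: "i < length Vs ==> Vs ! i \<subseteq> V"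
	using part nth_mem unfolding is_vertex_partition_def by blast

private abbreviation "Hb i \<equiv> generate GP (letters (Vs ! i))"

private lemma Hb_carrier: "i < length Vs ==> x : Hb i ==> x : car GP"
	using GP.generate_in_carrier[OF letters_carrier[OF blk]] by blast

private lemma Hb_comm:
	assumes "i < length Vs" "j < length Vs" "i ~= j" "x : Hb i" "y : Hb j"
	shows "x *[GP] y = y *[GP] x"
proof (rule GP.generate_commute[OF letters_carrier[OF blk[OF assms(1)]] letters_carrier[OF blk[OF assms(2)]] _ assms(4,5)])
	fix b c assume "b : letters (Vs ! i)" "c : letters (Vs ! j)"
	then obtain v a w d where b: "b = incl v a" "v : Vs ! i" "a : car (Gs v)" and c: "c = incl w d" "w : Vs ! j" "d : car (Gs w)"
		unfolding letters_def by blast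
	have "v : V" "w : V" using b c blk assms by blast+
	then show "b *[GP] c = c *[GP] b" unfolding b(1) c(1) by (rule incl_comm[OF _ _ joined[OF assms(1-3) b(2) c(2)] b(3) c(3)])
qed

private definition bprod :: "nat list => (nat => ('v \<times> 'a) list set) => ('v \<times> 'a) list set" where
	"bprod is f = foldr (%i acc. f i *[GP] acc) is one[GP]"

private lemma bprod_simps [simp]: "bprod [] f = one[GP]" "bprod (i # is) f = f i *[GP] bprod is f"
	by (simp_all add: bprod_def)

private lemma bprod_closed: "set is \<subseteq> {..<length Vs} ==> (!!i. i : set is ==> f i : Hb i) ==> bprod is f : car GP"
proof (induction "is")
	case (Cons i "is")
	have "f i : car GP" using Hb_carrier[of i "f i"] Cons.prems by simp
	then show ?case using Cons by simp
qed simp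

private lemma bprod_comm:
	assumes "set is \<subseteq> {..<length Vs}" "!!i. i : set is ==> f i : Hb i" "j < length Vs" "j \<notin> set is" "y : Hb j"
	shows "bprod is f *[GP] y = y *[GP] bprod is f"
	using assms(1,2,4)
proof (induction "is")
	case Nil then show ?case using Hb_carrier[OF assms(3,5)] by simp
next
	case (Cons i "is")
	have i: "i < length Vs" "i ~= j" "f i : Hb i" using Cons.prems by auto
	have c: "f i : car GP" "y : car GP" "bprod is f : car GP"
		using Hb_carrier[OF i(1,3)] Hb_carrier[OF assms(3,5)] bprod_closed[of "is" f] Cons.prems by auto
	have e: "bprod is f *[GP] y = y *[GP] bprod is f" using Cons by simp
	have "f i *[GP] bprod is f *[GP] y = f i *[GP] (y *[GP] bprod is f)" using c e by (simp add: GP.m_assoc)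
	also have "\<dots> = (y *[GP] f i) *[GP] bprod is f" using c Hb_comm[OF i(1) assms(3) i(2,3) assms(5)] by (simp add: GP.m_assoc[symmetric])
	finally show ?case using c by (simp add: GP.m_assoc)
qed

private lemma bprod_mult:
	assumes "set is \<subseteq> {..<length Vs}" "distinct is" "!!i. i : set is ==> f i : Hb i" "!!i. i : set is ==> g i : Hb i"
		"!!i. i : set is ==> h i = f i *[GP] g i"
	shows "bprod is h = bprod is f *[GP] bprod is g"
	using assms
proof (induction "is")
	case (Cons i "is")
	have i: "i < length Vs" "f i : Hb i" "g i : Hb i" "i \<notin> set is" "h i = f i *[GP] g i" using Cons.prems by auto
	have c: "f i : car GP" "g i : car GP" "bprod is f : car GP" "bprod is g : car GP"
		using Hb_carrier[OF i(1)] i bprod_closed[of "is" f] bprod_closed[of "is" g] Cons.prems by auto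
	have IH: "bprod is h = bprod is f *[GP] bprod is g" using Cons by simp
	have cm: "bprod is f *[GP] g i = g i *[GP] bprod is f" using bprod_comm[of "is" f i "g i"] i Cons.prems by simp
	have "bprod (i # is) h = f i *[GP] (g i *[GP] bprod is f) *[GP] bprod is g" using i(5) IH c by (simp add: GP.m_assoc)
	also have "\<dots> = f i *[GP] (bprod is f *[GP] g i) *[GP] bprod is g" using cm by simp
	finally show ?case using c by (simp add: GP.m_assoc)
qed simp

text \<open>The retraction onto one block reads off one component of a product; this gives
  injectivity of the product map.\<close>

private definition ret :: "nat => ('v \<times> 'a) list set => ('v \<times> 'a) list set" where
	"ret i = gp_lift GP (%v a. if v : Vs ! i then incl v a else one[GP])"

private lemma ret_compatible: "compatible GP (%v a. if v : Vs ! i then incl v a else one[GP])"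
	unfolding compatible_def
proof (intro conjI ballI impI)
	fix v assume "v : V"
	then show "(%a. if v : Vs ! i then incl v a else one[GP]) : hom (Gs v) GP"
		using incl_hom by (cases "v : Vs ! i") (auto simp: hom_def)
next
	fix v w a b assume "v : V" "w : V" "{v, w} : E" "a : car (Gs v)" "b : car (Gs w)"
	then show "(if v : Vs ! i then incl v a else one[GP]) *[GP] (if w : Vs ! i then incl w b else one[GP]) =
		(if w : Vs ! i then incl w b else one[GP]) *[GP] (if v : Vs ! i then incl v a else one[GP])"
		using incl_comm[of v w a b] by auto
qed

private lemma ret_hom: "ret i : hom GP GP" unfolding ret_def by (rule gp_lift_hom[OF group_GP ret_compatible])

private lemma ret_same: assumes "i < length Vs" "x : Hb i" shows "ret i x = x"
proof (rule GP.generate_hom_eq[OF letters_carrier[OF blk[OF assms(1)]] ret_hom iso_hom[OF id_iso] group_GP _ assms(2)])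
	fix b assume "b : letters (Vs ! i)"
	then obtain v a where "b = incl v a" "v : Vs ! i" "a : car (Gs v)" unfolding letters_def by blast
	then show "ret i b = b" unfolding ret_def using gp_lift_incl[OF group_GP ret_compatible, of v a i] blk[OF assms(1)] by auto
qed

private lemma ret_other: assumes "i < length Vs" "j < length Vs" "i ~= j" "x : Hb j" shows "ret i x = one[GP]"
proof (rule GP.generate_hom_eq[OF letters_carrier[OF blk[OF assms(2)]] ret_hom _ group_GP _ assms(4)])
	show "(%_. one[GP]) : hom GP GP" by (simp add: hom_def)
	fix b assume "b : letters (Vs ! j)"
	then obtain v a where b: "b = incl v a" "v : Vs ! j" "a : car (Gs v)" unfolding letters_def by blast
	have "v \<notin> Vs ! i" using part assms(1-3) b(2) unfolding is_vertex_partition_def by blast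
	then show "ret i b = one[GP]" unfolding ret_def using gp_lift_incl[OF group_GP ret_compatible, of v a i] blk[OF assms(2)] b by auto
qed

private lemma ret_bprod:
	assumes "i < length Vs" "set is \<subseteq> {..<length Vs}" "distinct is" "!!j. j : set is ==> f j : Hb j"
	shows "ret i (bprod is f) = (if i : set is then f i else one[GP])"
	using assms(2-4)
proof (induction "is")
	case Nil then show ?case using hom_one[OF ret_hom group_GP group_GP] by simp
next
	case (Cons j "is")
	have j: "j < length Vs" "f j : Hb j" "j \<notin> set is" using Cons.prems by auto
	have c: "f j : car GP" "bprod is f : car GP"
		using Hb_carrier[OF j(1,2)] bprod_closed[of "is" f] Cons.prems by auto
	have IH: "ret i (bprod is f) = (if i : set is then f i else one[GP])" using Cons by simp
	have m: "ret i (bprod (j # is) f) = ret i (f j) *[GP] ret i (bprod is f)" using hom_mult[OF ret_hom c] by simp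
	show ?case
	proof (cases "i = j")
		case True
		then have "ret i (f j) = f j" using ret_same[OF j(1,2)] by simp
		then show ?thesis using m IH True j(3) c by simp
	next
		case False
		then have f: "ret i (f j) = one[GP]" using ret_other[OF assms(1) j(1) _ j(2)] by simp
		have "i : set is ==> f i : car GP" using Hb_carrier[OF assms(1)] Cons.prems by simp
		then show ?thesis using m IH f False by auto
	qed
qed

lemma product_map_iso:
	"gp_product_map V E Gs Vs : iso (product_group {..<length Vs} (%i. gp_sub V E Gs (Vs ! i))) GP"
proof -
	let ?P = "product_group {..<length Vs} (%i. gp_sub V E Gs (Vs ! i))"
	let ?is = "[0..<length Vs]"
	have F: "gp_product_map V E Gs Vs f = bprod ?is f" for f by (simp add: gp_product_map_def bprod_def)
	have car: "car ?P = (\<Pi>\<^sub>E i\<in>{..<length Vs}. Hb i)" by (simp add: gp_sub_simps)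
	have mem: "f i : Hb i" if "f : car ?P" "i : set ?is" for f i using that unfolding car by auto
	have s: "set ?is \<subseteq> {..<length Vs}" by auto
	have gP: "group ?P" by (rule product_group) (use gp_sub_group blk in auto)
	have hm: "gp_product_map V E Gs Vs : hom ?P GP"
	proof (rule homI)
		show "gp_product_map V E Gs Vs f : car GP" if "f : car ?P" for f
			unfolding F using mem[OF that] by (intro bprod_closed[OF s])
		fix f g assume fg: "f : car ?P" "g : car ?P"
		show "gp_product_map V E Gs Vs (f *[?P] g) = gp_product_map V E Gs Vs f *[GP] gp_product_map V E Gs Vs g"
			unfolding F by (rule bprod_mult[OF s]) (use mem fg in \<open>auto simp: gp_sub_simps\<close>)
	qed
	have inj: "inj_on (gp_product_map V E Gs Vs) (car ?P)"
	proof (rule inj_onI)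
		fix f g assume fg: "f : car ?P" "g : car ?P" and e: "gp_product_map V E Gs Vs f = gp_product_map V E Gs Vs g"
		show "f = g"
		proof (rule PiE_ext)
			show "f : (\<Pi>\<^sub>E i\<in>{..<length Vs}. Hb i)" "g : (\<Pi>\<^sub>E i\<in>{..<length Vs}. Hb i)" using fg unfolding car by auto
			fix i assume i: "i : {..<length Vs}"
			then have il: "i < length Vs" by simp
			have "ret i (bprod ?is f) = f i" using ret_bprod[OF il s _ mem[OF fg(1)]] i by simp
			moreover have "ret i (bprod ?is g) = g i" using ret_bprod[OF il s _ mem[OF fg(2)]] i by simp
			ultimately show "f i = g i" using e unfolding F by simp
		qed
	qed
	have single: "bprod is (\<lambda>j\<in>{..<length Vs}. if j = i then x else one[GP]) = (if i : set is then x else one[GP])"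
		if "x : car GP" "set is \<subseteq> {..<length Vs}" "distinct is" for x i "is"
		using that(2,3) by (induction "is") (use that(1) in auto)
	have "car GP \<subseteq> gp_product_map V E Gs Vs ` car ?P"
	proof
		fix x assume "x : car GP"
		then show "x : gp_product_map V E Gs Vs ` car ?P"
		proof (induction rule: GP_induct)
			case one
			have "one[GP] = gp_product_map V E Gs Vs one[?P]" using hom_one[OF hm gP group_GP] by simp
			then show ?case using monoid.one_closed[OF group.is_monoid[OF gP]] by (rule image_eqI)
		next
			case (mult v a Q)
			have "v : \<Union>(set Vs)" using mult(1) part by (simp add: is_vertex_partition_def)
			then obtain i where i: "i < length Vs" "v : Vs ! i" by (auto simp: in_set_conv_nth)
			let ?f = "\<lambda>j\<in>{..<length Vs}. if j = i then incl v a else one[GP]"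
			have "incl v a : letters (Vs ! i)" using i mult(2) by (auto simp: letters_def)
			then have "incl v a : Hb i" by (rule generate.incl)
			then have f: "?f : car ?P" unfolding car using generate.one[of GP] by auto
			have "gp_product_map V E Gs Vs ?f = incl v a" unfolding F using single[of "incl v a" ?is i] mult(1,2) i(1) s by simp
			moreover obtain g where g: "g : car ?P" "Q = gp_product_map V E Gs Vs g" using mult(4) by blast
			ultimately have "incl v a *[GP] Q = gp_product_map V E Gs Vs (?f *[?P] g)" using hom_mult[OF hm f g(1)] by simp
			moreover have "?f *[?P] g : car ?P" by (rule monoid.m_closed[OF group.is_monoid[OF gP] f g(1)])
			ultimately show ?case by (rule image_eqI)
		qed
	qed
	then have "gp_product_map V E Gs Vs ` car ?P = car GP" using hom_in_carrier[OF hm] by blast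
	then show ?thesis using hm inj by (simp add: iso_def bij_betw_def)
qed

end

lemma finite_abelian_pos_scl:
	assumes graph: "is_graph V E" and no_cone: "\<forall>v\<in>V. st E v ~= V"
		and Gs: "!!v. v : V ==> comm_group (Gs v)" "!!v. v : V ==> finite (car (Gs v))" "!!v. v : V ==> car (Gs v) ~= {one[Gs v]}"
		and split: "~ bad_splitting V E Gs"
	shows "has_pos_scl_aut GP"
proof (rule ccontr)
	assume no: "~ has_pos_scl_aut GP"
	have fin: "finite V" and V0: "V ~= {}" using graph by (auto simp: is_graph_def)
	have loop: "{v} \<notin> E" for v using graph unfolding is_graph_def by (metis doubleton_eq_iff insert_absorb2)
	have EV: "x : V & y : V" if "{x, y} : E" for x y using graph that unfolding is_graph_def by (metis doubleton_eq_iff)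
	have one: "one[Gs v] : car (Gs v)" if "v : V" for v using vertex_group[OF that] group.is_monoid monoid.one_closed by blast
	have ntr: "\<exists>c\<in>car (Gs v). c ~= one[Gs v]" if "v : V" for v using Gs(3)[OF that] one[OF that] by blast
	\<comment> \<open>By the cone condition \<open>u\<close> has a non-neighbour v. A third element of
	  the group at \<open>u\<close> would provide two different non-trivial elements for the pair {u},
	  {v}.\<close>
	have two: "\<exists>c. car (Gs u) = {one[Gs u], c} & c ~= one[Gs u]" if u: "u : V" for u
	proof -
		have "~ V \<subseteq> st E u" using no_cone u EV by (auto simp: st_def lk_def)
		then obtain v where v: "v : V" "v ~= u" "{u, v} \<notin> E" by (auto simp: st_def lk_def)
		obtain c where c: "c : car (Gs u)" "c ~= one[Gs u]" using ntr[OF u] by blast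
		obtain d where d: "d : car (Gs v)" "d ~= one[Gs v]" using ntr[OF v(1)] by blast
		have "x = c" if x: "x : car (Gs u)" "x ~= one[Gs u]" for x
		proof (rule ccontr)
			assume ne: "x ~= c"
			have fe: "(\<lambda>w\<in>{u}. p) ~= (\<lambda>w\<in>{u}. q)" if "p ~= q" for p q :: 'a
				using that by (metis restrict_apply' singletonI)
			have o: "(\<lambda>w\<in>{u}. one[Gs w]) = (\<lambda>w\<in>{u}. one[Gs u])" by (rule restrict_ext) simp
			have "has_pos_scl_aut GP"
				by (rule finite_abelian_pair[where S = "{u}" and T = "{v}" and ?v1.0 = u and ?x1.0 = c and ?v2.0 = v and ?x2.0 = d
						 and ?a0.0 = "\<lambda>w\<in>{u}. c" and ?a1.0 = "\<lambda>w\<in>{u}. x", OF fin])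
					 (use Gs u v c d x ne fe o in auto)
			then show False using no by simp
		qed
		then have "car (Gs u) = {one[Gs u], c}" using c(1) one[OF u] by blast
		then show ?thesis using c(2) by blast
	qed
	\<comment> \<open>For an edge u w with both ends not adjacent to v, the side {u, w} has two
	  different non-trivial elements even if all vertex groups have order two. Excluding this makes
	  non-adjacency transitive.\<close>
	have nop: "False" if uvw: "u : V" "w : V" "v : V" "{u, w} : E" "{u, v} \<notin> E" "{w, v} \<notin> E" "u ~= v" "w ~= v" for u w v
	proof -
		have uw: "u ~= w" using uvw(4) loop by auto
		obtain c where c: "c : car (Gs u)" "c ~= one[Gs u]" using ntr[OF uvw(1)] by blast
		obtain c' where c': "c' : car (Gs w)" "c' ~= one[Gs w]" using ntr[OF uvw(2)] by blast
		obtain d where d: "d : car (Gs v)" "d ~= one[Gs v]" using ntr[OF uvw(3)] by blast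
		define a0 where "a0 = (\<lambda>z\<in>{u, w}. if z = u then c else one[Gs z])"
		define a1 where "a1 = (\<lambda>z\<in>{u, w}. if z = w then c' else one[Gs z])"
		have v0: "a0 u = c" "a0 w = one[Gs w]" "a1 u = one[Gs u]" "a1 w = c'" using uw by (auto simp: a0_def a1_def)
		have a01: "a0 : (\<Pi>\<^sub>E v\<in>{u, w}. car (Gs v))" "a1 : (\<Pi>\<^sub>E v\<in>{u, w}. car (Gs v))"
			using c c' one uvw by (auto simp: a0_def a1_def)
		have "a0 u ~= (\<lambda>v\<in>{u, w}. one[Gs v]) u" "a1 w ~= (\<lambda>v\<in>{u, w}. one[Gs v]) w" "a0 u ~= a1 u" using v0 c c' by auto
		then have ne: "a0 ~= (\<lambda>v\<in>{u, w}. one[Gs v])" "a1 ~= (\<lambda>v\<in>{u, w}. one[Gs v])" "a0 ~= a1" by metis+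
		have wu: "{w, u} : E" using uvw(4) by (simp add: insert_commute)
		have "has_pos_scl_aut GP"
			by (rule finite_abelian_pair[where S = "{u, w}" and T = "{v}" and ?v1.0 = u and ?x1.0 = c and ?v2.0 = v and ?x2.0 = d
					 and ?a0.0 = a0 and ?a1.0 = a1, OF fin])
				 (use Gs uvw wu c d ne a01 in auto)
		then show False using no by simp
	qed
	define R where "R u v \<longleftrightarrow> u = v | {u, v} \<notin> E" for u v
	have Rs: "R v u" if "R u v" for u v using that by (auto simp: R_def insert_commute)
	have Rt: "R u w" if "u : V" "v : V" "w : V" "R u v" "R v w" for u v w
		using nop[of u w v] that by (auto simp: R_def insert_commute)
	define C where "C v = {u : V. R v u}" for v
	obtain Vs where Vs: "set Vs = C ` V" "distinct Vs" using finite_distinct_list[of "C ` V"] fin by blast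
	have Ci: "\<exists>v\<in>V. Vs ! i = C v" if "i < length Vs" for i using that nth_mem Vs(1) by (metis imageE)
	have dis: "x \<notin> C w" if "v : V" "w : V" "C v ~= C w" "x : C v" for v w x
	proof
		assume "x : C w"
		then have "x : V" "R w x" "R v x" using that(4) by (auto simp: C_def)
		then have "R v w" using Rt[of v x w] Rs that(1,2) by blast
		then have "C v = C w" unfolding C_def using Rt Rs that(1,2) by blast
		then show False using that(3) by blast
	qed
	have self: "v : C v" if "v : V" for v using that by (simp add: C_def R_def)
	have ijne: "Vs ! i ~= Vs ! j" if "i < length Vs" "j < length Vs" "i ~= j" for i j using that Vs(2) by (simp add: nth_eq_iff_index_eq)
	have part: "is_vertex_partition V Vs" unfolding is_vertex_partition_def
	proof (intro conjI allI impI ballI)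
		show "1 <= length Vs" using V0 Vs(1) by (cases Vs) auto
		show "P ~= {}" if "P : set Vs" for P using that Vs(1) self by blast
		show "Vs ! i \<inter> Vs ! j = {}" if ij: "i < length Vs" "j < length Vs" "i ~= j" for i j
		proof -
			obtain v w where "v : V" "w : V" "Vs ! i = C v" "Vs ! j = C w" using Ci[OF ij(1)] Ci[OF ij(2)] by blast
			then show ?thesis using dis[of v w] ijne[OF ij] by auto
		qed
		show "\<Union>(set Vs) = V" using Vs(1) self by (auto simp: C_def)
	qed
	have joined: "{v, w} : E" if ij: "i < length Vs" "j < length Vs" "i ~= j" and vw: "v : Vs ! i" "w : Vs ! j" for i j v w
	proof (rule ccontr)
		assume "{v, w} \<notin> E"
		then have "R v w" by (simp add: R_def)
		obtain p q where pq: "p : V" "q : V" "Vs ! i = C p" "Vs ! j = C q" using Ci[OF ij(1)] Ci[OF ij(2)] by blast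
		have "R p v" "R q w" "v : V" "w : V" using vw pq by (auto simp: C_def)
		then have "R p w" using Rt[OF pq(1), of v w] \<open>R v w\<close> by blast
		then have "w : C p" using \<open>w : V\<close> by (simp add: C_def)
		then show False using dis[OF pq(1,2)] ijne[OF ij] pq vw(2) by auto
	qed
	have "\<exists>k\<ge>1. gp_sub V E Gs (Vs ! i) \<cong> Zk_grp k" if i: "i < length Vs" for i
	proof -
		obtain p where p: "p : V" "Vs ! i = C p" using Ci[OF i] by blast
		have CV: "C p \<subseteq> V" "finite (C p)" using fin by (auto simp: C_def)
		obtain f where f: "bij_betw f (C p) {..<card (C p)}" using ex_bij_betw_finite_nat[OF CV(2)] by (auto simp: atLeast0LessThan)
		have nE: "{v, w} \<notin> E" if "v : C p" "w : C p" for v w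
		proof (cases "v = w")
			case False
			have "R p v" "R p w" "v : V" "w : V" using that by (auto simp: C_def)
			then have "R v w" using Rt[of v p w] Rs p(1) by blast
			then show ?thesis using False by (simp add: R_def)
		qed (use loop in simp)
		have "gp_sub V E Gs (C p) \<cong> graph_product {..<card (C p)} {} (%_. integer_mod_group 2)"
		proof (rule gp_sub_discrete[OF CV(1) nE f, where h = "%v x. if x = one[Gs v] then 0 else 1"])
			show "group (integer_mod_group 2)" by simp
			fix v assume "v : C p"
			then have v: "v : V" using CV(1) by blast
			obtain c where "car (Gs v) = {one[Gs v], c}" "c ~= one[Gs v]" using two[OF v] by blast
			then show "(%x. if x = one[Gs v] then 0 else 1) : iso (Gs v) (integer_mod_group 2)" using order_two_iso[OF vertex_group[OF v]] by blast
		qed auto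
		moreover have "card (C p) \<ge> 1" using self[OF p(1)] CV(2) by (metis One_nat_def Suc_leI card_gt_0_iff empty_iff)
		ultimately show ?thesis unfolding p(2) Zk_grp_def by blast
	qed
	then have "bad_splitting V E Gs" unfolding bad_splitting_def using part product_map_iso[OF part joined] by (intro exI[of _ Vs]) auto
	then show False using split by simp
qed

end

section \<open>Nielsen reduction in the free group of rank two\<close>

fun lcp :: "'l list => 'l list => nat" where
	"lcp (x # p) (y # q) = (if x = y then Suc (lcp p q) else 0)"
| "lcp _ _ = 0"

lemma lcp_Nil2 [simp]: "lcp p [] = 0" by (cases p) auto
lemma lcp_comm: "lcp p q = lcp q p" by (induction p q rule: lcp.induct) auto
lemma lcp_le: "lcp p q <= length p" "lcp p q <= length q" by (induction p q rule: lcp.induct) auto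
lemma lcp_take: "take (lcp p q) p = take (lcp p q) q" by (induction p q rule: lcp.induct) auto

lemma lcp_prefix: "lcp p (t @ k) < length t ==> lcp p (t @ w) = lcp p (t @ k)"
proof (induction t arbitrary: p)
	case (Cons x t) then show ?case by (cases p) (auto split: if_splits)
qed simp

lemma lcp_append_eq: "lcp (p @ q) (p @ r) = length p + lcp q r" by (induction p) auto

locale letter_inverse =
	fixes linv :: "'l => 'l"
	assumes linv_linv [simp]: "linv (linv l) = l" and linv_ne [simp]: "linv l ~= l"
begin

definition red :: "'l list => bool" where "red = successively (%x y. y ~= linv x)"

lemma red_Nil [simp]: "red []" by (simp add: red_def)
lemma red_Cons: "red (x # w) \<longleftrightarrow> (w ~= [] --> hd w ~= linv x) & red w" by (cases w) (auto simp: red_def)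
lemma red_append: "red (u @ w) \<longleftrightarrow> red u & red w & (u ~= [] --> w ~= [] --> hd w ~= linv (last u))"
	by (auto simp: red_def successively_append_iff)
lemma red_nth: "red w ==> Suc i < length w ==> w ! Suc i ~= linv (w ! i)"
	by (simp add: red_def successively_conv_nth)

definition rinv :: "'l list => 'l list" where "rinv w = rev (map linv w)"

lemma rinv_simps [simp]: "rinv [] = []" "rinv (x # w) = rinv w @ [linv x]" "rinv (u @ w) = rinv w @ rinv u"
	"length (rinv w) = length w" "rinv w = [] \<longleftrightarrow> w = []"
	by (simp_all add: rinv_def)

lemma rinv_rinv [simp]: "rinv (rinv w) = w" by (induction w) auto

lemma rinv_take_rinv:
	assumes "h <= length w"
	shows "rinv (take h (rinv w)) = drop (length w - h) w"
proof -
	have "rinv w = rinv (drop (length w - h) w) @ rinv (take (length w - h) w)"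
		by (simp only: rinv_simps(3)[symmetric] append_take_drop_id)
	then have "take h (rinv w) = rinv (drop (length w - h) w)" using assms by simp
	then show ?thesis by simp
qed

lemma last_rinv: "w ~= [] ==> last (rinv w) = linv (hd w)" by (cases w) auto

lemma red_rinv: "red w ==> red (rinv w)"
proof (induction w)
	case (Cons x w)
	have "linv x ~= hd w" if "w ~= []" using Cons.prems that linv_linv by (auto simp: red_Cons)
	then show ?case using Cons by (auto simp: red_Cons red_append last_rinv)
qed simp

definition act :: "'l => 'l list => 'l list" where
	"act l w = (if w ~= [] & hd w = linv l then tl w else l # w)"

lemma red_act: "red w ==> red (act l w)" by (cases w) (auto simp: act_def red_Cons)

text \<open>Letters of \<open>u\<close> cancel exactly along the common prefix of its inverse with
  \<open>w\<close>: as \<open>u\<close> is reduced, cancellation cannot resume after a letter that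
  survives.\<close>

lemma foldr_act:
	assumes "red u" "red w"
	shows "foldr act u w = take (length u - lcp (rinv u) w) u @ drop (lcp (rinv u) w) w"
	using assms(1)
proof (induction u)
	case (Cons x u)
	let ?c = "lcp (rinv u) w"
	have IH: "foldr act u w = take (length u - ?c) u @ drop ?c w" using Cons by (simp add: red_Cons)
	have cu: "?c <= length u" using lcp_le(1)[of "rinv u" w] by simp
	show ?case
	proof (cases "?c < length u")
		case True
		have "lcp w (rinv u @ [linv x]) = lcp w (rinv u @ [])" using True by (intro lcp_prefix) (simp add: lcp_comm)
		then have c: "lcp (rinv (x # u)) w = ?c" by (simp add: lcp_comm)
		have "take (length u - ?c) u ~= []" "hd (take (length u - ?c) u) = hd u" using True by auto
		moreover have "hd u ~= linv x" using Cons.prems True by (auto simp: red_Cons)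
		ultimately have "act x (take (length u - ?c) u @ drop ?c w) = x # take (length u - ?c) u @ drop ?c w" by (simp add: act_def)
		then show ?thesis using IH c True by (simp add: Suc_diff_le)
	next
		case False
		then have e: "?c = length u" using cu by simp
		have "take (length u) w = rinv u" using lcp_take[of "rinv u" w] e by simp
		then obtain w' where w: "w = rinv u @ w'" by (metis append_take_drop_id)
		have c: "lcp (rinv (x # u)) w = length u + lcp [linv x] w'" unfolding w by (simp add: lcp_append_eq)
		have "foldr act (x # u) w = act x w'" using IH e w by simp
		also have "\<dots> = take (1 - lcp [linv x] w') [x] @ drop (lcp [linv x] w') w'" by (cases w') (auto simp: act_def)
		finally show ?thesis unfolding c using w lcp_le(1)[of "[linv x]" w'] by (cases "lcp [linv x] w'") auto
	qed
qed simp

lemma length_foldr_act: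
	assumes "red u" "red w"
	shows "length (foldr act u w) + 2 * lcp (rinv u) w = length u + length w"
	using foldr_act[OF assms] lcp_le[of "rinv u" w] by simp

text \<open>If half of x cancelled in x x, letters symmetric about the centre of x would be mutually
  inverse. At the centre this yields a letter equal to its own inverse or two adjacent inverse
  letters.\<close>

lemma lcp_self:
	assumes "red x" "x ~= []"
	shows "2 * lcp (rinv x) x < length x"
proof (rule ccontr)
	let ?c = "lcp (rinv x) x" and ?n = "length x"
	assume "~ 2 * ?c < ?n"
	then have c: "?n <= 2 * ?c" by simp
	have sym: "linv (x ! (?n - 1 - i)) = x ! i" if "i < ?c" for i
	proof -
		have i: "i < ?n" using that lcp_le(2)[of "rinv x" x] by simp
		have "take ?c (rinv x) ! i = take ?c x ! i" by (simp only: lcp_take)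
		then have "rinv x ! i = x ! i" using that by simp
		moreover have "rinv x ! i = linv (x ! (?n - 1 - i))" using i by (simp add: rinv_def rev_nth)
		ultimately show ?thesis by simp
	qed
	show False
	proof (cases "even ?n")
		case True
		then obtain m where m: "?n = 2 * m" by blast
		then have "m > 0" using assms(2) by (cases m) auto
		then have "linv (x ! m) = x ! (m - 1)" using sym[of "m - 1"] c m by (simp add: Suc_diff_Suc numeral_2_eq_2)
		then have "x ! Suc (m - 1) = linv (x ! (m - 1))" using \<open>m > 0\<close> by (metis Suc_diff_1 linv_linv)
		then show False using red_nth[OF assms(1), of "m - 1"] m \<open>m > 0\<close> by simp
	next
		case False
		then obtain m where m: "?n = 2 * m + 1" using oddE by blast
		then show False using sym[of m] c by simp
	qed
qed

end

section \<open>Letter words in the free group of rank two\<close>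

definition linv2 :: "bool \<times> bool => bool \<times> bool" where "linv2 l = (fst l, ~ snd l)"

global_interpretation FL: letter_inverse linv2
	by (rule letter_inverse.intro) (simp_all add: linv2_def prod_eq_iff)

lemma F2_incl_inv: "inv[F2] F2_incl i n = F2_incl i (- n)"
proof (rule Y.GP.inv_equality)
	show "F2_incl i (- n) *[F2] F2_incl i n = one[F2]" using Y.incl_mult[of i "- n" n] Y.incl_one[of i] by simp
qed simp_all

definition gl :: "bool \<times> bool => (bool \<times> int) list set" where
	"gl l = F2_incl (fst l) (if snd l then 1 else - 1)"

lemma gl_closed [simp]: "gl l : car F2" by (simp add: gl_def)
lemma gl_linv: "gl (linv2 l) = inv[F2] gl l" by (simp add: gl_def linv2_def F2_incl_inv)

definition evl :: "(bool \<times> bool) list => (bool \<times> int) list set" where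
	"evl w = foldr (%l g. gl l *[F2] g) w one[F2]"

lemma evl_simps [simp]: "evl [] = one[F2]" "evl (l # w) = gl l *[F2] evl w" by (simp_all add: evl_def)
lemma evl_closed [simp]: "evl w : car F2" by (induction w) auto
lemma evl_append: "evl (u @ w) = evl u *[F2] evl w" by (induction u) (auto simp: Y.GP.m_assoc)
lemma evl_rinv: "evl (FL.rinv w) = inv[F2] evl w"
	by (induction w) (auto simp: evl_append gl_linv Y.GP.inv_mult_group)

lemma evl_act: "evl (FL.act l w) = gl l *[F2] evl w"
proof (cases "w ~= [] & hd w = linv2 l")
	case True
	then obtain w' where "w = linv2 l # w'" by (cases w) auto
	then show ?thesis by (simp add: FL.act_def gl_linv Y.GP.inv_cancel)
qed (auto simp: FL.act_def)

definition ex :: "bool \<times> int => (bool \<times> bool) list" where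
	"ex x = replicate (nat \<bar>snd x\<bar>) (fst x, snd x > 0)"

text \<open>Nielsen length counts letters, while \<open>nf\<close> counts syllables; each syllable
  is expanded into unit letters.\<close>

definition lw :: "(bool \<times> int) list set => (bool \<times> bool) list" where
	"lw g = concat (map ex (Y.nf g))"

lemma ex_act:
	assumes "m ~= 0"
	shows "FL.act (i, s) (ex (i, m) @ r) = ex (i, (if s then 1 else - 1) + m) @ r"
proof (cases "m > 0")
	case True
	then obtain k where k: "m = int k + 1" using zero_less_imp_eq_int[of m] by (metis Suc_pred add.commute of_nat_0_less_iff of_nat_Suc)
	have e: "ex (i, m) = (i, True) # replicate k (i, True)" using k by (simp add: ex_def nat_add_distrib)
	show ?thesis
	proof (cases s)
		case True
		have "ex (i, 1 + m) = (i, True) # (i, True) # replicate k (i, True)" using k by (simp add: ex_def nat_add_distrib)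
		then show ?thesis using e True by (simp add: FL.act_def linv2_def)
	next
		case False
		have "ex (i, - 1 + m) = replicate k (i, True)" using k by (cases k) (simp_all add: ex_def nat_add_distrib)
		then show ?thesis using e False by (simp add: FL.act_def linv2_def)
	qed
next
	case F: False
	then have "- m > 0" using assms by simp
	then obtain k where k: "m = - int k - 1" using zero_less_imp_eq_int[of "- m"] by (metis Suc_pred add.commute add.inverse_inverse minus_add_distrib of_nat_0_less_iff of_nat_Suc uminus_add_conv_diff)
	have e: "ex (i, m) = (i, False) # replicate k (i, False)" using k by (simp add: ex_def nat_add_distrib)
	show ?thesis
	proof (cases s)
		case True
		have "ex (i, 1 + m) = replicate k (i, False)" using k by (cases k) (simp_all add: ex_def nat_add_distrib)
		then show ?thesis using e True by (simp add: FL.act_def linv2_def)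
	next
		case False
		have "ex (i, - 1 + m) = (i, False) # (i, False) # replicate k (i, False)" using k by (simp add: ex_def nat_add_distrib)
		then show ?thesis using e False by (simp add: FL.act_def linv2_def)
	qed
qed

lemma lw_gl:
	assumes g: "g : car F2"
	shows "lw (gl l *[F2] g) = FL.act l (lw g)"
proof -
	obtain i s where l: "l = (i, s)" by (cases l)
	define n :: int where "n = (if s then 1 else - 1)"
	have n: "n ~= 0" by (simp add: n_def)
	have gn: "gl l = F2_incl i n" by (simp add: gl_def l n_def)
	have e1: "ex (i, n) = [(i, s)]" by (simp add: ex_def n_def)
	have nf: "Y.nf (gl l *[F2] g) = Y.lact (i, n) (Y.nf g)"
		unfolding gn using g n Y.nf_mult[of "F2_incl i n" g] Y.incl_nf[of n i] by simp
	have r: "Y.rw (Y.nf g)" using g by (rule Y.nf_rw)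
	show ?thesis
	proof (cases "Y.nf g")
		case Nil
		have "Y.lact (i, n) [] = [(i, n)]" using n by (simp add: Y.lact_def)
		then show ?thesis unfolding lw_def nf Nil using e1 l by (simp add: FL.act_def)
	next
		case (Cons x w)
		obtain j m where x: "x = (j, m)" by (cases x)
		have m: "m ~= 0" using r Cons x by (simp add: Y.rw_Cons)
		show ?thesis
		proof (cases "i = j")
			case True
			have "concat (map ex (Y.lact (i, n) (x # w))) = ex (i, n + m) @ concat (map ex w)"
				using n x True by (simp add: Y.lact_def ex_def)
			then show ?thesis unfolding lw_def nf Cons using ex_act[OF m, of i s "concat (map ex w)"] x True l n_def by simp
		next
			case False
			have a: "Y.lact (i, n) (x # w) = (i, n) # x # w" using n x False by (simp add: Y.lact_def)
			obtain k where k: "nat \<bar>m\<bar> = Suc k" using m by (cases "nat \<bar>m\<bar>") auto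
			have h: "ex x = (j, m > 0) # replicate k (j, m > 0)" using x k by (simp add: ex_def)
			have "(j, m > 0) ~= linv2 l" using l False by (simp add: linv2_def)
			then show ?thesis unfolding lw_def nf Cons a using e1 l h by (simp add: FL.act_def)
		qed
	qed
qed

lemma F2_letter_induct [consumes 1, case_names one letter]:
	assumes "g : car F2" "P one[F2]" "!!l g. g : car F2 ==> P g ==> P (gl l *[F2] g)"
	shows "P g"
	using assms(1)
proof (induction rule: Y.GP_induct)
	case one then show ?case by (rule assms(2))
next
	case (mult i n Q)
	have step: "P (F2_incl i (of_int e * int k) *[F2] Q)" if "e = (if s then 1 else - 1)" for e k s
	proof (induction k)
		case 0 show ?case using mult(3,4) Y.incl_one[of i] by simp
	next
		case (Suc k)
		have "F2_incl i (of_int e * int (Suc k)) = gl (i, s) *[F2] F2_incl i (of_int e * int k)"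
			using that Y.incl_mult[of i e "of_int e * int k"] by (simp add: gl_def algebra_simps)
		then have "F2_incl i (of_int e * int (Suc k)) *[F2] Q = gl (i, s) *[F2] (F2_incl i (of_int e * int k) *[F2] Q)"
			using mult(3) by (simp add: Y.GP.m_assoc)
		then show ?case using assms(3)[OF _ Suc, of "(i, s)"] mult(3) by simp
	qed
	show ?case
	proof (cases "n \<ge> 0")
		case True then show ?thesis using step[of 1 True "nat n"] by simp
	next
		case False then show ?thesis using step[of "- 1" False "nat (- n)"] by simp
	qed
qed

lemma red_lw: "g : car F2 ==> FL.red (lw g)"
proof (induction rule: F2_letter_induct)
	case one then show ?case by (simp add: lw_def)
qed (simp add: lw_gl FL.red_act)

lemma evl_lw: "g : car F2 ==> evl (lw g) = g"
proof (induction rule: F2_letter_induct)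
	case one then show ?case by (simp add: lw_def)
qed (simp add: lw_gl evl_act)

lemma lw_one [simp]: "lw one[F2] = []" by (simp add: lw_def)

lemma lw_evl: "FL.red w ==> lw (evl w) = w"
proof (induction w)
	case (Cons x w) then show ?case by (auto simp: lw_gl FL.red_Cons FL.act_def)
qed simp

lemma lw_mult: "g : car F2 ==> h : car F2 ==> lw (g *[F2] h) = foldr FL.act (lw g) (lw h)"
proof -
	assume g: "g : car F2" and h: "h : car F2"
	have "lw (evl u *[F2] h) = foldr FL.act u (lw h)" for u
		by (induction u) (use h in \<open>auto simp: Y.GP.m_assoc lw_gl\<close>)
	then show ?thesis using evl_lw[OF g] by metis
qed

lemma lw_inv: "g : car F2 ==> lw (inv[F2] g) = FL.rinv (lw g)"
proof -
	assume g: "g : car F2"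
	show ?thesis using lw_evl[OF FL.red_rinv[OF red_lw[OF g]]] evl_rinv[of "lw g"] evl_lw[OF g] by simp
qed

abbreviation "llen g \<equiv> length (lw g)"

lemma llen_evl: "llen (evl w) <= length w"
proof (induction w)
	case (Cons x w) then show ?case by (auto simp: lw_gl FL.act_def)
qed simp

definition canc :: "(bool \<times> int) list set => (bool \<times> int) list set => nat" where
	"canc p q = lcp (FL.rinv (lw p)) (lw q)"

lemma llen_mult: "p : car F2 ==> q : car F2 ==> llen (p *[F2] q) + 2 * canc p q = llen p + llen q"
proof -
	assume p: "p : car F2" and q: "q : car F2"
	show ?thesis unfolding canc_def lw_mult[OF p q] by (rule FL.length_foldr_act[OF red_lw[OF p] red_lw[OF q]])
qed

lemma llen_zero: "p : car F2 ==> llen p = 0 \<longleftrightarrow> p = one[F2]"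
proof
	assume p: "p : car F2" and "llen p = 0"
	then show "p = one[F2]" using evl_lw[OF p] by simp
qed simp

lemma not_successivelyE:
	assumes "~ successively P xs"
	shows "\<exists>us p q vs. xs = us @ p # q # vs & ~ P p q"
	using assms
proof (induction xs)
	case (Cons x xs)
	show ?case
	proof (cases "successively P xs")
		case True
		then obtain y ys where "xs = y # ys" "~ P x y" using Cons.prems by (cases xs) auto
		then have "x # xs = [] @ x # y # ys & ~ P x y" by simp
		then show ?thesis by blast
	next
		case False
		then obtain us p q vs where "xs = us @ p # q # vs" "~ P p q" using Cons.IH by blast
		then have "x # xs = (x # us) @ p # q # vs & ~ P p q" by simp
		then show ?thesis by blast
	qed
qed simp

text \<open>Generation expressed through subgroups: a Nielsen move is checked by recovering the old
  pair inside any subgroup that contains the new one (\<open>full_pairI\<close>).\<close>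

definition full_pair :: "(bool \<times> int) list set => (bool \<times> int) list set => bool" where
	"full_pair x y \<longleftrightarrow> x : car F2 & y : car F2 & (\<forall>L. subgroup L F2 --> x : L --> y : L --> L = car F2)"

lemma full_pairD: "full_pair x y ==> subgroup L F2 ==> x : L ==> y : L ==> L = car F2"
	by (simp add: full_pair_def)

lemma full_pairI:
	assumes "full_pair x y" "p : car F2" "q : car F2"
		"!!L. subgroup L F2 ==> p : L ==> q : L ==> x : L & y : L"
	shows "full_pair p q"
	unfolding full_pair_def using assms(2,3,4) full_pairD[OF assms(1)] by simp

context
	fixes Q :: "(bool \<times> int) list set => (bool \<times> int) list set => bool"
	assumes swap: "!!x y. x : car F2 ==> y : car F2 ==> Q x y ==> Q y x"
		and invQ: "!!x y. x : car F2 ==> y : car F2 ==> Q x y ==> Q (inv[F2] x) y"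
		and multQ: "!!x y. x : car F2 ==> y : car F2 ==> Q x y ==> Q (x *[F2] y) y"
		and conjQ: "!!g x y. g : car F2 ==> x : car F2 ==> y : car F2 ==> Q x y ==>
			 Q (g *[F2] x *[F2] inv[F2] g) (g *[F2] y *[F2] inv[F2] g)"
		and baseQ: "Q (gl (True, True)) (gl (False, True))"
begin

private lemma invQ2: "x : car F2 ==> y : car F2 ==> Q x y ==> Q x (inv[F2] y)"
	by (rule swap[OF _ _ invQ[OF _ _ swap]]) simp_all

private lemma multQ': "x : car F2 ==> y : car F2 ==> Q x y ==> Q (x *[F2] inv[F2] y) y"
	using invQ2[OF _ _ multQ[OF _ _ invQ2], of x y] by simp

context
	fixes N :: nat
	assumes IH: "!!x y. llen x + llen y < N ==> full_pair x y ==> Q x y"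
begin

text \<open>A counterexample of total length N, while all shorter generating pairs are settled by
  \<open>IH\<close>.\<close>

private definition bad where "bad p q \<longleftrightarrow> full_pair p q & ~ Q p q & llen p + llen q = N"

private lemma bad_carrier: "bad p q ==> p : car F2 & q : car F2" by (simp add: bad_def full_pair_def)

private lemma bad_swap: "bad p q ==> bad q p"
	using swap[of q p] unfolding bad_def full_pair_def by auto

private lemma bad_inv: assumes "bad p q" shows "bad (inv[F2] p) q"
proof -
	have c: "p : car F2" "q : car F2" using bad_carrier[OF assms] by auto
	have f: "full_pair p q" using assms by (simp add: bad_def)
	have "full_pair (inv[F2] p) q"
	proof (rule full_pairI[OF f])
		fix L assume L: "subgroup L F2" "inv[F2] p : L" "q : L"
		then show "p : L & q : L" using subgroup.m_inv_closed[OF L(1,2)] c by simp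
	qed (use c in auto)
	moreover have "~ Q (inv[F2] p) q" using invQ[of "inv[F2] p" q] c assms by (auto simp: bad_def)
	ultimately show ?thesis using assms c by (simp add: bad_def lw_inv)
qed

private lemma bad_inv2: "bad p q ==> bad p (inv[F2] q)" using bad_swap bad_inv by blast

private lemma bad_len: assumes "bad p q" shows "llen p <= llen (p *[F2] q)"
proof (rule ccontr)
	assume "~ llen p <= llen (p *[F2] q)"
	then have l: "llen (p *[F2] q) + llen q < N" using assms by (simp add: bad_def)
	have c: "p : car F2" "q : car F2" using bad_carrier[OF assms] by auto
	have f: "full_pair p q" using assms by (simp add: bad_def)
	have e: "p *[F2] q *[F2] inv[F2] q = p" using c by (simp add: Y.GP.m_assoc)
	have "full_pair (p *[F2] q) q"
	proof (rule full_pairI[OF f])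
		fix L assume L: "subgroup L F2" "p *[F2] q : L" "q : L"
		then show "p : L & q : L" using subgroup.m_closed[OF L(1,2) subgroup.m_inv_closed[OF L(1,3)]] e by simp
	qed (use c in auto)
	from multQ'[OF _ _ IH[OF l this]] show False using c e assms by (simp add: bad_def)
qed

text \<open>\<open>bad_len\<close> for the pair and for the exchanged pair of inverses shows that
  the product is at least as long as either factor.\<close>

private lemma bad_canc: assumes "bad p q" shows "2 * canc p q <= llen p" "2 * canc p q <= llen q"
proof -
	have c: "p : car F2" "q : car F2" using bad_carrier[OF assms] by auto
	have "bad (inv[F2] q) (inv[F2] p)" by (rule bad_inv[OF bad_inv2[OF bad_swap[OF assms]]])
	from bad_len[OF this] have "llen (inv[F2] q) <= llen (inv[F2] (p *[F2] q))" using c by (simp add: Y.GP.inv_mult_group)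
	then have "llen q <= llen (p *[F2] q)" using c by (simp add: lw_inv)
	then show "2 * canc p q <= llen p" "2 * canc p q <= llen q" using llen_mult[OF c] bad_len[OF assms] by linarith+
qed

private lemma bad_ne: assumes "bad p q" shows "lw p ~= []"
proof
	assume "lw p = []"
	have c: "p : car F2" "q : car F2" using bad_carrier[OF assms] by auto
	have f: "full_pair p q" using assms by (simp add: bad_def)
	have p1: "p = one[F2]" using llen_zero[OF c(1)] \<open>lw p = []\<close> by simp
	let ?a = "gl (True, True)" and ?b = "gl (False, True)"
	have qs: "{q} \<subseteq> car F2" using c by simp
	have gen: "generate F2 {q} = car F2"
		by (rule full_pairD[OF f Y.GP.generate_is_subgroup[OF qs]]) (auto simp: p1 intro: generate.one generate.incl)
	have "?b *[F2] ?a = ?a *[F2] ?b" by (rule Y.GP.generate_commute[OF qs qs]) (simp_all add: gen)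
	then have "evl [(False, True), (True, True)] = evl [(True, True), (False, True)]" by simp
	then have "lw (evl [(False, True), (True, True)]) = lw (evl [(True, True), (False, True)])" by simp
	moreover have "FL.red [(False, True), (True, True)]" "FL.red [(True, True), (False, True)]" by (simp_all add: FL.red_Cons linv2_def)
	ultimately show False by (simp add: lw_evl del: evl_simps)
qed

text \<open>A product \<open>p q r\<close> in which \<open>q\<close> cancels completely would have to cancel exactly half of \<open>q\<close> on either side;
	then \<open>p = r\<close>, and a Nielsen move followed by a conjugation shortens the pair.\<close>
private lemma bad_triple:
	assumes b: "bad p q" and r: "r = p | r = inv[F2] p"
	shows "canc p q + canc q r < llen q"
proof (rule ccontr)
	assume "~ canc p q + canc q r < llen q"
	then have ge: "llen q <= canc p q + canc q r" by simp
	have c: "p : car F2" "q : car F2" using bad_carrier[OF b] by auto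
	have bqr: "bad q r" using r bad_swap[OF b] bad_inv2[OF bad_swap[OF b]] by auto
	define h where "h = canc p q"
	have h: "canc q r = h" "llen q = 2 * h" "2 * h <= llen p"
		using ge bad_canc[OF b] bad_canc[OF bqr] by (auto simp: h_def)
	have h0: "h > 0" using bad_ne[OF bad_swap[OF b]] h(2) by (cases h) auto
	\<comment> \<open>The two halves of q: the first cancels against p, the second against r.\<close>
	define P where "P = take h (lw q)"
	define Q' where "Q' = drop h (lw q)"
	have q: "lw q = P @ Q'" "length P = h" "length Q' = h" using h(2) by (auto simp: P_def Q'_def)
	have tp: "take h (FL.rinv (lw p)) = P" using lcp_take[of "FL.rinv (lw p)" "lw q"] by (simp add: P_def h_def canc_def)
	have "take h (FL.rinv (lw q)) = take h (lw r)" using lcp_take[of "FL.rinv (lw q)" "lw r"] h(1) by (simp add: canc_def)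
	then have tr: "take h (lw r) = FL.rinv Q'" using q by simp
	have Q0: "Q' ~= []" "P ~= []" using q h0 by auto
	from r show False
	proof
		\<comment> \<open>Both halves face the same letters of p, so q would be P followed by its inverse,
		  which is not reduced.\<close>
		assume "r = inv[F2] p"
		then have "P = FL.rinv Q'" using tp tr c by (simp add: lw_inv)
		moreover have "hd Q' ~= linv2 (last P)" using red_lw[OF c(2)] q(1) Q0 by (simp add: FL.red_append)
		ultimately show False using Q0 by (simp add: FL.last_rinv)
	next
		assume rp: "r = p"
		\<comment> \<open>Now p = Q'^-1 s P^-1. With qq = Q'^-1, the product p q is the conjugate of s by
		  qq, and q is the conjugate by qq of the rotated word Q' P. The pair formed by s and Q' P has
		  total length at most the length of p, which is below N.\<close>
		define s where "s = drop h (take (llen p - h) (lw p))"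
		have sl: "length s = llen p - 2 * h" using h(3) by (simp add: s_def)
		have "FL.rinv (take h (FL.rinv (lw p))) = drop (llen p - h) (lw p)" using h(3) by (intro FL.rinv_take_rinv) simp
		then have dp: "drop (llen p - h) (lw p) = FL.rinv P" using tp by simp
		have "lw p = take h (take (llen p - h) (lw p)) @ s @ drop (llen p - h) (lw p)"
			unfolding s_def by (simp only: append_assoc[symmetric] append_take_drop_id)
		moreover have "take h (take (llen p - h) (lw p)) = FL.rinv Q'" using tr rp h(3) by (auto simp: min_def)
		ultimately have p: "lw p = FL.rinv Q' @ s @ FL.rinv P" using dp by simp
		define qq pp ss where "qq = evl (FL.rinv Q')" and "pp = evl P" and "ss = evl s"
		have cl: "qq : car F2" "pp : car F2" "ss : car F2" by (simp_all add: qq_def pp_def ss_def)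
		have pe: "p = qq *[F2] ss *[F2] inv[F2] pp"
			using evl_lw[OF c(1)] p by (simp add: evl_append evl_rinv qq_def pp_def ss_def Y.GP.m_assoc)
		have Qe: "evl Q' = inv[F2] qq" by (simp add: qq_def evl_rinv)
		have qe: "q = pp *[F2] inv[F2] qq" using evl_lw[OF c(2)] q(1) Qe by (simp add: evl_append pp_def)
		define z where "z = inv[F2] qq *[F2] pp"
		have zc: "z : car F2" using cl by (simp add: z_def)
		have "z = evl (Q' @ P)" using Qe by (simp add: z_def evl_append pp_def)
		then have zl: "llen z <= 2 * h" using llen_evl[of "Q' @ P"] q by simp
		have "llen ss <= llen p - 2 * h" using llen_evl[of s] sl by (simp add: ss_def)
		moreover have "llen p + llen q = N" using b by (simp add: bad_def)
		ultimately have lt: "llen ss + llen z < N" using zl h h0 by linarith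
		have qz: "q = qq *[F2] z *[F2] inv[F2] qq" using cl by (simp add: qe z_def Y.GP.m_assoc Y.GP.inv_cancel)
		have pz: "p = (qq *[F2] ss *[F2] inv[F2] qq) *[F2] inv[F2] q"
			unfolding pe qe using cl by (simp add: Y.GP.m_assoc Y.GP.inv_cancel Y.GP.inv_mult_group)
		have "full_pair ss z" unfolding full_pair_def
		proof (intro conjI allI impI)
			fix L assume L: "subgroup L F2" "ss : L" "z : L"
			interpret L: subgroup L F2 by (rule L)
			let ?M = "{g : car F2. inv[F2] qq *[F2] g *[F2] qq : L}"
			have M: "subgroup ?M F2"
			proof (rule Y.GP.subgroupI)
				have "one[F2] : ?M" using cl L.one_closed by simp
				then show "?M ~= {}" by blast
				fix g assume g: "g : ?M"
				have "inv[F2] qq *[F2] inv[F2] g *[F2] qq = inv[F2] (inv[F2] qq *[F2] g *[F2] qq)"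
					using g cl by (simp add: Y.GP.inv_mult_group Y.GP.m_assoc)
				then show "inv[F2] g : ?M" using g L.m_inv_closed by simp
				fix h assume h: "h : ?M"
				have "inv[F2] qq *[F2] (g *[F2] h) *[F2] qq = (inv[F2] qq *[F2] g *[F2] qq) *[F2] (inv[F2] qq *[F2] h *[F2] qq)"
					using g h cl by (simp add: Y.GP.inv_cancel Y.GP.m_assoc)
				then show "g *[F2] h : ?M" using g h L.m_closed by simp
			qed auto
			have "inv[F2] qq *[F2] q *[F2] qq = z" unfolding qz using cl zc by (simp add: Y.GP.inv_cancel Y.GP.m_assoc)
			then have qM: "q : ?M" using c L(3) by simp
			have "inv[F2] qq *[F2] (qq *[F2] ss *[F2] inv[F2] qq) *[F2] qq = ss" using cl by (simp add: Y.GP.inv_cancel Y.GP.m_assoc)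
			then have "qq *[F2] ss *[F2] inv[F2] qq : ?M" using cl L(2) by simp
			then have "p : ?M" unfolding pz by (rule subgroup.m_closed[OF M _ subgroup.m_inv_closed[OF M qM]])
			then have all: "?M = car F2" using qM M b full_pairD[of p q ?M] by (simp add: bad_def)
			show "L = car F2"
			proof
				show "car F2 \<subseteq> L"
				proof
					fix g assume g: "g : car F2"
					then have "qq *[F2] g *[F2] inv[F2] qq : ?M" using all cl by simp
					then have "inv[F2] qq *[F2] (qq *[F2] g *[F2] inv[F2] qq) *[F2] qq : L" by simp
					then show "g : L" using g cl by (simp add: Y.GP.inv_cancel Y.GP.m_assoc)
				qed
			qed (rule L.subset)
		qed (use cl zc in auto)
		from conjQ[OF cl(1) cl(3) zc IH[OF lt this]]
		have "Q (qq *[F2] ss *[F2] inv[F2] qq) q" using qz by simp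
		then have "Q p q" using multQ'[of "qq *[F2] ss *[F2] inv[F2] qq" q] cl c pz by simp
		then show False using b by (simp add: bad_def)
	qed
qed

text \<open>A minimal counterexample is Nielsen reduced: in a product of members of
  \<open>XX\<close> without adjacent inverses no factor disappears, so k factors give at least k
  letters. The free generators have one letter and are therefore members of \<open>XX\<close>, and
  the base case settles the pair.\<close>

private lemma not_bad: "~ bad x y"
proof
	assume b: "bad x y"
	define X1 where "X1 = {x, inv[F2] x}"
	define X2 where "X2 = {y, inv[F2] y}"
	define XX where "XX = X1 \<union> X2"
	have c: "x : car F2" "y : car F2" using bad_carrier[OF b] by auto
	have b12: "bad p q" if "p : X1" "q : X2" for p q
		using that b bad_inv[OF b] bad_inv2[OF b] bad_inv2[OF bad_inv[OF b]] by (auto simp: X1_def X2_def)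
	have b21: "bad p q" if "p : X2" "q : X1" for p q using bad_swap[OF b12[OF that(2,1)]] .
	have XXc: "p : car F2" if "p : XX" for p using that c by (auto simp: XX_def X1_def X2_def)
	have XXi: "inv[F2] p : XX" if "p : XX" for p using that c by (auto simp: XX_def X1_def X2_def)
	have ne: "lw p ~= []" if "p : XX" for p
		using that bad_ne[OF b12, of p y] bad_ne[OF b21, of p x] by (auto simp: XX_def X1_def X2_def)
	have same: "q = p | q = inv[F2] p" if "p : X1 & q : X1 | p : X2 & q : X2" for p q
		using that c by (auto simp: X1_def X2_def)
	have two: "2 * canc p q <= llen p & 2 * canc p q <= llen q & (p = q --> 2 * canc p q < llen q)"
		if pq: "p : XX" "q : XX" "q ~= inv[F2] p" for p q
	proof -
		have self: "2 * canc p p < llen p" unfolding canc_def by (rule FL.lcp_self[OF red_lw[OF XXc[OF pq(1)]] ne[OF pq(1)]])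
		consider "bad p q" | "p = q" using pq b12 b21 same[of p q] unfolding XX_def by blast
		then show ?thesis using self bad_canc[of p q] by cases auto
	qed
	have triple: "canc p q + canc q r < llen q"
		if pqr: "p : XX" "q : XX" "r : XX" "q ~= inv[F2] p" "r ~= inv[F2] q" for p q r
	proof -
		note t1 = two[OF pqr(1,2,4)] and t2 = two[OF pqr(2,3,5)]
		consider "p = q" | "q = r" | "p ~= q" "q ~= r" by blast
		then show ?thesis
		proof cases
			case 3
			have "~ (p : X1 & q : X1 | p : X2 & q : X2)" using same[of p q] pqr(4) 3(1) by blast
			then have pq: "p : X1 & q : X2 | p : X2 & q : X1" using pqr(1,2) unfolding XX_def by blast
			have "~ (q : X1 & r : X1 | q : X2 & r : X2)" using same[of q r] pqr(5) 3(2) by blast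
			then have "p : X1 & r : X1 | p : X2 & r : X2" using pq pqr(3) unfolding XX_def by blast
			then have r: "r = p | r = inv[F2] p" by (rule same)
			have "bad p q" using pq b12 b21 by (elim disjE conjE) simp_all
			from this r
			show ?thesis by (rule bad_triple)
		qed (use t1 t2 in auto)
	qed
	define pr where "pr xs = foldr (%p g. p *[F2] g) xs one[F2]" for xs
	have pr_simps: "pr [] = one[F2]" "pr (p # xs) = p *[F2] pr xs" for p xs by (simp_all add: pr_def)
	have prc: "pr xs : car F2" if "set xs \<subseteq> XX" for xs using that by (induction xs) (auto simp: pr_simps XXc)
	\<comment> \<open>\<open>t\<close> is the beginning of the first factor that survives in the
	  product, \<open>k\<close> the end lost to the next factor, and \<open>w\<close> has room for a
	  letter from each further factor.\<close>
	have grow: "\<exists>t k w. lw p = t @ k & lw (pr (p # xs)) = t @ w & t ~= [] & length xs <= length w &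
		 length k = (if xs = [] then 0 else canc p (hd xs))"
		if "set (p # xs) \<subseteq> XX" "successively (%p q. q ~= inv[F2] p) (p # xs)" for p xs
		using that
	proof (induction xs arbitrary: p)
		case Nil
		then have "pr [p] = p" using XXc by (simp add: pr_simps)
		then show ?case using ne[of p] Nil by (intro exI[of _ "lw p", OF exI[of _ "[]", OF exI[of _ "[]"]]]) simp
	next
		case (Cons q xs)
		have m: "p : XX" "q : XX" "set (q # xs) \<subseteq> XX" and pq: "q ~= inv[F2] p" and su: "successively (%p q. q ~= inv[F2] p) (q # xs)"
			using Cons.prems by auto
		obtain t k w where t: "lw q = t @ k" "lw (pr (q # xs)) = t @ w" "t ~= []" "length xs <= length w" "length k = (if xs = [] then 0 else canc q (hd xs))"
			using Cons.IH[OF m(3) su] by (elim exE conjE)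
		have lq: "llen q = length t + length k" using t(1) by simp
		have ct: "canc p q < length t"
		proof (cases "xs = []")
			case True
			then show ?thesis using two[OF m(1,2) pq] t lq ne[OF m(2)] by (cases "lw q") auto
		next
			case False
			then obtain r xs' where xs: "xs = r # xs'" by (cases xs) auto
			then have "canc p q + canc q r < llen q" using m su pq by (intro triple) auto
			then show ?thesis using lq t(5) xs by simp
		qed
		let ?c = "canc p q"
		have "lcp (FL.rinv (lw p)) (t @ w) = lcp (FL.rinv (lw p)) (t @ k)" using ct t(1) by (intro lcp_prefix) (simp add: canc_def)
		then have lc: "lcp (FL.rinv (lw p)) (lw (pr (q # xs))) = ?c" using t(1,2) by (simp add: canc_def)
		have "lw (pr (p # q # xs)) = foldr FL.act (lw p) (lw (pr (q # xs)))"
			using lw_mult[OF XXc[OF m(1)] prc[OF m(3)]] by (simp add: pr_simps)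
		also have "\<dots> = take (llen p - ?c) (lw p) @ drop ?c (t @ w)"
			using FL.foldr_act[OF red_lw[OF XXc[OF m(1)]] red_lw[OF prc[OF m(3)]]] lc t(2) by simp
		finally have res: "lw (pr (p # q # xs)) = take (llen p - ?c) (lw p) @ (drop ?c t @ w)" using ct by simp
		have cp: "2 * ?c <= llen p" using two[OF m(1,2) pq] by blast
		have lp: "llen p > 0" using ne[OF m(1)] by simp
		have pos: "llen p - ?c > 0" using cp lp by linarith
		show ?case
		proof (intro exI conjI)
			show "lw p = take (llen p - ?c) (lw p) @ drop (llen p - ?c) (lw p)" by simp
			show "lw (pr (p # q # xs)) = take (llen p - ?c) (lw p) @ (drop ?c t @ w)" by (rule res)
			show "take (llen p - ?c) (lw p) ~= []" using pos ne[OF m(1)] by simp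
			show "length (q # xs) <= length (drop ?c t @ w)" using ct t(4) by simp
			show "length (drop (llen p - ?c) (lw p)) = (if q # xs = [] then 0 else canc p (hd (q # xs)))" using cp by simp
		qed
	qed
	have pr_append: "pr (us @ vs) = pr us *[F2] pr vs" if "set us \<subseteq> XX" "set vs \<subseteq> XX" for us vs
		using that(1) prc[OF that(2)] by (induction us) (auto simp: pr_simps Y.GP.m_assoc XXc prc)
	define L where "L = {pr xs | xs. set xs \<subseteq> XX}"
	have Ls: "subgroup L F2"
	proof (rule Y.GP.subgroupI)
		show "L \<subseteq> car F2" using prc by (auto simp: L_def)
		show "L ~= {}" by (auto simp: L_def intro: exI[of _ "[]"])
		fix g assume "g : L"
		then obtain xs where xs: "g = pr xs" "set xs \<subseteq> XX" by (auto simp: L_def)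
		have "inv[F2] pr xs = pr (rev (map (%p. inv[F2] p) xs)) & set (rev (map (%p. inv[F2] p) xs)) \<subseteq> XX" using xs(2)
		proof (induction xs)
			case (Cons p xs)
			then have s: "set (rev (map (%p. inv[F2] p) xs)) \<subseteq> XX" and p: "p : XX" and s': "set xs \<subseteq> XX" by auto
			have ip: "inv[F2] p : XX" by (rule XXi[OF p])
			show ?case using Cons pr_append[OF s, of "[inv[F2] p]"] ip XXc[OF p] prc[OF s'] by (simp add: pr_simps Y.GP.inv_mult_group)
		qed (simp add: pr_simps)
		then show "inv[F2] g : L" unfolding xs(1) L_def by blast
		fix g' assume "g' : L"
		then obtain ys where ys: "g' = pr ys" "set ys \<subseteq> XX" by (auto simp: L_def)
		have "g *[F2] g' = pr (xs @ ys)" "set (xs @ ys) \<subseteq> XX" using pr_append[OF xs(2) ys(2)] xs ys by auto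
		then show "g *[F2] g' : L" unfolding L_def by blast
	qed
	have XL: "p : L" if "p : XX" for p
	proof -
		have "p = pr [p]" "set [p] \<subseteq> XX" using that XXc by (auto simp: pr_simps)
		then show ?thesis unfolding L_def by blast
	qed
	have f: "full_pair x y" using b by (simp add: bad_def)
	have "L = car F2" by (rule full_pairD[OF f Ls]) (auto intro!: XL simp: XX_def X1_def X2_def)
	\<comment> \<open>A shortest expression has no adjacent inverse factors, so \<open>grow\<close>
	  limits it to one factor.\<close>
	have gen: "gl l : XX" for l
	proof -
		have "gl l : L" using \<open>L = car F2\<close> by simp
		then have "\<exists>xs. gl l = pr xs & set xs \<subseteq> XX" by (auto simp: L_def)
		then obtain xs where xs: "gl l = pr xs" "set xs \<subseteq> XX" and least: "!!ys. gl l = pr ys & set ys \<subseteq> XX ==> length xs <= length ys"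
			using ex_has_least_nat[of "%xs. gl l = pr xs & set xs \<subseteq> XX" _ length] by blast
		have "gl l = evl [l]" by simp
		then have lw1: "lw (gl l) = [l]" using lw_evl[of "[l]"] by (simp add: FL.red_Cons del: evl_simps)
		have su: "successively (%p q. q ~= inv[F2] p) xs"
		proof (rule ccontr)
			assume "~ ?thesis"
			from not_successivelyE[OF this] obtain us p q vs where e: "xs = us @ p # q # vs" "q = inv[F2] p" by blast
			have m: "set us \<subseteq> XX" "set vs \<subseteq> XX" "p : XX" "set (p # q # vs) \<subseteq> XX" using xs(2) e(1) by auto
			have "pr (p # q # vs) = pr vs" using e(2) XXc[OF m(3)] prc[OF m(2)] by (simp add: pr_simps Y.GP.inv_cancel)
			then have "pr xs = pr (us @ vs)" using pr_append[OF m(1,4)] pr_append[OF m(1,2)] e(1) by simp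
			then have "length xs <= length (us @ vs)" using least[of "us @ vs"] xs(1) m by simp
			then show False using e(1) by simp
		qed
		have "xs ~= []"
		proof
			assume "xs = []"
			then have "lw (gl l) = []" using xs(1) by (simp add: pr_simps)
			then show False using lw1 by simp
		qed
		then obtain p ys where pys: "xs = p # ys" by (cases xs) auto
		have "set (p # ys) \<subseteq> XX" using xs(2) pys by simp
		moreover have "successively (%p q. q ~= inv[F2] p) (p # ys)" using su pys by simp
		ultimately obtain t k w where t: "lw (pr (p # ys)) = t @ w" "t ~= []" "length ys <= length w" using grow by blast
		have "length (t @ w) = 1" using t(1) lw1 xs(1) pys by simp
		moreover have "length t > 0" using t(2) by simp
		ultimately have "length w = 0" unfolding length_append by linarith
		then have "ys = []" using t(3) by simp
		then have "gl l = p" using xs pys XXc by (simp add: pr_simps)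
		then show ?thesis using xs(2) pys by simp
	qed
	let ?a = "gl (True, True)" and ?b = "gl (False, True)"
	have lw1: "lw (gl l) = [l]" for l
	proof -
		have "gl l = evl [l]" by simp
		then show ?thesis using lw_evl[of "[l]"] by (simp add: FL.red_Cons del: evl_simps)
	qed
	have ab: "?b ~= ?a" "?b ~= inv[F2] ?a"
	proof -
		show "?b ~= ?a" using lw1[of "(True, True)"] lw1[of "(False, True)"] by auto
		have "lw (inv[F2] ?a) = [(True, False)]" using lw1[of "(True, False)"] gl_linv[of "(True, True)"] by (simp add: linv2_def)
		then show "?b ~= inv[F2] ?a" using lw1[of "(False, True)"] by auto
	qed
	have from_ab: "Q u v" if "a : {u, inv[F2] u}" "b' : {v, inv[F2] v}" "Q a b'" "u : car F2" "v : car F2" for u v a b'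
	proof -
		have "Q u b'" if "b' : car F2" using \<open>a : _\<close> \<open>Q a b'\<close> invQ[of "inv[F2] u" b'] \<open>u : _\<close> that by auto
		then show ?thesis using \<open>b' : _\<close> invQ2[of u "inv[F2] v"] \<open>u : _\<close> \<open>v : _\<close> by auto
	qed
	have nq: "~ Q x y" using b by (simp add: bad_def)
	have "?a : X1 & ?b : X2 | ?a : X2 & ?b : X1"
		using gen[of "(True, True)"] gen[of "(False, True)"] ab same[of ?a ?b] unfolding XX_def by blast
	then show False
	proof
		assume "?a : X1 & ?b : X2"
		then have "Q x y" using from_ab[OF _ _ baseQ c] by (simp add: X1_def X2_def)
		then show False using nq by simp
	next
		assume "?a : X2 & ?b : X1"
		then have "Q y x" using from_ab[OF _ _ baseQ c(2,1)] by (simp add: X1_def X2_def)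
		then show False using nq swap[OF c(2,1)] by simp
	qed
qed

lemma nielsen_step: "full_pair x y ==> llen x + llen y = N ==> Q x y"
	using not_bad[of x y] by (auto simp: bad_def)

end

text \<open>Induction on the total letter length. Conjugation is among the closure assumptions
  because a pair with cancellation of exactly one half is shortened only up to conjugacy
  (\<open>bad_triple\<close>).\<close>

theorem nielsen:
	assumes "full_pair x y"
	shows "Q x y"
	using assms
proof (induction "llen x + llen y" arbitrary: x y rule: less_induct)
	case less
	show ?case by (rule nielsen_step[OF _ less.prems refl]) (use less.hyps in blast)
qed

end

section \<open>A cocycle on the free group of rank two\<close>

text \<open>The Klein four-group. Its elements serve both as the four strands and, acting by
  translation, as the permutations of strands induced by the free group.\<close>

datatype pos = Pz | Pa | Pb | Pc

primrec padd :: "pos => pos => pos" where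
	"padd Pz j = j"
| "padd Pa j = (case j of Pz => Pa | Pa => Pz | Pb => Pc | Pc => Pb)"
| "padd Pb j = (case j of Pz => Pb | Pa => Pc | Pb => Pz | Pc => Pa)"
| "padd Pc j = (case j of Pz => Pc | Pa => Pb | Pb => Pa | Pc => Pz)"

lemma padd_Pz [simp]: "padd i Pz = i" by (cases i) auto
lemma padd_self [simp]: "padd i i = Pz" by (cases i) auto
lemma padd_assoc: "padd (padd i j) k = padd i (padd j k)" by (cases i; cases j; cases k) auto
lemma padd_cancel [simp]: "padd (padd i j) j = i" by (simp add: padd_assoc)
lemma finite_pos: "finite (UNIV :: pos set)"
proof -
	have "(UNIV :: pos set) \<subseteq> {Pz, Pa, Pb, Pc}" using pos.exhaust by auto
	then show ?thesis by (rule finite_subset) simp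
qed

text \<open>The wreath product with the Klein four-group: a homomorphism into it is a homomorphism
  to that group together with a four-component cocycle.\<close>

definition wreath :: "('h, 'z) monoid_scheme => (pos \<times> (pos => 'h)) monoid" where
	"wreath H = \<lparr>carrier = {x. \<forall>i. snd x i : car H},
		 monoid.mult = (%x y. (padd (fst x) (fst y), %i. snd x i *[H] snd y (padd i (fst x)))),
		 one = (Pz, %_. one[H])\<rparr>"

lemma wreath_simps: "x : car (wreath H) \<longleftrightarrow> (\<forall>i. snd x i : car H)"
	"x *[wreath H] y = (padd (fst x) (fst y), %i. snd x i *[H] snd y (padd i (fst x)))"
	"one[wreath H] = (Pz, %_. one[H])"
	by (simp_all add: wreath_def)

lemma (in group) wreath_group: "group (wreath G)"
proof (rule groupI)
	fix x assume x: "x : car (wreath G)"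
	let ?y = "(fst x, %i. inv (snd x (padd i (fst x))))"
	have "?y : car (wreath G)" "?y *[wreath G] x = one[wreath G]" using x by (auto simp: wreath_simps)
	then show "\<exists>y\<in>car (wreath G). y *[wreath G] x = one[wreath G]" by blast
qed (auto simp: wreath_simps padd_assoc m_assoc prod_eq_iff)

text \<open>Orders 3 and 2 give the modular group; the factor of order 3 has the two different
  non-trivial elements required later.\<close>

definition AZ :: "bool => int monoid" where "AZ i = integer_mod_group (if i then 3 else 2)"

global_interpretation PZ: free_prod AZ by (rule free_prod.intro) (simp add: AZ_def)

abbreviation "HZ \<equiv> graph_product (UNIV :: bool set) {} AZ"

lemma AZ_comm: "comm_group (AZ i)" by (simp add: AZ_def abelian_integer_mod_group)
lemma AZ_finite: "finite (car (AZ i))" by (simp add: AZ_def carrier_integer_mod_group)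
lemma AZ_car: "1 : car (AZ i)" "2 : car (AZ True)" by (auto simp: AZ_def carrier_integer_mod_group)
lemma AZ_one: "one[AZ i] = 0" by (simp add: AZ_def)

definition xg where "xg = PZ.incl False 1"
definition yg where "yg = PZ.incl True 1"

lemma xy_closed [simp]: "xg : car HZ" "yg : car HZ" using AZ_car by (simp_all add: xg_def yg_def)

lemma xx: "xg *[HZ] xg = one[HZ]"
	using PZ.incl_mult[of False 1 1] PZ.incl_one[of False] AZ_car by (simp add: xg_def AZ_def mult_integer_mod_group)

lemma y2: "yg *[HZ] yg = PZ.incl True 2"
	using PZ.incl_mult[of True 1 1] AZ_car by (simp add: yg_def AZ_def mult_integer_mod_group)

lemma yyy: "yg *[HZ] (yg *[HZ] yg) = one[HZ]"
	unfolding y2 using PZ.incl_mult[of True 1 2] PZ.incl_one[of True] AZ_car by (simp add: yg_def AZ_def mult_integer_mod_group)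

lemma xx': "z : car HZ ==> xg *[HZ] (xg *[HZ] z) = z" using xx by (simp flip: PZ.GP.m_assoc)

lemma yyy': assumes z: "z : car HZ" shows "yg *[HZ] (yg *[HZ] (yg *[HZ] z)) = z"
proof -
	have "yg *[HZ] (yg *[HZ] (yg *[HZ] z)) = (yg *[HZ] (yg *[HZ] yg)) *[HZ] z"
		using z by (simp add: PZ.GP.m_assoc)
	then show ?thesis using yyy z by simp
qed

lemma inv_xy: "inv[HZ] xg = xg" "inv[HZ] yg = yg *[HZ] yg"
	using PZ.GP.inv_equality[OF xx] PZ.GP.inv_equality[of "yg *[HZ] yg" yg] yyy by (simp_all add: PZ.GP.m_assoc)

lemmas HZ_simps = PZ.GP.m_assoc xx xx' yyy yyy' inv_xy PZ.GP.inv_mult_group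

text \<open>Inverting both factors is, up to conjugacy, what mirror images of braids induce on the
  modular group.\<close>

definition mu where "mu = gp_lift HZ (%i a. PZ.incl i (inv[AZ i] a))"

lemma mu_compatible: "PZ.compatible HZ (%i a. PZ.incl i (inv[AZ i] a))"
	unfolding PZ.compatible_def
proof (intro conjI ballI impI homI)
	fix i :: bool and a b
	interpret Ai: comm_group "AZ i" by (rule AZ_comm)
	assume a: "a : car (AZ i)"
	then show "PZ.incl i (inv[AZ i] a) : car HZ" by simp
	assume b: "b : car (AZ i)"
	show "PZ.incl i (inv[AZ i] (a *[AZ i] b)) = PZ.incl i (inv[AZ i] a) *[HZ] PZ.incl i (inv[AZ i] b)"
		using a b PZ.incl_mult[of i "inv[AZ i] a" "inv[AZ i] b"] by (simp add: Ai.inv_mult)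
qed simp

lemma mu_hom: "mu : hom HZ HZ" unfolding mu_def by (rule PZ.gp_lift_hom[OF PZ.group_GP mu_compatible])
lemma mu_incl: "a : car (AZ i) ==> mu (PZ.incl i a) = PZ.incl i (inv[AZ i] a)"
	unfolding mu_def by (rule PZ.gp_lift_incl[OF PZ.group_GP mu_compatible]) simp_all

lemma mu_incl': assumes a: "a : car (AZ i)" shows "mu (PZ.incl i a) = inv[HZ] PZ.incl i a"
proof -
	have "PZ.incl i (inv[AZ i] a) *[HZ] PZ.incl i a = one[HZ]"
		using a PZ.incl_mult[of i "inv[AZ i] a" a] PZ.incl_one[of i] group.l_inv[OF PZ.factor_group a] by simp
	then show ?thesis unfolding mu_incl[OF a] using a PZ.GP.inv_equality[of "PZ.incl i (inv[AZ i] a)" "PZ.incl i a"] by simp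
qed

lemma mu_closed [simp]: "z : car HZ ==> mu z : car HZ" using mu_hom by (meson hom_in_carrier)
lemma mu_one: "mu one[HZ] = one[HZ]" by (rule hom_one[OF mu_hom PZ.group_GP PZ.group_GP])
lemma mu_mult: "z : car HZ ==> w : car HZ ==> mu (z *[HZ] w) = mu z *[HZ] mu w" by (rule hom_mult[OF mu_hom])
lemma mu_xy: "mu xg = xg" "mu yg = yg *[HZ] yg"
	using mu_incl'[OF AZ_car(1), of False] mu_incl'[OF AZ_car(1), of True] inv_xy by (simp_all add: xg_def yg_def)
lemma mu_mu: "z : car HZ ==> mu (mu z) = z"
proof -
	assume z: "z : car HZ"
	have "(%z. mu (mu z)) : hom HZ HZ" using hom_compose[OF mu_hom mu_hom] by (simp add: comp_def)
	then show ?thesis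
	proof (rule PZ.hom_ext[OF _ iso_hom[OF id_iso] PZ.group_GP z])
		fix i a assume a: "a : car (AZ i)"
		then show "mu (mu (PZ.incl i a)) = PZ.incl i a" by (simp add: mu_incl group.inv_inv[OF PZ.factor_group])
	qed
qed

definition th :: "bool => (bool \<times> int) list set => (bool \<times> int) list set" where "th e z = (if e then mu z else z)"

lemma th_closed [simp]: "z : car HZ ==> th e z : car HZ" by (simp add: th_def)
lemma th_mult: "z : car HZ ==> w : car HZ ==> th e (z *[HZ] w) = th e z *[HZ] th e w" by (simp add: th_def mu_mult)
lemma th_one: "th e one[HZ] = one[HZ]" by (simp add: th_def mu_one)
lemma th_inv: "z : car HZ ==> th e (inv[HZ] z) = inv[HZ] th e z"
proof -
	assume z: "z : car HZ"
	have "th e (inv[HZ] z) *[HZ] th e z = one[HZ]" using z th_mult[of "inv[HZ] z" z e] th_one[of e] by simp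
	then show ?thesis using z PZ.GP.inv_equality[of "th e (inv[HZ] z)" "th e z"] by simp
qed
lemma th_th: "z : car HZ ==> th e (th f z) = th (e ~= f) z" by (cases e; cases f) (simp_all add: th_def mu_mu)

text \<open>The free group of rank two is the kernel of the map from the braid group on four strands to the one on three strands;
	on it, forgetting any one of the four strands gives four maps to the modular group, permuted by the group itself.
	The two elements below are the images of its generators.\<close>
primrec alc :: "pos => (bool \<times> int) list set" where
	"alc Pz = yg *[HZ] xg"
| "alc Pa = yg *[HZ] xg"
| "alc Pb = one[HZ]"
| "alc Pc = yg *[HZ] (yg *[HZ] (xg *[HZ] (yg *[HZ] (yg *[HZ] xg))))"

primrec bec :: "pos => (bool \<times> int) list set" where
	"bec Pz = yg *[HZ] (yg *[HZ] (xg *[HZ] (yg *[HZ] xg)))"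
| "bec Pa = yg *[HZ] (yg *[HZ] (xg *[HZ] (yg *[HZ] yg)))"
| "bec Pb = yg *[HZ] yg"
| "bec Pc = xg"

lemma albe_closed [simp]: "alc i : car HZ" "bec i : car HZ" by (cases i; simp)+

interpretation WR: group "wreath HZ" by (rule PZ.GP.wreath_group)

lemma int_pow_hom: "group G ==> x : car G ==> (\<lambda>n::int. x ^[G] n) : hom integer_group G"
	by (auto simp: hom_def group.int_pow_mult group.int_pow_closed)

lemma F2_compatible: "group G ==> x : car G ==> y : car G ==> Y.compatible G (%i n. (if i then x else y) ^[G] (n::int))"
	unfolding Y.compatible_def using int_pow_hom[of G x] int_pow_hom[of G y] by auto

abbreviation "ga \<equiv> gl (True, True)"
abbreviation "gb \<equiv> gl (False, True)"

lemma F2_map: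
	assumes "group G" "x : car G" "y : car G"
	shows "\<exists>f\<in>hom F2 G. f ga = x & f gb = y"
proof (intro bexI conjI)
	let ?f = "gp_lift G (%i n. (if i then x else y) ^[G] (n::int))"
	show "?f : hom F2 G" by (rule Y.gp_lift_hom[OF assms(1) F2_compatible[OF assms]])
	have one: "z ^[G] (1::int) = z" if "z : car G" for z using group.int_pow_1[OF assms(1) that] .
	show "?f ga = x" "?f gb = y"
		using Y.gp_lift_incl[OF assms(1) F2_compatible[OF assms], of True 1] Y.gp_lift_incl[OF assms(1) F2_compatible[OF assms], of False 1]
			one assms(2,3) by (simp_all add: gl_def)
qed

lemma F2_subgroup_induct:
	assumes "g : car F2" "P one[F2]" "P ga" "P gb" "!!g. g : car F2 ==> P g ==> P (inv[F2] g)"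
		"!!g h. g : car F2 ==> h : car F2 ==> P g ==> P h ==> P (g *[F2] h)"
	shows "P g"
proof -
	have "P (gl l)" for l
	proof -
		obtain i s where l: "l = (i, s)" by (cases l)
		have 1: "P (gl (i, True))" for i using assms(3,4) by (cases i) auto
		have "gl (i, False) = inv[F2] gl (i, True)" using gl_linv[of "(i, True)"] by (simp add: linv2_def)
		then have "P (gl (i, False))" using assms(5)[OF gl_closed 1] by simp
		then show ?thesis using l 1 by (cases s) auto
	qed
	note letters = this
	show ?thesis using assms(1)
	proof (induction rule: F2_letter_induct)
		case one show ?case by (rule assms(2))
	next
		case (letter l g) show ?case by (rule assms(6)[OF gl_closed letter(1) letters letter(2)])
	qed
qed

lemma F2_hom_ext:
	assumes "f : hom F2 G" "f' : hom F2 G" "group G" "f ga = f' ga" "f gb = f' gb" "g : car F2"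
	shows "f g = f' g"
proof -
	interpret f: group_hom F2 G f using assms Y.group_GP by (simp add: group_hom_def group_hom_axioms_def)
	interpret f': group_hom F2 G f' using assms Y.group_GP by (simp add: group_hom_def group_hom_axioms_def)
	show ?thesis by (rule F2_subgroup_induct[OF assms(6)]) (use assms in auto)
qed

definition kp :: "(bool \<times> int) list set => pos \<times> (pos => (bool \<times> int) list set)" where
	"kp = (SOME f. f : hom F2 (wreath HZ) & f ga = (Pa, alc) & f gb = (Pb, bec))"

lemma kp: "kp : hom F2 (wreath HZ)" "kp ga = (Pa, alc)" "kp gb = (Pb, bec)"
proof -
	have "\<exists>f. f : hom F2 (wreath HZ) & f ga = (Pa, alc) & f gb = (Pb, bec)"
		using F2_map[OF WR.is_group, of "(Pa, alc)" "(Pb, bec)"] by (auto simp: wreath_simps)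
	then have "kp : hom F2 (wreath HZ) & kp ga = (Pa, alc) & kp gb = (Pb, bec)" unfolding kp_def by (rule someI_ex)
	then show "kp : hom F2 (wreath HZ)" "kp ga = (Pa, alc)" "kp gb = (Pb, bec)" by auto
qed

text \<open>The exponents of the two generators modulo 2. Where \<open>vc\<close> is trivial, each
  component of the cocycle \<open>cc\<close> is multiplicative.\<close>

definition vc where "vc g = fst (kp g)"
definition cc where "cc g = snd (kp g)"

lemma cc_closed [simp]: "g : car F2 ==> cc g i : car HZ"
	using hom_in_carrier[OF kp(1)] by (simp add: cc_def wreath_simps)

lemma vc_cc_mult: assumes "g : car F2" "h : car F2"
	shows "vc (g *[F2] h) = padd (vc g) (vc h)" "cc (g *[F2] h) i = cc g i *[HZ] cc h (padd i (vc g))"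
	using hom_mult[OF kp(1) assms] by (simp_all add: vc_def cc_def wreath_simps)

lemma vc_cc_one: "vc one[F2] = Pz" "cc one[F2] i = one[HZ]"
	using hom_one[OF kp(1) Y.group_GP WR.is_group] by (simp_all add: vc_def cc_def wreath_simps)

lemma vc_cc_gen: "vc ga = Pa" "vc gb = Pb" "cc ga = alc" "cc gb = bec" by (simp_all add: vc_def cc_def kp)

lemma padd_eq_Pz: "padd i j = Pz ==> j = i" by (cases i; cases j) auto

lemma vc_cc_inv: assumes g: "g : car F2"
	shows "vc (inv[F2] g) = vc g" "cc (inv[F2] g) i = inv[HZ] cc g (padd i (vc g))"
proof -
	have "padd (vc (inv[F2] g)) (vc g) = Pz" using vc_cc_mult(1)[of "inv[F2] g" g] g vc_cc_one by simp
	then show v: "vc (inv[F2] g) = vc g" using padd_eq_Pz by metis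
	have "cc (inv[F2] g) i *[HZ] cc g (padd i (vc g)) = one[HZ]"
		using vc_cc_mult(2)[of "inv[F2] g" g i] g vc_cc_one v by simp
	then show "cc (inv[F2] g) i = inv[HZ] cc g (padd i (vc g))" using g by (simp add: PZ.GP.inv_equality)
qed

text \<open>\<sigma> pulls the cocycle back to itself up to mirror image (\<open>e\<close>),
  relabelling of strands (\<pi>) and a coboundary (\<open>h\<close>). Where \<open>vc\<close> of the
  image is trivial, a component after \<sigma> is thus conjugate to a component or to its mirror
  image, with a conjugator that does not depend on the element.\<close>

definition itw_at where
	"itw_at \<sigma> e \<pi> h g \<longleftrightarrow> (\<forall>i. cc (\<sigma> g) i = h i *[HZ] th e (cc g (\<pi> i)) *[HZ] inv[HZ] h (padd i (vc (\<sigma> g))) &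
		 \<pi> (padd i (vc (\<sigma> g))) = padd (\<pi> i) (vc g))"

definition itw :: "((bool \<times> int) list set => (bool \<times> int) list set) => bool" where
	"itw \<sigma> \<longleftrightarrow> (\<exists>e \<pi> h. (\<forall>i. h i : car HZ) & (\<forall>g\<in>car F2. itw_at \<sigma> e \<pi> h g))"

text \<open>Both sides satisfy the same cocycle rule, so the identity spreads from the two
  generators to products and inverses.\<close>

lemma itwI:
	assumes s: "\<sigma> : hom F2 F2" and h: "!!i. h i : car HZ" and gen: "itw_at \<sigma> e \<pi> h ga" "itw_at \<sigma> e \<pi> h gb"
	shows "itw \<sigma>"
	unfolding itw_def
proof (rule exI[of _ e, OF exI[of _ \<pi>, OF exI[of _ h]]], intro conjI allI ballI)
	show "h i : car HZ" for i by (rule h)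
	interpret s: group_hom F2 F2 \<sigma> using s Y.group_GP by (simp add: group_hom_def group_hom_axioms_def)
	fix g assume "g : car F2"
	then show "itw_at \<sigma> e \<pi> h g"
	proof (rule F2_subgroup_induct)
		show "itw_at \<sigma> e \<pi> h one[F2]" using h by (simp add: itw_at_def vc_cc_one th_one)
		fix g assume g: "g : car F2" and it: "itw_at \<sigma> e \<pi> h g"
		have sg: "\<sigma> g : car F2" using g by simp
		have e1: "cc (\<sigma> g) i = h i *[HZ] th e (cc g (\<pi> i)) *[HZ] inv[HZ] h (padd i (vc (\<sigma> g)))"
			and e2: "\<pi> (padd i (vc (\<sigma> g))) = padd (\<pi> i) (vc g)" for i using it by (auto simp: itw_at_def)
		show "itw_at \<sigma> e \<pi> h (inv[F2] g)" unfolding itw_at_def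
		proof (intro allI conjI)
			fix i
			have v: "vc (\<sigma> (inv[F2] g)) = vc (\<sigma> g)" using g sg by (simp add: vc_cc_inv)
			show "\<pi> (padd i (vc (\<sigma> (inv[F2] g)))) = padd (\<pi> i) (vc (inv[F2] g))" unfolding v using e2 g by (simp add: vc_cc_inv)
			have "cc (\<sigma> (inv[F2] g)) i = inv[HZ] cc (\<sigma> g) (padd i (vc (\<sigma> g)))" using g sg by (simp add: vc_cc_inv)
			also have "\<dots> = h i *[HZ] th e (inv[HZ] cc g (padd (\<pi> i) (vc g))) *[HZ] inv[HZ] h (padd i (vc (\<sigma> g)))"
				unfolding e1 e2 using h g by (simp add: PZ.GP.inv_mult_group PZ.GP.m_assoc th_inv)
			finally show "cc (\<sigma> (inv[F2] g)) i = h i *[HZ] th e (cc (inv[F2] g) (\<pi> i)) *[HZ] inv[HZ] h (padd i (vc (\<sigma> (inv[F2] g))))"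
				unfolding v using g by (simp add: vc_cc_inv)
		qed
		fix g' assume g': "g' : car F2" and it': "itw_at \<sigma> e \<pi> h g'"
		have sg': "\<sigma> g' : car F2" using g' by simp
		have e1': "cc (\<sigma> g') i = h i *[HZ] th e (cc g' (\<pi> i)) *[HZ] inv[HZ] h (padd i (vc (\<sigma> g')))"
			and e2': "\<pi> (padd i (vc (\<sigma> g'))) = padd (\<pi> i) (vc g')" for i using it' by (auto simp: itw_at_def)
		show "itw_at \<sigma> e \<pi> h (g *[F2] g')" unfolding itw_at_def
		proof (intro allI conjI)
			fix i
			have v: "vc (\<sigma> (g *[F2] g')) = padd (vc (\<sigma> g)) (vc (\<sigma> g'))" using g g' sg sg' by (simp add: vc_cc_mult)
			show "\<pi> (padd i (vc (\<sigma> (g *[F2] g')))) = padd (\<pi> i) (vc (g *[F2] g'))"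
				unfolding v padd_assoc[symmetric] e2' e2 using g g' by (simp add: vc_cc_mult padd_assoc)
			have "cc (\<sigma> (g *[F2] g')) i = cc (\<sigma> g) i *[HZ] cc (\<sigma> g') (padd i (vc (\<sigma> g)))" using g g' sg sg' by (simp add: vc_cc_mult)
			also have "\<dots> = h i *[HZ] th e (cc g (\<pi> i) *[HZ] cc g' (padd (\<pi> i) (vc g))) *[HZ] inv[HZ] h (padd (padd i (vc (\<sigma> g))) (vc (\<sigma> g')))"
				unfolding e1 e1' e2 using h g g' by (simp add: PZ.GP.m_assoc PZ.GP.inv_cancel th_mult)
			finally show "cc (\<sigma> (g *[F2] g')) i = h i *[HZ] th e (cc (g *[F2] g') (\<pi> i)) *[HZ] inv[HZ] h (padd i (vc (\<sigma> (g *[F2] g'))))"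
				unfolding v using g g' by (simp add: vc_cc_mult padd_assoc)
		qed
	qed (rule gen)+
qed

lemma itw_comp:
	assumes "itw \<sigma>" "itw \<tau>" "\<tau> : hom F2 F2"
	shows "itw (%g. \<sigma> (\<tau> g))"
proof -
	obtain e \<pi> h where s: "\<forall>i. h i : car HZ" "\<forall>g\<in>car F2. itw_at \<sigma> e \<pi> h g" using assms(1) unfolding itw_def by (elim exE conjE)
	obtain e' \<pi>' h' where t: "\<forall>i. h' i : car HZ" "\<forall>g\<in>car F2. itw_at \<tau> e' \<pi>' h' g" using assms(2) unfolding itw_def by (elim exE conjE)
	let ?h = "%i. h i *[HZ] th e (h' (\<pi> i))" and ?p = "%i. \<pi>' (\<pi> i)"
	have "itw_at (%g. \<sigma> (\<tau> g)) (e ~= e') ?p ?h g" if g: "g : car F2" for g unfolding itw_at_def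
	proof (intro allI conjI)
		fix i
		have tg: "\<tau> g : car F2" using assms(3) g by (rule hom_in_carrier)
		have s1: "cc (\<sigma> (\<tau> g)) i = h i *[HZ] th e (cc (\<tau> g) (\<pi> i)) *[HZ] inv[HZ] h (padd i (vc (\<sigma> (\<tau> g))))"
			and s2: "\<pi> (padd i (vc (\<sigma> (\<tau> g)))) = padd (\<pi> i) (vc (\<tau> g))" using bspec[OF s(2) tg] by (auto simp: itw_at_def)
		have t1: "cc (\<tau> g) (\<pi> i) = h' (\<pi> i) *[HZ] th e' (cc g (\<pi>' (\<pi> i))) *[HZ] inv[HZ] h' (padd (\<pi> i) (vc (\<tau> g)))"
			and t2: "\<pi>' (padd (\<pi> i) (vc (\<tau> g))) = padd (\<pi>' (\<pi> i)) (vc g)" using bspec[OF t(2) g] by (auto simp: itw_at_def)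
		show "\<pi>' (\<pi> (padd i (vc (\<sigma> (\<tau> g))))) = padd (\<pi>' (\<pi> i)) (vc g)" using s2 t2 by simp
		show "cc (\<sigma> (\<tau> g)) i = ?h i *[HZ] th (e ~= e') (cc g (?p i)) *[HZ] inv[HZ] ?h (padd i (vc (\<sigma> (\<tau> g))))"
			unfolding s1 s2 t1 using s(1) t(1) g by (simp add: th_mult th_inv PZ.GP.inv_mult_group PZ.GP.m_assoc th_th)
	qed
	moreover have "\<forall>i. ?h i : car HZ" using s(1) t(1) by simp
	ultimately show ?thesis unfolding itw_def by (intro exI[of _ "e ~= e'", OF exI[of _ ?p, OF exI[of _ ?h]]]) simp
qed

text \<open>Conjugation by \<open>g\<close> shifts the strands by \<open>vc g\<close>, with the
  cocycle of \<open>g\<close> itself as coboundary.\<close>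

lemma itw_inner: assumes g: "g : car F2" shows "itw (%k. g *[F2] k *[F2] inv[F2] g)"
proof -
	have pc: "padd i (padd j k) = padd (padd i k) j" for i j k by (cases i; cases j; cases k) auto
	have "itw_at (%k. g *[F2] k *[F2] inv[F2] g) False (%i. padd i (vc g)) (cc g) k" if k: "k : car F2" for k
		unfolding itw_at_def
	proof (intro allI conjI)
		fix i
		have v: "vc (g *[F2] k *[F2] inv[F2] g) = vc k"
			using g k by (simp add: vc_cc_mult vc_cc_inv) (cases "vc g"; cases "vc k"; simp)
		show "padd (padd i (vc (g *[F2] k *[F2] inv[F2] g))) (vc g) = padd (padd i (vc g)) (vc k)"
			unfolding v by (cases i; cases "vc g"; cases "vc k"; simp)
		have p: "padd (padd i (padd (vc g) (vc k))) (vc g) = padd i (vc k)" by (cases i; cases "vc g"; cases "vc k"; simp)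
		show "cc (g *[F2] k *[F2] inv[F2] g) i = cc g i *[HZ] th False (cc k (padd i (vc g))) *[HZ] inv[HZ] cc g (padd i (vc (g *[F2] k *[F2] inv[F2] g)))"
			unfolding v using g k p by (simp add: vc_cc_mult vc_cc_inv th_def)
	qed
	then show ?thesis unfolding itw_def using g
		by (intro exI[of _ False, OF exI[of _ "%i. padd i (vc g)", OF exI[of _ "cc g"]]]) simp
qed

text \<open>Explicit coboundaries and relabellings for the swap, the inversion and the transvection,
  verified strand by strand. The mirror image accompanies the moves of determinant -1.\<close>

primrec h_swap :: "pos => (bool \<times> int) list set" where
	"h_swap Pz = yg" | "h_swap Pa = one[HZ]" | "h_swap Pb = one[HZ]" | "h_swap Pc = yg"
primrec p_swap :: "pos => pos" where "p_swap Pz = Pc" | "p_swap Pa = Pa" | "p_swap Pb = Pb" | "p_swap Pc = Pz"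
primrec h_inv :: "pos => (bool \<times> int) list set" where
	"h_inv Pz = yg" | "h_inv Pa = yg" | "h_inv Pb = xg" | "h_inv Pc = xg"
primrec h_tr :: "pos => (bool \<times> int) list set" where
	"h_tr Pz = one[HZ]" | "h_tr Pa = one[HZ]" | "h_tr Pb = xg *[HZ] yg" | "h_tr Pc = xg *[HZ] yg"
primrec p_tr :: "pos => pos" where "p_tr Pz = Pa" | "p_tr Pa = Pz" | "p_tr Pb = Pb" | "p_tr Pc = Pc"

lemma itw_swap: assumes s: "\<sigma> : hom F2 F2" "\<sigma> ga = gb" "\<sigma> gb = ga" shows "itw \<sigma>"
proof (rule itwI[OF s(1), where e = True and \<pi> = p_swap and h = h_swap])
	show "h_swap i : car HZ" for i by (cases i) auto
	show "itw_at \<sigma> True p_swap h_swap ga" unfolding itw_at_def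
	proof (intro allI conjI)
		fix i
		show "cc (\<sigma> ga) i = h_swap i *[HZ] th True (cc ga (p_swap i)) *[HZ] inv[HZ] h_swap (padd i (vc (\<sigma> ga)))"
			unfolding s  vc_cc_gen th_def by (cases i) (simp_all add: HZ_simps mu_mult mu_xy mu_one)
		show "p_swap (padd i (vc (\<sigma> ga))) = padd (p_swap i) (vc ga)" unfolding s  vc_cc_gen by (cases i) simp_all
	qed
	show "itw_at \<sigma> True p_swap h_swap gb" unfolding itw_at_def
	proof (intro allI conjI)
		fix i
		show "cc (\<sigma> gb) i = h_swap i *[HZ] th True (cc gb (p_swap i)) *[HZ] inv[HZ] h_swap (padd i (vc (\<sigma> gb)))"
			unfolding s  vc_cc_gen th_def by (cases i) (simp_all add: HZ_simps mu_mult mu_xy mu_one)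
		show "p_swap (padd i (vc (\<sigma> gb))) = padd (p_swap i) (vc gb)" unfolding s  vc_cc_gen by (cases i) simp_all
	qed
qed

lemma itw_inv: assumes s: "\<sigma> : hom F2 F2" "\<sigma> ga = inv[F2] ga" "\<sigma> gb = gb" shows "itw \<sigma>"
proof (rule itwI[OF s(1), where e = True and \<pi> = "%i. padd i Pa" and h = h_inv])
	show "h_inv i : car HZ" for i by (cases i) auto
	have v: "vc (inv[F2] ga) = Pa" "cc (inv[F2] ga) i = inv[HZ] alc (padd i Pa)" for i using vc_cc_inv[OF gl_closed] vc_cc_gen by simp_all
	show "itw_at \<sigma> True (%i. padd i Pa) h_inv ga" unfolding itw_at_def
	proof (intro allI conjI)
		fix i
		show "cc (\<sigma> ga) i = h_inv i *[HZ] th True (cc ga (padd i Pa)) *[HZ] inv[HZ] h_inv (padd i (vc (\<sigma> ga)))"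
			unfolding s v vc_cc_gen th_def by (cases i) (simp_all add: HZ_simps mu_mult mu_xy mu_one)
		show "padd (padd i (vc (\<sigma> ga))) Pa = padd (padd i Pa) (vc ga)" unfolding s v vc_cc_gen by (cases i) simp_all
	qed
	show "itw_at \<sigma> True (%i. padd i Pa) h_inv gb" unfolding itw_at_def
	proof (intro allI conjI)
		fix i
		show "cc (\<sigma> gb) i = h_inv i *[HZ] th True (cc gb (padd i Pa)) *[HZ] inv[HZ] h_inv (padd i (vc (\<sigma> gb)))"
			unfolding s v vc_cc_gen th_def by (cases i) (simp_all add: HZ_simps mu_mult mu_xy mu_one)
		show "padd (padd i (vc (\<sigma> gb))) Pa = padd (padd i Pa) (vc gb)" unfolding s v vc_cc_gen by (cases i) simp_all
	qed
qed

lemma itw_transvection: assumes s: "\<sigma> : hom F2 F2" "\<sigma> ga = ga" "\<sigma> gb = gb *[F2] ga" shows "itw \<sigma>"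
proof (rule itwI[OF s(1), where e = False and \<pi> = p_tr and h = h_tr])
	show "h_tr i : car HZ" for i by (cases i) auto
	have v: "vc (gb *[F2] ga) = Pc" "cc (gb *[F2] ga) i = bec i *[HZ] alc (padd i Pb)" for i
		using vc_cc_mult[OF gl_closed gl_closed] vc_cc_gen by simp_all
	show "itw_at \<sigma> False p_tr h_tr ga" unfolding itw_at_def
	proof (intro allI conjI)
		fix i
		show "cc (\<sigma> ga) i = h_tr i *[HZ] th False (cc ga (p_tr i)) *[HZ] inv[HZ] h_tr (padd i (vc (\<sigma> ga)))"
			unfolding s v vc_cc_gen th_def by (cases i) (simp_all add: HZ_simps )
		show "p_tr (padd i (vc (\<sigma> ga))) = padd (p_tr i) (vc ga)" unfolding s v vc_cc_gen by (cases i) simp_all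
	qed
	show "itw_at \<sigma> False p_tr h_tr gb" unfolding itw_at_def
	proof (intro allI conjI)
		fix i
		show "cc (\<sigma> gb) i = h_tr i *[HZ] th False (cc gb (p_tr i)) *[HZ] inv[HZ] h_tr (padd i (vc (\<sigma> gb)))"
			unfolding s v vc_cc_gen th_def by (cases i) (simp_all add: HZ_simps )
		show "p_tr (padd i (vc (\<sigma> gb))) = padd (p_tr i) (vc gb)" unfolding s v vc_cc_gen by (cases i) simp_all
	qed
qed

definition itw_pair where "itw_pair x y \<longleftrightarrow> (\<exists>\<sigma>. \<sigma> : hom F2 F2 & \<sigma> ga = x & \<sigma> gb = y & itw \<sigma>)"

text \<open>A move on the pair (\<sigma> a, \<sigma> b) precomposes \<sigma> with one fixed
  automorphism, and conjugation postcomposes it with an inner one; \<open>itw_comp\<close> then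
  gives the closure properties required by \<open>nielsen\<close>.\<close>

lemma itw_pair_full: assumes "full_pair x y" shows "itw_pair x y"
proof (rule nielsen[OF _ _ _ _ _ assms, of itw_pair])
	have comp: "(%g. \<sigma> (\<tau> g)) : hom F2 F2" if "\<sigma> : hom F2 F2" "\<tau> : hom F2 F2" for \<sigma> \<tau>
		using hom_compose[OF that(2,1)] by (simp add: comp_def)
	have pre: "itw_pair (\<sigma> u) (\<sigma> v)" if "\<sigma> : hom F2 F2" "itw \<sigma>" "u : car F2" "v : car F2"
		"!!\<tau>. \<tau> : hom F2 F2 ==> \<tau> ga = u ==> \<tau> gb = v ==> itw \<tau>" for \<sigma> u v
	proof -
		from F2_map[OF Y.group_GP that(3,4)] obtain \<tau> where t: "\<tau> : hom F2 F2" "\<tau> ga = u" "\<tau> gb = v" by blast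
		show ?thesis unfolding itw_pair_def
			by (rule exI[of _ "%g. \<sigma> (\<tau> g)"]) (use comp[OF that(1) t(1)] itw_comp[OF that(2) that(5)[OF t] t(1)] t in simp)
	qed
	have sw: "itw_pair y x" if p: "itw_pair x y" for x y
	proof -
		obtain \<sigma> where s: "\<sigma> : hom F2 F2" "\<sigma> ga = x" "\<sigma> gb = y" "itw \<sigma>" using p unfolding itw_pair_def by (elim exE conjE)
		have "itw_pair (\<sigma> gb) (\<sigma> ga)" by (rule pre[OF s(1,4) gl_closed gl_closed]) (rule itw_swap)
		then show ?thesis using s(2,3) by simp
	qed
	then show "itw_pair y x" if "itw_pair x y" for x y using that .
	show "itw_pair (inv[F2] x) y" if p: "itw_pair x y" for x y
	proof -
		obtain \<sigma> where s: "\<sigma> : hom F2 F2" "\<sigma> ga = x" "\<sigma> gb = y" "itw \<sigma>" using p unfolding itw_pair_def by (elim exE conjE)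
		have "\<sigma> (inv[F2] ga) = inv[F2] x" using group_hom.hom_inv[of F2 F2 \<sigma> ga] s Y.group_GP by (simp add: group_hom_def group_hom_axioms_def)
		moreover have "itw_pair (\<sigma> (inv[F2] ga)) (\<sigma> gb)" by (rule pre[OF s(1,4)]) (simp, simp, rule itw_inv)
		ultimately show ?thesis using s(3) by simp
	qed
	show "itw_pair (x *[F2] y) y" if p: "itw_pair x y" for x y
	proof -
		obtain \<sigma> where s: "\<sigma> : hom F2 F2" "\<sigma> ga = y" "\<sigma> gb = x" "itw \<sigma>" using sw[OF p] unfolding itw_pair_def by (elim exE conjE)
		have "\<sigma> (gb *[F2] ga) = x *[F2] y" using hom_mult[OF s(1) gl_closed gl_closed] s(2,3) by simp
		moreover have "itw_pair (\<sigma> ga) (\<sigma> (gb *[F2] ga))" by (rule pre[OF s(1,4)]) (simp, simp, rule itw_transvection)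
		ultimately have "itw_pair y (x *[F2] y)" using s(2) by simp
		then show ?thesis by (rule sw)
	qed
	show "itw_pair (g *[F2] x *[F2] inv[F2] g) (g *[F2] y *[F2] inv[F2] g)" if g: "g : car F2" and p: "itw_pair x y" for g x y
	proof -
		obtain \<sigma> where s: "\<sigma> : hom F2 F2" "\<sigma> ga = x" "\<sigma> gb = y" "itw \<sigma>" using p unfolding itw_pair_def by (elim exE conjE)
		have i: "(%k. g *[F2] k *[F2] inv[F2] g) : hom F2 F2" by (rule iso_hom[OF Y.GP.inner_iso[OF g]])
		show ?thesis unfolding itw_pair_def
			by (rule exI[of _ "%k. g *[F2] \<sigma> k *[F2] inv[F2] g"]) (use comp[OF i s(1)] itw_comp[OF itw_inner[OF g] s(4,1)] s(2,3) in simp)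
	qed
	have "one[F2] *[F2] ga *[F2] inv[F2] one[F2] = ga" "one[F2] *[F2] gb *[F2] inv[F2] one[F2] = gb" by simp_all
	then show "itw_pair ga gb" unfolding itw_pair_def
		using iso_hom[OF Y.GP.inner_iso[OF Y.GP.one_closed]] itw_inner[OF Y.GP.one_closed]
		by (intro exI[of _ "%k. one[F2] *[F2] k *[F2] inv[F2] one[F2]"]) simp
qed

text \<open>A surjective endomorphism sends the generators to a generating pair and is determined by
  that pair.\<close>

lemma itw_surj:
	assumes s: "\<sigma> : hom F2 F2" "car F2 \<subseteq> \<sigma> ` car F2"
	shows "itw \<sigma>"
proof -
	interpret s: group_hom F2 F2 \<sigma> using s Y.group_GP by (simp add: group_hom_def group_hom_axioms_def)
	have "full_pair (\<sigma> ga) (\<sigma> gb)" unfolding full_pair_def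
	proof (intro conjI allI impI)
		fix L assume L: "subgroup L F2" "\<sigma> ga : L" "\<sigma> gb : L"
		have "\<sigma> g : L" if "g : car F2" for g
			using that by (rule F2_subgroup_induct) (use L subgroup.m_inv_closed[OF L(1)] subgroup.m_closed[OF L(1)] subgroup.one_closed[OF L(1)] in auto)
		then show "L = car F2" using s(2) subgroup.subset[OF L(1)] by blast
	qed simp_all
	then obtain \<tau> where t: "\<tau> : hom F2 F2" "\<tau> ga = \<sigma> ga" "\<tau> gb = \<sigma> gb" "itw \<tau>" using itw_pair_full unfolding itw_pair_def by blast
	have e: "\<tau> g = \<sigma> g" if "g : car F2" for g by (rule F2_hom_ext[OF t(1) s(1) Y.group_GP t(2,3) that])
	have "itw_at \<tau> e' \<pi> h g \<longleftrightarrow> itw_at \<sigma> e' \<pi> h g" if "g : car F2" for e' \<pi> h g using e[OF that] by (simp add: itw_at_def)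
	then show ?thesis using t(4) unfolding itw_def by simp
qed

text \<open>\<open>sF\<close> and \<open>tF\<close> have even exponent in both generators, and their
  components at \<open>Pz\<close> are cubes of the commutators of y and of y^2 with x, the two
  elements that the finite criterion separates.\<close>

definition sF where "sF = ga *[F2] (gb *[F2] (ga *[F2] (ga *[F2] (inv[F2] gb *[F2] ga))))"
definition tF where "tF = gb *[F2] (ga *[F2] (ga *[F2] (inv[F2] gb *[F2] (ga *[F2] ga))))"

lemma cc_sF: "cc sF Pz = PZ.commutator 1 1 ^[HZ] (3::nat)"
proof -
	have c: "PZ.commutator 1 1 = yg *[HZ] (xg *[HZ] (yg *[HZ] (yg *[HZ] xg)))"
		unfolding PZ.commutator_def xg_def[symmetric] yg_def[symmetric] by (simp add: HZ_simps)
	show ?thesis unfolding c sF_def by (simp add: vc_cc_mult vc_cc_inv vc_cc_gen HZ_simps numeral_3_eq_3)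
qed

lemma cc_tF: "cc tF Pz = PZ.commutator 2 1 ^[HZ] (3::nat)"
proof -
	have c: "PZ.commutator 2 1 = yg *[HZ] (yg *[HZ] (xg *[HZ] (yg *[HZ] xg)))"
		unfolding PZ.commutator_def xg_def[symmetric] y2[symmetric] by (simp add: HZ_simps)
	show ?thesis unfolding c tF_def by (simp add: vc_cc_mult vc_cc_inv vc_cc_gen HZ_simps numeral_3_eq_3)
qed

text \<open>On \<open>K\<close> the component at \<open>Pz\<close> after \<open>q\<close> is a
  homomorphism to the modular group. An automorphism invisible in \<open>Q\<close> descends to a
  surjective endomorphism of the free group, so composing with it yields, up to conjugacy, one of
  eight maps: four components, each with or without mirror image.\<close>

lemma (in graph_prod) pos_scl_of_free_quotient:
	fixes \<pi> :: "('v \<times> 'a) list set => 'q" and Q :: "'q monoid"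
	assumes q: "q : hom GP F2" "car F2 \<subseteq> q ` car GP"
		and Q: "group Q" "finite (car Q)" "\<pi> : hom GP Q"
		and S0: "finite S0" "S0 \<subseteq> car GP" "car GP \<subseteq> generate GP S0"
		and K: "subgroup K GP" "!!\<phi> k. \<phi> : iso GP GP ==> k : K ==> \<phi> k : K"
		and T: "finite T" "T \<subseteq> car GP" "!!g. g : car GP ==> \<exists>t\<in>T. g *[GP] inv[GP] t : K"
		and even: "!!k. k : K ==> vc (q k) = Pz"
		and desc: "!!\<omega>. \<omega> : iso GP GP ==> (\<forall>g\<in>car GP. \<pi> (\<omega> g) = \<pi> g) ==>
			 \<exists>\<sigma>\<in>hom F2 F2. \<forall>g\<in>car GP. q (\<omega> g) = \<sigma> (q g)"
		and st: "s : K" "q s = sF" "t : K" "q t = tF"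
	shows "has_pos_scl_aut GP"
proof -
	interpret K: subgroup K GP by (rule K)
	define \<rho> where "\<rho> k = cc (q k) Pz" for k
	have qc: "q g : car F2" if "g : car GP" for g using q(1) that by (rule hom_in_carrier)
	have Kc: "k : car GP" if "k : K" for k using that by (rule K.mem_carrier)
	define P1 where "P1 = (%(e, j) k. th e (cc (q k) j)) ` (UNIV :: (bool \<times> pos) set)"
	have "finite (UNIV :: (bool \<times> pos) set)" unfolding UNIV_Times_UNIV[symmetric] using finite_pos by (intro finite_cartesian_product) simp_all
	then have P1f: "finite P1" unfolding P1_def by (rule finite_imageI)
	have P1I: "(%k. th e (cc (q k) j)) : P1" for e j unfolding P1_def by (rule image_eqI[of _ _ "(e, j)"]) simp_all
	have P1c: "p k : car HZ" if "p : P1" "k : K" for p k using that qc Kc by (auto simp: P1_def)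
	have same: "\<exists>p\<in>P1. conjugate_on K HZ (%k. \<rho> (\<omega> k)) p"
		if w: "\<omega> : iso GP GP" and e: "\<forall>g\<in>car GP. \<pi> (\<omega> g) = \<pi> g" for \<omega>
	proof -
		obtain \<sigma> where s: "\<sigma> : hom F2 F2" "\<forall>g\<in>car GP. q (\<omega> g) = \<sigma> (q g)" using desc[OF w e] by (elim bexE)
		have "car F2 \<subseteq> \<sigma> ` car F2"
		proof
			fix z assume "z : car F2"
			then obtain g where g: "g : car GP" "z = q g" using q(2) by blast
			have "\<omega> ` car GP = car GP" using w by (simp add: iso_def bij_betw_def)
			then obtain g' where "g' : car GP" "g = \<omega> g'" using g(1) by blast
			then have "z = \<sigma> (q g')" "q g' : car F2" using g s(2) qc by auto
			then show "z : \<sigma> ` car F2" by blast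
		qed
		then have "itw \<sigma>" by (rule itw_surj[OF s(1)])
		then obtain e p h where ith: "\<forall>i. h i : car HZ" "\<forall>g\<in>car F2. itw_at \<sigma> e p h g" unfolding itw_def by (elim exE conjE)
		have "conjugate_on K HZ (%k. \<rho> (\<omega> k)) (%k. th e (cc (q k) (p Pz)))" unfolding conjugate_on_def
		proof (rule bexI[of _ "h Pz"], rule ballI)
			fix k assume k: "k : K"
			have v: "vc (\<sigma> (q k)) = Pz" using even[OF K(2)[OF w k]] s(2) Kc[OF k] by simp
			have "itw_at \<sigma> e p h (q k)" using ith(2) qc[OF Kc[OF k]] by blast
			then have "cc (\<sigma> (q k)) Pz = h Pz *[HZ] th e (cc (q k) (p Pz)) *[HZ] inv[HZ] h (padd Pz (vc (\<sigma> (q k))))" unfolding itw_at_def by blast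
			then show "\<rho> (\<omega> k) = h Pz *[HZ] th e (cc (q k) (p Pz)) *[HZ] inv[HZ] h Pz" using v s(2) Kc[OF k] by (simp add: \<rho>_def)
		qed (use ith(1) in blast)
		then show ?thesis using P1I by (rule bexI)
	qed
	have "\<exists>P. finite P & (\<forall>p\<in>P. \<forall>k\<in>K. p k : car HZ) & (\<forall>\<phi>\<in>iso GP GP. \<exists>p\<in>P. conjugate_on K HZ (%k. \<rho> (\<phi> k)) p)"
	proof (rule finite_cover[where H = HZ and K = K and \<rho> = \<rho> and \<pi> = \<pi>, OF PZ.group_GP Q S0 _ K.subset P1f])
		show "\<phi> k : K" if "\<phi> : iso GP GP" "k : K" for \<phi> k using that by (rule K(2))
		show "p k : car HZ" if "p : P1" "k : K" for p k using that by (rule P1c)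
		show "\<exists>p\<in>P1. conjugate_on K HZ (%k. \<rho> (\<omega> k)) p"
			if "\<omega> : iso GP GP" "\<forall>g\<in>car GP. \<pi> (\<omega> g) = \<pi> g" for \<omega> using that by (rule same)
	qed
	then obtain P where P: "finite P" "\<forall>p\<in>P. \<forall>k\<in>K. p k : car HZ"
		"\<forall>\<phi>\<in>iso GP GP. \<exists>p\<in>P. conjugate_on K HZ (%k. \<rho> (\<phi> k)) p" by (elim exE conjE)
	show ?thesis
	proof (rule finite_free_product_criterion[where A = AZ and K = K and T = T and \<rho> = \<rho> and P = P and s = s and t = t
				and ?e1.0 = 3 and ?e2.0 = 3 and ?a0.0 = 1 and ?a1.0 = 2 and ?b0.0 = 1])
		show "comm_group (AZ i)" "finite (car (AZ i))" for i by (rule AZ_comm, rule AZ_finite)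
		show "\<rho> : hom (GP\<lparr>carrier := K\<rparr>) HZ"
			using qc Kc even by (intro homI) (auto simp: \<rho>_def hom_mult[OF q(1)] vc_cc_mult)
		show "\<phi> k : K" if "\<phi> : iso GP GP" "k : K" for \<phi> k using that by (rule K(2))
		show "\<exists>t\<in>T. g *[GP] inv[GP] t : K" if "g : car GP" for g using that by (rule T(3))
		show "\<exists>p\<in>P. conjugate_on K HZ (%k. \<rho> (\<phi> k)) p" if "\<phi> : iso GP GP" for \<phi> using P(3) that by (rule bspec)
		show "p k : car HZ" if "p : P" "k : K" for p k using P(2) that by simp
		show "\<rho> s = PZ.commutator 1 1 ^[HZ] (3::nat)" unfolding \<rho>_def st(2) by (rule cc_sF)
		show "\<rho> t = PZ.commutator 2 1 ^[HZ] (3::nat)" unfolding \<rho>_def st(4) by (rule cc_tF)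
	qed (use K(1) T P(1) st AZ_car AZ_one in simp_all)
qed

section \<open>Right-angled Artin groups\<close>

lemma hom_int_nat_pow:
	assumes "f : hom G integer_group" "group G" "x : car G"
	shows "f (x ^[G] (n::nat)) = int n * f x"
proof (induction n)
	case 0 show ?case using hom_one[OF assms(1,2)] by simp
next
	case (Suc n)
	interpret group G by (rule assms)
	show ?case using Suc hom_mult[OF assms(1), of "x ^[G] n" x] assms(3) by (simp add: algebra_simps)
qed

lemma hom_int_int_pow:
	assumes "f : hom G integer_group" "group G" "x : car G"
	shows "f (x ^[G] (n::int)) = n * f x"
proof -
	interpret group G by (rule assms)
	have i: "f (inv[G] z) = - f z" if "z : car G" for z
		using hom_mult[OF assms(1), of z "inv[G] z"] hom_one[OF assms(1,2)] that by simp
	show ?thesis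
	proof (cases n)
		case (nonneg k) then show ?thesis using hom_int_nat_pow[OF assms, of k] by (simp add: int_pow_int)
	next
		case (neg k)
		have "f (x ^[G] n) = f (inv[G] (x ^[G] Suc k))" unfolding neg by (simp only: int_pow_neg_int[OF assms(3)])
		also have "\<dots> = - f (x ^[G] Suc k)" by (rule i) (use assms(3) in simp)
		also have "\<dots> = - (int (Suc k) * f x)" by (simp only: hom_int_nat_pow[OF assms])
		finally show ?thesis unfolding neg by (simp only: mult_minus_left)
	qed
qed

context free_prod
begin

lemma elliptic_one: "elliptic one[GP]"
	unfolding elliptic_def
	by (intro bexI[of _ "one[GP]"] exI[of _ True] bexI[of _ "one[A True]"]) (simp_all add: incl_one)

lemma elliptic_conj: assumes "elliptic Q" "d : car GP" shows "elliptic (d *[GP] Q *[GP] inv[GP] d)"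
proof -
	obtain c i a where c: "c : car GP" "a : car (A i)" "Q = c *[GP] incl i a *[GP] inv[GP] c"
		using assms(1) unfolding elliptic_def by (elim bexE exE)
	have "d *[GP] Q *[GP] inv[GP] d = (d *[GP] c) *[GP] incl i a *[GP] inv[GP] (d *[GP] c)"
		unfolding c(3) using c(1,2) assms(2) by (simp add: GP.m_assoc GP.inv_mult_group)
	moreover have "d *[GP] c : car GP" using assms(2) c(1) by simp
	ultimately show ?thesis unfolding elliptic_def using c(2) by blast
qed

lemma elliptic_incl: assumes "a : car (A i)" shows "elliptic (incl i a)"
	unfolding elliptic_def by (rule bexI[of _ "one[GP]"], rule exI[of _ i], rule bexI[of _ a]) (use assms in simp_all)

lemma elliptic_int_pow: assumes "elliptic Q" shows "elliptic (Q ^[GP] (n::int))"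
proof -
	obtain d i a where d: "d : car GP" "a : car (A i)" "Q = d *[GP] incl i a *[GP] inv[GP] d"
		using assms unfolding elliptic_def by (elim bexE exE)
	have f: "(%z. d *[GP] incl i z *[GP] inv[GP] d) : hom (A i) GP"
		using hom_compose[OF incl_hom[of i] iso_hom[OF GP.inner_iso[OF d(1)]]] by (simp add: comp_def)
	have "Q ^[GP] n = d *[GP] incl i (a ^[A i] n) *[GP] inv[GP] d"
		unfolding d(3) using hom_int_pow[OF f d(2) factor_group group_GP, of n] by simp
	moreover have "a ^[A i] n : car (A i)" by (rule group.int_pow_closed[OF factor_group d(2)])
	ultimately show ?thesis unfolding elliptic_def using d(1) by blast
qed

lemma hyperbolic_pow_inj:
	assumes "Q : car GP" "~ elliptic Q" "Q ^[GP] (a::int) = Q ^[GP] (b::int)"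
	shows "a = b"
proof (rule ccontr)
	assume ne: "a ~= b"
	have z: "Q ^[GP] (c - d) = one[GP]" if "Q ^[GP] c = Q ^[GP] d" for c d :: int
		using that assms(1) by (simp add: GP.int_pow_diff)
	have "Q ^[GP] \<bar>a - b\<bar> = one[GP]" using z[OF assms(3)] z[OF assms(3)[symmetric]] by (cases "a \<ge> b") (simp_all add: abs_if)
	moreover have "\<bar>a - b\<bar> = int (nat \<bar>a - b\<bar>)" by simp
	ultimately have "Q ^[GP] nat \<bar>a - b\<bar> = one[GP]" by (metis int_pow_int)
	then show False using torsion_elliptic[OF assms(1), of "nat \<bar>a - b\<bar>"] assms(2) ne by simp
qed

lemma commuting_hyperbolic_int:
	assumes "g : car GP" "~ elliptic g" "h : car GP" "g *[GP] h = h *[GP] g"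
	shows "\<exists>m (e::int). m > 0 & h ^[GP] (m::nat) = g ^[GP] e"
proof -
	obtain m n where mn: "m > 0" "h ^[GP] (m::nat) = g ^[GP] (n::nat) | inv[GP] h ^[GP] (m::nat) = g ^[GP] (n::nat)"
		using commuting_hyperbolic[OF assms] by (elim exE conjE)
	from mn(2) show ?thesis
	proof
		assume "h ^[GP] m = g ^[GP] n"
		then have "h ^[GP] m = g ^[GP] int n" by (simp add: int_pow_int)
		then show ?thesis using mn(1) by blast
	next
		assume "inv[GP] h ^[GP] m = g ^[GP] n"
		then have "inv[GP] (h ^[GP] m) = g ^[GP] n" using assms(3) by (simp add: GP.nat_pow_inv)
		then have "h ^[GP] m = inv[GP] (g ^[GP] n)" using assms(3) by (metis GP.inv_inv GP.nat_pow_closed)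
		then have "h ^[GP] m = g ^[GP] (- int n)" using assms(1) by (simp add: GP.int_pow_neg_int)
		then show ?thesis using mn(1) by blast
	qed
qed

end

text \<open>Compares two projections of one graph product, where the second kills more vertices or
  passes to images of the vertex groups. \<open>kmap\<close> preserves elliptic elements, so
  hyperbolicity seen in the coarser target holds in the finer one.\<close>

locale pair_map = P: pair_projection V E Gs D \<theta> S T + R: pair_projection V E Gs D' \<theta>' S' T'
	for V :: "'v set" and E and Gs :: "'v => 'a monoid" and D :: "'v => 'd monoid" and \<theta> S T
		and D' :: "'v => 'e monoid" and \<theta>' S' T' +
	fixes \<tau> :: "'v => 'd => 'e"
	assumes sub: "S' \<subseteq> S" "T' \<subseteq> T"
		and \<tau>: "!!v. v : S' \<union> T' ==> \<tau> v : hom (D v) (D' v)"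
		and \<tau>\<theta>: "!!v a. v : S' \<union> T' ==> a : car (Gs v) ==> \<tau> v (\<theta> v a) = \<theta>' v a"
begin

definition fac :: "bool => ('v => 'd) => 'v => 'e" where "fac i f = (\<lambda>v\<in>R.side i. \<tau> v (f v))"

lemma side_sub: "v : R.side i ==> v : P.side i & v : S' \<union> T'"
	using sub by (cases i) (auto simp: R.side_def P.side_def)

lemma fac_closed: assumes "f : car (P.PD i)" shows "fac i f : car (R.PD i)"
proof -
	have "\<tau> v (f v) : car (D' v)" if "v : R.side i" for v
		using hom_in_carrier[OF \<tau>] side_sub[OF that] assms by (auto simp: P.PD_carrier)
	then show ?thesis by (auto simp: fac_def R.PD_carrier)
qed

lemma fac_hom: "fac i : hom (P.PD i) (R.PD i)"
proof (rule homI)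
	fix f g assume fg: "f : car (P.PD i)" "g : car (P.PD i)"
	have "\<tau> v (f v *[D v] g v) = \<tau> v (f v) *[D' v] \<tau> v (g v)" if v: "v : R.side i" for v
		using hom_mult[OF \<tau>[of v]] side_sub[OF v] fg by (auto simp: P.PD_carrier)
	then show "fac i (f *[P.PD i] g) = fac i f *[R.PD i] fac i g"
		using side_sub by (auto simp: fac_def P.PD_mult R.PD_mult intro!: restrict_ext)
qed (rule fac_closed)

definition kmap where "kmap = gp_lift R.HG (%i f. R.HH.incl i (fac i f))"

lemma kmap_compatible: "P.HH.compatible R.HG (%i f. R.HH.incl i (fac i f))"
	unfolding P.HH.compatible_def
proof (intro conjI ballI impI)
	fix i :: bool
	show "(%f. R.HH.incl i (fac i f)) : hom (P.PD i) R.HG"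
		using hom_compose[OF fac_hom[of i] R.HH.incl_hom[of i]] by (simp add: comp_def)
qed simp

lemma kmap_hom: "kmap : hom P.HG R.HG" unfolding kmap_def by (rule P.HH.gp_lift_hom[OF R.HH.group_GP kmap_compatible])
lemma kmap_incl: "f : car (P.PD i) ==> kmap (P.HH.incl i f) = R.HH.incl i (fac i f)"
	unfolding kmap_def by (rule P.HH.gp_lift_incl[OF R.HH.group_GP kmap_compatible]) simp_all

lemma kmap_rho: assumes x: "x : car P.GP" shows "kmap (P.rho x) = R.rho x"
proof -
	have "(%x. kmap (P.rho x)) : hom P.GP R.HG" using hom_compose[OF P.rho_hom kmap_hom] by (simp add: comp_def)
	then show ?thesis
	proof (rule P.hom_ext[OF _ R.rho_hom R.HH.group_GP x])
		fix v a assume v: "v : V" "a : car (Gs v)"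
		show "kmap (P.rho (P.incl v a)) = R.rho (P.incl v a)"
		proof (cases "v : S \<union> T")
			case True
			then obtain i where i: "v : P.side i" using P.sides[OF v(1)] by blast
			have sc: "P.single i v (\<theta> v a) : car (P.PD i)" by (rule P.single_carrier[OF i P.\<theta>_closed[OF v]])
			have k: "kmap (P.rho (P.incl v a)) = R.HH.incl i (fac i (P.single i v (\<theta> v a)))"
				unfolding P.rho_incl[OF v] P.letter_side[OF i] by (rule kmap_incl[OF sc])
			have one: "\<tau> u one[D u] = one[D' u]" if "u : R.side i" for u
				using hom_one[OF \<tau>[of u] P.D_group R.D_group] side_sub[OF that] by blast
			show ?thesis
			proof (cases "v : R.side i")
				case True
				have "fac i (P.single i v (\<theta> v a)) = R.single i v (\<theta>' v a)" unfolding fac_def R.single_def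
				proof (rule restrict_ext)
					fix u assume u: "u : R.side i"
					show "\<tau> u (P.single i v (\<theta> v a) u) = (if u = v then \<theta>' v a else one[D' u])"
						using one[OF u] side_sub[OF u] \<tau>\<theta>[of v a] v(2) by (auto simp: P.single_def)
				qed
				then show ?thesis unfolding k R.rho_incl[OF v] R.letter_side[OF True] by simp
			next
				case False
				have "fac i (P.single i v (\<theta> v a)) = one[R.PD i]" unfolding fac_def R.PD_one
				proof (rule restrict_ext)
					fix u assume u: "u : R.side i"
					then have "u ~= v" using False by blast
					then show "\<tau> u (P.single i v (\<theta> v a) u) = one[D' u]" using one[OF u] side_sub[OF u] by (simp add: P.single_def)
				qed
				then have "kmap (P.rho (P.incl v a)) = one[R.HG]" unfolding k using R.HH.incl_one[of i] by simp
				moreover have "v \<notin> S' \<union> T'"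
					using False i sub P.ST(3) by (cases i) (auto simp: P.side_def R.side_def)
				ultimately show ?thesis unfolding R.rho_incl[OF v] by (simp add: R.letter_def)
			qed
		next
			case False
			then have "v \<notin> S' \<union> T'" using sub by blast
			then show ?thesis unfolding P.rho_incl[OF v] R.rho_incl[OF v] using False hom_one[OF kmap_hom P.HH.group_GP R.HH.group_GP]
				by (simp add: P.letter_def R.letter_def)
		qed
	qed
qed

lemma kmap_elliptic: assumes "P.HH.elliptic Q" shows "R.HH.elliptic (kmap Q)"
proof -
	obtain d i a where d: "d : car P.HG" "a : car (P.PD i)" "Q = d *[P.HG] P.HH.incl i a *[P.HG] inv[P.HG] d"
		using assms unfolding P.HH.elliptic_def by (elim bexE exE)
	interpret k: group_hom P.HG R.HG kmap using kmap_hom P.HH.group_GP R.HH.group_GP by (simp add: group_hom_def group_hom_axioms_def)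
	have "kmap Q = kmap d *[R.HG] R.HH.incl i (fac i a) *[R.HG] inv[R.HG] kmap d"
		unfolding d(3) using d(1,2) kmap_incl[OF d(2)] by simp
	then show ?thesis using R.HH.elliptic_conj[OF R.HH.elliptic_incl[OF fac_closed[OF d(2)]], of "kmap d"] d(1) by simp
qed

end

text \<open>The integral Heisenberg group; elements (a, b, c) and (a', b', c') commute exactly when
  a b' = a' b.\<close>

definition heis :: "(int \<times> int \<times> int) monoid" where
	"heis = \<lparr>carrier = UNIV, monoid.mult = (%(a, b, c) (a', b', c'). (a + a', b + b', c + c' + a * b')), one = (0, 0, 0)\<rparr>"

lemma heis_group: "group heis"
proof (rule groupI)
	fix x assume "x : car heis"
	obtain a b c where x: "x = (a, b, c)" by (cases x) auto
	have "(- a, - b, a * b - c) : car heis" "(- a, - b, a * b - c) *[heis] x = one[heis]" by (simp_all add: heis_def x)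
	then show "\<exists>y\<in>car heis. y *[heis] x = one[heis]" by blast
qed (auto simp: heis_def algebra_simps)

section \<open>Exponent vectors and automorphisms congruent to the identity modulo 3\<close>

locale raag =
	fixes V :: "'v set" and E :: "'v set set"
	assumes graph: "is_graph V E"
begin

sublocale graph_prod V E "%_. integer_group" by (rule graph_prod.intro) simp

lemma finV: "finite V" and neV: "V ~= {}" using graph by (auto simp: is_graph_def)
lemma loop: "{v, v} \<notin> E" using graph unfolding is_graph_def by (metis doubleton_eq_iff)
lemma edgeV: "{x, y} : E ==> x : V & y : V" using graph unfolding is_graph_def by (metis doubleton_eq_iff)
lemma edge_sym: "{x, y} : E ==> {y, x} : E" by (simp add: insert_commute)

abbreviation "gen v \<equiv> incl v 1"

lemma gen_pow: "v : V ==> incl v a = gen v ^[GP] a"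
proof -
	assume v: "v : V"
	have "(1::int) ^[integer_group] a = a" using hom_int_int_pow[OF iso_hom[OF id_iso], of 1 a] by simp
	then show ?thesis using hom_int_pow[OF incl_hom[OF v], of 1 a] group_GP by simp
qed

lemma gens_generate: "car GP \<subseteq> generate GP (gen ` V)"
proof
	have sub: "gen ` V \<subseteq> car GP" by auto
	have sg: "subgroup (generate GP (gen ` V)) GP" by (rule GP.generate_is_subgroup[OF sub])
	fix x assume "x : car GP"
	then show "x : generate GP (gen ` V)"
	proof (induction rule: GP_induct)
		case one show ?case by (rule generate.one)
	next
		case (mult v a Q)
		have "gen v : generate GP (gen ` V)" using mult(1) by (intro generate.incl) simp
		from GP.subgroup_int_pow_closed[OF sg this, of a]
		have "incl v a : generate GP (gen ` V)" by (simp only: gen_pow[OF mult(1), of a, symmetric])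
		then show ?case using mult(4) by (rule generate.eng)
	qed
qed

definition ep :: "'v => ('v \<times> int) list set => int" where
	"ep p = gp_lift integer_group (%w a. if w = p then a else 0)"

lemma ep_compatible: "compatible integer_group (%w a. if w = p then a else 0)"
	unfolding compatible_def by (auto simp: hom_def)

lemma ep_hom: "ep p : hom GP integer_group" unfolding ep_def by (rule gp_lift_hom[OF _ ep_compatible]) simp
lemma ep_incl: "w : V ==> ep p (incl w a) = (if w = p then a else 0)"
	unfolding ep_def by (rule gp_lift_incl[OF _ ep_compatible]) simp_all
lemma lift_ep: "gp_lift integer_group (%w a. if w = p then a else one[integer_group]) = ep p"
	by (simp add: ep_def cong: if_cong)
lemma ep_mult: "x : car GP ==> y : car GP ==> ep p (x *[GP] y) = ep p x + ep p y" using hom_mult[OF ep_hom] by simp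
lemma ep_one: "ep p one[GP] = 0" using hom_one[OF ep_hom group_GP] by simp
lemma ep_inv: "x : car GP ==> ep p (inv[GP] x) = - ep p x"
	using ep_mult[of x "inv[GP] x" p] ep_one by simp

lemma hom_linear:
	assumes h: "h : hom GP integer_group" and g: "g : car GP"
	shows "h g = (\<Sum>w\<in>V. ep w g * h (gen w))"
proof (rule hom_ext[OF h _ _ g, of "%g. \<Sum>w\<in>V. ep w g * h (gen w)"])
	show "(%g. \<Sum>w\<in>V. ep w g * h (gen w)) : hom GP integer_group"
		by (rule homI) (simp_all add: ep_mult sum.distrib distrib_right)
	fix v and a :: int assume v: "v : V"
	have "(\<Sum>w\<in>V. ep w (incl v a) * h (gen w)) = (\<Sum>w\<in>V. if v = w then a * h (gen w) else 0)"
		using v by (intro sum.cong) (auto simp: ep_incl)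
	also have "\<dots> = a * h (gen v)" using v finV by simp
	finally show "h (incl v a) = (\<Sum>w\<in>V. ep w (incl v a) * h (gen w))"
		using hom_int_int_pow[OF h group_GP, of "gen v" a] v gen_pow[OF v, of a] by simp
qed simp

text \<open>Since p and q are not adjacent, sending them to the two generators of the Heisenberg
  group and all other vertices to 1 respects the relations; commuting images have vanishing
  determinant.\<close>

lemma commuting_ep:
	assumes gh: "g : car GP" "h : car GP" "g *[GP] h = h *[GP] g" and pq: "p ~= q" "{p, q} \<notin> E"
	shows "ep p g * ep q h = ep q g * ep p h"
proof -
	let ?f = "\<lambda>w (a::int). if w = p then (a, 0, 0) else if w = q then (0, a, 0) else (0, 0, 0)"
	have comp: "compatible heis ?f" unfolding compatible_def
	proof (intro conjI ballI impI)
		show "?f v : hom integer_group heis" for v by (auto simp: hom_def heis_def)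
		fix v w :: 'v and a b :: int assume "{v, w} : E"
		then have "~ (v = p & w = q)" "~ (v = q & w = p)" using pq(2) by (auto simp: insert_commute)
		then show "?f v a *[heis] ?f w b = ?f w b *[heis] ?f v a" by (auto simp: heis_def)
	qed
	define H where "H = gp_lift heis ?f"
	have Hh: "H : hom GP heis" unfolding H_def by (rule gp_lift_hom[OF heis_group comp])
	have Hi: "H (incl w a) = ?f w a" if "w : V" for w a unfolding H_def using gp_lift_incl[OF heis_group comp that, of a] by simp
	have f1: "fst (H x) = ep p x" if "x : car GP" for x
	proof (rule hom_ext[OF _ ep_hom _ that])
		show "(%x. fst (H x)) : hom GP integer_group"
			using hom_mult[OF Hh] by (intro homI) (auto simp: heis_def split: prod.splits)
	qed (auto simp: Hi ep_incl)
	have f2: "fst (snd (H x)) = ep q x" if "x : car GP" for x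
	proof (rule hom_ext[OF _ ep_hom _ that])
		show "(%x. fst (snd (H x))) : hom GP integer_group"
			using hom_mult[OF Hh] by (intro homI) (auto simp: heis_def split: prod.splits)
	qed (use pq(1) in \<open>auto simp: Hi ep_incl\<close>)
	have "H g *[heis] H h = H h *[heis] H g" using hom_mult[OF Hh gh(1,2)] hom_mult[OF Hh gh(2,1)] gh(3) by simp
	then have "fst (H g) * fst (snd (H h)) = fst (H h) * fst (snd (H g))" by (cases "H g"; cases "H h") (auto simp: heis_def)
	then show ?thesis using f1 f2 gh(1,2) by (simp add: mult.commute)
qed

text \<open>Neighbours of \<open>v\<close> commute with it, so arbitrary exponents on them are
  realized in its centralizer. Only values of homomorphisms to the integers are recorded, so the
  order of the factors does not matter.\<close>

lemma star_product:
	assumes v: "v : V" and "finite Q" "!!q. q : Q ==> {q, v} : E"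
	shows "\<exists>e\<in>car GP. e *[GP] gen v = gen v *[GP] e & (\<forall>h\<in>hom GP integer_group. h e = (\<Sum>q\<in>Q. \<eta> q * h (gen q)))"
	using assms(2,3)
proof (induction Q rule: finite_induct)
	case empty
	show ?case
	proof (rule bexI[of _ "one[GP]"], intro conjI ballI)
		show "one[GP] *[GP] gen v = gen v *[GP] one[GP]" using v by simp
		show "h one[GP] = (\<Sum>q\<in>{}. \<eta> q * h (gen q))" if "h : hom GP integer_group" for h using hom_one[OF that group_GP] by simp
	qed simp
next
	case (insert q Q)
	obtain e where e: "e : car GP" "e *[GP] gen v = gen v *[GP] e" "\<forall>h\<in>hom GP integer_group. h e = (\<Sum>q\<in>Q. \<eta> q * h (gen q))"
		using insert.IH insert.prems by blast
	have qv: "{q, v} : E" "q : V" "v : V" using insert.prems edgeV by blast+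
	have c: "incl q (\<eta> q) *[GP] gen v = gen v *[GP] incl q (\<eta> q)" using incl_comm[OF qv(2,3,1), of "\<eta> q" 1] by simp
	have cl: "incl q (\<eta> q) : car GP" "gen v : car GP" using qv by auto
	have "incl q (\<eta> q) *[GP] e *[GP] gen v = incl q (\<eta> q) *[GP] (gen v *[GP] e)" using cl e by (simp add: GP.m_assoc)
	also have "\<dots> = (gen v *[GP] incl q (\<eta> q)) *[GP] e" using cl e(1) c by (simp flip: GP.m_assoc)
	finally have "incl q (\<eta> q) *[GP] e *[GP] gen v = gen v *[GP] (incl q (\<eta> q) *[GP] e)" using cl e(1) by (simp add: GP.m_assoc)
	moreover have "h (incl q (\<eta> q) *[GP] e) = (\<Sum>q\<in>insert q Q. \<eta> q * h (gen q))" if h: "h : hom GP integer_group" for h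
		using hom_mult[OF h cl(1) e(1)] e(3) h hom_int_int_pow[OF h group_GP, of "gen q" "\<eta> q"] qv(2) gen_pow[OF qv(2), of "\<eta> q"] insert.hyps by simp
	ultimately show ?case using cl(1) e(1) by (intro bexI[of _ "incl q (\<eta> q) *[GP] e"]) auto
qed

lemma hom_iso_ep: "\<phi> : iso GP GP ==> (%g. ep p (\<phi> g)) : hom GP integer_group"
proof -
	assume "\<phi> : iso GP GP"
	from hom_compose[OF iso_hom[OF this] ep_hom] show ?thesis by (simp add: comp_def)
qed

text \<open>The combination \<open>\<beta> v * \<gamma> - \<gamma> v * \<beta>\<close> of the exponent vectors of \<open>\<psi> y\<close> and \<open>\<psi> z\<close> is supported on the link of \<open>v\<close>,
	so its image under \<open>\<phi>\<close> still commutes with \<open>\<phi> v\<close>.\<close>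
lemma matrix_zero:
	assumes \<phi>: "\<phi> : iso GP GP" and \<psi>: "\<psi> : iso GP GP" "\<forall>g\<in>car GP. \<phi> (\<psi> g) = g"
		and xyz: "x ~= y" "{y, z} : E" "z ~= x" "{x, z} \<notin> E" and v: "v : V"
	shows "ep x (\<phi> (gen v)) * ep v (\<psi> (gen y)) = 0"
proof -
	define \<beta> where "\<beta> p = ep p (\<psi> (gen y))" for p
	define \<gamma> where "\<gamma> p = ep p (\<psi> (gen z))" for p
	define \<eta> where "\<eta> p = \<beta> v * \<gamma> p - \<gamma> v * \<beta> p" for p
	have yz: "y : V" "z : V" "y ~= z" using edgeV[OF xyz(2)] xyz(2) loop by auto
	have c: "gen y : car GP" "gen z : car GP" "gen v : car GP" using yz v by auto
	have \<psi>c: "\<psi> (gen y) : car GP" "\<psi> (gen z) : car GP" using iso_carrier[OF \<psi>(1)] c by auto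
	have "gen y *[GP] gen z = gen z *[GP] gen y" using incl_comm[OF yz(1,2) xyz(2), of 1 1] by simp
	then have cm: "\<psi> (gen y) *[GP] \<psi> (gen z) = \<psi> (gen z) *[GP] \<psi> (gen y)"
		using hom_mult[OF iso_hom[OF \<psi>(1)] c(1,2)] hom_mult[OF iso_hom[OF \<psi>(1)] c(2,1)] by simp
	\<comment> \<open>Off the link of \<open>v\<close> this is a 2 by 2 minor of the exponents of two
	  commuting elements at non-adjacent vertices.\<close>
	have \<eta>0: "\<eta> q = 0" if "q : V - {q : V. {q, v} : E}" for q
	proof (cases "q = v")
		case False
		have "{v, q} \<notin> E" using that edge_sym by blast
		then show ?thesis using commuting_ep[OF \<psi>c cm False[symmetric]] by (simp add: \<eta>_def \<beta>_def \<gamma>_def mult.commute)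
	qed (simp add: \<eta>_def)
	let ?Q = "{q : V. {q, v} : E}"
	have "finite ?Q" using finV by simp
	then have "\<exists>e\<in>car GP. e *[GP] gen v = gen v *[GP] e & (\<forall>h\<in>hom GP integer_group. h e = (\<Sum>q\<in>?Q. \<eta> q * h (gen q)))"
		by (rule star_product[OF v]) simp
	then obtain e where e: "e : car GP" "e *[GP] gen v = gen v *[GP] e" "\<forall>h\<in>hom GP integer_group. h e = (\<Sum>q\<in>?Q. \<eta> q * h (gen q))"
		by (elim bexE conjE)
	have epe: "ep p (\<phi> e) = \<beta> v * ep p (gen z) - \<gamma> v * ep p (gen y)" for p
	proof -
		have h: "(%g. ep p (\<phi> g)) : hom GP integer_group" by (rule hom_iso_ep[OF \<phi>])
		have "ep p (\<phi> e) = (\<Sum>q\<in>?Q. \<eta> q * ep p (\<phi> (gen q)))" by (rule bspec[OF e(3) h])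
		also have "\<dots> = (\<Sum>q\<in>V. \<eta> q * ep p (\<phi> (gen q)))" using finV \<eta>0 by (intro sum.mono_neutral_left) auto
		also have "\<dots> = \<beta> v * (\<Sum>q\<in>V. \<gamma> q * ep p (\<phi> (gen q))) - \<gamma> v * (\<Sum>q\<in>V. \<beta> q * ep p (\<phi> (gen q)))"
			by (simp add: \<eta>_def sum_distrib_left sum_subtractf algebra_simps)
		also have "(\<Sum>q\<in>V. \<gamma> q * ep p (\<phi> (gen q))) = ep p (gen z)" using hom_linear[OF h \<psi>c(2)] \<psi>(2) c(2) by (simp add: \<gamma>_def)
		also have "(\<Sum>q\<in>V. \<beta> q * ep p (\<phi> (gen q))) = ep p (gen y)" using hom_linear[OF h \<psi>c(1)] \<psi>(2) c(1) by (simp add: \<beta>_def)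
		finally show ?thesis .
	qed
	have \<phi>c: "\<phi> e : car GP" "\<phi> (gen v) : car GP" using iso_carrier[OF \<phi>] c e(1) by auto
	have "\<phi> e *[GP] \<phi> (gen v) = \<phi> (gen v) *[GP] \<phi> e"
		using hom_mult[OF iso_hom[OF \<phi>] e(1) c(3)] hom_mult[OF iso_hom[OF \<phi>] c(3) e(1)] e(2) by simp
	from commuting_ep[OF \<phi>c this xyz(3)[symmetric] xyz(4)]
	have "ep x (\<phi> e) * ep z (\<phi> (gen v)) = ep z (\<phi> e) * ep x (\<phi> (gen v))" .
	then show ?thesis unfolding epe using xyz yz by (auto simp: ep_incl \<beta>_def)
qed

definition cong3 where "cong3 \<phi> \<longleftrightarrow> \<phi> : iso GP GP & (\<forall>v\<in>V. \<forall>g\<in>car GP. ep v (\<phi> g) mod 3 = ep v g mod 3)"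

lemma cong3_inverse:
	assumes "cong3 \<phi>"
	shows "\<exists>\<psi>. cong3 \<psi> & (\<forall>g\<in>car GP. \<phi> (\<psi> g) = g) & (\<forall>g\<in>car GP. \<psi> (\<phi> g) = g)"
proof -
	have \<phi>: "\<phi> : iso GP GP" "\<forall>v\<in>V. \<forall>g\<in>car GP. ep v (\<phi> g) mod 3 = ep v g mod 3" using assms by (auto simp: cong3_def)
	obtain \<psi> where \<psi>: "\<psi> : iso GP GP" "\<forall>x\<in>car GP. \<psi> (\<phi> x) = x" "\<forall>y\<in>car GP. \<phi> (\<psi> y) = y"
		using iso_inverse[OF group_GP \<phi>(1)] by (elim bexE conjE)
	have "ep v (\<psi> g) mod 3 = ep v g mod 3" if "v : V" "g : car GP" for v g
		using \<phi>(2) that iso_carrier[OF \<psi>(1) that(2)] \<psi>(3) by metis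
	then have "cong3 \<psi>" using \<psi>(1) by (simp add: cong3_def)
	then show ?thesis using \<psi>(2,3) by blast
qed

text \<open>Otherwise some neighbour z of v is neither x nor adjacent to x, and
  \<open>matrix_zero\<close> annihilates the product of the given exponent with the diagonal entry
  of the inverse at v; the latter is 1 modulo 3.\<close>

lemma cong3_le:
	assumes "cong3 \<phi>" "v : V" "x : V" "ep x (\<phi> (gen v)) ~= 0"
	shows "tau_le E v x"
proof (rule ccontr)
	assume "~ tau_le E v x"
	then obtain z where z: "v ~= x" "{v, z} : E" "z ~= x" "{x, z} \<notin> E" by (auto simp: tau_le_def lk_def st_def)
	obtain \<psi> where \<psi>: "cong3 \<psi>" "\<forall>g\<in>car GP. \<phi> (\<psi> g) = g" using cong3_inverse[OF assms(1)] by (elim exE conjE)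
	have i: "\<phi> : iso GP GP" "\<psi> : iso GP GP" using assms(1) \<psi>(1) by (simp_all add: cong3_def)
	have "ep x (\<phi> (gen v)) * ep v (\<psi> (gen v)) = 0"
		by (rule matrix_zero[OF i(1,2) \<psi>(2) z(1)[symmetric] z(2-4) assms(2)])
	moreover have "ep v (\<psi> (gen v)) mod 3 = 1" using \<psi>(1) assms(2) by (simp add: cong3_def ep_incl)
	ultimately show False using assms(4) by auto
qed

end

text \<open>Stated for two sets instead of two classes, because a free class of rank two is split
  into two single vertices. \<open>unif\<close> and \<open>down\<close> express what is used of
  classes: uniform adjacency to the outside, and closure of the union downwards.\<close>

locale raag_pair = raag V E for V :: "'v set" and E +
	fixes M N :: "'v set"
	assumes MN: "M \<subseteq> V" "N \<subseteq> V" "M ~= {}" "N ~= {}" "M \<inter> N = {}"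
		and noedge: "!!m n. m : M ==> n : N ==> {m, n} \<notin> E"
		and cliq: "!!x y. x : M ==> y : M ==> x ~= y ==> {x, y} : E" "!!x y. x : N ==> y : N ==> x ~= y ==> {x, y} : E"
		and unif: "!!y x x'. y : V - (M \<union> N) ==> x : M ==> x' : M ==> {y, x} : E ==> {y, x'} : E"
			"!!y x x'. y : V - (M \<union> N) ==> x : N ==> x' : N ==> {y, x} : E ==> {y, x'} : E"
		and down: "!!w x. w : V ==> x : M \<union> N ==> tau_le E w x ==> w : M \<union> N"
begin

lemma int_pair: "S \<subseteq> V ==> T \<subseteq> V ==> S \<inter> T = {} ==> (!!s t. s : S ==> t : T ==> {s, t} \<notin> E) ==>
		pair_projection V E (%_. integer_group) (%_. integer_group) (%_ a. a) S T"
	by (rule pair_projection.intro, rule graph_prod_axioms, rule pair_projection_axioms.intro)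
		(auto simp: finV hom_def abelian_integer_group)

sublocale R0: pair_projection V E "%_. integer_group" "%_. integer_group" "%_ a. a" M N
	by (rule int_pair) (use MN noedge in auto)

text \<open>Enlarging \<open>M\<close> and \<open>N\<close> to \<open>S\<close> and \<open>T\<close>
  refines the projection, where the image of \<open>g\<close> is still hyperbolic. There a power of
  the image of \<open>h\<close> equals a power of that of \<open>g\<close>; the coordinates give
  proportional exponents on \<open>S\<close> and \<open>T\<close>.\<close>

lemma commuting_ratio:
	assumes gh: "g : car GP" "h : car GP" "g *[GP] h = h *[GP] g" and hyp: "~ R0.HH.elliptic (R0.rho g)"
		and ST: "M \<subseteq> S" "N \<subseteq> T" "S \<subseteq> V" "T \<subseteq> V" "S \<inter> T = {}" "!!s t. s : S ==> t : T ==> {s, t} \<notin> E"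
	shows "\<exists>k (e::int). k > 0 & R0.rho h ^[R0.HG] (k::nat) = R0.rho g ^[R0.HG] e & (\<forall>p\<in>S \<union> T. int k * ep p h = e * ep p g)"
proof -
	interpret P: pair_projection V E "%_. integer_group" "%_. integer_group" "%_ a. a" S T by (rule int_pair[OF ST(3-6)])
	interpret pm: pair_map V E "%_. integer_group" "%_. integer_group" "%_ a. a" S T "%_. integer_group" "%_ a. a" M N "%_ a. a"
		by (rule pair_map.intro, rule P.pair_projection_axioms, rule R0.pair_projection_axioms, rule pair_map_axioms.intro)
			(use ST(1,2) in \<open>auto simp: hom_def\<close>)
	have c: "P.rho g : car P.HG" "P.rho h : car P.HG" using P.rho_closed gh by auto
	have "~ P.HH.elliptic (P.rho g)" using hyp pm.kmap_elliptic[of "P.rho g"] pm.kmap_rho[OF gh(1)] by auto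
	moreover have "P.rho g *[P.HG] P.rho h = P.rho h *[P.HG] P.rho g"
		using hom_mult[OF P.rho_hom gh(1,2)] hom_mult[OF P.rho_hom gh(2,1)] gh(3) by simp
	ultimately obtain k and e :: int where k: "k > 0" "P.rho h ^[P.HG] (k::nat) = P.rho g ^[P.HG] e"
		using P.HH.commuting_hyperbolic_int[OF c(1) _ c(2)] by blast
	have "pm.kmap (P.rho h ^[P.HG] k) = pm.kmap (P.rho g ^[P.HG] e)" using k(2) by simp
	then have r: "R0.rho h ^[R0.HG] k = R0.rho g ^[R0.HG] e"
		using hom_nat_pow[OF pm.kmap_hom c(2) P.HH.group_GP R0.HH.group_GP, of k] hom_int_pow[OF pm.kmap_hom c(1) P.HH.group_GP R0.HH.group_GP, of e]
			pm.kmap_rho[OF gh(1)] pm.kmap_rho[OF gh(2)] by simp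
	have "int k * ep p h = e * ep p g" if p: "p : S \<union> T" for p
	proof -
		obtain i where i: "p : P.side i" using p by (metis P.side_def Un_iff)
		let ?c = "%Q. P.HH.proj i Q p"
		have hc: "?c : hom P.HG integer_group" by (rule homI) (use i in \<open>simp_all add: P.HH.proj_mult P.PD_mult\<close>)
		have pv: "?c (P.rho x) = ep p x" if "x : car GP" for x
			using P.proj_rho[OF i that] unfolding P.coord_def lift_ep .
		have "?c (P.rho h ^[P.HG] k) = ?c (P.rho g ^[P.HG] e)" using k(2) by simp
		then show ?thesis
			unfolding hom_int_nat_pow[OF hc P.HH.group_GP c(2)] hom_int_int_pow[OF hc P.HH.group_GP c(1)] using pv gh by simp
	qed
	then show ?thesis using k(1) r by blast
qed

lemma elliptic_of_ep_zero:
	assumes "g : car GP" "R0.HH.elliptic (R0.rho g)" "!!p. p : M \<union> N ==> ep p g = 0"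
	shows "R0.rho g = one[R0.HG]"
proof -
	obtain d i where d: "d : car R0.HG" "R0.rho g = d *[R0.HG] R0.HH.incl i (R0.HH.proj i (R0.rho g)) *[R0.HG] inv[R0.HG] d"
		using R0.elliptic_proj[OF assms(2)] by blast
	have "R0.HH.proj i (R0.rho g) = R0.HH.proj i (R0.rho one[GP])"
	proof (rule PiE_ext[of _ "R0.side i" "%v. car integer_group"])
		show "R0.HH.proj i (R0.rho g) : (\<Pi>\<^sub>E v\<in>R0.side i. car integer_group)" "R0.HH.proj i (R0.rho one[GP]) : (\<Pi>\<^sub>E v\<in>R0.side i. car integer_group)"
			using R0.HH.proj_closed[OF R0.rho_closed, of _ i] assms(1) GP.one_closed unfolding R0.PD_carrier by blast+
		fix p assume p: "p : R0.side i"
		then have "p : M \<union> N" by (cases i) (auto simp: R0.side_def)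
		then show "R0.HH.proj i (R0.rho g) p = R0.HH.proj i (R0.rho one[GP]) p"
			using R0.proj_rho[OF p assms(1)] R0.proj_rho[OF p GP.one_closed] assms(3) ep_one unfolding R0.coord_def lift_ep by simp
	qed
	also have "\<dots> = one[R0.PD i]" using hom_one[OF R0.rho_hom group_GP R0.HH.group_GP] R0.HH.proj_one[of i] by simp
	finally show ?thesis using d R0.HH.incl_one[of i] by simp
qed

text \<open>Suppose the image of w survives. Its exponents on \<open>M\<close> and \<open>N\<close>
  vanish by \<open>down\<close>, so it is hyperbolic, and a neighbour t of w outside L gets
  exponents proportional to those of w at all vertices outside L. Apply the inverse automorphism and
  read the exponent at t: vertices of L contribute nothing, as L is closed upwards and misses t, so
  k = 0, a contradiction.\<close>

lemma descent:
	assumes \<phi>: "cong3 \<phi>" and w: "w : V - (M \<union> N)"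
	shows "R0.rho (\<phi> (gen w)) = one[R0.HG]"
proof (rule ccontr)
	assume ne: "R0.rho (\<phi> (gen w)) ~= one[R0.HG]"
	have \<phi>i: "\<phi> : iso GP GP" using \<phi> by (simp add: cong3_def)
	have \<phi>c: "\<phi> x : car GP" if "x : car GP" for x using \<phi>i that by (rule iso_carrier)
	have wV: "w : V" and wc: "gen w : car GP" using w by auto
	have w0: "ep p (\<phi> (gen w)) = 0" if "p : M \<union> N" for p
	proof (rule ccontr)
		assume "ep p (\<phi> (gen w)) ~= 0"
		then have "tau_le E w p" using cong3_le[OF \<phi> wV] that MN by blast
		then show False using down[OF wV that] w by blast
	qed
	have hyp: "~ R0.HH.elliptic (R0.rho (\<phi> (gen w)))" using elliptic_of_ep_zero[OF \<phi>c[OF wc]] w0 ne by blast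
	\<comment> \<open>The outside vertices that can be adjoined to neither side, being joined to all of
	  \<open>M\<close> and \<open>N\<close>.\<close>
	define L where "L = {y : V - (M \<union> N). \<forall>x\<in>M \<union> N. {y, x} : E}"
	have Lup: "x : L" if y: "y : L" "x : V" "tau_le E y x" for x y
	proof (cases "y = x")
		case False
		then have st: "x' = x | {x, x'} : E" if "x' : M \<union> N" for x'
			using y(1,3) that by (auto simp: tau_le_def L_def lk_def st_def)
		obtain m n where mn: "m : M" "n : N" using MN by blast
		have "x \<notin> M" using st[of n] mn noedge MN(5) by blast
		moreover have "x \<notin> N" using st[of m] mn noedge[of m x] MN(5) edge_sym[of x m] by blast
		ultimately show ?thesis unfolding L_def using y(2) st by blast
	qed (use y in simp)
	\<comment> \<open>If w is in L, a vertex of \<open>M\<close> serves. Otherwise not all neighbours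
	  of w lie in L, since then w would be below a vertex of \<open>M\<close>, against
	  \<open>down\<close>.\<close>
	obtain t where t: "t : V" "{w, t} : E" "t \<notin> L"
	proof (cases "w : L")
		case True
		obtain m where m: "m : M" using MN by blast
		then show ?thesis using that[of m] True MN unfolding L_def by blast
	next
		case False
		obtain m where m: "m : M" using MN by blast
		have "~ lk E w \<subseteq> L"
		proof
			assume "lk E w \<subseteq> L"
			then have "tau_le E w m" using m edge_sym unfolding tau_le_def L_def lk_def st_def by blast
			then show False using down[OF wV, of m] m w by blast
		qed
		then show ?thesis using that edgeV unfolding lk_def by blast
	qed
	have tw: "t ~= w" using t(2) loop by auto
	have tc: "gen t : car GP" using t by simp
	have "gen w *[GP] gen t = gen t *[GP] gen w" using incl_comm[OF wV t(1,2), of 1 1] by simp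
	then have cm: "\<phi> (gen w) *[GP] \<phi> (gen t) = \<phi> (gen t) *[GP] \<phi> (gen w)"
		using hom_mult[OF iso_hom[OF \<phi>i] wc tc] hom_mult[OF iso_hom[OF \<phi>i] tc wc] by simp
	have "\<exists>k (e::int). k > 0 & R0.rho (\<phi> (gen t)) ^[R0.HG] (k::nat) = R0.rho (\<phi> (gen w)) ^[R0.HG] e &
		 (\<forall>p\<in>M \<union> N. int k * ep p (\<phi> (gen t)) = e * ep p (\<phi> (gen w)))"
		by (rule commuting_ratio[OF \<phi>c[OF wc] \<phi>c[OF tc] cm hyp subset_refl subset_refl MN(1,2,5)]) (rule noedge)
	then obtain k and e :: int where k: "k > 0" "R0.rho (\<phi> (gen t)) ^[R0.HG] (k::nat) = R0.rho (\<phi> (gen w)) ^[R0.HG] e"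
		 "\<forall>p\<in>M \<union> N. int k * ep p (\<phi> (gen t)) = e * ep p (\<phi> (gen w))"
		by (elim exE conjE)
	\<comment> \<open>By \<open>unif\<close>, a vertex outside L, \<open>M\<close> and \<open>N\<close>
	  has no neighbour on one side and can be adjoined to the opposite one. The ratio found there is
	  the old one, because different powers of a hyperbolic element differ.\<close>
	have rat: "int k * ep y (\<phi> (gen t)) = e * ep y (\<phi> (gen w))" if y: "y : V - L" for y
	proof (cases "y : M \<union> N")
		case False
		have yV: "y : V" using y by blast
		have "(\<forall>x\<in>M. {y, x} \<notin> E) | (\<forall>x\<in>N. {y, x} \<notin> E)"
		proof (rule ccontr)
			assume "~ ?thesis"
			then obtain m n where "m : M" "{y, m} : E" "n : N" "{y, n} : E" by blast
			then have "\<forall>x\<in>M \<union> N. {y, x} : E" using unif(1)[of y m] unif(2)[of y n] y False by blast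
			then show False using y False unfolding L_def by blast
		qed
		then have "\<exists>k' (e'::int). k' > 0 & R0.rho (\<phi> (gen t)) ^[R0.HG] (k'::nat) = R0.rho (\<phi> (gen w)) ^[R0.HG] e' &
			 int k' * ep y (\<phi> (gen t)) = e' * ep y (\<phi> (gen w))"
		proof
			assume n: "\<forall>x\<in>M. {y, x} \<notin> E"
			have ne: "{s, t} \<notin> E" if "s : M" "t : insert y N" for s t using that n noedge edge_sym by blast
			have sV: "insert y N \<subseteq> V" "M \<inter> insert y N = {}" using MN yV False by blast+
			have cr: "\<exists>k (e::int). k > 0 & R0.rho (\<phi> (gen t)) ^[R0.HG] (k::nat) = R0.rho (\<phi> (gen w)) ^[R0.HG] e &
		 (\<forall>p\<in>M \<union> insert y N. int k * ep p (\<phi> (gen t)) = e * ep p (\<phi> (gen w)))"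
				by (rule commuting_ratio[OF \<phi>c[OF wc] \<phi>c[OF tc] cm hyp subset_refl subset_insertI MN(1) sV]) (rule ne)
			obtain k' and e' :: int where k': "k' > 0" "R0.rho (\<phi> (gen t)) ^[R0.HG] (k'::nat) = R0.rho (\<phi> (gen w)) ^[R0.HG] e'"
				"\<forall>p\<in>M \<union> insert y N. int k' * ep p (\<phi> (gen t)) = e' * ep p (\<phi> (gen w))"
				using cr by (elim exE conjE)
			show ?thesis by (rule exI[of _ k', OF exI[of _ e']]) (use k' in simp)
		next
			assume n: "\<forall>x\<in>N. {y, x} \<notin> E"
			have ne: "{s, t} \<notin> E" if "s : insert y M" "t : N" for s t using that n noedge edge_sym by blast
			have sV: "insert y M \<subseteq> V" "insert y M \<inter> N = {}" using MN yV False by blast+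
			have cr: "\<exists>k (e::int). k > 0 & R0.rho (\<phi> (gen t)) ^[R0.HG] (k::nat) = R0.rho (\<phi> (gen w)) ^[R0.HG] e &
		 (\<forall>p\<in>insert y M \<union> N. int k * ep p (\<phi> (gen t)) = e * ep p (\<phi> (gen w)))"
				by (rule commuting_ratio[OF \<phi>c[OF wc] \<phi>c[OF tc] cm hyp subset_insertI subset_refl sV(1) MN(2) sV(2)]) (rule ne)
			obtain k' and e' :: int where k': "k' > 0" "R0.rho (\<phi> (gen t)) ^[R0.HG] (k'::nat) = R0.rho (\<phi> (gen w)) ^[R0.HG] e'"
				"\<forall>p\<in>insert y M \<union> N. int k' * ep p (\<phi> (gen t)) = e' * ep p (\<phi> (gen w))"
				using cr by (elim exE conjE)
			show ?thesis by (rule exI[of _ k', OF exI[of _ e']]) (use k' in simp)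
		qed
		then obtain k' and e' :: int where k': "k' > 0" "R0.rho (\<phi> (gen t)) ^[R0.HG] (k'::nat) = R0.rho (\<phi> (gen w)) ^[R0.HG] e'"
			 "int k' * ep y (\<phi> (gen t)) = e' * ep y (\<phi> (gen w))" by (elim exE conjE)
		have rc: "R0.rho (\<phi> (gen t)) : car R0.HG" "R0.rho (\<phi> (gen w)) : car R0.HG" using R0.rho_closed \<phi>c wc tc by auto
		have "R0.rho (\<phi> (gen w)) ^[R0.HG] (e * int k') = (R0.rho (\<phi> (gen t)) ^[R0.HG] k) ^[R0.HG] k'"
			unfolding k(2) using rc(2) by (simp add: R0.HH.GP.int_pow_pow[symmetric] int_pow_int)
		also have "\<dots> = (R0.rho (\<phi> (gen t)) ^[R0.HG] k') ^[R0.HG] k" using rc(1) by (simp add: R0.HH.GP.nat_pow_pow mult.commute)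
		also have "\<dots> = R0.rho (\<phi> (gen w)) ^[R0.HG] (e' * int k)"
			unfolding k'(2) using rc(2) by (simp add: R0.HH.GP.int_pow_pow[symmetric] int_pow_int)
		finally have ee: "e * int k' = e' * int k" using R0.HH.hyperbolic_pow_inj[OF rc(2) hyp] by blast
		have "int k' * (int k * ep y (\<phi> (gen t))) = int k * (e' * ep y (\<phi> (gen w)))" using k'(3) by simp
		also have "\<dots> = int k' * (e * ep y (\<phi> (gen w)))" using ee by (metis mult.assoc mult.commute)
		finally show ?thesis using k'(1) by simp
	qed (use k(3) in blast)
	obtain \<psi> where \<psi>: "cong3 \<psi>" "\<forall>g\<in>car GP. \<psi> (\<phi> g) = g" using cong3_inverse[OF \<phi>] by (elim exE conjE)
	have \<psi>i: "\<psi> : iso GP GP" using \<psi>(1) by (simp add: cong3_def)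
	have h: "(%g. ep t (\<psi> g)) : hom GP integer_group" by (rule hom_iso_ep[OF \<psi>i])
	have lin: "ep t x = (\<Sum>y\<in>V. ep y (\<phi> x) * ep t (\<psi> (gen y)))" if "x : car GP" for x
		using hom_linear[OF h \<phi>c[OF that]] \<psi>(2) that by simp
	have "int k * ep t (gen t) - e * ep t (gen w) = (\<Sum>y\<in>V. (int k * ep y (\<phi> (gen t)) - e * ep y (\<phi> (gen w))) * ep t (\<psi> (gen y)))"
		unfolding lin[OF tc] lin[OF wc] by (simp add: sum_distrib_left sum_subtractf algebra_simps)
	also have "\<dots> = 0"
	proof (rule sum.neutral, rule ballI)
		fix y assume y: "y : V"
		show "(int k * ep y (\<phi> (gen t)) - e * ep y (\<phi> (gen w))) * ep t (\<psi> (gen y)) = 0"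
		proof (cases "y : L")
			case True
			have "ep t (\<psi> (gen y)) = 0" using cong3_le[OF \<psi>(1) y t(1)] Lup[OF True t(1)] t(3) by blast
			then show ?thesis by simp
		qed (use rat y in simp)
	qed
	finally show False using k(1) wV t(1) tw by (simp add: ep_incl)
qed

end

section \<open>Elliptic images modulo 3 and positivity for a pair\<close>

context raag_pair
begin

lemma mod3_hom: "(%a. a mod 3) : hom integer_group (integer_mod_group 3)"
	by (rule homI) (simp_all add: carrier_integer_mod_group mult_integer_mod_group mod_simps)

sublocale R3: pair_projection V E "%_. integer_group" "%_. integer_mod_group 3" "%_ a. a mod 3" M N
	by (rule pair_projection.intro, rule graph_prod_axioms, rule pair_projection_axioms.intro)
		(use MN noedge mod3_hom in \<open>auto simp: finV abelian_integer_mod_group\<close>)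

sublocale pm3: pair_map V E "%_. integer_group" "%_. integer_group" "%_ a. a" M N "%_. integer_mod_group 3" "%_ a. a mod 3" M N "%_ a. a mod 3"
	by (rule pair_map.intro, rule R0.pair_projection_axioms, rule R3.pair_projection_axioms, rule pair_map_axioms.intro)
		(use mod3_hom in auto)

lemma coord3: assumes v: "v : V" and g: "g : car GP" shows "R3.coord v g = ep v g mod 3"
proof (rule hom_ext[OF R3.coord_hom[OF v] _ _ g, of "%g. ep v g mod 3"])
	show "(%g. ep v g mod 3) : hom GP (integer_mod_group 3)" using hom_compose[OF ep_hom mod3_hom] by (simp add: comp_def)
	show "R3.coord v (incl w a) = ep v (incl w a) mod 3" if "w : V" for w a
		using R3.coord_incl[OF v that, of a] ep_incl[OF that, of v a] by simp
qed simp

lemma proj_ep: "p : R0.side j ==> x : car GP ==> R0.HH.proj j (R0.rho x) p = ep p x"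
	using R0.proj_rho[of p j x] unfolding R0.coord_def lift_ep by blast

lemma side_mem: "p : R0.side j \<longleftrightarrow> (if j then p : M else p : N)" by (simp add: R0.side_def)

lemma cong3_gen: assumes "cong3 \<omega>" "v : V" "p : V" shows "ep p (\<omega> (gen v)) mod 3 = (if v = p then 1 else 0)"
	using assms by (simp add: cong3_def ep_incl)

text \<open>A hyperbolic image would make the exponents of v and its commuting companion v'
  proportional; but their 2 by 2 block is the identity modulo 3 and has non-zero
  determinant.\<close>

lemma side_elliptic:
	assumes w: "cong3 \<omega>" and v: "v : M & v' : M | v : N & v' : N" "v ~= v'"
	shows "R0.HH.elliptic (R0.rho (\<omega> (gen v)))"
proof (rule ccontr)
	assume hyp: "~ R0.HH.elliptic (R0.rho (\<omega> (gen v)))"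
	have vV: "v : V" "v' : V" using v MN by auto
	have E: "{v, v'} : E" using v cliq by blast
	have \<omega>i: "\<omega> : iso GP GP" using w by (simp add: cong3_def)
	have c: "gen v : car GP" "gen v' : car GP" using vV by auto
	have \<omega>c: "\<omega> (gen v) : car GP" "\<omega> (gen v') : car GP" using iso_carrier[OF \<omega>i] c by auto
	have "gen v *[GP] gen v' = gen v' *[GP] gen v" using incl_comm[OF vV E, of 1 1] by simp
	then have cm: "\<omega> (gen v) *[GP] \<omega> (gen v') = \<omega> (gen v') *[GP] \<omega> (gen v)"
		using hom_mult[OF iso_hom[OF \<omega>i] c] hom_mult[OF iso_hom[OF \<omega>i] c(2,1)] by simp
	have "\<exists>k (e::int). k > 0 & R0.rho (\<omega> (gen v')) ^[R0.HG] (k::nat) = R0.rho (\<omega> (gen v)) ^[R0.HG] e &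
		 (\<forall>p\<in>M \<union> N. int k * ep p (\<omega> (gen v')) = e * ep p (\<omega> (gen v)))"
		by (rule commuting_ratio[OF \<omega>c cm hyp subset_refl subset_refl MN(1,2,5)]) (rule noedge)
	then obtain k and e :: int where k: "k > 0" "\<forall>p\<in>M \<union> N. int k * ep p (\<omega> (gen v')) = e * ep p (\<omega> (gen v))"
		by (elim exE conjE)
	define a b c d where "a = ep v (\<omega> (gen v))" and "b = ep v' (\<omega> (gen v))" and "c = ep v (\<omega> (gen v'))" and "d = ep v' (\<omega> (gen v'))"
	have m: "a mod 3 = 1" "b mod 3 = 0" "c mod 3 = 0" "d mod 3 = 1"
		using cong3_gen[OF w] vV v(2) by (simp_all add: a_def b_def c_def d_def)
	have e: "int k * c = e * a" "int k * d = e * b" using k(2) v(1) by (auto simp: a_def b_def c_def d_def)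
	have "int k * (d * a) = int k * (c * b)" using e by (metis mult.assoc mult.commute)
	then have "d * a = c * b" using k(1) by simp
	then have "(d mod 3) * (a mod 3) mod 3 = (c mod 3) * (b mod 3) mod 3" by (simp add: mod_mult_eq)
	then show False using m by simp
qed

lemma PD_torsion_free:
	assumes "a : car (R0.PD i)" "a ~= one[R0.PD i]" "n > 0"
	shows "a ^[R0.PD i] (n::nat) ~= one[R0.PD i]"
proof
	assume z: "a ^[R0.PD i] n = one[R0.PD i]"
	have "a = one[R0.PD i]"
	proof (rule PiE_ext[of _ "R0.side i" "%_. UNIV"])
		show "a : (\<Pi>\<^sub>E v\<in>R0.side i. UNIV)" "one[R0.PD i] : (\<Pi>\<^sub>E v\<in>R0.side i. UNIV)" using assms(1) by (auto simp: R0.PD_carrier R0.PD_one)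
		fix p assume p: "p : R0.side i"
		have h: "(%f. f p) : hom (R0.PD i) integer_group" by (rule homI) (use p in \<open>simp_all add: R0.PD_mult\<close>)
		have "int n * a p = (a ^[R0.PD i] n) p" using hom_int_nat_pow[OF h R0.HH.factor_group assms(1), of n] by simp
		also have "\<dots> = 0" unfolding z using p by (simp add: R0.PD_one)
		finally show "a p = one[R0.PD i] p" using assms(3) p by (simp add: R0.PD_one)
	qed
	then show False using assms(2) by simp
qed

text \<open>A lone m has no companion, so generation takes its place. The images of \<open>N\<close>
  lie in one conjugate of the False factor and outside vertices die by \<open>descent\<close>, so
  after conjugation this factor and the image g' of m generate. Hence g' = x a y with x, y in the
  False factor and a in the True factor; modulo 3 the product x y vanishes and g' becomes a
  conjugate of a.\<close>

lemma single_elliptic: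
	assumes w: "cong3 \<omega>" and M: "M = {m}" and n: "n : N" "n' : N" "n ~= n'"
	shows "R3.HH.elliptic (R3.rho (\<omega> (gen m)))"
proof -
	have \<omega>i: "\<omega> : iso GP GP" using w by (simp add: cong3_def)
	have \<omega>c: "\<omega> x : car GP" if "x : car GP" for x using \<omega>i that by (rule iso_carrier)
	define f where "f x = R0.rho (\<omega> x)" for x
	have f: "f : hom GP R0.HG" using hom_compose[OF iso_hom[OF \<omega>i] R0.rho_hom] by (simp add: comp_def f_def[abs_def])
	have fc: "f x : car R0.HG" if "x : car GP" for x using f that by (rule hom_in_carrier)
	have mV: "m : V" and nV: "n : V" using M MN n by auto
	have mc: "gen m : car GP" and nc: "gen n : car GP" using mV nV by auto
	have nside: "n : R0.side False" using n by (simp add: side_mem)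
	define c where "c = R0.HH.proj False (f (gen n))"
	have cc': "c : car (R0.PD False)" unfolding c_def by (rule R0.HH.proj_closed[OF fc[OF nc]])
	have "c n mod 3 = 1" unfolding c_def f_def using proj_ep[OF nside \<omega>c[OF nc]] cong3_gen[OF w nV nV] by simp
	then have "c n ~= one[R0.PD False] n" using nside by (auto simp: R0.PD_one)
	then have c1: "c ~= one[R0.PD False]" by metis
	have ell: "R0.HH.elliptic (f (gen n))" unfolding f_def by (rule side_elliptic[OF w _ n(3)]) (use n in simp)
	obtain g0 i where g0: "g0 : car R0.HG" "f (gen n) = g0 *[R0.HG] R0.HH.incl i (R0.HH.proj i (f (gen n))) *[R0.HG] inv[R0.HG] g0"
		"\<forall>j. j ~= i --> R0.HH.proj j (f (gen n)) = one[R0.PD j]" using R0.elliptic_proj[OF ell] by blast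
	have iF: "i = False"
	proof (rule ccontr)
		assume "i ~= False"
		then have "R0.HH.proj False (f (gen n)) = one[R0.PD False]" using g0(3) by blast
		then show False using c1 by (simp add: c_def)
	qed
	have fn: "f (gen n) = g0 *[R0.HG] R0.HH.incl False c *[R0.HG] inv[R0.HG] g0" using g0(2) iF by (simp add: c_def)
	have gN: "gen u : car GP" if "u : N" for u using that MN by auto
	have fN: "f (gen u) = g0 *[R0.HG] R0.HH.incl False (R0.HH.proj False (f (gen u))) *[R0.HG] inv[R0.HG] g0" if u: "u : N" for u
	proof (rule R0.HH.elliptic_conj_fix[where C = "gen ` N" and f = f and ?a0.0 = "gen n" and c = c, OF R0.PD_comm _ _ _ fn g0(1) cc' c1])
		show "f a : car R0.HG" if "a : gen ` N" for a using that gN fc by blast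
		show "gen n : gen ` N" "gen u : gen ` N" using n u by auto
		fix a b assume "a : gen ` N" "b : gen ` N"
		then obtain s t where st: "s : N" "t : N" "a = gen s" "b = gen t" by blast
		have "a *[GP] b = b *[GP] a"
		proof (cases "s = t")
			case False
			have V: "s : V" "t : V" using st MN by auto
			show ?thesis unfolding st(3,4) using incl_comm[OF V cliq(2)[OF st(1,2) False], of 1 1] by simp
		qed (use st in simp)
		then show "f a *[R0.HG] f b = f b *[R0.HG] f a"
			using hom_mult[OF f, of a b] hom_mult[OF f, of b a] gN st by simp
	qed
	\<comment> \<open>Conjugated back, so that the images of \<open>N\<close> lie in the factor
	  itself.\<close>
	define F where "F x = inv[R0.HG] g0 *[R0.HG] f x *[R0.HG] inv[R0.HG] (inv[R0.HG] g0)" for x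
	have F: "F : hom GP R0.HG"
		using hom_compose[OF f iso_hom[OF R0.HH.GP.inner_iso[OF R0.HH.GP.inv_closed[OF g0(1)]]]] by (simp add: comp_def F_def[abs_def])
	define g' where "g' = F (gen m)"
	have g'c: "g' : car R0.HG" unfolding g'_def by (rule hom_in_carrier[OF F mc])
	let ?B = "{R0.HH.incl False a | a. a : car (R0.PD False)} \<union> {g'}"
	have B: "?B \<subseteq> car R0.HG" using g'c by auto
	have Ls: "subgroup (generate R0.HG ?B) R0.HG" by (rule R0.HH.GP.generate_is_subgroup[OF B])
	have FL: "F b : generate R0.HG ?B" if bV: "b : gen ` V" for b
	proof -
		obtain v where v: "v : V" "b = gen v" using bV by blast
		consider "v = m" | "v : N" | "v : V - (M \<union> N)" using v(1) M by blast
		then show ?thesis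
		proof cases
			case 1 then show ?thesis using v(2) by (intro generate.incl) (simp add: g'_def)
		next
			case 2
			define c' where "c' = R0.HH.proj False (f b)"
			have pc: "c' : car (R0.PD False)" unfolding c'_def v(2) by (rule R0.HH.proj_closed[OF fc[OF gN[OF 2]]])
			have e: "f b = g0 *[R0.HG] R0.HH.incl False c' *[R0.HG] inv[R0.HG] g0" unfolding c'_def v(2) by (rule fN[OF 2])
			have "F b = R0.HH.incl False c'"
				unfolding F_def e using pc g0(1) by (simp add: R0.HH.GP.m_assoc R0.HH.GP.inv_cancel)
			then have "F b : ?B" using pc by blast
			then show ?thesis by (rule generate.incl)
		next
			case 3
			have "f b = one[R0.HG]" unfolding f_def v(2) by (rule descent[OF w 3])
			then have "F b = one[R0.HG]" unfolding F_def using g0(1) by simp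
			then show ?thesis using generate.one[of R0.HG ?B] by simp
		qed
	qed
	have surj: "car R0.HG \<subseteq> f ` car GP"
	proof -
		have "\<omega> ` car GP = car GP" using \<omega>i by (simp add: iso_def bij_betw_def)
		then have "f ` car GP = R0.rho ` car GP" unfolding f_def by (metis image_image)
		then show ?thesis using R0.rho_surj by simp
	qed
	have all: "car R0.HG \<subseteq> generate R0.HG ?B"
	proof
		fix z assume z: "z : car R0.HG"
		then have "g0 *[R0.HG] z *[R0.HG] inv[R0.HG] g0 : car R0.HG" using g0(1) by simp
		then have "g0 *[R0.HG] z *[R0.HG] inv[R0.HG] g0 : f ` car GP" using surj by blast
		then obtain x where x: "x : car GP" "g0 *[R0.HG] z *[R0.HG] inv[R0.HG] g0 = f x" by blast
		have "F x = z" unfolding F_def x(2)[symmetric] using g0(1) z by (simp add: R0.HH.GP.m_assoc R0.HH.GP.inv_cancel)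
		moreover have "x : generate GP (gen ` V)" using gens_generate x(1) by blast
		then have "F x : generate R0.HG ?B"
			by (rule GP.generate_image_closed[where B = "gen ` V" and h = F, OF _ F R0.HH.group_GP FL Ls, rotated 2]) auto
		ultimately show "z : generate R0.HG ?B" by simp
	qed
	have mM: "m : M" using M by simp
	have ms: "m : R0.side True" using mM by (simp add: side_mem)
	have sc: "R0.single True m 1 : car (R0.PD True)" by (rule R0.single_carrier[OF ms]) simp
	have s1: "R0.single True m 1 ~= one[R0.PD True]" using R0.single_one_iff[OF ms, of 1] by simp
	have "\<exists>x\<in>car (R0.PD False). \<exists>y\<in>car (R0.PD False). \<exists>a\<in>car (R0.PD True).
		 g' = R0.HH.incl False x *[R0.HG] R0.HH.incl True a *[R0.HG] R0.HH.incl False y & (\<forall>b\<in>car (R0.PD True). \<exists>n::int. b = a ^[R0.PD True] n)"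
		by (rule R0.HH.factor_and_element_generate[OF _ g'c all _ sc s1]) (rule PD_torsion_free, assumption+, simp)
	then obtain x y a where xya: "x : car (R0.PD False)" "y : car (R0.PD False)" "a : car (R0.PD True)"
		"g' = R0.HH.incl False x *[R0.HG] R0.HH.incl True a *[R0.HG] R0.HH.incl False y" by (elim bexE conjE)
	have ic: "R0.HH.incl False x : car R0.HG" "R0.HH.incl True a : car R0.HG" "R0.HH.incl False y : car R0.HG" using xya by auto
	have "R0.HH.proj False g' = R0.HH.proj False (f (gen m))"
		unfolding g'_def F_def using R0.HH.proj_conj[OF R0.PD_comm fc[OF mc] R0.HH.GP.inv_closed[OF g0(1)], of False] .
	moreover have "R0.HH.proj False g' = x *[R0.PD False] y"
		unfolding xya(4) using ic xya(1-3) by (simp add: R0.HH.proj_mult R0.HH.proj_incl)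
	ultimately have xy: "x *[R0.PD False] y = R0.HH.proj False (f (gen m))" by simp
	\<comment> \<open>x y is the projection of the image of m, whose exponents at vertices of
	  \<open>N\<close> are 0 modulo 3.\<close>
	have fac1: "pm3.fac False (x *[R0.PD False] y) = one[R3.PD False]"
		unfolding pm3.fac_def R3.PD_one xy f_def
	proof (rule restrict_ext)
		fix p assume p: "p : R3.side False"
		then have pN: "p : N" by (simp add: R3.side_def)
		then have "m ~= p" "p : V" using M MN by auto
		then show "R0.HH.proj False (R0.rho (\<omega> (gen m))) p mod 3 = one[integer_mod_group 3]"
			using proj_ep[of p False "\<omega> (gen m)"] pN \<omega>c[OF mc] cong3_gen[OF w mV] by (simp add: side_mem)
	qed
	interpret k: group_hom R0.HG R3.HG pm3.kmap using pm3.kmap_hom R0.HH.group_GP R3.HH.group_GP by (simp add: group_hom_def group_hom_axioms_def)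
	let ?X = "R3.HH.incl False (pm3.fac False x)" and ?Y = "R3.HH.incl False (pm3.fac False y)"
	have XY: "?X : car R3.HG" "?Y : car R3.HG" using pm3.fac_closed xya by auto
	have "?X *[R3.HG] ?Y = R3.HH.incl False (pm3.fac False x *[R3.PD False] pm3.fac False y)"
		using R3.HH.incl_mult[of False "pm3.fac False x" "pm3.fac False y"] pm3.fac_closed xya by simp
	also have "\<dots> = R3.HH.incl False one[R3.PD False]" using hom_mult[OF pm3.fac_hom xya(1,2)] fac1 by simp
	finally have "?X *[R3.HG] ?Y = one[R3.HG]" using R3.HH.incl_one[of False] by simp
	then have "inv[R3.HG] ?Y = ?X" by (rule R3.HH.GP.inv_equality[OF _ XY(2,1)])
	then have Yi: "?Y = inv[R3.HG] ?X" using R3.HH.GP.inv_inv[OF XY(2)] by simp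
	have "pm3.kmap g' = ?X *[R3.HG] R3.HH.incl True (pm3.fac True a) *[R3.HG] inv[R3.HG] ?X"
		unfolding xya(4) using ic pm3.kmap_incl xya(1-3) Yi by simp
	then have eg: "R3.HH.elliptic (pm3.kmap g')"
		using R3.HH.elliptic_conj[OF R3.HH.elliptic_incl[OF pm3.fac_closed[OF xya(3)]] XY(1)] by simp
	have "f (gen m) = g0 *[R0.HG] g' *[R0.HG] inv[R0.HG] g0"
		unfolding g'_def F_def using g0(1) fc[OF mc] by (simp add: R0.HH.GP.m_assoc R0.HH.GP.inv_cancel)
	then have "pm3.kmap (f (gen m)) = pm3.kmap g0 *[R3.HG] pm3.kmap g' *[R3.HG] inv[R3.HG] pm3.kmap g0"
		using g0(1) g'c by simp
	then have "R3.HH.elliptic (pm3.kmap (f (gen m)))" using R3.HH.elliptic_conj[OF eg, of "pm3.kmap g0"] g0(1) by simp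
	then show ?thesis using pm3.kmap_rho[OF \<omega>c[OF mc]] by (simp add: f_def)
qed

lemma cong3I: assumes "\<omega> : iso GP GP" "\<forall>v\<in>V. \<forall>g\<in>car GP. R3.coord v (\<omega> g) = R3.coord v g" shows "cong3 \<omega>"
	unfolding cong3_def using assms coord3 iso_carrier[OF assms(1)] by simp

lemma mod3_finite: "finite (car (integer_mod_group 3))" by (simp add: carrier_integer_mod_group)

text \<open>With a second vertex in \<open>N\<close>, each vertex falls under
  \<open>descent\<close>, \<open>side_elliptic\<close> or \<open>single_elliptic\<close>, so
  \<open>conjugate_to_rho\<close> applies modulo 3. The residues 1 and 2 at m are the two different
  non-trivial elements.\<close>

lemma pos_scl_big:
	assumes n: "n : N" "n' : N" "n ~= n'"
	shows "has_pos_scl_aut GP"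
proof -
	obtain m where m: "m : M" using MN by blast
	have ms: "m : R3.side True" and ns: "n : R3.side False" using m n by (simp_all add: R3.side_def)
	have c12: "(1::int) : car (integer_mod_group 3)" "(2::int) : car (integer_mod_group 3)" by (simp_all add: carrier_integer_mod_group)
	have sub: "car (integer_mod_group 3) \<subseteq> (%a. a mod 3) ` car integer_group"
	proof
		fix a :: int assume "a : car (integer_mod_group 3)"
		then have "a = a mod 3" by (simp add: carrier_integer_mod_group)
		then show "a : (%a. a mod 3) ` car integer_group" by (rule image_eqI) simp
	qed
	have sub': "car (integer_mod_group 3) \<subseteq> (%a. a mod 3) ` car integer_group" if "v : M \<union> N" for v by (rule sub)
	have ell: "R3.HH.elliptic (R3.rho (\<omega> (gen v)))" if w: "cong3 \<omega>" and v: "v : V" for \<omega> v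
	proof -
		have \<omega>c: "\<omega> (gen v) : car GP" using w v by (auto simp: cong3_def intro: iso_carrier)
		have via0: "R3.HH.elliptic (R3.rho (\<omega> (gen v)))" if "R0.HH.elliptic (R0.rho (\<omega> (gen v)))"
			using pm3.kmap_elliptic[OF that] pm3.kmap_rho[OF \<omega>c] by simp
		consider "v : V - (M \<union> N)" | "v : N" | v' where "v : M" "v' : M" "v' ~= v" | "M = {v}" using v by blast
		then show ?thesis
		proof cases
			case 1
			have "R0.HH.elliptic (R0.rho (\<omega> (gen v)))" unfolding descent[OF w 1] by (rule R0.HH.elliptic_one)
			then show ?thesis by (rule via0)
		next
			case 2
			obtain v' where "v' : N" "v' ~= v" using n by blast
			then show ?thesis using 2 side_elliptic[OF w, of v v'] via0 by blast
		next
			case 3 then show ?thesis using side_elliptic[OF w, of v v'] via0 by blast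
		next
			case 4 then show ?thesis using single_elliptic[OF w 4 n] by simp
		qed
	qed
	have same: "\<exists>p\<in>{R3.rho}. conjugate_on (car GP) R3.HG (%k. R3.rho (\<omega> k)) p"
		if \<omega>: "\<omega> : iso GP GP" and e: "\<forall>v\<in>V. \<forall>g\<in>car GP. R3.coord v (\<omega> g) = R3.coord v g" for \<omega>
	proof (rule bexI[of _ R3.rho])
		have w: "cong3 \<omega>" by (rule cong3I[OF \<omega> e])
		have \<omega>h: "\<omega> : hom GP GP" by (rule iso_hom[OF \<omega>])
		have \<omega>c: "\<omega> g : car GP" if "g : car GP" for g using \<omega> that by (rule iso_carrier)
		have fh: "(%k. R3.rho (\<omega> k)) : hom GP R3.HG" using hom_compose[OF \<omega>h R3.rho_hom] by (simp add: comp_def)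
		show "conjugate_on (car GP) R3.HG (%k. R3.rho (\<omega> k)) R3.rho"
		proof (rule R3.conjugate_to_rho[OF fh])
			have "\<omega> ` car GP = car GP" using \<omega> by (simp add: iso_def bij_betw_def)
			then have "(%k. R3.rho (\<omega> k)) ` car GP = R3.rho ` car GP" by (metis image_image)
			then show "car R3.HG \<subseteq> (%k. R3.rho (\<omega> k)) ` car GP" using R3.rho_surj[OF sub'] by simp
			show "R3.HH.proj i (R3.rho (\<omega> x)) = R3.HH.proj i (R3.rho x)" if x: "x : car GP" for x i
				by (rule R3.proj_eqI[OF \<omega>c[OF x] x]) (use e x in blast)
			show "R3.HH.elliptic (R3.rho (\<omega> (incl v x)))" if v: "v : V" for v x
			proof -
				have "R3.rho (\<omega> (incl v x)) = R3.rho (\<omega> (gen v)) ^[R3.HG] x"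
					using hom_int_pow[OF fh, of "gen v" x] group_GP R3.HH.group_GP v gen_pow[OF v, of x] by simp
				then show ?thesis using R3.HH.elliptic_int_pow[OF ell[OF w v]] by simp
			qed
			show "{v, u} : E" if "v : R3.side i" "u : R3.side i" "v ~= u" for i v u using that cliq by (cases i) (auto simp: R3.side_def)
			show "comm_group integer_group" by (rule abelian_integer_group)
			show "\<exists>v\<in>R3.side i. \<exists>a\<in>car integer_group. a mod 3 ~= one[integer_mod_group 3]" for i
				by (cases i) (use ms ns in \<open>auto intro!: exI[of _ 1]\<close>)
		qed
	qed simp
	have ne: "R3.single True m 1 ~= R3.single True m 2"
	proof
		assume "R3.single True m 1 = R3.single True m 2"
		then have "R3.single True m 1 m = R3.single True m 2 m" by simp
		then show False using ms by (simp add: R3.single_def)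
	qed
	show ?thesis
	proof (rule R3.pos_scl_of_pair[where ?S0.0 = "gen ` V" and ?P1.0 = "{R3.rho}" and ?a0.0 = "R3.single True m 1" and ?a1.0 = "R3.single True m 2" and ?b0.0 = "R3.single False n 1"])
		show "car (integer_mod_group 3) \<subseteq> (%a. a mod 3) ` car integer_group" if "v : M \<union> N" for v by (rule sub)
		show "\<exists>p\<in>{R3.rho}. conjugate_on (car GP) R3.HG (%k. R3.rho (\<omega> k)) p"
			if "\<omega> : iso GP GP" "\<forall>v\<in>V. \<forall>g\<in>car GP. R3.coord v (\<omega> g) = R3.coord v g" for \<omega> using that by (rule same)
		show "p k : car R3.HG" if "p : {R3.rho}" "k : car GP" for p k using that R3.rho_closed by simp
		show "car GP \<subseteq> generate GP (gen ` V)" by (rule gens_generate)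
		show "R3.single True m 1 : car (R3.PD True)" "R3.single True m 2 : car (R3.PD True)" "R3.single False n 1 : car (R3.PD False)"
			using R3.single_carrier[OF ms] R3.single_carrier[OF ns] c12 by auto
		show "R3.single True m 1 ~= one[R3.PD True]" "R3.single True m 2 ~= one[R3.PD True]" "R3.single False n 1 ~= one[R3.PD False]"
			using R3.single_one_iff[OF ms] R3.single_one_iff[OF ns] by auto
	qed (use mod3_finite finV ne in auto)
qed

text \<open>The target is the free group of rank two, where an automorphism congruent to the
  identity modulo 3 can induce a non-inner one. By \<open>descent\<close> it induces an
  endomorphism, which is what the braid cocycle can handle. All exponents being even defines a
  characteristic subgroup on which \<open>vc\<close> is trivial.\<close>

lemma pos_scl_small:
	assumes MNs: "M = {m}" "N = {n}"
	shows "has_pos_scl_aut GP"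
proof -
	have mV: "m : V" and nV: "n : V" and mn: "m ~= n" and mnE: "{m, n} \<notin> E" "{n, m} \<notin> E"
		using MN MNs noedge[of m n] by (auto simp: insert_commute)
	have mM: "m : M" and nN: "n : N" using MNs by auto
	let ?f = "%v a. if v = m then F2_incl True a else if v = n then F2_incl False a else one[F2]"
	have comp: "compatible F2 ?f" unfolding compatible_def
	proof (intro conjI ballI impI)
		show "?f v : hom integer_group F2" for v
			using Y.incl_hom[of True] Y.incl_hom[of False] by (cases "v = m"; cases "v = n") (auto simp: hom_def)
		fix v w and a b :: int assume e: "{v, w} : E"
		have "~ (v : {m, n} & w : {m, n})" using e mnE loop by auto
		then show "?f v a *[F2] ?f w b = ?f w b *[F2] ?f v a" by auto
	qed
	define q where "q = gp_lift F2 ?f"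
	have q: "q : hom GP F2" unfolding q_def by (rule gp_lift_hom[OF Y.group_GP comp])
	have qi: "q (incl v a) = ?f v a" if "v : V" for v a unfolding q_def using gp_lift_incl[OF Y.group_GP comp that, of a] by simp
	interpret q: group_hom GP F2 q using q group_GP Y.group_GP by (simp add: group_hom_def group_hom_axioms_def)
	have qm: "q (gen m) = ga" and qn: "q (gen n) = gb" using qi mV nV mn by (simp_all add: gl_def)
	have mc: "gen m : car GP" and nc: "gen n : car GP" using mV nV by auto
	have surj: "car F2 \<subseteq> q ` car GP"
	proof
		fix z assume "z : car F2"
		then show "z : q ` car GP"
		proof (rule F2_subgroup_induct)
			show "one[F2] : q ` car GP" using q.hom_one GP.one_closed by (metis imageI)
			show "ga : q ` car GP" "gb : q ` car GP" using qm qn mc nc by (metis imageI)+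
			show "inv[F2] g : q ` car GP" if gq: "g : q ` car GP" for g
			proof -
				obtain x where "x : car GP" "g = q x" using gq by (elim imageE)
				then have "inv[F2] g = q (inv[GP] x)" "inv[GP] x : car GP" by simp_all
				then show ?thesis by blast
			qed
			show "g *[F2] h : q ` car GP" if gq: "g : q ` car GP" and hq: "h : q ` car GP" for g h
			proof -
				obtain x where "x : car GP" "g = q x" using gq by (elim imageE)
				moreover obtain y where "y : car GP" "h = q y" using hq by (elim imageE)
				ultimately have "g *[F2] h = q (x *[GP] y)" "x *[GP] y : car GP" by simp_all
				then show ?thesis by blast
			qed
		qed
	qed
	let ?k = "%i f. F2_incl i (f (if i then m else n))"
	have kcomp: "R0.HH.compatible F2 ?k" unfolding R0.HH.compatible_def
	proof (intro conjI ballI impI)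
		fix i :: bool
		have s: "(if i then m else n) : R0.side i" using mM nN by (simp add: side_mem)
		show "?k i : hom (R0.PD i) F2" by (rule homI) (use s Y.incl_mult[of i] in \<open>simp_all add: R0.PD_mult\<close>)
	qed simp
	define \<kappa> where "\<kappa> = gp_lift F2 ?k"
	have \<kappa>: "\<kappa> : hom R0.HG F2" unfolding \<kappa>_def by (rule R0.HH.gp_lift_hom[OF Y.group_GP kcomp])
	have \<kappa>i: "\<kappa> (R0.HH.incl i f) = ?k i f" if "f : car (R0.PD i)" for i f
		unfolding \<kappa>_def using R0.HH.gp_lift_incl[OF Y.group_GP kcomp, of i f] that by simp
	have q\<kappa>: "q x = \<kappa> (R0.rho x)" if x: "x : car GP" for x
	proof -
		have "(%x. \<kappa> (R0.rho x)) : hom GP F2" using hom_compose[OF R0.rho_hom \<kappa>] by (simp add: comp_def)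
		then show ?thesis
		proof (rule hom_ext[OF q _ Y.group_GP x])
			fix v and a :: int assume v: "v : V"
			consider i where "v : R0.side i" "v = (if i then m else n)" | "v ~= m" "v ~= n"
				using mM nN side_mem[of v True] side_mem[of v False] by (cases "v = m"; cases "v = n") auto
			then show "q (incl v a) = \<kappa> (R0.rho (incl v a))"
			proof cases
				case (1 i)
				have "\<kappa> (R0.rho (incl v a)) = ?k i (R0.single i v a)"
					using R0.rho_incl[OF v, of a] R0.letter_side[OF 1(1), of a] \<kappa>i[OF R0.single_carrier[OF 1(1)], of a] by simp
				also have "\<dots> = F2_incl i a" using 1 by (simp add: R0.single_def)
				also have "\<dots> = q (incl v a)" using qi[OF v, of a] 1(2) mn by (cases i) auto
				finally show ?thesis by simp
			next
				case 2
				then have "v \<notin> M \<union> N" using MNs by simp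
				then have "R0.rho (incl v a) = one[R0.HG]" using R0.rho_incl[OF v, of a] by (simp add: R0.letter_def)
				then show ?thesis using 2 qi[OF v, of a] hom_one[OF \<kappa> R0.HH.group_GP Y.group_GP] by simp
			qed
		qed
	qed
	have vodd: "vc (F2_incl i a) = (if odd a then if i then Pa else Pb else Pz)" for i and a :: int
	proof -
		have ev: "vc (F2_incl i (2 * b)) = Pz" for b :: int
		proof -
			have e: "2 * b = b + b" by simp
			have "F2_incl i (2 * b) = F2_incl i b *[F2] F2_incl i b" unfolding e using Y.incl_mult[of i b b] by simp
			then show ?thesis using vc_cc_mult(1)[of "F2_incl i b" "F2_incl i b"] by simp
		qed
		have g1: "F2_incl i 1 = gl (i, True)" by (simp add: gl_def)
		show ?thesis
		proof (cases "even a")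
			case True then show ?thesis using ev by (auto elim!: evenE)
		next
			case False
			then obtain b where b: "a = 2 * b + 1" using oddE by blast
			have "F2_incl i a = F2_incl i (2 * b) *[F2] gl (i, True)" using Y.incl_mult[of i "2 * b" 1] b g1 by simp
			then have "vc (F2_incl i a) = vc (gl (i, True))" using vc_cc_mult(1)[of "F2_incl i (2 * b)" "gl (i, True)"] ev by simp
			also have "\<dots> = (if i then Pa else Pb)" using vc_cc_gen(1,2) by (cases i) simp_all
			finally show ?thesis using False by simp
		qed
	qed
	have vq: "vc (q g) = padd (if odd (ep m g) then Pa else Pz) (if odd (ep n g) then Pb else Pz)" if "g : car GP" for g
		using that
	proof (induction rule: GP_induct)
		case one then show ?case by (simp add: vc_cc_one ep_one)
	next
		case (mult v a Q)
		have "vc (q (incl v a *[GP] Q)) = padd (vc (q (incl v a))) (vc (q Q))" using mult(1,3) by (simp add: vc_cc_mult)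
		moreover have "vc (q (incl v a)) = (if v = m & odd a then Pa else if v = n & odd a then Pb else Pz)"
			using qi[OF mult(1), of a] vodd mn by (auto simp: vc_cc_one)
		ultimately show ?case using mult(1,3,4) mn by (auto simp: ep_mult ep_incl)
	qed
	define K where "K = {g : car GP. \<forall>v\<in>V. even (ep v g)}"
	have Ks: "subgroup K GP"
	proof (rule GP.subgroupI)
		have "one[GP] : K" by (simp add: K_def ep_one)
		then show "K ~= {}" by blast
	qed (auto simp: K_def ep_mult ep_inv)
	have Kchar: "\<phi> k : K" if \<phi>: "\<phi> : iso GP GP" and k: "k : K" for \<phi> k
	proof -
		have kc: "k : car GP" using k by (simp add: K_def)
		have "even (ep v (\<phi> k))" for v
		proof -
			have "ep v (\<phi> k) = (\<Sum>u\<in>V. ep u k * ep v (\<phi> (gen u)))" using hom_linear[OF hom_iso_ep[OF \<phi>] kc] .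
			then show ?thesis using k by (auto simp: K_def intro!: dvd_sum)
		qed
		then show ?thesis using iso_carrier[OF \<phi> kc] by (simp add: K_def)
	qed
	define val where "val g = {v : V. odd (ep v g)}" for g
	define rep where "rep s = (SOME g. g : car GP & val g = s)" for s
	have rep: "rep (val g) : car GP & val (rep (val g)) = val g" if "g : car GP" for g
		unfolding rep_def by (rule someI[of _ g]) (use that in simp)
	define T where "T = rep ` val ` car GP"
	have Tf: "finite T"
	proof -
		have "val ` car GP \<subseteq> Pow V" by (auto simp: val_def)
		then show ?thesis unfolding T_def using finV by (meson finite_Pow_iff finite_imageI finite_subset)
	qed
	have Tc: "T \<subseteq> car GP" unfolding T_def using rep by blast
	have Tcov: "\<exists>t\<in>T. g *[GP] inv[GP] t : K" if g: "g : car GP" for g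
	proof (rule bexI[of _ "rep (val g)"])
		have r: "rep (val g) : car GP" "val (rep (val g)) = val g" using rep[OF g] by auto
		have "even (ep v (g *[GP] inv[GP] rep (val g)))" if "v : V" for v
		proof -
			have "v : val (rep (val g)) \<longleftrightarrow> v : val g" using r(2) by simp
			then have "odd (ep v (rep (val g))) \<longleftrightarrow> odd (ep v g)" using that by (simp add: val_def)
			then show ?thesis using g r(1) by (simp add: ep_mult ep_inv)
		qed
		then show "g *[GP] inv[GP] rep (val g) : K" using g r(1) by (simp add: K_def)
		show "rep (val g) : T" using g by (simp add: T_def)
	qed
	have even: "vc (q k) = Pz" if "k : K" for k using vq[of k] that mV nV by (simp add: K_def)
	have gQ: "group (product_group V (%_. integer_mod_group 3))" by simp
	have fQ: "finite (car (product_group V (%_. integer_mod_group 3)))" using finV mod3_finite by (auto intro!: finite_PiE)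
	have desc: "\<exists>\<sigma>\<in>hom F2 F2. \<forall>g\<in>car GP. q (\<omega> g) = \<sigma> (q g)"
		if \<omega>: "\<omega> : iso GP GP" and e: "\<forall>g\<in>car GP. R3.coords (\<omega> g) = R3.coords g" for \<omega>
	proof -
		have "R3.coord v (\<omega> g) = R3.coord v g" if "v : V" "g : car GP" for v g
		proof -
			have "R3.coords (\<omega> g) v = R3.coords g v" using e that by simp
			then show ?thesis using that(1) by (simp add: R3.coords_def)
		qed
		then have w: "cong3 \<omega>" using cong3I[OF \<omega>] by blast
		have \<omega>c: "\<omega> g : car GP" if "g : car GP" for g using \<omega> that by (rule iso_carrier)
		obtain \<sigma> where s: "\<sigma> : hom F2 F2" "\<sigma> ga = q (\<omega> (gen m))" "\<sigma> gb = q (\<omega> (gen n))"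
			using F2_map[OF Y.group_GP q.hom_closed[OF \<omega>c[OF mc]] q.hom_closed[OF \<omega>c[OF nc]]] by (elim bexE conjE)
		have h1: "(%g. q (\<omega> g)) : hom GP F2" using hom_compose[OF iso_hom[OF \<omega>] q] by (simp add: comp_def)
		have h2: "(%g. \<sigma> (q g)) : hom GP F2" using hom_compose[OF q s(1)] by (simp add: comp_def)
		have gens: "q (\<omega> b) = \<sigma> (q b)" if bV: "b : gen ` V" for b
		proof -
			obtain v where v: "v : V" "b = gen v" using bV by blast
			consider "v = m" | "v = n" | "v : V - (M \<union> N)" using v(1) MNs by blast
			then show ?thesis
			proof cases
				case 3
				have "q (\<omega> b) = \<kappa> one[R0.HG]" using q\<kappa>[OF \<omega>c, of b] descent[OF w 3] v by simp
				also have "\<dots> = one[F2]" by (rule hom_one[OF \<kappa> R0.HH.group_GP Y.group_GP])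
				also have "one[F2] = \<sigma> one[F2]" using hom_one[OF s(1) Y.group_GP Y.group_GP] by simp
				also have "one[F2] = q b" using qi[OF v(1), of 1] v(2) 3 MNs by simp
				finally show ?thesis .
			qed (use s(2,3) qm qn v(2) in simp_all)
		qed
		have "q (\<omega> g) = \<sigma> (q g)" if "g : car GP" for g
			by (rule GP.generate_hom_eq[where B = "gen ` V", OF _ h1 h2 Y.group_GP gens]) (use that gens_generate in auto)
		then show ?thesis using s(1) by blast
	qed
	define s where "s = gen m *[GP] (gen n *[GP] (gen m *[GP] (gen m *[GP] (inv[GP] gen n *[GP] gen m))))"
	define t where "t = gen n *[GP] (gen m *[GP] (gen m *[GP] (inv[GP] gen n *[GP] (gen m *[GP] gen m))))"
	have st: "s : K" "t : K" "q s = sF" "q t = tF"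
		using mc nc mV nV qm qn by (auto simp: s_def t_def K_def ep_mult ep_inv ep_incl sF_def tF_def)
	show ?thesis
	proof (rule pos_scl_of_free_quotient[where \<pi> = R3.coords and ?S0.0 = "gen ` V" and K = K and T = T and q = q and s = s and t = t
				and Q = "product_group V (%_. integer_mod_group 3)", OF q surj gQ fQ R3.coords_hom])
		show "\<phi> k : K" if "\<phi> : iso GP GP" "k : K" for \<phi> k using that by (rule Kchar)
		show "\<exists>t\<in>T. g *[GP] inv[GP] t : K" if "g : car GP" for g using that by (rule Tcov)
		show "vc (q k) = Pz" if "k : K" for k using that by (rule even)
		show "\<exists>\<sigma>\<in>hom F2 F2. \<forall>g\<in>car GP. q (\<omega> g) = \<sigma> (q g)"
			if "\<omega> : iso GP GP" "\<forall>g\<in>car GP. R3.coords (\<omega> g) = R3.coords g" for \<omega> using that by (rule desc)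
		show "car GP \<subseteq> generate GP (gen ` V)" by (rule gens_generate)
	qed (use finV Ks Tf Tc st in auto)
qed

end

lemma raag_pair_swap: "raag_pair V E M N ==> raag_pair V E N M"
proof -
	assume "raag_pair V E M N"
	then interpret raag_pair V E M N .
	show ?thesis
	proof (rule raag_pair.intro, rule raag_axioms, rule raag_pair_axioms.intro)
		show "{m, n} \<notin> E" if "m : N" "n : M" for m n using noedge[OF that(2,1)] by (simp add: insert_commute)
		show "{y, x'} : E" if "y : V - (N \<union> M)" "x : N" "x' : N" "{y, x} : E" for y x x' using unif(2)[of y x x'] that by blast
		show "{y, x'} : E" if "y : V - (N \<union> M)" "x : M" "x' : M" "{y, x} : E" for y x x' using unif(1)[of y x x'] that by blast
		show "w : N \<union> M" if "w : V" "x : N \<union> M" "tau_le E w x" for w x using down[of w x] that by blast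
	qed (use MN cliq in auto)
qed

lemma (in raag_pair) pos_scl: "has_pos_scl_aut GP"
proof -
	obtain m n where mn: "m : M" "n : N" using MN by blast
	consider n' where "n' : N" "n' ~= n" | m' where "m' : M" "m' ~= m" | "M = {m}" "N = {n}" using mn by blast
	then show ?thesis
	proof cases
		case 1 then show ?thesis using pos_scl_big[of n n'] mn by blast
	next
		case 2
		interpret sw: raag_pair V E N M by (rule raag_pair_swap[OF raag_pair_axioms])
		show ?thesis using sw.pos_scl_big[of m m'] 2 mn by blast
	next
		case 3 then show ?thesis by (rule pos_scl_small)
	qed
qed

section \<open>Choice of the pair of classes\<close>

context raag
begin

lemma tau_le_refl: "tau_le E v v" by (simp add: tau_le_def)

lemma tau_leD: "tau_le E v w ==> {v, x} : E ==> x = w | {w, x} : E"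
	by (auto simp: tau_le_def lk_def st_def)

lemma tau_le_trans:
	assumes "tau_le E u v" "tau_le E v w"
	shows "tau_le E u w"
proof (cases "u = w | u = v | v = w")
	case False
	have "x = w | {w, x} : E" if x: "{u, x} : E" for x
	proof -
		consider "x = v" | "{v, x} : E" using tau_leD[OF assms(1) x] by blast
		then show ?thesis
		proof cases
			case 1
			have "{v, u} : E" using x 1 edge_sym by blast
			then have "{w, u} : E" using tau_leD[OF assms(2)] False by blast
			then have "{u, w} : E" by (rule edge_sym)
			then have "{v, w} : E" using tau_leD[OF assms(1)] False by blast
			then show ?thesis using 1 edge_sym by blast
		next
			case 2 then show ?thesis using tau_leD[OF assms(2)] by blast
		qed
	qed
	then show ?thesis by (auto simp: tau_le_def lk_def st_def)
qed (use assms in \<open>auto simp: tau_le_refl\<close>)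

definition tcl :: "'v => 'v set" where "tcl v = {w : V. tau_equiv E v w}"

lemma tcl_le: "a : tcl v ==> b : tcl v ==> tau_le E a b"
	using tau_le_trans[of a v b] by (auto simp: tcl_def tau_equiv_def)

lemma tcl_self: "v : V ==> v : tcl v" by (simp add: tcl_def tau_equiv_def tau_le_refl)
lemma tcl_V: "tcl v \<subseteq> V" by (auto simp: tcl_def)
lemma tcl_class: "v : V ==> tcl v : tau_classes V E" by (auto simp: tau_classes_def tcl_def)
lemma class_tcl: "C : tau_classes V E ==> \<exists>v\<in>V. C = tcl v" by (auto simp: tau_classes_def tcl_def)

text \<open>One edge a b inside a class makes b adjacent to every other member c, as a is below c;
  and b being below d then makes d adjacent to c.\<close>

lemma tcl_dichotomy:
	"(\<forall>a\<in>tcl v. \<forall>b\<in>tcl v. a ~= b --> {a, b} : E) | (\<forall>a\<in>tcl v. \<forall>b\<in>tcl v. {a, b} \<notin> E)"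
proof (rule ccontr)
	assume "~ ?thesis"
	then obtain a b c d where ab: "a : tcl v" "b : tcl v" "{a, b} : E" and cd: "c : tcl v" "d : tcl v" "c ~= d" "{c, d} \<notin> E" by blast
	have b: "x = b | {x, b} : E" if "x : tcl v" for x using tau_leD[OF tcl_le[OF ab(1) that] ab(3)] by blast
	show False
	proof (cases "c = b")
		case True then show False using b[OF cd(2)] cd(3,4) edge_sym[of d b] by blast
	next
		case False
		then have "{b, c} : E" using b[OF cd(1)] edge_sym by blast
		then have "{d, c} : E" using tau_leD[OF tcl_le[OF ab(2) cd(2)]] cd(3) by blast
		then show False using cd(4) edge_sym by blast
	qed
qed

text \<open>Members of a class have the same neighbours outside it, so one non-edge between
  inequivalent vertices spreads to their whole classes.\<close>

lemma pair_of_classes: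
	assumes m: "m : V" "n : V" "{m, n} \<notin> E" "~ tau_equiv E m n"
		and cl: "!!a b. a : tcl m ==> b : tcl m ==> a ~= b ==> {a, b} : E" "!!a b. a : tcl n ==> b : tcl n ==> a ~= b ==> {a, b} : E"
		and down: "!!w x. w : V ==> x : tcl m \<union> tcl n ==> tau_le E w x ==> w : tcl m \<union> tcl n"
	shows "has_pos_scl_aut GP"
proof -
	have dj: "tcl m \<inter> tcl n = {}"
	proof -
		have "False" if "x : tcl m" "x : tcl n" for x
			using that m(4) tau_le_trans[of m x n] tau_le_trans[of n x m] by (auto simp: tcl_def tau_equiv_def)
		then show ?thesis by blast
	qed
	have ne: "{a, b} \<notin> E" if a: "a : tcl m" and b: "b : tcl n" for a b
	proof
		assume "{a, b} : E"
		then have "{b, a} : E" by (rule edge_sym)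
		then have "a = n | {n, a} : E" using tau_leD[OF tcl_le[OF b tcl_self[OF m(2)]]] by blast
		then have "{a, n} : E" using a dj tcl_self[OF m(2)] edge_sym by blast
		then have "n = m | {m, n} : E" using tau_leD[OF tcl_le[OF a tcl_self[OF m(1)]]] by blast
		then show False using m by (auto simp: tau_equiv_def tau_le_refl)
	qed
	have un: "{y, x'} : E" if "x : tcl v" "x' : tcl v" "y \<notin> tcl v" "{y, x} : E" for v x x' y
		using tau_leD[OF tcl_le[OF that(1,2)], of y] that(2-4) edge_sym by blast
	interpret raag_pair V E "tcl m" "tcl n"
	proof (rule raag_pair.intro, rule raag_axioms, rule raag_pair_axioms.intro)
		show "{y, x'} : E" if "y : V - (tcl m \<union> tcl n)" "x : tcl m" "x' : tcl m" "{y, x} : E" for y x x' using un[OF that(2,3) _ that(4)] that(1) by blast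
		show "{y, x'} : E" if "y : V - (tcl m \<union> tcl n)" "x : tcl n" "x' : tcl n" "{y, x} : E" for y x x' using un[OF that(2,3) _ that(4)] that(1) by blast
		show "w : tcl m \<union> tcl n" if "w : V" "x : tcl m \<union> tcl n" "tau_le E w x" for w x using that by (rule down)
	qed (use tcl_V tcl_self[OF m(1)] tcl_self[OF m(2)] dj ne cl in auto)
	show ?thesis by (rule pos_scl)
qed

text \<open>Among the elements of \<open>A\<close> below \<open>w\<close>, take one with the fewest
  elements of \<open>A\<close> below it.\<close>

lemma minimal_below:
	assumes A: "A \<subseteq> V" "w : A"
	shows "\<exists>m\<in>A. tau_le E m w & (\<forall>z\<in>A. tau_le E z m --> tau_le E m z)"
proof -
	have fA: "finite A" using A(1) finV finite_subset by blast
	let ?P = "%m. m : A & tau_le E m w" and ?c = "%m. card {z : A. tau_le E z m}"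
	have "\<exists>m. ?P m & (\<forall>y. ?P y --> ?c m <= ?c y)" by (rule ex_has_least_nat[of ?P w]) (use A(2) tau_le_refl in simp)
	then obtain m where m: "m : A" "tau_le E m w" and least: "\<forall>y. ?P y --> ?c m <= ?c y" by blast
	have "tau_le E m z" if z: "z : A" "tau_le E z m" for z
	proof (rule ccontr)
		assume n: "~ tau_le E m z"
		have "{y : A. tau_le E y z} \<subset> {y : A. tau_le E y m}"
		proof
			show "{y : A. tau_le E y z} \<subseteq> {y : A. tau_le E y m}" using tau_le_trans z(2) by blast
			show "{y : A. tau_le E y z} ~= {y : A. tau_le E y m}" using n m(1) tau_le_refl by blast
		qed
		then have "?c z < ?c m" using fA by (intro psubset_card_mono) auto
		moreover have "tau_le E z w" using tau_le_trans[OF z(2) m(2)] .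
		ultimately show False using least z(1) by (auto simp: not_less[symmetric])
	qed
	then show ?thesis using m by blast
qed

text \<open>Take m minimal; the cone condition gives it a non-neighbour. If some non-neighbour w is
  not above m, a minimal n below w is not adjacent to m either, and both classes are minimal.
  Otherwise the class of m is {m}, and n is chosen minimal among the non-neighbours of m: a vertex
  below n is m or equivalent to n.\<close>

lemma pos_scl_clique_classes:
	assumes no_cone: "\<forall>v\<in>V. st E v ~= V"
		and cl: "!!v a b. v : V ==> a : tcl v ==> b : tcl v ==> a ~= b ==> {a, b} : E"
	shows "has_pos_scl_aut GP"
proof -
	obtain v0 where "v0 : V" using neV by blast
	then obtain m where m: "m : V" "!!z. z : V ==> tau_le E z m ==> tau_le E m z" using minimal_below[OF subset_refl] by blast
	have in_tcl: "z : tcl u" if "z : V" "tau_le E z u" "tau_le E u z" for z u using that by (simp add: tcl_def tau_equiv_def)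
	have down_m: "w : tcl m" if "w : V" "x : tcl m" "tau_le E w x" for w x
		using that m tau_le_trans[OF that(3) tcl_le[OF that(2) tcl_self[OF m(1)]]] in_tcl by blast
	define A where "A = {w : V. w ~= m & {m, w} \<notin> E}"
	have "A ~= {}"
	proof
		assume "A = {}"
		then have "st E m = V" using m(1) edgeV by (auto simp: A_def st_def lk_def)
		then show False using no_cone m(1) by blast
	qed
	show ?thesis
	proof (cases "\<exists>w\<in>A. ~ tau_le E m w")
		case True
		then obtain w where w: "w : V" "w ~= m" "{m, w} \<notin> E" "~ tau_le E m w" by (auto simp: A_def)
		then obtain n where n: "n : V" "tau_le E n w" "!!z. z : V ==> tau_le E z n ==> tau_le E n z" using minimal_below[OF subset_refl] by blast
		have nm: "~ tau_le E m n" using tau_le_trans[OF _ n(2)] w(4) by blast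
		have "{m, n} \<notin> E"
		proof
			assume "{m, n} : E"
			then have "{n, m} : E" by (rule edge_sym)
			then have "m = w | {w, m} : E" by (rule tau_leD[OF n(2)])
			then show False using w edge_sym by blast
		qed
		moreover have "~ tau_equiv E m n" using nm by (simp add: tau_equiv_def)
		moreover have "w' : tcl m \<union> tcl n" if "w' : V" "x : tcl m \<union> tcl n" "tau_le E w' x" for w' x
		proof (cases "x : tcl m")
			case False
			then have "x : tcl n" using that(2) by blast
			then have "tau_le E w' n" using tau_le_trans[OF that(3)] tcl_le tcl_self[OF n(1)] by blast
			then show ?thesis using n(3) that(1) in_tcl by blast
		qed (use down_m that in blast)
		ultimately show ?thesis using m(1) n(1) cl[OF m(1)] cl[OF n(1)] by (intro pair_of_classes[of m n])
	next
		case False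
		then have le: "tau_le E m w" if "w : A" for w using that by blast
		have AV: "A \<subseteq> V" by (auto simp: A_def)
		obtain w where "w : A" using \<open>A ~= {}\<close> by blast
		then obtain n where n: "n : A" "!!z. z : A ==> tau_le E z n ==> tau_le E n z" using minimal_below[OF AV] by blast
		have nA: "n : V" "n ~= m" "{m, n} \<notin> E" using n(1) by (auto simp: A_def)
		\<comment> \<open>Another member z would be a neighbour of m, hence of n because m is below n;
		  then m, above z, would be adjacent to n.\<close>
		have single: "z = m" if z: "z : tcl m" for z
		proof (rule ccontr)
			assume "z ~= m"
			then have "{m, z} : E" using cl[OF m(1) tcl_self[OF m(1)] z] by blast
			then have "z = n | {n, z} : E" by (rule tau_leD[OF le[OF n(1)]])
			then have "{z, n} : E" using \<open>{m, z} : E\<close> nA(3) edge_sym by blast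
			then have "n = m | {m, n} : E" by (rule tau_leD[OF tcl_le[OF z tcl_self[OF m(1)]]])
			then show False using nA by blast
		qed
		have "~ tau_equiv E m n" using single[of n] nA(1,2) by (auto simp: tcl_def)
		moreover have "w' : tcl m \<union> tcl n" if w': "w' : V" "x : tcl m \<union> tcl n" "tau_le E w' x" for w' x
		proof (cases "x : tcl m")
			case False
			then have "x : tcl n" using w'(2) by blast
			then have wn: "tau_le E w' n" using tau_le_trans[OF w'(3)] tcl_le tcl_self[OF nA(1)] by blast
			consider "w' : A" | "w' = m" | "{m, w'} : E" using w'(1) by (auto simp: A_def)
			then show ?thesis
			proof cases
				case 1 then show ?thesis using n(2) wn w'(1) in_tcl by blast
			next
				case 2 then show ?thesis using tcl_self[OF m(1)] by simp
			next
				\<comment> \<open>A neighbour of m below n would make n adjacent to m.\<close>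
				case 3
				then have "{w', m} : E" by (rule edge_sym)
				then have "m = n | {n, m} : E" by (rule tau_leD[OF wn])
				then show ?thesis using nA edge_sym by blast
			qed
		qed (use down_m w' in blast)
		ultimately show ?thesis using m(1) nA cl[OF m(1)] cl[OF nA(1)] by (intro pair_of_classes[of m n])
	qed
qed

text \<open>Only an abstract isomorphism is given. Non-commutativity excludes a clique, so the class
  is discrete, and exponent vectors, generated by those of two elements, allow at most two vertices.
  The class is then treated as a pair of single vertices.\<close>

lemma pos_scl_minimal_F2:
	assumes min: "tau_minimal_class V E M" and iso2: "gp_sub V E (%_. integer_group) M \<cong> free_grp 2"
	shows "has_pos_scl_aut GP"
proof -
	have "M : tau_classes V E" using min by (simp add: tau_minimal_class_def)
	then obtain v0 where v0: "v0 : V" "M = tcl v0" using class_tcl by blast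
	have MV: "M \<subseteq> V" using v0 tcl_V by simp
	interpret F: raag "{..<2::nat}" "{}" by (rule raag.intro) (simp add: is_graph_def lessThan_empty_iff)
	have FG: "free_grp 2 = F.GP" by (simp add: free_grp_def RAAG_def)
	let ?S = "gp_sub V E (%_. integer_group) M"
	obtain \<phi> where \<phi>: "\<phi> : iso ?S F.GP" using iso2 unfolding FG is_iso_def by blast
	obtain \<psi> where \<psi>: "\<psi> : iso F.GP ?S" "\<forall>x\<in>car ?S. \<psi> (\<phi> x) = x"
		using iso_inverse[OF gp_sub_group[OF MV] \<phi>] by (elim bexE conjE)
	have \<psi>S: "\<psi> x : generate GP (letters M)" if "x : car F.GP" for x
		using iso_carrier[OF \<psi>(1) that] by (simp add: gp_sub_simps)
	have Lc: "letters M \<subseteq> car GP" by (rule letters_carrier[OF MV])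
	have \<psi>c: "\<psi> x : car GP" if "x : car F.GP" for x using GP.generate_in_carrier[OF Lc \<psi>S[OF that]] .
	have \<psi>h: "\<psi> : hom F.GP GP"
		by (rule homI) (use \<psi>c hom_mult[OF iso_hom[OF \<psi>(1)]] in \<open>simp_all add: gp_sub_simps\<close>)
	have g01: "F.gen 0 : car F.GP" "F.gen 1 : car F.GP" by auto
	have noncomm: "\<psi> (F.gen 0) *[GP] \<psi> (F.gen 1) ~= \<psi> (F.gen 1) *[GP] \<psi> (F.gen 0)"
	proof
		assume "\<psi> (F.gen 0) *[GP] \<psi> (F.gen 1) = \<psi> (F.gen 1) *[GP] \<psi> (F.gen 0)"
		then have e: "\<psi> (F.gen 0 *[F.GP] F.gen 1) = \<psi> (F.gen 1 *[F.GP] F.gen 0)"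
			using hom_mult[OF \<psi>h g01] hom_mult[OF \<psi>h g01(2,1)] by simp
		have inj: "inj_on \<psi> (car F.GP)" using \<psi>(1) by (simp add: iso_def bij_betw_def)
		from inj_onD[OF inj e F.GP.m_closed[OF g01] F.GP.m_closed[OF g01(2,1)]]
		have "F.gen 0 *[F.GP] F.gen 1 = F.gen 1 *[F.GP] F.gen 0" .
		from F.commuting_ep[OF g01 this, of 0 1] show False by (simp add: F.ep_incl)
	qed
	have not_clique: False if cl: "\<forall>a\<in>M. \<forall>b\<in>M. a ~= b --> {a, b} : E"
	proof -
		have lc: "x *[GP] y = y *[GP] x" if "x : letters M" "y : letters M" for x y
		proof -
			from that have "\<exists>s c t d. x = incl s c & s : M & y = incl t d & t : M" unfolding letters_def by blast
			then obtain s t c d where st: "x = incl s c" "s : M" "y = incl t d" "t : M" by (elim exE conjE)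
			have V: "s : V" "t : V" using st MV by auto
			show ?thesis
			proof (cases "s = t")
				case True
				then show ?thesis using st V incl_mult[of s c d] incl_mult[of s d c] by (simp add: add.commute)
			next
				case False
				then show ?thesis unfolding st(1,3) using incl_comm[OF V _, of c d] cl st(2,4) by simp
			qed
		qed
		have "\<psi> (F.gen 0) *[GP] \<psi> (F.gen 1) = \<psi> (F.gen 1) *[GP] \<psi> (F.gen 0)"
			by (rule GP.generate_commute[OF Lc Lc _ \<psi>S[OF g01(1)] \<psi>S[OF g01(2)]]) (rule lc)
		then show False using noncomm by simp
	qed
	have disc: "{a, b} \<notin> E" if "a : M" "b : M" for a b
		using not_clique tcl_dichotomy[of v0] that v0(2) by blast
	have lin: "ep p (\<psi> z) = F.ep 0 z * ep p (\<psi> (F.gen 0)) + F.ep 1 z * ep p (\<psi> (F.gen 1))" if z: "z : car F.GP" for p z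
	proof -
		have h: "(%z. ep p (\<psi> z)) : hom F.GP integer_group" using hom_compose[OF \<psi>h ep_hom] by (simp add: comp_def)
		have two: "{..<2::nat} = {0, 1}" by auto
		show ?thesis using F.hom_linear[OF h z] unfolding two by simp
	qed
	have rank: "\<exists>\<alpha> \<beta>. \<forall>p. (if u = p then 1 else 0) = \<alpha> * ep p (\<psi> (F.gen 0)) + \<beta> * ep p (\<psi> (F.gen 1))" if u: "u : M" for u
	proof -
		have "gen u : letters M" using u by (auto simp: letters_def)
		then have gS: "gen u : car ?S" by (simp add: gp_sub_simps generate.incl)
		have uV: "u : V" using u MV by blast
		have "ep p (gen u) = F.ep 0 (\<phi> (gen u)) * ep p (\<psi> (F.gen 0)) + F.ep 1 (\<phi> (gen u)) * ep p (\<psi> (F.gen 1))" for p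
			using lin[OF iso_carrier[OF \<phi> gS], of p] \<psi>(2) gS by simp
		then show ?thesis using uV by (auto simp: ep_incl)
	qed
	have three: False if uvw: "u : M" "v : M" "w : M" "u ~= v" "u ~= w" "v ~= w" for u v w
	proof -
		define a b where "a p = ep p (\<psi> (F.gen 0))" and "b p = ep p (\<psi> (F.gen 1))" for p
		obtain \<alpha>1 \<beta>1 where 1: "\<forall>p. (if u = p then 1 else 0) = \<alpha>1 * a p + \<beta>1 * b p" using rank[OF uvw(1)] unfolding a_def b_def by (elim exE)
		obtain \<alpha>2 \<beta>2 where 2: "\<forall>p. (if v = p then 1 else 0) = \<alpha>2 * a p + \<beta>2 * b p" using rank[OF uvw(2)] unfolding a_def b_def by (elim exE)
		obtain \<alpha>3 \<beta>3 where 3: "\<forall>p. (if w = p then 1 else 0) = \<alpha>3 * a p + \<beta>3 * b p" using rank[OF uvw(3)] unfolding a_def b_def by (elim exE)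
		\<comment> \<open>Three unit vectors cannot lie in the span of two: a 3 by 3 matrix that factors
		  through rank 2 has determinant 0.\<close>
		have det: "(x1 * a1 + y1 * b1) * ((x2 * a2 + y2 * b2) * (x3 * a3 + y3 * b3) - (x2 * a3 + y2 * b3) * (x3 * a2 + y3 * b2))
			- (x1 * a2 + y1 * b2) * ((x2 * a1 + y2 * b1) * (x3 * a3 + y3 * b3) - (x2 * a3 + y2 * b3) * (x3 * a1 + y3 * b1))
			+ (x1 * a3 + y1 * b3) * ((x2 * a1 + y2 * b1) * (x3 * a2 + y3 * b2) - (x2 * a2 + y2 * b2) * (x3 * a1 + y3 * b1)) = 0"
			for x1 x2 x3 y1 y2 y3 a1 a2 a3 b1 b2 b3 :: int by (simp add: algebra_simps)
		have e: "\<alpha>1 * a u + \<beta>1 * b u = 1" "\<alpha>1 * a v + \<beta>1 * b v = 0" "\<alpha>1 * a w + \<beta>1 * b w = 0"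
			"\<alpha>2 * a u + \<beta>2 * b u = 0" "\<alpha>2 * a v + \<beta>2 * b v = 1" "\<alpha>2 * a w + \<beta>2 * b w = 0"
			"\<alpha>3 * a u + \<beta>3 * b u = 0" "\<alpha>3 * a v + \<beta>3 * b v = 0" "\<alpha>3 * a w + \<beta>3 * b w = 1"
			using 1[rule_format, of u] 1[rule_format, of v] 1[rule_format, of w] 2[rule_format, of u] 2[rule_format, of v] 2[rule_format, of w]
				3[rule_format, of u] 3[rule_format, of v] 3[rule_format, of w] uvw(4-6) by simp_all
		from det[of \<alpha>1 "a u" \<beta>1 "b u" \<alpha>2 "a v" \<beta>2 "b v" \<alpha>3 "a w" \<beta>3 "b w"] show False unfolding e by simp
	qed
	have vM: "v0 : M" using v0 tcl_self by simp
	have "\<exists>v1. v1 : M & v1 ~= v0" using not_clique by blast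
	then obtain v1 where v1: "v1 : M" "v1 ~= v0" by blast
	have M2: "M = {v0, v1}" using three[of v0 v1] vM v1 by blast
	have down: "w : {v0} \<union> {v1}" if w: "w : V" "x : {v0} \<union> {v1}" "tau_le E w x" for w x
	proof -
		have "x : M" using w(2) M2 by blast
		then have "tau_class_le E (tcl w) M" using w(3) tcl_self[OF w(1)] by (auto simp: tau_class_le_def)
		then have "tcl w = M" using min tcl_class[OF w(1)] by (simp add: tau_minimal_class_def)
		then show ?thesis using tcl_self[OF w(1)] M2 by blast
	qed
	interpret raag_pair V E "{v0}" "{v1}"
	proof (rule raag_pair.intro, rule raag_axioms, rule raag_pair_axioms.intro)
		show "w : {v0} \<union> {v1}" if "w : V" "x : {v0} \<union> {v1}" "tau_le E w x" for w x using that by (rule down)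
	qed (use MV vM v1 disc in auto)
	show ?thesis by (rule pos_scl)
qed

end

theorem theorem8p4:
  fixes V :: "'v set" and E :: "'v set set"
  assumes graph: "is_graph V E"
    and no_cone: "\<forall>v\<in>V. st E v \<noteq> V"
  shows "(\<forall>Gs :: 'v \<Rightarrow> 'a monoid.
            (\<forall>v\<in>V. comm_group (Gs v) \<and> finite (carrier (Gs v)) \<and> carrier (Gs v) \<noteq> {\<one>\<^bsub>Gs v\<^esub>})
            \<and> \<not> bad_splitting V E Gs
          \<longrightarrow> has_pos_scl_aut (graph_product V E Gs))
       \<and> (((\<exists>M. tau_minimal_class V E M \<and> gp_sub V E (\<lambda>_. integer_group) M \<cong> free_grp 2)
            \<or> (\<forall>N\<in>tau_classes V E. \<forall>k\<ge>2. \<not> (gp_sub V E (\<lambda>_. integer_group) N \<cong> free_grp k)))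
          \<longrightarrow> has_pos_scl_aut (RAAG V E))"
proof (intro conjI allI impI)
	fix Gs :: "'v => 'a monoid"
	assume a: "(\<forall>v\<in>V. comm_group (Gs v) & finite (car (Gs v)) & car (Gs v) ~= {one[Gs v]}) & ~ bad_splitting V E Gs"
	interpret graph_prod V E Gs by (rule graph_prod.intro) (use a comm_group.axioms(2) in blast)
	show "has_pos_scl_aut (graph_product V E Gs)"
		by (rule finite_abelian_pos_scl[OF graph no_cone]) (use a in auto)
next
	interpret raag V E by (rule raag.intro) (rule graph)
	assume "(\<exists>M. tau_minimal_class V E M & gp_sub V E (%_. integer_group) M \<cong> free_grp 2)
		| (\<forall>N\<in>tau_classes V E. \<forall>k\<ge>2. ~ (gp_sub V E (%_. integer_group) N \<cong> free_grp k))"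
	then show "has_pos_scl_aut (RAAG V E)" unfolding RAAG_def
	proof
		assume "\<exists>M. tau_minimal_class V E M & gp_sub V E (%_. integer_group) M \<cong> free_grp 2"
		then show "has_pos_scl_aut GP" using pos_scl_minimal_F2 by blast
	next
		assume no: "\<forall>N\<in>tau_classes V E. \<forall>k\<ge>2. ~ (gp_sub V E (%_. integer_group) N \<cong> free_grp k)"
		have "{a, b} : E" if v: "v : V" and ab: "a : tcl v" "b : tcl v" "a ~= b" for v a b
		proof (rule ccontr)
			assume "{a, b} \<notin> E"
			\<comment> \<open>A class with a non-edge is discrete, so its subgroup is free of rank its
			  cardinality, at least 2, which the hypothesis excludes.\<close>
			then have disc: "\<forall>a\<in>tcl v. \<forall>b\<in>tcl v. {a, b} \<notin> E" using tcl_dichotomy[of v] ab by blast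
			have fC: "finite (tcl v)" using tcl_V finV finite_subset by blast
			obtain f where f: "bij_betw f (tcl v) {..<card (tcl v)}" using ex_bij_betw_finite_nat[OF fC] by (auto simp: atLeast0LessThan)
			have "gp_sub V E (%_. integer_group) (tcl v) \<cong> graph_product {..<card (tcl v)} {} (%_. integer_group)"
				by (rule gp_sub_discrete[OF tcl_V _ f, where h = "%_ x. x"]) (use disc id_iso in auto)
			moreover have "card {a, b} <= card (tcl v)" using ab fC by (intro card_mono) auto
			then have "card (tcl v) \<ge> 2" using ab(3) by simp
			ultimately show False using no tcl_class[OF v] unfolding free_grp_def RAAG_def by blast
		qed
		then show "has_pos_scl_aut GP" by (rule pos_scl_clique_classes[OF no_cone])
	qed
qed

end
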